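(* Let $H=(H_0,H_1,H_2)\in(0,1)^3$ be such that $H_0+H_1+H_2\le 1$, and let $D\subset\mathbb{R}^2$ be a compact domain. Then, for all $\alpha>0$ and $t>0$, $$\mathbb{E}\Big[\|\Psi^{(2),n}(t,\cdot)\|^2_{\mathcal{W}^{-2\alpha,2}(D)}\Big]\longrightarrow\infty\qquad\text{as } n\to\infty .$$
   Context: Function spaces: for $s\in\mathbb{R}$, $p\geq 1$, $\mathcal{W}^{s,p}(\mathbb{R}^2)$ is the classical (Bessel potential) Sobolev space, with norm $\|\mathcal{F}^{-1}(\{1+|\cdot|^2\}^{s/2}\mathcal{F}f)\|_{L^p(\mathbb{R}^2)}$; for a domain $D\subset\mathbb{R}^2$ (in particular with non-empty interior), $\mathcal{W}^{s,p}(D)$ is the localized Sobolev space (restrictions to $D$, with the quotient norm). Noise: on a complete filtered probability space $(\Omega,\mathcal{F},\mathbb{P})$, let $\widehat W$ be the Fourier transform of a space-time white noise on $\mathbb{R}^3$. For $n\ge 1$ set $$B^n_t(x_1,x_2)=c_H\int_{|\xi|\le 2^n}\int_{|\eta|\le 2^n}\widehat W(d\xi,d\eta)\frac{e^{i t\xi}-1}{|\xi|^{H_0+\frac12}}\frac{e^{i x_1\eta_1}-1}{|\eta_1|^{H_1+\frac12}}\frac{e^{i x_2\eta_2}-1}{|\eta_2|^{H_2+\frac12}}$$ (with $\xi\in\mathbb{R}$, $\eta=(\eta_1,\eta_2)\in\mathbb{R}^2$), where $c_H>0$ is the constant such that the same formula with unrestricted integration represents the space-time fractional Brownian motion of index $H$,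 i.e. the centered Gaussian process $B$ with covariance $\mathbb{E}[B_s(x_1,x_2)B_t(y_1,y_2)]=R_{H_0}(s,t)R_{H_1}(x_1,y_1)R_{H_2}(x_2,y_2)$, $R_h(x,y)=\frac12(|x|^{2h}+|y|^{2h}-|x-y|^{2h})$. The process $B^n$ is smooth; set $\dot B^n=\partial_t\partial_{x_1}\partial_{x_2}B^n$. $\Psi^n$ is the unique solution of $\partial_t^2\Psi^n-\Delta\Psi^n=\dot B^n$ ($t\geq 0$, $x\in\mathbb{R}^2$) with $\Psi^n(0,\cdot)=0$, $\partial_t\Psi^n(0,\cdot)=0$, and $\Psi^{(2),n}(t,y)=(\Psi^n(t,y))^2-\mathbb{E}[(\Psi^n(t,y))^2]$. *)

theory Defs
  imports "HOL-Probability.Probability"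
begin

section \<open>Differentiability classes and classical wave equation\<close>

text \<open>
  Derivatives are taken within a set \<open>S\<close>; on a closed half-space such as
  \<open>{0..} \<times> UNIV\<close> they are still unique and are one-sided on the boundary.
\<close>

definition pderiv_within ::
  "'a::euclidean_space set \<Rightarrow> 'a \<Rightarrow> ('a \<Rightarrow> 'b::real_normed_vector) \<Rightarrow> 'a \<Rightarrow> 'b" where
  "pderiv_within S b f = (\<lambda>z. frechet_derivative f (at z within S) b)"

fun Ck_on :: "nat \<Rightarrow> 'a::euclidean_space set \<Rightarrow> ('a \<Rightarrow> 'b::real_normed_vector) \<Rightarrow> bool" where
  "Ck_on 0 S f \<longleftrightarrow> continuous_on S f"
| "Ck_on (Suc k) S f \<longleftrightarrow>
     f differentiable_on S \<and> (\<forall>b\<in>Basis. Ck_on k S (pderiv_within S b f))"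

definition smooth_on :: "'a::euclidean_space set \<Rightarrow> ('a \<Rightarrow> 'b::real_normed_vector) \<Rightarrow> bool" where
  "smooth_on S f \<longleftrightarrow> (\<forall>k. Ck_on k S f)"

type_synonym plane = "real \<times> real"
type_synonym spacetime = "real \<times> plane"

abbreviation e_t :: spacetime where "e_t \<equiv> (1, (0, 0))"
abbreviation e_1 :: spacetime where "e_1 \<equiv> (0, (1, 0))"
abbreviation e_2 :: spacetime where "e_2 \<equiv> (0, (0, 1))"

definition mixed_derivative :: "(spacetime \<Rightarrow> real) \<Rightarrow> spacetime \<Rightarrow> real" where
  "mixed_derivative f =
     pderiv_within UNIV e_t (pderiv_within UNIV e_1 (pderiv_within UNIV e_2 f))"

definition wave_solution :: "(spacetime \<Rightarrow> real) \<Rightarrow> (spacetime \<Rightarrow> real) \<Rightarrow> bool" where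
  "wave_solution f u \<longleftrightarrow>
     (let S = {0..} \<times> UNIV; D = pderiv_within S in
        Ck_on 2 S u \<and>
        (\<forall>z\<in>S. D e_t (D e_t u) z - (D e_1 (D e_1 u) z + D e_2 (D e_2 u) z) = f z) \<and>
        (\<forall>x. u (0, x) = 0 \<and> D e_t u (0, x) = 0))"


section \<open>Tempered distributions and Bessel potential spaces\<close>

fun iterated_pderiv :: "'a::euclidean_space list \<Rightarrow> ('a \<Rightarrow> complex) \<Rightarrow> 'a \<Rightarrow> complex" where
  "iterated_pderiv [] f = f"
| "iterated_pderiv (b # bs) f = pderiv_within UNIV b (iterated_pderiv bs f)"

definition schwartz :: "('a::euclidean_space \<Rightarrow> complex) set" where
  "schwartz = {\<phi>. smooth_on UNIV \<phi> \<and>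
     (\<forall>N bs. set bs \<subseteq> Basis \<longrightarrow>
        bounded (range (\<lambda>x. (1 + norm x) ^ N *\<^sub>R iterated_pderiv bs \<phi> x)))}"

definition schwartz_seminorm :: "nat \<Rightarrow> ('a::euclidean_space \<Rightarrow> complex) \<Rightarrow> real" where
  "schwartz_seminorm N \<phi> =
     (SUP (bs, x) \<in> {bs. set bs \<subseteq> Basis \<and> length bs \<le> N} \<times> UNIV.
        (1 + norm x) ^ N * norm (iterated_pderiv bs \<phi> x))"

text \<open>Only the values of a functional on \<open>schwartz\<close> are meaningful.\<close>

type_synonym 'a functional = "('a \<Rightarrow> complex) \<Rightarrow> complex"

definition tempered_distribution :: "'a::euclidean_space functional \<Rightarrow> bool" where
  "tempered_distribution u \<longleftrightarrow>
     (\<forall>\<phi>\<in>schwartz. \<forall>\<psi>\<in>schwartz. u (\<lambda>x. \<phi> x + \<psi> x) = u \<phi> + u \<psi>) \<and>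
     (\<forall>c. \<forall>\<phi>\<in>schwartz. u (\<lambda>x. c * \<phi> x) = c * u \<phi>) \<and>
     (\<exists>C N. \<forall>\<phi>\<in>schwartz. norm (u \<phi>) \<le> C * schwartz_seminorm N \<phi>)"

definition fourier :: "('a::euclidean_space \<Rightarrow> complex) \<Rightarrow> 'a \<Rightarrow> complex" where
  "fourier f \<xi> = (LINT x|lborel. cis (- (x \<bullet> \<xi>)) * f x)"

definition inverse_fourier :: "('a::euclidean_space \<Rightarrow> complex) \<Rightarrow> 'a \<Rightarrow> complex" where
  "inverse_fourier f x =
     (LINT \<xi>|lborel. cis (x \<bullet> \<xi>) * f \<xi>) / complex_of_real ((2 * pi) ^ DIM('a))"

definition fourier_dist :: "'a::euclidean_space functional \<Rightarrow> 'a functional" where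
  "fourier_dist u = (\<lambda>\<phi>. u (fourier \<phi>))"

definition inverse_fourier_dist :: "'a::euclidean_space functional \<Rightarrow> 'a functional" where
  "inverse_fourier_dist u = (\<lambda>\<phi>. u (inverse_fourier \<phi>))"

definition mult_dist :: "('a::euclidean_space \<Rightarrow> real) \<Rightarrow> 'a functional \<Rightarrow> 'a functional" where
  "mult_dist m u = (\<lambda>\<phi>. u (\<lambda>\<xi>. complex_of_real (m \<xi>) * \<phi> \<xi>))"

definition bessel_potential :: "real \<Rightarrow> 'a::euclidean_space functional \<Rightarrow> 'a functional" where
  "bessel_potential s u =
     inverse_fourier_dist (mult_dist (\<lambda>\<xi>. (1 + (norm \<xi>)\<^sup>2) powr (s / 2)) (fourier_dist u))"

definition dist_of :: "('a::euclidean_space \<Rightarrow> complex) \<Rightarrow> 'a functional" where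
  "dist_of f = (\<lambda>\<phi>. LINT x|lborel. f x * \<phi> x)"

definition Lp_space :: "real \<Rightarrow> ('a::euclidean_space \<Rightarrow> 'b::euclidean_space) set" where
  "Lp_space p = {f \<in> borel_measurable lborel. integrable lborel (\<lambda>x. norm (f x) powr p)}"

definition Lp_norm :: "real \<Rightarrow> ('a::euclidean_space \<Rightarrow> 'b::euclidean_space) \<Rightarrow> real" where
  "Lp_norm p f = (LINT x|lborel. norm (f x) powr p) powr (1 / p)"

text \<open>
  The set below has at most one element, since the representing function is unique up to
  null sets; it is empty, and the norm infinite, when \<open>u\<close> is not in the space.
\<close>

definition sobolev_norm :: "real \<Rightarrow> real \<Rightarrow> 'a::euclidean_space functional \<Rightarrow> ennreal" where
  "sobolev_norm s p u =
     Inf {ennreal (Lp_norm p g) | g.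
            g \<in> Lp_space p \<and> (\<forall>\<phi>\<in>schwartz. bessel_potential s u \<phi> = dist_of g \<phi>)}"

definition test_function :: "'a::euclidean_space set \<Rightarrow> ('a \<Rightarrow> complex) \<Rightarrow> bool" where
  "test_function U \<phi> \<longleftrightarrow> smooth_on UNIV \<phi> \<and>
     compact (closure {x. \<phi> x \<noteq> 0}) \<and> closure {x. \<phi> x \<noteq> 0} \<subseteq> U"

text \<open>
  Quotient norm on the restrictions to \<open>D\<close>; as usual, two distributions coincide on \<open>D\<close>
  when they agree on test functions supported in its interior.
\<close>

definition sobolev_norm_on ::
  "real \<Rightarrow> real \<Rightarrow> 'a::euclidean_space set \<Rightarrow> 'a functional \<Rightarrow> ennreal" where
  "sobolev_norm_on s p D u =
     Inf {sobolev_norm s p v | v. tempered_distribution v \<and>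
            (\<forall>\<phi>. test_function (interior D) \<phi> \<longrightarrow> v \<phi> = u \<phi>)}"


section \<open>White noise and fractional Brownian motion\<close>

definition complete_filtered_prob_space :: "'w measure \<Rightarrow> (real \<Rightarrow> 'w measure) \<Rightarrow> bool" where
  "complete_filtered_prob_space M F \<longleftrightarrow>
     prob_space M \<and> complete_measure M \<and>
     (\<forall>t\<ge>0. subalgebra M (F t) \<and> null_sets M \<subseteq> sets (F t)) \<and>
     (\<forall>s t. 0 \<le> s \<and> s \<le> t \<longrightarrow> sets (F s) \<subseteq> sets (F t))"

definition centered_gaussian :: "'w measure \<Rightarrow> ('w \<Rightarrow> real) \<Rightarrow> bool" where
  "centered_gaussian M Y \<longleftrightarrow> Y \<in> borel_measurable M \<and>
     ((AE \<omega> in M. Y \<omega> = 0) \<or>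
      (\<exists>\<sigma>>0. distributed M lborel Y (\<lambda>y. ennreal (normal_density 0 \<sigma> y))))"

definition centered_gaussian_family ::
  "'w measure \<Rightarrow> 'i set \<Rightarrow> ('i \<Rightarrow> 'w \<Rightarrow> real) \<Rightarrow> bool" where
  "centered_gaussian_family M I X \<longleftrightarrow>
     (\<forall>J c. finite J \<and> J \<subseteq> I \<longrightarrow> centered_gaussian M (\<lambda>\<omega>. \<Sum>i\<in>J. c i * X i \<omega>))"

definition white_noise :: "'w measure \<Rightarrow> (('a::euclidean_space \<Rightarrow> real) \<Rightarrow> 'w \<Rightarrow> real) \<Rightarrow> bool" where
  "white_noise M W \<longleftrightarrow>
     centered_gaussian_family M (Lp_space 2) W \<and>
     (\<forall>f\<in>Lp_space 2. \<forall>g\<in>Lp_space 2.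
        prob_space.expectation M (\<lambda>\<omega>. W f \<omega> * W g \<omega>) = (LINT x|lborel. f x * g x))"

text \<open>
  The \<open>L\<^sup>2\<close> Fourier transform, as the \<open>L\<^sup>2\<close> limit of the transforms truncated to balls.
\<close>

definition L2_fourier :: "('a::euclidean_space \<Rightarrow> complex) \<Rightarrow> 'a \<Rightarrow> complex" where
  "L2_fourier f = (SOME g. g \<in> Lp_space 2 \<and>
     ((\<lambda>R. \<integral>\<^sup>+x. ennreal ((norm (g x - fourier (\<lambda>y. indicator (cball 0 R) y * f y) x))\<^sup>2) \<partial>lborel)
        \<longlongrightarrow> 0) at_top)"

text \<open>
  The Fourier transform of the noise is defined by duality, with \<open>W\<close> extended linearly to
  complex-valued functions.
\<close>

definition noise_fourier ::
  "(('a::euclidean_space \<Rightarrow> real) \<Rightarrow> 'w \<Rightarrow> real) \<Rightarrow> ('a \<Rightarrow> complex) \<Rightarrow> 'w \<Rightarrow> complex" where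
  "noise_fourier W f \<omega> =
     Complex (W (\<lambda>x. Re (L2_fourier f x)) \<omega>) (W (\<lambda>x. Im (L2_fourier f x)) \<omega>)"

definition harmonic_factor :: "real \<Rightarrow> real \<Rightarrow> real \<Rightarrow> complex" where
  "harmonic_factor h x \<xi> = (cis (x * \<xi>) - 1) / complex_of_real (\<bar>\<xi>\<bar> powr (h + 1/2))"

definition harmonic_kernel :: "real \<Rightarrow> real \<Rightarrow> real \<Rightarrow> real \<Rightarrow> plane \<Rightarrow> spacetime \<Rightarrow> complex" where
  "harmonic_kernel H0 H1 H2 t x = (\<lambda>(\<xi>, \<eta>).
     harmonic_factor H0 t \<xi> * harmonic_factor H1 (fst x) (fst \<eta>) * harmonic_factor H2 (snd x) (snd \<eta>))"

definition frequency_box :: "nat \<Rightarrow> spacetime set" where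
  "frequency_box n = {(\<xi>, \<eta>). \<bar>\<xi>\<bar> \<le> 2 ^ n \<and> norm \<eta> \<le> 2 ^ n}"

text \<open>
  \<open>B\<close> is a version of the harmonizable integral restricted to frequencies in \<open>A\<close>.
\<close>

definition harmonizable_version ::
  "'w measure \<Rightarrow> ((spacetime \<Rightarrow> real) \<Rightarrow> 'w \<Rightarrow> real) \<Rightarrow> real \<Rightarrow> real \<Rightarrow> real \<Rightarrow> real \<Rightarrow>
     spacetime set \<Rightarrow> (real \<Rightarrow> plane \<Rightarrow> 'w \<Rightarrow> real) \<Rightarrow> bool" where
  "harmonizable_version M W c H0 H1 H2 A B \<longleftrightarrow>
     (\<forall>t x. AE \<omega> in M. complex_of_real (B t x \<omega>) =
        complex_of_real c *
          noise_fourier W (\<lambda>z. indicator A z * harmonic_kernel H0 H1 H2 t x z) \<omega>)"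

definition fbm_covariance :: "real \<Rightarrow> real \<Rightarrow> real \<Rightarrow> real" where
  "fbm_covariance h x y =
     (\<bar>x\<bar> powr (2 * h) + \<bar>y\<bar> powr (2 * h) - \<bar>x - y\<bar> powr (2 * h)) / 2"

definition fractional_brownian ::
  "'w measure \<Rightarrow> real \<Rightarrow> real \<Rightarrow> real \<Rightarrow> (real \<Rightarrow> plane \<Rightarrow> 'w \<Rightarrow> real) \<Rightarrow> bool" where
  "fractional_brownian M H0 H1 H2 B \<longleftrightarrow>
     centered_gaussian_family M UNIV (\<lambda>(t, x). B t x) \<and>
     (\<forall>s t x y. prob_space.expectation M (\<lambda>\<omega>. B s x \<omega> * B t y \<omega>) =
        fbm_covariance H0 s t * fbm_covariance H1 (fst x) (fst y) * fbm_covariance H2 (snd x) (snd y))"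

definition harmonizable_constant ::
  "'w measure \<Rightarrow> ((spacetime \<Rightarrow> real) \<Rightarrow> 'w \<Rightarrow> real) \<Rightarrow> real \<Rightarrow> real \<Rightarrow> real \<Rightarrow> real \<Rightarrow> bool" where
  "harmonizable_constant M W H0 H1 H2 c \<longleftrightarrow> c > 0 \<and>
     (\<exists>B. harmonizable_version M W c H0 H1 H2 UNIV B \<and> fractional_brownian M H0 H1 H2 B)"

definition wick_square ::
  "'w measure \<Rightarrow> (real \<Rightarrow> plane \<Rightarrow> 'w \<Rightarrow> real) \<Rightarrow> real \<Rightarrow> plane \<Rightarrow> 'w \<Rightarrow> real" where
  "wick_square M \<Psi> t y \<omega> =
     (\<Psi> t y \<omega>)\<^sup>2 - prob_space.expectation M (\<lambda>\<omega>'. (\<Psi> t y \<omega>')\<^sup>2)"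

end

theory Submission
  imports Defs
begin

text \<open>
  Duality bounds the Sobolev norm on \<open>D\<close> from below by the value of the Wick square on one bump
  function \<open>\<theta>\<close> supported inside \<open>D\<close>, for every regularity index (\<open>sobolev_norm_on_lower_bound\<close>).
  For a centered Gaussian field with covariance \<open>K\<close>, the second moment of this value is
  \<open>2 \<integral>\<integral> \<theta>(y) \<theta>(y') K(y, y')\<^sup>2 dy dy'\<close> (\<open>wick_second_moment\<close>), so it suffices that this energy
  tends to infinity.

  The field is Gaussian with an explicit spectrum. The noise density is a white noise integral over
  frequencies \<open>(\<xi>, \<eta>)\<close> of the plane wave with, up to a phase, the amplitude
  \<open>\<bar>\<xi>\<bar>\<^bsup>1/2-H0\<^esup> \<bar>\<eta>1\<bar>\<^bsup>1/2-H1\<^esup> \<bar>\<eta>2\<bar>\<^bsup>1/2-H2\<^esup>\<close>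
  (\<open>density_repr\<close>, resting on \<open>plancherel\<close>). Duhamel's formula writes the solution as an average of
  the density over the backward light cone (\<open>C2_wave.duhamel\<close>), and the average of a plane wave is, up to
  a plane wave factor in space, the solution of the oscillator equation \<open>g'' + \<bar>\<eta>\<bar>\<^sup>2 g = e\<^bsup>i\<xi>s\<^esup>\<close> with zero initial data
  (\<open>cone_integral_plane_wave\<close>). Hence \<open>K(y, y') = \<integral> \<rho>(\<xi>, \<eta>) cos ((y - y') \<bullet> \<eta>)\<close> with \<open>\<rho>\<close> the
  squared amplitude times the squared oscillator response, up to a constant (\<open>solution_repr\<close>,
  \<open>Phi_solution_cov\<close>).

  The oscillator resonates at \<open>\<xi> = \<bar>\<eta>\<bar>\<close>: within a fixed distance of the resonance its response has
  size \<open>t / \<bar>\<eta>\<bar>\<close>, so that \<open>\<rho>\<close> is at least of order \<open>\<bar>\<eta>\<bar>\<close> to the power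
  \<open>1 - 2 (H0 + H1 + H2) \<ge> -1\<close> (\<open>spectral_density_lower\<close>). The energy of the covariance is a double
  integral of \<open>\<rho>(w) \<rho>(w')\<close> against a nonnegative kernel that is bounded below when the spatial
  frequencies are close; it therefore dominates the sum of the squared \<open>\<rho>\<close>-masses of disjoint small
  cells (\<open>spectral_energy_lower_bound\<close>). Cells placed at the resonance over lattice squares at
  distance of order \<open>j\<close> have mass at least of order \<open>1/j\<close>, and there are \<open>j\<close> of them for each \<open>j\<close>:
  the sum dominates the harmonic series \<open>\<Sum> j \<cdot> (1/j)\<^sup>2\<close>, which the growing frequency box exhausts.
\<close>

section \<open>Schwartz functions and test functions\<close>

abbreviation partial :: "'a::euclidean_space \<Rightarrow> ('a \<Rightarrow> 'b::real_normed_vector) \<Rightarrow> 'a \<Rightarrow> 'b" where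
  "partial \<equiv> pderiv_within UNIV"

lemma partial_eq:
  assumes "(f has_derivative f') (at x)"
  shows "partial b f x = f' b"
  using frechet_derivative_at[OF assms] by (simp add: pderiv_within_def)

lemma has_derivative_partial:
  assumes "f differentiable_on UNIV"
  shows "(f has_derivative (\<lambda>h. partial h f x)) (at x)"
  using assms by (simp add: pderiv_within_def differentiable_on_def frechet_derivative_works)

lemma smooth_on_coinduct:
  assumes "f \<in> C"
    and "\<And>g. g \<in> C \<Longrightarrow> g differentiable_on S"
    and "\<And>g b. g \<in> C \<Longrightarrow> b \<in> Basis \<Longrightarrow> pderiv_within S b g \<in> C"
  shows "smooth_on S f"
proof -
  have "\<forall>g\<in>C. Ck_on k S g" for k
    by (induction k) (simp_all add: differentiable_imp_continuous_on assms(2,3))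
  with assms(1) show ?thesis by (auto simp: smooth_on_def)
qed

lemma smooth_on_step:
  assumes "smooth_on S f"
  shows "f differentiable_on S" "b \<in> Basis \<Longrightarrow> smooth_on S (pderiv_within S b f)"
proof -
  have "Ck_on (Suc k) S f" for k using assms by (simp only: smooth_on_def)
  then show "f differentiable_on S" "b \<in> Basis \<Longrightarrow> smooth_on S (pderiv_within S b f)"
    by (auto simp: smooth_on_def)
qed

definition rapid :: "('a::euclidean_space \<Rightarrow> complex) \<Rightarrow> bool" where
  "rapid f \<longleftrightarrow> (\<forall>N. \<exists>K. \<forall>x. (1 + norm x) ^ N * norm (f x) \<le> K)"

lemma rapid_iff: "rapid f \<longleftrightarrow> (\<forall>N. bounded (range (\<lambda>x. (1 + norm x) ^ N *\<^sub>R f x)))"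
  unfolding rapid_def bounded_iff by auto

lemma iterated_pderiv_append:
  "iterated_pderiv (as @ bs) f = iterated_pderiv as (iterated_pderiv bs f)"
  by (induction as) auto

text \<open>Schwartz space is the largest class of rapidly decaying differentiable functions that is
  stable under partial derivatives. All membership proofs below exhibit such a class, so no
  Leibniz formula for iterated derivatives is needed.\<close>

lemma schwartz_coinduct:
  assumes "f \<in> C"
    and diff: "\<And>g. g \<in> C \<Longrightarrow> g differentiable_on UNIV"
    and deriv: "\<And>g b. g \<in> C \<Longrightarrow> b \<in> Basis \<Longrightarrow> partial b g \<in> C"
    and rapid: "\<And>g. g \<in> C \<Longrightarrow> rapid g"
  shows "f \<in> schwartz"
proof -
  have "iterated_pderiv bs f \<in> C" if "set bs \<subseteq> Basis" for bs
    using that by (induction bs) (use assms in auto)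
  then show ?thesis
    using smooth_on_coinduct[of f C UNIV] assms rapid by (auto simp: schwartz_def rapid_iff)
qed

lemma schwartz_step:
  assumes "f \<in> schwartz"
  shows "f differentiable_on UNIV" "rapid f" "b \<in> Basis \<Longrightarrow> partial b f \<in> schwartz"
proof -
  show "f differentiable_on UNIV" using assms smooth_on_step by (auto simp: schwartz_def)
  have it: "set bs \<subseteq> Basis \<Longrightarrow> bounded (range (\<lambda>x. (1 + norm x) ^ N *\<^sub>R iterated_pderiv bs f x))"
    for N bs using assms by (auto simp: schwartz_def)
  show "rapid f" using it[of "[]"] by (auto simp: rapid_iff)
  show "partial b f \<in> schwartz" if b: "b \<in> Basis"
    using assms smooth_on_step(2)[of UNIV f b] b it[of "_ @ [b]"]
    by (auto simp: schwartz_def iterated_pderiv_append)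
qed

lemma rapidI_bound:
  assumes "rapid f" "\<And>x. norm (g x) \<le> K * (1 + norm x) ^ m * norm (f x)"
  shows "rapid g"
  unfolding rapid_def
proof
  fix N
  obtain L where L: "\<And>x. (1 + norm x) ^ (N + m) * norm (f x) \<le> L"
    using assms(1) unfolding rapid_def by meson
  have "(1 + norm x) ^ N * norm (g x) \<le> \<bar>K\<bar> * L" for x
  proof -
    have "norm (g x) \<le> \<bar>K\<bar> * ((1 + norm x) ^ m * norm (f x))"
      using assms(2)[of x] mult_right_mono[of K "\<bar>K\<bar>" "(1 + norm x) ^ m * norm (f x)"]
      by (simp add: mult.assoc del: mult_le_cancel_right) (erule order_trans, simp)
    then have "(1 + norm x) ^ N * norm (g x)
        \<le> (1 + norm x) ^ N * (\<bar>K\<bar> * ((1 + norm x) ^ m * norm (f x)))"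
      by (intro mult_left_mono) auto
    also have "\<dots> = \<bar>K\<bar> * ((1 + norm x) ^ (N + m) * norm (f x))"
      by (simp add: power_add algebra_simps)
    also have "\<dots> \<le> \<bar>K\<bar> * L" using L by (intro mult_left_mono) auto
    finally show ?thesis .
  qed
  then show "\<exists>K. \<forall>x. (1 + norm x) ^ N * norm (g x) \<le> K" by blast
qed

lemma rapid_add:
  assumes "rapid f" "rapid g"
  shows "rapid (\<lambda>x. f x + g x)"
  unfolding rapid_def
proof
  fix N
  obtain K L where "\<And>x. (1 + norm x) ^ N * norm (f x) \<le> K" "\<And>x. (1 + norm x) ^ N * norm (g x) \<le> L"
    using assms unfolding rapid_def by meson
  then have "(1 + norm x) ^ N * norm (f x + g x) \<le> K + L" for x
    using mult_left_mono[OF norm_triangle_ineq[of "f x" "g x"], of "(1 + norm x) ^ N"]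
    by (smt (verit) distrib_left norm_ge_zero zero_le_power)
  then show "\<exists>K. \<forall>x. (1 + norm x) ^ N * norm (f x + g x) \<le> K" by blast
qed

lemma has_derivative_add_partial:
  assumes "f differentiable_on UNIV" "g differentiable_on UNIV"
  shows "((\<lambda>x. f x + g x) has_derivative (\<lambda>h. partial h f x + partial h g x)) (at x)"
  using assms by (intro has_derivative_add has_derivative_partial)

lemma differentiable_onI_UNIV:
  "(\<And>x. \<exists>D. (f has_derivative D) (at x)) \<Longrightarrow> f differentiable_on UNIV"
  by (auto simp: differentiable_on_def differentiable_def)

lemma schwartz_add:
  assumes "f \<in> schwartz" "g \<in> schwartz"
  shows "(\<lambda>x. f x + g x) \<in> schwartz"
proof (rule schwartz_coinduct[where C = "{\<lambda>x. f x + g x | f g. f \<in> schwartz \<and> g \<in> schwartz}"])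
  show "(\<lambda>x. f x + g x) \<in> {\<lambda>x. f x + g x | f g. f \<in> schwartz \<and> g \<in> schwartz}"
    using assms by auto
next
  fix h :: "'a \<Rightarrow> complex" assume "h \<in> {\<lambda>x. f x + g x | f g. f \<in> schwartz \<and> g \<in> schwartz}"
  then obtain f g where h: "h = (\<lambda>x. f x + g x)" "f \<in> schwartz" "g \<in> schwartz" by auto
  note D = has_derivative_add_partial[OF schwartz_step(1)[OF h(2)] schwartz_step(1)[OF h(3)]]
  show "h differentiable_on UNIV" using D h(1) by (auto intro: differentiable_onI_UNIV)
  show "rapid h" using h schwartz_step(2) by (auto intro: rapid_add)
  fix b :: 'a assume b: "b \<in> Basis"
  have "partial b h = (\<lambda>x. partial b f x + partial b g x)"
    using partial_eq[OF D] h(1) by auto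
  then show "partial b h \<in> {\<lambda>x. f x + g x | f g. f \<in> schwartz \<and> g \<in> schwartz}"
    using schwartz_step(3)[OF _ b] h by auto
qed

lemma schwartz_cmult:
  assumes "f \<in> schwartz"
  shows "(\<lambda>x. c * f x) \<in> schwartz"
proof (rule schwartz_coinduct[where C = "{\<lambda>x. c * f x | f. f \<in> schwartz}"])
  show "(\<lambda>x. c * f x) \<in> {\<lambda>x. c * f x | f. f \<in> schwartz}" using assms by auto
next
  fix h :: "'a \<Rightarrow> complex" assume "h \<in> {\<lambda>x. c * f x | f. f \<in> schwartz}"
  then obtain f where h: "h = (\<lambda>x. c * f x)" "f \<in> schwartz" by auto
  have D: "((\<lambda>x. c * f x) has_derivative (\<lambda>h. c * partial h f x)) (at x)" for x
    by (rule has_derivative_mult_right[OF has_derivative_partial[OF schwartz_step(1)[OF h(2)]]])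
  show "h differentiable_on UNIV" using D h(1) by (auto intro: differentiable_onI_UNIV)
  show "rapid h" using h schwartz_step(2)[OF h(2)]
    by (auto intro: rapidI_bound[where f = f and K = "norm c" and m = 0] simp: norm_mult)
  fix b :: 'a assume b: "b \<in> Basis"
  have "partial b h = (\<lambda>x. c * partial b f x)"
    using partial_eq[OF D] h(1) by auto
  then show "partial b h \<in> {\<lambda>x. c * f x | f. f \<in> schwartz}"
    using schwartz_step(3)[OF h(2) b] by auto
qed

lemma abs_inner_le_one_plus_norm: "b \<in> Basis \<Longrightarrow> \<bar>x \<bullet> b\<bar> \<le> 1 + norm x"
  using Basis_le_norm[of b x] by simp

text \<open>The derivative of a product with a coordinate function leaves the product class only by
  a Schwartz function, which is why the class below has a second summand.\<close>

lemma schwartz_coordinate_mult: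
  fixes f :: "'a::euclidean_space \<Rightarrow> complex"
  assumes "f \<in> schwartz" and a: "a \<in> Basis"
  shows "(\<lambda>x. complex_of_real (x \<bullet> a) * f x) \<in> schwartz"
proof -
  let ?C = "{\<lambda>x. complex_of_real (x \<bullet> a) * f x + g x | f g. f \<in> schwartz \<and> g \<in> schwartz}"
  have "(\<lambda>x. complex_of_real (x \<bullet> a) * f x) \<in> ?C"
    using assms schwartz_cmult[OF assms(1), of 0] by force
  then show ?thesis
  proof (rule schwartz_coinduct)
    fix h :: "'a \<Rightarrow> complex" assume "h \<in> ?C"
    then obtain f g where h: "h = (\<lambda>x. complex_of_real (x \<bullet> a) * f x + g x)" "f \<in> schwartz" "g \<in> schwartz"
      by auto
    have D: "(h has_derivative (\<lambda>k. complex_of_real (x \<bullet> a) * partial k f x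
        + (complex_of_real (k \<bullet> a) * f x + partial k g x))) (at x)" for x
      unfolding h(1)
      by (rule derivative_eq_intros has_derivative_partial schwartz_step(1) h refl)+
        (simp add: algebra_simps)
    show "h differentiable_on UNIV" using D by (auto intro: differentiable_onI_UNIV)
    show "rapid h" unfolding h(1)
      using abs_inner_le_one_plus_norm[OF a]
      by (intro rapid_add schwartz_step(2) h rapidI_bound[OF schwartz_step(2)[OF h(2)], where K = 1 and m = 1])
        (auto simp: norm_mult intro!: mult_right_mono)
    fix b :: 'a assume b: "b \<in> Basis"
    have "partial b h = (\<lambda>x. complex_of_real (x \<bullet> a) * partial b f x
        + (complex_of_real (b \<bullet> a) * f x + partial b g x))"
      using partial_eq[OF D] by auto
    moreover have "(\<lambda>x. complex_of_real (b \<bullet> a) * f x + partial b g x) \<in> schwartz"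
      by (intro schwartz_add schwartz_cmult h schwartz_step(3) b)
    ultimately show "partial b h \<in> ?C"
      using schwartz_step(3)[OF h(2) b] by (intro CollectI exI conjI)
  qed
qed

text \<open>Differentiating a power of \<open>1 + |x|\<^sup>2\<close> lowers its exponent and produces a coordinate, which the
  Schwartz factor absorbs. This is why all exponents are admitted at once.\<close>

inductive_set bracket_class :: "('a::euclidean_space \<Rightarrow> complex) set" where
  power: "f \<in> schwartz \<Longrightarrow> (\<lambda>x. complex_of_real ((1 + (norm x)\<^sup>2) powr \<beta>) * f x) \<in> bracket_class"
| add: "f \<in> bracket_class \<Longrightarrow> g \<in> bracket_class \<Longrightarrow> (\<lambda>x. f x + g x) \<in> bracket_class"

lemma bracket_powr_le: "(1 + (norm x)\<^sup>2) powr \<beta> \<le> (1 + norm x) ^ (2 * nat \<lceil>\<bar>\<beta>\<bar>\<rceil>)"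
proof -
  have 1: "(1::real) \<le> 1 + (norm x)\<^sup>2" by simp
  have "(1 + (norm x)\<^sup>2) powr \<beta> \<le> (1 + (norm x)\<^sup>2) powr real (nat \<lceil>\<bar>\<beta>\<bar>\<rceil>)"
    using 1 by (intro powr_mono) linarith+
  also have "\<dots> = (1 + (norm x)\<^sup>2) ^ nat \<lceil>\<bar>\<beta>\<bar>\<rceil>"
    by (rule powr_realpow) (smt (verit) zero_le_power2)
  also have "\<dots> \<le> ((1 + norm x)\<^sup>2) ^ nat \<lceil>\<bar>\<beta>\<bar>\<rceil>"
    by (intro power_mono) (auto simp: power2_eq_square algebra_simps)
  finally show ?thesis by (simp add: power_mult)
qed

lemma bracket_class_derivative:
  fixes h :: "'a::euclidean_space \<Rightarrow> complex"
  assumes "h \<in> bracket_class"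
  shows "h differentiable_on UNIV \<and> rapid h \<and> (\<forall>b\<in>Basis. partial b h \<in> bracket_class)"
  using assms
proof induction
  case (power f \<beta>)
  let ?h = "\<lambda>x. complex_of_real ((1 + (norm x)\<^sup>2) powr \<beta>) * f x"
  have pos: "1 + x \<bullet> x > 0" for x :: 'a by (smt (verit) inner_ge_zero)
  have P: "((\<lambda>x. complex_of_real ((1 + x \<bullet> x) powr \<beta>)) has_derivative
      (\<lambda>k. complex_of_real (2 * \<beta> * ((1 + x \<bullet> x) powr (\<beta> - 1)) * (x \<bullet> k)))) (at x)" for x :: 'a
  proof -
    have "((\<lambda>x. 1 + x \<bullet> x) has_derivative (\<lambda>k. 2 * (x \<bullet> k))) (at x)"
      by (auto intro!: derivative_eq_intros simp: inner_commute)
    from has_derivative_compose[OF this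
        has_real_derivative_powr[OF pos, unfolded has_field_derivative_def]]
    have "((\<lambda>x. (1 + x \<bullet> x) powr \<beta>) has_derivative
        (\<lambda>k. \<beta> * (1 + x \<bullet> x) powr (\<beta> - 1) * (2 * (x \<bullet> k)))) (at x)" .
    from has_derivative_of_real[OF this] show ?thesis
      by (rule has_derivative_eq_rhs) (auto simp: algebra_simps)
  qed
  have D: "(?h has_derivative (\<lambda>k. complex_of_real ((1 + (norm x)\<^sup>2) powr \<beta>) * partial k f x
      + complex_of_real ((1 + (norm x)\<^sup>2) powr (\<beta> - 1)) * (complex_of_real (2 * \<beta>) * (complex_of_real (x \<bullet> k) * f x)))) (at x)" for x
    unfolding power2_norm_eq_inner
    by (rule has_derivative_eq_rhs[OF has_derivative_mult[OF P has_derivative_partial[OF schwartz_step(1)[OF power]]]])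
      (simp add: algebra_simps)
  have "?h differentiable_on UNIV" using D by (auto intro: differentiable_onI_UNIV)
  moreover have "rapid ?h"
    by (intro rapidI_bound[OF schwartz_step(2)[OF power], where K = 1 and m = "2 * nat \<lceil>\<bar>\<beta>\<bar>\<rceil>"])
      (auto simp: norm_mult intro!: mult_right_mono bracket_powr_le)
  moreover have "partial b ?h \<in> bracket_class" if b: "b \<in> Basis" for b
  proof -
    have "partial b ?h = (\<lambda>x. complex_of_real ((1 + (norm x)\<^sup>2) powr \<beta>) * partial b f x
      + complex_of_real ((1 + (norm x)\<^sup>2) powr (\<beta> - 1)) * (complex_of_real (2 * \<beta>) * (complex_of_real (x \<bullet> b) * f x)))"
      using partial_eq[OF D] by blast
    also have "\<dots> \<in> bracket_class"
      by (intro bracket_class.intros schwartz_step(3)[OF power b] schwartz_cmult schwartz_coordinate_mult b power)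
    finally show ?thesis .
  qed
  ultimately show ?case by blast
next
  case (add f g)
  then have D: "((\<lambda>x. f x + g x) has_derivative (\<lambda>h. partial h f x + partial h g x)) (at x)" for x
    by (intro has_derivative_add_partial) auto
  have "partial b (\<lambda>x. f x + g x) = (\<lambda>x. partial b f x + partial b g x)" for b
    using partial_eq[OF D] by blast
  then show ?case
    using add D by (auto intro: differentiable_onI_UNIV rapid_add bracket_class.add)
qed

lemma schwartz_bracket_mult:
  assumes "f \<in> schwartz"
  shows "(\<lambda>x. complex_of_real ((1 + (norm x)\<^sup>2) powr \<beta>) * f x) \<in> schwartz"
  by (rule schwartz_coinduct[where C = bracket_class])
    (use assms bracket_class_derivative in \<open>auto intro: bracket_class.power\<close>)

lemma schwartz_reflect:
  fixes f :: "'a::euclidean_space \<Rightarrow> complex"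
  assumes "f \<in> schwartz"
  shows "(\<lambda>x. f (- x)) \<in> schwartz"
proof (rule schwartz_coinduct[where C = "{\<lambda>x. f (- x) | f. f \<in> schwartz}"])
  show "(\<lambda>x. f (- x)) \<in> {\<lambda>x. f (- x) | f. f \<in> schwartz}" using assms by auto
next
  fix h :: "'a \<Rightarrow> complex" assume "h \<in> {\<lambda>x. f (- x) | f. f \<in> schwartz}"
  then obtain f where h: "h = (\<lambda>x. f (- x))" "f \<in> schwartz" by auto
  have D: "((\<lambda>x. f (- x)) has_derivative (\<lambda>k. - partial k f (- x))) (at x)" for x
  proof -
    have L: "linear (\<lambda>h. partial h f (- x))"
      using has_derivative_partial[OF schwartz_step(1)[OF h(2)]] has_derivative_linear by blast
    have "((\<lambda>x. f (- x)) has_derivative (\<lambda>k. partial (- k) f (- x))) (at x)"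
      by (rule has_derivative_compose[of uminus uminus x UNIV f])
        (auto intro!: derivative_eq_intros has_derivative_partial[OF schwartz_step(1)[OF h(2)]])
    then show ?thesis using linear_neg[OF L] by simp
  qed
  show "h differentiable_on UNIV" using D h(1) by (auto intro: differentiable_onI_UNIV)
  show "rapid h" using schwartz_step(2)[OF h(2)] h(1) unfolding rapid_def
    by (metis norm_minus_cancel)
  fix b :: 'a assume b: "b \<in> Basis"
  define g where "g = (\<lambda>x. (-1) * partial b f x)"
  have "g \<in> schwartz" unfolding g_def by (intro schwartz_cmult schwartz_step(3) h b)
  moreover have "partial b h = (\<lambda>x. g (- x))"
    using partial_eq[OF D] h(1) by (auto simp: g_def)
  ultimately show "partial b h \<in> {\<lambda>x. f (- x) | f. f \<in> schwartz}" by blast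
qed

lemma test_function_schwartz:
  fixes \<phi> :: "'a::euclidean_space \<Rightarrow> complex"
  assumes "test_function U \<phi>"
  shows "\<phi> \<in> schwartz"
proof -
  define K where "K = closure {x. \<phi> x \<noteq> 0}"
  have K: "compact K" using assms by (simp add: test_function_def K_def)
  let ?C = "{g. smooth_on UNIV g \<and> (\<forall>x. x \<notin> K \<longrightarrow> g x = 0)}"
  have "\<phi> \<in> ?C" 
    using assms closure_subset[of "{x. \<phi> x \<noteq> 0}"] by (auto simp: test_function_def K_def)
  then show ?thesis
  proof (rule schwartz_coinduct)
    fix g :: "'a \<Rightarrow> complex" assume g: "g \<in> ?C"
    then show d: "g differentiable_on UNIV" using smooth_on_step(1) by blast
    have "continuous_on K (\<lambda>x. (1 + norm x) ^ N * norm (g x))" for N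
      by (intro continuous_intros continuous_on_subset[OF differentiable_imp_continuous_on[OF d]]) auto
    then have bd: "bounded ((\<lambda>x. (1 + norm x) ^ N * norm (g x)) ` K)" for N
      using K compact_continuous_image compact_imp_bounded by blast
    show "rapid g" unfolding rapid_def
    proof
      fix N
      obtain L where L: "\<And>x. x \<in> K \<Longrightarrow> \<bar>(1 + norm x) ^ N * norm (g x)\<bar> \<le> L"
        using bd[of N] by (auto simp: bounded_iff)
      have "(1 + norm x) ^ N * norm (g x) \<le> \<bar>L\<bar>" for x
        using L[of x] g by (cases "x \<in> K") auto
      then show "\<exists>K. \<forall>x. (1 + norm x) ^ N * norm (g x) \<le> K" by blast
    qed
    fix b :: 'a assume b: "b \<in> Basis"
    have "partial b g x = 0" if x: "x \<notin> K" for x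
    proof -
      have "(g has_derivative (\<lambda>_. 0)) (at x)"
        by (rule has_derivative_transform_within_open[of "\<lambda>_. 0" _ x UNIV "- K"])
          (use K x g in \<open>auto simp: open_Compl compact_imp_closed\<close>)
      then show ?thesis by (rule partial_eq)
    qed
    then show "partial b g \<in> ?C" using g smooth_on_step(2)[OF _ b] by auto
  qed
qed

subsection \<open>A bump function\<close>

text \<open>The negative powers are needed because differentiating \<open>exp (- 1/u)\<close> produces them.\<close>

definition flat_exp :: "nat \<Rightarrow> real \<Rightarrow> real" where
  "flat_exp k u = (if u > 0 then (1 / u) ^ k * exp (- (1 / u)) else 0)"

lemma flat_exp_deriv:
  "(flat_exp k has_real_derivative flat_exp (k + 2) u - real k * flat_exp (k + 1) u) (at u)"
proof -
  consider "u > 0" | "u < 0" | "u = 0" by linarith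
  then show ?thesis
  proof cases
    case 1
    have "((\<lambda>u. (1 / u) ^ k * exp (- (1 / u))) has_real_derivative
        flat_exp (k + 2) u - real k * flat_exp (k + 1) u) (at u)"
    proof -
      have V: "((\<lambda>u. 1 / u) has_real_derivative - ((1 / u) ^ 2)) (at u)"
        using 1 by (auto intro!: derivative_eq_intros simp: power2_eq_square)
      show ?thesis
        by (rule DERIV_cong[OF DERIV_mult[OF DERIV_power[OF V, of k] DERIV_chain2[OF DERIV_exp DERIV_minus[OF V]]]])
          (use 1 in \<open>cases k; simp add: flat_exp_def algebra_simps power2_eq_square\<close>)
    qed
    then show ?thesis
      by (rule has_field_derivative_transform_within[of _ _ _ _ u]) (use 1 in \<open>auto simp: flat_exp_def dist_real_def\<close>)
  next
    case 2
    have "((\<lambda>u. 0) has_real_derivative 0) (at u)" by simp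
    then have "(flat_exp k has_real_derivative 0) (at u)"
      by (rule has_field_derivative_transform_within[of _ _ _ _ "- u"]) (use 2 in \<open>auto simp: flat_exp_def dist_real_def\<close>)
    then show ?thesis using 2 by (simp add: flat_exp_def)
  next
    case 3
    have "((\<lambda>h. flat_exp k h / h) \<longlongrightarrow> 0) (at_right 0)"
    proof (rule Lim_transform_eventually)
      have "((\<lambda>y::real. y ^ (k + 1) / exp y) \<longlongrightarrow> 0) at_top"
        by (rule tendsto_power_div_exp_0)
      then show "((\<lambda>h. (inverse h) ^ (k + 1) / exp (inverse h)) \<longlongrightarrow> (0::real)) (at_right 0)"
        by (rule filterlim_compose[OF _ filterlim_inverse_at_top_right])
      show "\<forall>\<^sub>F h in at_right 0. inverse h ^ (k + 1) / exp (inverse h) = flat_exp k h / h"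
        by (auto simp: eventually_at_filter flat_exp_def exp_minus divide_inverse)
    qed
    moreover have "((\<lambda>h. flat_exp k h / h) \<longlongrightarrow> 0) (at_left 0)"
      by (rule Lim_transform_eventually[of "\<lambda>_. 0"])
        (auto simp: eventually_at_filter flat_exp_def)
    ultimately have "((\<lambda>h. flat_exp k h / h) \<longlongrightarrow> 0) (at 0)"
      using filterlim_split_at by blast
    then show ?thesis using 3 by (simp add: DERIV_def flat_exp_def)
  qed
qed

text \<open>Every derivative of the bump function is a combination of its generators, and differentiating a
  generator does not leave the class. This replaces explicit formulas for higher derivatives.\<close>

inductive_set bump_class :: "real \<Rightarrow> 'a::euclidean_space \<Rightarrow> ('a \<Rightarrow> complex) set"
  for r :: real and a :: "'a::euclidean_space" where
  base: "(\<lambda>x. complex_of_real (flat_exp k (r\<^sup>2 - (x - a) \<bullet> (x - a)))) \<in> bump_class r a"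
| coord: "f \<in> bump_class r a \<Longrightarrow> (\<lambda>x. complex_of_real (c * ((x - a) \<bullet> b)) * f x) \<in> bump_class r a"
| cmult: "f \<in> bump_class r a \<Longrightarrow> (\<lambda>x. complex_of_real c * f x) \<in> bump_class r a"
| add: "f \<in> bump_class r a \<Longrightarrow> g \<in> bump_class r a \<Longrightarrow> (\<lambda>x. f x + g x) \<in> bump_class r a"

lemma bump_class_derivative:
  fixes h :: "'a::euclidean_space \<Rightarrow> complex"
  assumes "h \<in> bump_class r a"
  shows "h differentiable_on UNIV \<and> (\<forall>b. partial b h \<in> bump_class r a)"
  using assms
proof induction
  case (base k)
  let ?q = "\<lambda>x. r\<^sup>2 - (x - a) \<bullet> (x - a)"
  have D: "((\<lambda>x. complex_of_real (flat_exp k (?q x))) has_derivative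
      (\<lambda>y. complex_of_real ((-2) * ((x - a) \<bullet> y)) * (complex_of_real (flat_exp (k + 2) (?q x))
         + complex_of_real (- real k) * complex_of_real (flat_exp (k + 1) (?q x))))) (at x)" for x
  proof -
    have "(?q has_derivative (\<lambda>y. (-2) * ((x - a) \<bullet> y))) (at x)"
      by (auto intro!: derivative_eq_intros simp: inner_commute)
    from has_derivative_compose[OF this flat_exp_deriv[unfolded has_field_derivative_def]]
    have "((\<lambda>x. flat_exp k (?q x)) has_derivative (\<lambda>y. (flat_exp (k + 2) (?q x) - real k * flat_exp (k + 1) (?q x)) *
        ((-2) * ((x - a) \<bullet> y)))) (at x)" .
    from has_derivative_of_real[OF this] show ?thesis
      by (rule has_derivative_eq_rhs) (auto simp: algebra_simps)
  qed
  have "partial b (\<lambda>x. complex_of_real (flat_exp k (?q x))) \<in> bump_class r a" for b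
    unfolding partial_eq[OF D] by (intro bump_class.intros)
  then show ?case using D by (auto intro: differentiable_onI_UNIV)
next
  case (coord f c b)
  have D: "((\<lambda>x. complex_of_real (c * ((x - a) \<bullet> b)) * f x) has_derivative
      (\<lambda>y. complex_of_real (c * ((x - a) \<bullet> b)) * partial y f x + complex_of_real (c * (y \<bullet> b)) * f x)) (at x)" for x
    by (rule derivative_eq_intros has_derivative_partial conjunct1[OF coord.IH] refl)+
      (simp add: algebra_simps)
  have "partial y (\<lambda>x. complex_of_real (c * ((x - a) \<bullet> b)) * f x) \<in> bump_class r a" for y
    unfolding partial_eq[OF D] using coord by (intro bump_class.intros) auto
  then show ?case using D by (auto intro: differentiable_onI_UNIV)
next
  case (cmult f c)
  have D: "((\<lambda>x. complex_of_real c * f x) has_derivative (\<lambda>h. complex_of_real c * partial h f x)) (at x)" for x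
    by (rule has_derivative_mult_right[OF has_derivative_partial[OF conjunct1[OF cmult.IH]]])
  have "partial y (\<lambda>x. complex_of_real c * f x) \<in> bump_class r a" for y
    unfolding partial_eq[OF D] using cmult by (intro bump_class.intros) auto
  then show ?case using D by (auto intro: differentiable_onI_UNIV)
next
  case (add f g)
  then have D: "((\<lambda>x. f x + g x) has_derivative (\<lambda>h. partial h f x + partial h g x)) (at x)" for x
    by (intro has_derivative_add_partial) auto
  have "partial b (\<lambda>x. f x + g x) \<in> bump_class r a" for b
    unfolding partial_eq[OF D] using add by (intro bump_class.intros) auto
  then show ?case using D by (auto intro: differentiable_onI_UNIV)
qed

definition bump :: "real \<Rightarrow> 'a::euclidean_space \<Rightarrow> 'a \<Rightarrow> real" where
  "bump r a x = flat_exp 0 (r\<^sup>2 - (x - a) \<bullet> (x - a))"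

lemma bump_nonneg: "bump r a x \<ge> 0"
  by (simp add: bump_def flat_exp_def)

lemma bump_nonzero_iff:
  assumes "r > 0" shows "bump r a x \<noteq> 0 \<longleftrightarrow> dist x a < r"
proof -
  have "(x - a) \<bullet> (x - a) < r\<^sup>2 \<longleftrightarrow> norm (x - a) < r"
    using assms by (metis abs_norm_cancel abs_of_pos power2_norm_eq_inner abs_le_square_iff not_le)
  then show ?thesis by (auto simp: bump_def flat_exp_def dist_norm)
qed

lemma test_function_bump:
  assumes "r > 0" "cball a r \<subseteq> U"
  shows "test_function U (\<lambda>x. complex_of_real (bump r a x))"
proof -
  have "smooth_on UNIV (\<lambda>x. complex_of_real (bump r a x))"
    by (rule smooth_on_coinduct[where C = "bump_class r a"])
      (use bump_class_derivative in \<open>auto simp: bump_def intro: bump_class.base\<close>)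
  moreover have "{x. complex_of_real (bump r a x) \<noteq> 0} = ball a r"
    using bump_nonzero_iff[OF assms(1), of a] by (simp add: set_eq_iff dist_commute[of _ a])
  ultimately show ?thesis using assms by (simp add: test_function_def)
qed

lemma continuous_on_bump: "continuous_on S (bump r a)"
proof -
  have "isCont (flat_exp 0) u" for u using flat_exp_deriv DERIV_isCont by blast
  then have "continuous_on UNIV (flat_exp 0)" by (simp add: continuous_at_imp_continuous_on)
  then show ?thesis unfolding bump_def[abs_def]
    by (rule continuous_on_compose2) (auto intro!: continuous_intros)
qed

section \<open>The Fourier transform\<close>

subsection \<open>Integrals over Euclidean space\<close>

lemma lborel_integral_prod_Basis:
  fixes g :: "'a::euclidean_space \<Rightarrow> real \<Rightarrow> 'b::{real_normed_field,banach,second_countable_topology}"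
  assumes g: "\<And>b. b \<in> Basis \<Longrightarrow> integrable lborel (g b)"
  shows "integrable lborel (\<lambda>x::'a. \<Prod>b\<in>Basis. g b (x \<bullet> b))"
    and "(LINT x|lborel. (\<Prod>b\<in>Basis. g b (x \<bullet> b))) = (\<Prod>b\<in>(Basis::'a set). (LINT t|lborel. g b t))"
proof -
  interpret product_sigma_finite "\<lambda>_::'a. lborel :: real measure" ..
  have m[measurable]: "g b \<in> borel_measurable borel" if "b \<in> Basis" for b
    using borel_measurable_integrable[OF g[OF that]] by simp
  have c: "(\<Prod>b\<in>Basis. g b ((\<Sum>a\<in>Basis. f a *\<^sub>R a) \<bullet> b)) = (\<Prod>b\<in>Basis. g b (f b))" for f :: "'a \<Rightarrow> real"
    by (intro prod.cong refl) (simp add: inner_sum_left_Basis)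
  have T: "(\<lambda>f. \<Sum>b\<in>Basis. f b *\<^sub>R b) \<in> measurable (\<Pi>\<^sub>M b\<in>(Basis::'a set). lborel) borel"
    by measurable
  have G: "(\<lambda>x::'a. \<Prod>b\<in>Basis. g b (x \<bullet> b)) \<in> borel_measurable borel"
    by measurable
  show "integrable lborel (\<lambda>x::'a. \<Prod>b\<in>Basis. g b (x \<bullet> b))"
    unfolding lborel_eq[where 'a='a]
    by (subst integrable_distr_eq[OF T G]) (simp only: c product_integrable_prod[OF finite_Basis g])
  show "(LINT x|lborel. (\<Prod>b\<in>Basis. g b (x \<bullet> b))) = (\<Prod>b\<in>(Basis::'a set). (LINT t|lborel. g b t))"
    unfolding lborel_eq[where 'a='a]
    by (subst integral_distr[OF T G]) (simp only: c product_integral_prod[OF finite_Basis g])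
qed

lemma lborel_integral_affine:
  fixes f :: "'a::euclidean_space \<Rightarrow> 'b::{banach,second_countable_topology}"
  assumes [measurable]: "f \<in> borel_measurable borel" and c: "c \<noteq> 0"
  shows "(LINT x|lborel. f x) = \<bar>c\<bar> ^ DIM('a) *\<^sub>R (LINT x|lborel. f (t + c *\<^sub>R x))"
    and "integrable lborel f \<longleftrightarrow> integrable lborel (\<lambda>x. f (t + c *\<^sub>R x))"
proof -
  have L: "lborel = density (distr lborel borel (\<lambda>x::'a. t + c *\<^sub>R x)) (\<lambda>_. ennreal (\<bar>c\<bar> ^ DIM('a)))"
    by (rule lborel_affine[OF c])
  show "(LINT x|lborel. f x) = \<bar>c\<bar> ^ DIM('a) *\<^sub>R (LINT x|lborel. f (t + c *\<^sub>R x))"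
    by (subst L, subst integral_density) (auto simp: integral_distr)
  show "integrable lborel f \<longleftrightarrow> integrable lborel (\<lambda>x. f (t + c *\<^sub>R x))"
    using c integrable_scaleR_right[of "inverse (\<bar>c\<bar> ^ DIM('a))" lborel "\<lambda>x. \<bar>c\<bar> ^ DIM('a) *\<^sub>R f (t + c *\<^sub>R x)"]
    by (subst L, subst integrable_density) (auto simp: integrable_distr_eq)
qed

lemma lborel_integral_translate:
  fixes f :: "'a::euclidean_space \<Rightarrow> 'b::{banach,second_countable_topology}"
  assumes "f \<in> borel_measurable borel"
  shows "(LINT x|lborel. f (x + z)) = (LINT x|lborel. f x)"
    and "integrable lborel (\<lambda>x. f (x + z)) \<longleftrightarrow> integrable lborel f"
  using lborel_integral_affine[OF assms, of 1 z] by (simp_all add: add.commute)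

lemma lborel_integral_reflect:
  fixes f :: "'a::euclidean_space \<Rightarrow> 'b::{banach,second_countable_topology}"
  assumes "f \<in> borel_measurable borel"
  shows "(LINT x|lborel. f (- x)) = (LINT x|lborel. f x)"
    and "integrable lborel (\<lambda>x. f (- x)) \<longleftrightarrow> integrable lborel f"
  using lborel_integral_affine[OF assms, of "-1" 0] by simp_all

lemma integrable_pair_mult:
  fixes f :: "'a::euclidean_space \<Rightarrow> 'c::{real_normed_field,banach,second_countable_topology}"
    and g :: "'b::euclidean_space \<Rightarrow> 'c"
  assumes f: "integrable lborel f" and g: "integrable lborel g"
  shows "integrable (lborel \<Otimes>\<^sub>M lborel) (\<lambda>(x, y). f x * g y)"
proof (rule lborel_pair.Fubini_integrable)
  have [measurable]: "f \<in> borel_measurable borel" "g \<in> borel_measurable borel"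
    using f g borel_measurable_integrable by auto
  show "(\<lambda>(x, y). f x * g y) \<in> borel_measurable (lborel \<Otimes>\<^sub>M lborel)" by measurable
  show "integrable lborel (\<lambda>x. \<integral> y. norm (case (x, y) of (x, y) \<Rightarrow> f x * g y) \<partial>lborel)"
    using f by (simp add: norm_mult)
  show "AE x in lborel. integrable lborel (\<lambda>y. case (x, y) of (x, y) \<Rightarrow> f x * g y)"
    using g by simp
qed

subsection \<open>Gaussians\<close>

definition gauss :: "real \<Rightarrow> 'a::euclidean_space \<Rightarrow> real" where
  "gauss e x = exp (- ((e * norm x)\<^sup>2 / 2))"

lemma gauss_pos: "gauss e x > 0" and gauss_le_1: "gauss e x \<le> 1"
  by (simp_all add: gauss_def)

lemma abs_gauss_le_1: "\<bar>gauss e x\<bar> \<le> 1"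
  by (simp add: gauss_def)

lemma gauss_measurable[measurable]: "gauss e \<in> borel_measurable borel"
  unfolding gauss_def[abs_def] by measurable

text \<open>A rescaled form of the characteristic function of the standard normal distribution.\<close>

lemma gauss_fourier_1d:
  fixes s e :: real
  assumes "e > 0"
  shows "integrable lborel (\<lambda>t. cis (s * t) * complex_of_real (exp (- ((e * t)\<^sup>2 / 2))))"
    and "(LINT t|lborel. cis (s * t) * complex_of_real (exp (- ((e * t)\<^sup>2 / 2))))
      = complex_of_real (sqrt (2 * pi) / e * exp (- ((s / e)\<^sup>2 / 2)))"
proof -
  have D: "complex_of_real (std_normal_density x) = complex_of_real (exp (- (x\<^sup>2 / 2))) / complex_of_real (sqrt (2 * pi))" for x
    by (simp add: std_normal_density_def)
  have I: "integrable lborel (\<lambda>x::real. exp (- (x\<^sup>2 / 2)))"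
  proof -
    have "integrable lborel (\<lambda>x::real. sqrt (2 * pi) * std_normal_density x)"
      by (intro integrable_mult_right integrable_normal_density) simp
    then show ?thesis by (simp add: std_normal_density_def)
  qed
  have I1: "integrable lborel (\<lambda>x. cis (r * x) * complex_of_real (exp (- (x\<^sup>2 / 2))))" for r
    by (rule Bochner_Integration.integrable_bound[OF I]) (auto simp: norm_mult cis_conv_exp)
  have 1: "(LINT x|lborel. cis (r * x) * complex_of_real (exp (- (x\<^sup>2 / 2))))
      = complex_of_real (sqrt (2 * pi) * exp (- (r\<^sup>2 / 2)))" for r :: real
  proof -
    have "char std_normal_distribution r = (LINT x|lborel. std_normal_density x *\<^sub>R cis (r * x))"
      unfolding char_def by (subst integral_density) (auto simp: cis_conv_exp)
    also have "\<dots> = (LINT x|lborel. cis (r * x) * complex_of_real (exp (- (x\<^sup>2 / 2)))) / complex_of_real (sqrt (2 * pi))"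
      unfolding scaleR_conv_of_real D by (simp add: mult.commute)
    finally show ?thesis
      by (simp add: char_std_normal_distribution field_simps)
  qed
  have m: "(\<lambda>t. cis (r * t) * complex_of_real (exp (- (t\<^sup>2 / 2)))) \<in> borel_measurable borel" for r
    by (simp add: cis_conv_exp)
  note A = lborel_integral_affine[OF m, of e "s / e" 0]
  show "integrable lborel (\<lambda>t. cis (s * t) * complex_of_real (exp (- ((e * t)\<^sup>2 / 2))))"
    using A(2) I1[of "s / e"] assms by simp
  show "(LINT t|lborel. cis (s * t) * complex_of_real (exp (- ((e * t)\<^sup>2 / 2))))
      = complex_of_real (sqrt (2 * pi) / e * exp (- ((s / e)\<^sup>2 / 2)))"
    using A(1) 1[of "s / e"] assms by (simp add: scaleR_conv_of_real field_simps)
qed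

lemma cis_sum: "finite A \<Longrightarrow> cis (\<Sum>a\<in>A. f a) = (\<Prod>a\<in>A. cis (f a))"
  by (simp add: cis_conv_exp sum_distrib_left exp_sum)

lemma gauss_prod: "gauss e x = (\<Prod>b\<in>Basis. exp (- ((e * (x \<bullet> b))\<^sup>2 / 2)))"
proof -
  have "(norm x)\<^sup>2 = (\<Sum>b\<in>Basis. (x \<bullet> b)\<^sup>2)"
    unfolding power2_norm_eq_inner by (subst euclidean_inner) (simp add: power2_eq_square)
  then show ?thesis
    by (simp add: gauss_def exp_sum[symmetric] power_mult_distrib sum_distrib_left sum_negf sum_divide_distrib)
qed

lemma gauss_fourier:
  fixes s :: "'a::euclidean_space"
  assumes "e > 0"
  shows "integrable lborel (\<lambda>\<xi>. cis (s \<bullet> \<xi>) * complex_of_real (gauss e \<xi>))"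
    and "(LINT \<xi>|lborel. cis (s \<bullet> \<xi>) * complex_of_real (gauss e \<xi>))
      = complex_of_real ((sqrt (2 * pi) / e) ^ DIM('a) * gauss (1 / e) s)"
proof -
  have eq: "cis (s \<bullet> \<xi>) * complex_of_real (gauss e \<xi>)
      = (\<Prod>b\<in>Basis. cis ((s \<bullet> b) * (\<xi> \<bullet> b)) * complex_of_real (exp (- ((e * (\<xi> \<bullet> b))\<^sup>2 / 2))))" for \<xi> :: 'a
    by (subst euclidean_inner) (simp add: cis_sum prod.distrib gauss_prod)
  note P = lborel_integral_prod_Basis[where 'a='a and g = "\<lambda>b t. cis ((s \<bullet> b) * t) * complex_of_real (exp (- ((e * t)\<^sup>2 / 2)))",
      OF gauss_fourier_1d(1)[OF assms]]
  show "integrable lborel (\<lambda>\<xi>. cis (s \<bullet> \<xi>) * complex_of_real (gauss e \<xi>))"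
    unfolding eq by (rule P(1))
  show "(LINT \<xi>|lborel. cis (s \<bullet> \<xi>) * complex_of_real (gauss e \<xi>))
      = complex_of_real ((sqrt (2 * pi) / e) ^ DIM('a) * gauss (1 / e) s)"
    unfolding eq P(2) gauss_fourier_1d(2)[OF assms]
    unfolding gauss_prod[of "1 / e" s]
    by (simp only: of_real_mult of_real_prod of_real_power prod.distrib prod_constant) simp
qed

lemma gauss_integrable:
  assumes "e > 0"
  shows "integrable lborel (gauss e :: 'a::euclidean_space \<Rightarrow> real)"
    and "(LINT x|lborel. gauss e (x::'a)) = (sqrt (2 * pi) / e) ^ DIM('a)"
proof -
  have "integrable lborel (\<lambda>x::'a. complex_of_real (gauss e x))"
    using gauss_fourier(1)[OF assms, of 0] by simp
  then show "integrable lborel (gauss e :: 'a \<Rightarrow> real)"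
    by (simp only: complex_of_real_integrable_eq)
  have "complex_of_real (LINT x|lborel. gauss e (x::'a)) = complex_of_real ((sqrt (2 * pi) / e) ^ DIM('a))"
    using gauss_fourier(2)[OF assms, of 0] by (simp add: gauss_def[of _ 0] integral_complex_of_real)
  then show "(LINT x|lborel. gauss e (x::'a)) = (sqrt (2 * pi) / e) ^ DIM('a)"
    using of_real_eq_iff by blast
qed

subsection \<open>Gaussian summation of the inversion integral\<close>

lemma cis_measurable[measurable]: "cis \<in> borel_measurable borel"
  by (rule borel_measurable_continuous_onI) (intro continuous_intros)

lemma integrable_cis_mult:
  fixes f :: "'a::euclidean_space \<Rightarrow> complex"
  assumes "integrable lborel f" and "g \<in> borel_measurable borel"
  shows "integrable lborel (\<lambda>x. cis (g x) * f x)"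
  using assms by (intro Bochner_Integration.integrable_bound[OF assms(1)])
    (auto simp: norm_mult dest: borel_measurable_integrable)

lemma fourier_measurable[measurable]:
  fixes f :: "'a::euclidean_space \<Rightarrow> complex"
  assumes [measurable]: "f \<in> borel_measurable borel"
  shows "fourier f \<in> borel_measurable borel"
  unfolding fourier_def[abs_def] by measurable

lemma norm_fourier_le:
  fixes f :: "'a::euclidean_space \<Rightarrow> complex"
  shows "norm (fourier f \<xi>) \<le> (LINT x|lborel. norm (f x))"
  unfolding fourier_def
  by (rule order_trans[OF integral_norm_bound]) (simp add: norm_mult)

text \<open>Damping the inversion integral by a Gaussian makes Fubini applicable and turns the
  inversion integral into a Gaussian average of \<open>f\<close> around \<open>x\<close>.\<close>

lemma gauss_inversion:
  fixes f :: "'a::euclidean_space \<Rightarrow> complex"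
  assumes f: "integrable lborel f" and e: "e > 0"
  shows "(LINT \<xi>|lborel. cis (x \<bullet> \<xi>) * fourier f \<xi> * complex_of_real (gauss e \<xi>))
    = complex_of_real (sqrt (2 * pi) ^ DIM('a)) * (LINT u|lborel. f (x + e *\<^sub>R u) * complex_of_real (gauss 1 u))"
proof -
  have [measurable]: "f \<in> borel_measurable borel" using f borel_measurable_integrable by auto
  have "integrable (lborel \<Otimes>\<^sub>M lborel) (\<lambda>(\<xi>::'a, y). complex_of_real (gauss e \<xi>) * f y)"
    using gauss_integrable(1)[OF e]
    by (intro integrable_pair_mult f) (simp only: complex_of_real_integrable_eq)
  then have I: "integrable (lborel \<Otimes>\<^sub>M lborel)
      (\<lambda>(\<xi>, y). cis ((x - y) \<bullet> \<xi>) * complex_of_real (gauss e \<xi>) * f y)"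
    by (rule Bochner_Integration.integrable_bound) (auto simp: norm_mult)
  have "(LINT \<xi>|lborel. cis (x \<bullet> \<xi>) * fourier f \<xi> * complex_of_real (gauss e \<xi>))
    = (LINT \<xi>|lborel. LINT y|lborel. cis ((x - y) \<bullet> \<xi>) * complex_of_real (gauss e \<xi>) * f y)"
    unfolding fourier_def
    by (simp add: integral_mult_right_zero[symmetric] integral_mult_left_zero[symmetric]
        inner_diff_left cis_divide[symmetric] cis_mult[symmetric] cis_inverse[symmetric] field_simps
        del: integral_mult_right_zero integral_mult_left_zero)
  also have "\<dots> = (LINT y|lborel. LINT \<xi>|lborel. cis ((x - y) \<bullet> \<xi>) * complex_of_real (gauss e \<xi>) * f y)"
    using lborel_pair.Fubini_integral[OF I] by simp
  also have "\<dots> = (LINT y|lborel. complex_of_real ((sqrt (2 * pi) / e) ^ DIM('a)) * (f y * complex_of_real (gauss (1 / e) (x - y))))"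
    unfolding integral_mult_left_zero gauss_fourier(2)[OF e] by (simp add: mult_ac)
  also have "\<dots> = complex_of_real ((sqrt (2 * pi) / e) ^ DIM('a)) * (LINT y|lborel. f y * complex_of_real (gauss (1 / e) (x - y)))"
    by (rule integral_mult_right_zero)
  also have "(LINT y|lborel. f y * complex_of_real (gauss (1 / e) (x - y)))
    = e ^ DIM('a) *\<^sub>R (LINT u|lborel. f (x + e *\<^sub>R u) * complex_of_real (gauss 1 u))"
    using e by (subst lborel_integral_affine(1)[of _ e x]) (auto simp: gauss_def)
  finally show ?thesis using e by (simp add: scaleR_conv_of_real power_divide)
qed

lemma gauss_tendsto: "(\<lambda>n. gauss (1 / real (Suc n)) x) \<longlonglongrightarrow> 1"
proof -
  have "(\<lambda>n. exp (- ((1 / real (Suc n) * norm x)\<^sup>2 / 2))) \<longlonglongrightarrow> exp (- ((0 * norm x)\<^sup>2 / 2))"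
    by (intro tendsto_intros LIMSEQ_Suc[OF lim_1_over_n]) simp
  then show ?thesis by (simp add: gauss_def)
qed

text \<open>As the Gaussian flattens, the damped integral converges to the inversion integral by dominated
  convergence, and the Gaussian average concentrates at the point of continuity.\<close>

theorem fourier_inversion:
  fixes f :: "'a::euclidean_space \<Rightarrow> complex"
  assumes f: "integrable lborel f" and Ff: "integrable lborel (fourier f)"
    and cont: "isCont f x" and bd: "\<And>y. norm (f y) \<le> K"
  shows "(LINT \<xi>|lborel. cis (x \<bullet> \<xi>) * fourier f \<xi>) = complex_of_real ((2 * pi) ^ DIM('a)) * f x"
proof -
  have [measurable]: "f \<in> borel_measurable borel" using f borel_measurable_integrable by auto
  let ?e = "\<lambda>n. 1 / real (Suc n)"
  have e0: "?e \<longlonglongrightarrow> 0" by (rule LIMSEQ_Suc[OF lim_1_over_n])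
  have L: "(\<lambda>n. LINT \<xi>|lborel. cis (x \<bullet> \<xi>) * fourier f \<xi> * complex_of_real (gauss (?e n) \<xi>))
      \<longlonglongrightarrow> (LINT \<xi>|lborel. cis (x \<bullet> \<xi>) * fourier f \<xi> * complex_of_real 1)"
  proof (rule integral_dominated_convergence[where w = "\<lambda>\<xi>. norm (fourier f \<xi>)"])
    show "integrable lborel (\<lambda>\<xi>. norm (fourier f \<xi>))" using Ff by simp
    show "AE \<xi> in lborel. (\<lambda>n. cis (x \<bullet> \<xi>) * fourier f \<xi> * complex_of_real (gauss (?e n) \<xi>))
        \<longlonglongrightarrow> cis (x \<bullet> \<xi>) * fourier f \<xi> * complex_of_real 1"
      by (intro AE_I2 tendsto_intros gauss_tendsto)
    show "AE \<xi> in lborel. norm (cis (x \<bullet> \<xi>) * fourier f \<xi> * complex_of_real (gauss (?e n) \<xi>)) \<le> norm (fourier f \<xi>)" for n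
      by (intro AE_I2) (simp add: norm_mult mult_left_le abs_gauss_le_1 del: of_nat_Suc)
  qed measurable
  have B: "norm (f y * complex_of_real (gauss 1 u)) \<le> K * gauss 1 u" for y and u :: 'a
  proof -
    have "norm (f y * complex_of_real (gauss 1 u)) = norm (f y) * gauss 1 u"
      by (simp add: norm_mult abs_of_pos[OF gauss_pos])
    then show ?thesis using mult_right_mono[OF bd less_imp_le[OF gauss_pos]] by metis
  qed
  have R: "(\<lambda>n. LINT u|lborel. f (x + ?e n *\<^sub>R u) * complex_of_real (gauss 1 u))
      \<longlonglongrightarrow> (LINT u|lborel. f x * complex_of_real (gauss 1 (u::'a)))"
  proof (rule integral_dominated_convergence[where w = "\<lambda>u. K * gauss 1 u"])
    show "integrable lborel (\<lambda>u::'a. K * gauss 1 u)" using gauss_integrable(1)[of 1, where 'a='a] by simp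
    show "AE u in lborel. (\<lambda>n. f (x + ?e n *\<^sub>R u) * complex_of_real (gauss 1 u)) \<longlonglongrightarrow> f x * complex_of_real (gauss 1 (u::'a))"
    proof (intro AE_I2 tendsto_intros)
      fix u :: 'a
      have "(\<lambda>n. x + ?e n *\<^sub>R u) \<longlonglongrightarrow> x + 0 *\<^sub>R u" by (intro tendsto_intros e0)
      then show "(\<lambda>n. f (x + ?e n *\<^sub>R u)) \<longlonglongrightarrow> f x"
        by (intro isCont_tendsto_compose[OF cont]) simp
    qed
    show "AE u in lborel. norm (f (x + ?e n *\<^sub>R u) * complex_of_real (gauss 1 u)) \<le> K * gauss 1 (u::'a)" for n
      by (intro AE_I2 B)
  qed measurable
  have E: "(LINT u|lborel. f x * complex_of_real (gauss 1 (u::'a))) = f x * complex_of_real (sqrt (2 * pi) ^ DIM('a))"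
    using gauss_integrable(2)[of 1, where 'a='a] by (simp add: integral_complex_of_real)
  have "(\<lambda>n. complex_of_real (sqrt (2 * pi) ^ DIM('a)) * (LINT u|lborel. f (x + ?e n *\<^sub>R u) * complex_of_real (gauss 1 u)))
      \<longlonglongrightarrow> complex_of_real (sqrt (2 * pi) ^ DIM('a)) * (f x * complex_of_real (sqrt (2 * pi) ^ DIM('a)))"
    using R unfolding E by (intro tendsto_intros)
  then have "(\<lambda>n. LINT \<xi>|lborel. cis (x \<bullet> \<xi>) * fourier f \<xi> * complex_of_real (gauss (?e n) \<xi>))
     \<longlonglongrightarrow> complex_of_real (sqrt (2 * pi) ^ DIM('a)) * (f x * complex_of_real (sqrt (2 * pi) ^ DIM('a)))"
    by (subst gauss_inversion[OF f]) simp_all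
  moreover have "complex_of_real (sqrt (2 * pi) ^ DIM('a)) * (f x * complex_of_real (sqrt (2 * pi) ^ DIM('a)))
      = complex_of_real ((sqrt (2 * pi) * sqrt (2 * pi)) ^ DIM('a)) * f x"
    by (simp only: power_mult_distrib of_real_mult mult_ac)
  ultimately show ?thesis using LIMSEQ_unique[OF L] by simp
qed

subsection \<open>Plancherel's identity\<close>

lemma cnj_measurable[measurable]: "cnj \<in> borel_measurable borel"
  by (rule borel_measurable_continuous_onI) (intro continuous_intros)

lemma abs_mult_le_squares:
  fixes x y :: real
  shows "\<bar>x * y\<bar> \<le> x\<^sup>2 + y\<^sup>2"
proof -
  have "2 * (\<bar>x\<bar> * \<bar>y\<bar>) \<le> x\<^sup>2 + y\<^sup>2"
    using sum_squares_bound[of "\<bar>x\<bar>" "\<bar>y\<bar>"] by (simp add: mult.assoc)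
  moreover have "0 \<le> \<bar>x\<bar> * \<bar>y\<bar>" by simp
  ultimately show ?thesis unfolding abs_mult by linarith
qed

text \<open>Translation is continuous in mean: for the indicator of an open set this is dominated
  convergence, outer regularity gives Borel sets, and integrable functions follow by
  approximation.\<close>

lemma L1_translation_open:
  fixes U :: "'a::euclidean_space set"
  assumes U: "open U" "emeasure lborel U < \<infinity>" and z: "z \<longlonglongrightarrow> 0"
  shows "(\<lambda>n. LINT x|lborel. \<bar>indicator U (x + z n) - indicator U x :: real\<bar>) \<longlonglongrightarrow> 0"
proof -
  have [measurable]: "U \<in> sets borel" using U by simp
  have IU: "integrable lborel (indicator U :: 'a \<Rightarrow> real)"
    using U by (intro integrable_real_indicator) auto
  have IT: "integrable lborel (\<lambda>x. indicator U (x + z n) :: real)" for n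
    using IU by (subst lborel_integral_translate(2)) auto
  have IP: "integrable lborel (\<lambda>x. indicator U (x + z n) * indicator U x :: real)" for n
    by (rule Bochner_Integration.integrable_bound[OF IU]) (auto simp: indicator_def)
  have eq: "(LINT x|lborel. \<bar>indicator U (x + z n) - indicator U x :: real\<bar>)
     = 2 * measure lborel U - 2 * (LINT x|lborel. indicator U (x + z n) * indicator U x)" for n
  proof -
    have "(LINT x|lborel. \<bar>indicator U (x + z n) - indicator U x :: real\<bar>)
      = (LINT x|lborel. indicator U (x + z n) + indicator U x - 2 * (indicator U (x + z n) * indicator U x))"
      by (intro Bochner_Integration.integral_cong refl) (auto simp: indicator_def)
    also have "\<dots> = (LINT x|lborel. indicator U (x + z n)) + (LINT x|lborel. indicator U x)
        - 2 * (LINT x|lborel. indicator U (x + z n) * indicator U x)"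
      using IU IT IP by simp
    also have "(LINT x|lborel. indicator U (x + z n) :: real) = (LINT x|lborel. indicator U x)"
      by (rule lborel_integral_translate(1)) simp
    finally show ?thesis using U by simp
  qed
  have "(\<lambda>n. LINT x|lborel. indicator U (x + z n) * indicator U x :: real)
      \<longlonglongrightarrow> (LINT x|lborel. indicator U x)"
  proof (rule integral_dominated_convergence[OF _ _ IU])
    show "AE x in lborel. (\<lambda>n. indicator U (x + z n) * indicator U x) \<longlonglongrightarrow> (indicator U x :: real)"
    proof (intro AE_I2)
      fix x :: 'a
      show "(\<lambda>n. indicator U (x + z n) * indicator U x) \<longlonglongrightarrow> (indicator U x :: real)"
      proof (cases "x \<in> U")
        case True
        have "(\<lambda>n. x + z n) \<longlonglongrightarrow> x + 0" by (intro tendsto_intros z)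
        then have "\<forall>\<^sub>F n in sequentially. x + z n \<in> U"
          using True U(1) by (intro topological_tendstoD) auto
        then have "\<forall>\<^sub>F n in sequentially. (1::real) = indicator U (x + z n) * indicator U x"
          by eventually_elim (use True in auto)
        from Lim_transform_eventually[OF tendsto_const this] show ?thesis using True by simp
      qed simp
    qed
  qed (auto simp: indicator_def)
  then have "(\<lambda>n. 2 * measure lborel U - 2 * (LINT x|lborel. indicator U (x + z n) * indicator U x))
      \<longlonglongrightarrow> 2 * measure lborel U - 2 * measure lborel U"
    using U by (intro tendsto_intros) simp
  then show ?thesis unfolding eq by simp
qed

lemma L1_translation_borel:
  fixes A :: "'a::euclidean_space set"
  assumes [measurable]: "A \<in> sets borel" and fin: "emeasure lborel A < \<infinity>" and z: "z \<longlonglongrightarrow> 0"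
  shows "(\<lambda>n. LINT x|lborel. \<bar>indicator A (x + z n) - indicator A x :: real\<bar>) \<longlonglongrightarrow> 0"
proof (rule LIMSEQ_I)
  fix r :: real assume r: "r > 0"
  obtain U where U: "open U" "A \<subseteq> U" "emeasure lborel (U - A) < ennreal (r / 4)"
    using outer_regular_lborel[OF assms(1), of "r / 4"] r by auto
  have [measurable]: "U \<in> sets borel" using U by simp
  have Dfin: "emeasure lborel (U - A) < \<infinity>" using U(3) by (rule order_less_trans) simp
  have "U = A \<union> (U - A)" using U by auto
  then have "emeasure lborel U \<le> emeasure lborel A + emeasure lborel (U - A)"
    using emeasure_subadditive[of A lborel "U - A"] by simp
  also have "\<dots> < \<infinity>" using fin Dfin by simp
  finally have Ufin: "emeasure lborel U < \<infinity>" .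
  have mD: "measure lborel (U - A) < r / 4"
    using U(3) Dfin r by (simp add: emeasure_eq_ennreal_measure ennreal_less_iff)
  have ID: "integrable lborel (indicator (U - A) :: 'a \<Rightarrow> real)"
    using Dfin by (intro integrable_real_indicator) auto
  have IU: "integrable lborel (indicator U :: 'a \<Rightarrow> real)"
    using Ufin by (intro integrable_real_indicator) auto
  have IDT: "integrable lborel (\<lambda>x. indicator (U - A) (x + w) :: real)" for w
    using ID by (subst lborel_integral_translate(2)) auto
  have IUT: "integrable lborel (\<lambda>x. indicator U (x + w) :: real)" for w
    using IU by (subst lborel_integral_translate(2)) auto
  obtain N where N: "\<And>n. n \<ge> N \<Longrightarrow> (LINT x|lborel. \<bar>indicator U (x + z n) - indicator U x :: real\<bar>) < r / 2"
    using LIMSEQ_D[OF L1_translation_open[OF U(1) Ufin z], of "r / 2"] r by fastforce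
  have "(LINT x|lborel. \<bar>indicator A (x + z n) - indicator A x :: real\<bar>) < r" if "n \<ge> N" for n
  proof -
    have "(LINT x|lborel. \<bar>indicator A (x + z n) - indicator A x :: real\<bar>)
      \<le> (LINT x|lborel. \<bar>indicator U (x + z n) - indicator U x\<bar> + (indicator (U - A) (x + z n) + indicator (U - A) x))"
    proof (rule integral_mono_AE')
      show "integrable lborel (\<lambda>x. \<bar>indicator U (x + z n) - indicator U x\<bar> + (indicator (U - A) (x + z n) + indicator (U - A) x) :: real)"
        using ID IU IDT IUT by auto
    qed (use U(2) in \<open>auto simp: indicator_def\<close>)
    also have "\<dots> = (LINT x|lborel. \<bar>indicator U (x + z n) - indicator U x :: real\<bar>)
       + ((LINT x|lborel. indicator (U - A) (x + z n)) + (LINT x|lborel. indicator (U - A) x))"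
      using ID IU IDT IUT by simp
    also have "(LINT x|lborel. indicator (U - A) (x + z n) :: real) = (LINT x|lborel. indicator (U - A) x)"
      by (rule lborel_integral_translate(1)) simp
    also have "(LINT x|lborel. indicator (U - A) x :: real) = measure lborel (U - A)" by simp
    also have "(LINT x|lborel. \<bar>indicator U (x + z n) - indicator U x :: real\<bar>) + (measure lborel (U - A) + measure lborel (U - A)) < r"
      using N[OF that] mD by linarith
    finally show ?thesis .
  qed
  then show "\<exists>N. \<forall>n\<ge>N. norm ((LINT x|lborel. \<bar>indicator A (x + z n) - indicator A x :: real\<bar>) - 0) < r"
    by (intro exI[of _ N]) simp
qed

lemma L1_translation:
  fixes f :: "'a::euclidean_space \<Rightarrow> 'b::{banach,second_countable_topology}"
  assumes f: "integrable lborel f" and z: "z \<longlonglongrightarrow> 0"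
  shows "(\<lambda>n. LINT x|lborel. norm (f (x + z n) - f x)) \<longlonglongrightarrow> 0"
  using f
proof (induction rule: integrable_induct)
  case (base A c)
  have "(\<lambda>n. (LINT x|lborel. \<bar>indicator A (x + z n) - indicator A x :: real\<bar>) * norm c) \<longlonglongrightarrow> 0 * norm c"
    using base z by (intro tendsto_intros L1_translation_borel) auto
  then show ?case by (simp flip: scaleR_diff_left)
next
  case (add f g)
  have T: "integrable lborel (\<lambda>x. f (x + w))" "integrable lborel (\<lambda>x. g (x + w))" for w
    using add borel_measurable_integrable by (auto simp: lborel_integral_translate(2))
  have S: "(\<lambda>n. (LINT x|lborel. norm (f (x + z n) - f x)) + (LINT x|lborel. norm (g (x + z n) - g x))) \<longlonglongrightarrow> 0 + 0"
    by (intro tendsto_add add.IH)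
  have le: "(LINT x|lborel. norm (f (x + z n) + g (x + z n) - (f x + g x)))
     \<le> (LINT x|lborel. norm (f (x + z n) - f x)) + (LINT x|lborel. norm (g (x + z n) - g x))" for n
  proof -
    have "(LINT x|lborel. norm (f (x + z n) + g (x + z n) - (f x + g x)))
      \<le> (LINT x|lborel. norm (f (x + z n) - f x) + norm (g (x + z n) - g x))"
      using add T by (intro integral_mono) (auto intro!: norm_triangle_le simp: norm_diff_triangle_ineq)
    then show ?thesis using add T by simp
  qed
  show ?case
  proof (rule tendsto_sandwich[OF _ _ tendsto_const[of 0]])
    show "\<forall>\<^sub>F n in sequentially. 0 \<le> (LINT x|lborel. norm (f (x + z n) + g (x + z n) - (f x + g x)))"
      by simp
    show "\<forall>\<^sub>F n in sequentially. (LINT x|lborel. norm (f (x + z n) + g (x + z n) - (f x + g x)))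
        \<le> (LINT x|lborel. norm (f (x + z n) - f x)) + (LINT x|lborel. norm (g (x + z n) - g x))"
      using le by simp
  qed (use S in simp)
next
  case (lim f s)
  have m: "f \<in> borel_measurable borel" "s i \<in> borel_measurable borel" for i
    using lim borel_measurable_integrable by auto
  have T: "integrable lborel (\<lambda>x. f (x + w))" "integrable lborel (\<lambda>x. s i (x + w))" for w i
    using lim m by (auto simp: lborel_integral_translate(2))
  have D: "(\<lambda>i. LINT x|lborel. norm (s i x - f x)) \<longlonglongrightarrow> (LINT x::'a|lborel. norm (0::'b))"
  proof (rule integral_dominated_convergence[where w = "\<lambda>x. 3 * norm (f x)"])
    show "AE x in lborel. (\<lambda>i. norm (s i x - f x)) \<longlonglongrightarrow> norm (0::'b)"
      using lim.hyps(2) by (intro AE_I2 tendsto_norm) (simp add: LIM_zero)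
    show "AE x in lborel. norm (norm (s i x - f x)) \<le> 3 * norm (f x)" for i
    proof (intro AE_I2)
      fix x show "norm (norm (s i x - f x)) \<le> 3 * norm (f x)"
        using lim.hyps(3)[of x i] norm_triangle_ineq4[of "s i x" "f x"] by simp
    qed
  qed (use m lim in auto)
  show ?case
  proof (rule LIMSEQ_I)
    fix r :: real assume r: "r > 0"
    obtain i where i: "(LINT x|lborel. norm (s i x - f x)) < r / 3"
      using LIMSEQ_D[OF D, of "r / 3"] r by fastforce
    obtain N where N: "\<And>n. n \<ge> N \<Longrightarrow> (LINT x|lborel. norm (s i (x + z n) - s i x)) < r / 3"
      using LIMSEQ_D[OF lim.IH[of i], of "r / 3"] r by fastforce
    have "(LINT x|lborel. norm (f (x + z n) - f x)) < r" if n: "n \<ge> N" for n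
    proof -
      have "(LINT x|lborel. norm (f (x + z n) - f x))
        \<le> (LINT x|lborel. norm (s i (x + z n) - f (x + z n)) + (norm (s i (x + z n) - s i x) + norm (s i x - f x)))"
        using lim T
      proof (intro integral_mono Bochner_Integration.integrable_add integrable_norm Bochner_Integration.integrable_diff)
        fix x
        show "norm (f (x + z n) - f x) \<le> norm (s i (x + z n) - f (x + z n)) + (norm (s i (x + z n) - s i x) + norm (s i x - f x))"
        proof -
          have eq: "f (x + z n) - f x = (s i (x + z n) - s i x) + (s i x - f x) - (s i (x + z n) - f (x + z n))"
            by simp
          show ?thesis
            unfolding eq
            using norm_triangle_ineq4[of "(s i (x + z n) - s i x) + (s i x - f x)" "s i (x + z n) - f (x + z n)"]
              norm_triangle_ineq[of "s i (x + z n) - s i x" "s i x - f x"] by linarith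
        qed
      qed auto
      also have "\<dots> = (LINT x|lborel. norm (s i (x + z n) - f (x + z n)))
          + ((LINT x|lborel. norm (s i (x + z n) - s i x)) + (LINT x|lborel. norm (s i x - f x)))"
        using lim T by simp
      also have "(LINT x|lborel. norm (s i (x + z n) - f (x + z n))) = (LINT x|lborel. norm (s i x - f x))"
        by (rule lborel_integral_translate(1)) (use m in measurable)
      also have "(LINT x|lborel. norm (s i x - f x)) + ((LINT x|lborel. norm (s i (x + z n) - s i x)) + (LINT x|lborel. norm (s i x - f x))) < r"
        using i N[OF n] by linarith
      finally show ?thesis .
    qed
    then show "\<exists>N. \<forall>n\<ge>N. norm ((LINT x|lborel. norm (f (x + z n) - f x)) - 0) < r"
      by (intro exI[of _ N]) simp
  qed
qed

lemma mult_le_weighted_squares: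
  fixes a b d :: real assumes "d > 0"
  shows "a * b \<le> d * a\<^sup>2 + b\<^sup>2 / (4 * d)"
proof -
  have "0 \<le> (2 * d * a - b)\<^sup>2 / (4 * d)" using assms by simp
  also have "\<dots> = d * a\<^sup>2 + b\<^sup>2 / (4 * d) - a * b"
    using assms by (simp add: field_simps power2_eq_square)
  finally show ?thesis by simp
qed

text \<open>Where \<open>|f|\<close> is at most \<open>R\<close>, continuity of translations in mean suffices;
  the rest of \<open>f\<close> is small in mean square.\<close>

lemma autocorrelation_tendsto:
  fixes f :: "'a::euclidean_space \<Rightarrow> complex"
  assumes f: "integrable lborel f" and f2: "integrable lborel (\<lambda>x. (norm (f x))\<^sup>2)" and z: "z \<longlonglongrightarrow> 0"
  shows "(\<lambda>n. LINT x|lborel. f (x + z n) * cnj (f x)) \<longlonglongrightarrow> (LINT x|lborel. f x * cnj (f x))"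
proof -
  have m[measurable]: "f \<in> borel_measurable borel" using f borel_measurable_integrable by auto
  have T2: "integrable lborel (\<lambda>x. (norm (f (x + w)))\<^sup>2)" for w
    using f2 by (subst lborel_integral_translate(2)) auto
  have T1: "integrable lborel (\<lambda>x. f (x + w))" for w
    using f by (subst lborel_integral_translate(2)) auto
  have IP: "integrable lborel (\<lambda>x. f (x + w) * cnj (f x))" for w
  proof (rule Bochner_Integration.integrable_bound)
    show "integrable lborel (\<lambda>x. (norm (f (x + w)))\<^sup>2 + (norm (f x))\<^sup>2)" using T2 f2 by simp
    show "AE x in lborel. norm (f (x + w) * cnj (f x)) \<le> norm ((norm (f (x + w)))\<^sup>2 + (norm (f x))\<^sup>2)"
    proof (intro AE_I2)
      fix x
      show "norm (f (x + w) * cnj (f x)) \<le> norm ((norm (f (x + w)))\<^sup>2 + (norm (f x))\<^sup>2)"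
        using abs_mult_le_squares[of "norm (f (x + w))" "norm (f x)"] by (simp add: norm_mult)
    qed
  qed measurable
  define S where "S = (LINT x|lborel. (norm (f x))\<^sup>2)"
  have S0: "S \<ge> 0" unfolding S_def by simp
  \<comment> \<open>the part of \<open>\<bar>f\<bar>\<close> above the level \<open>R\<close>\<close>
  define h where "h R x = (if norm (f x) > R then norm (f x) else 0)" for R :: real and x
  have [measurable]: "h R \<in> borel_measurable borel" for R unfolding h_def by measurable
  have Ih: "integrable lborel (\<lambda>x. (h R x)\<^sup>2)" for R
    by (rule Bochner_Integration.integrable_bound[OF f2]) (auto simp: h_def)
  have h0: "(\<lambda>k. LINT x|lborel. (h (real k) x)\<^sup>2) \<longlonglongrightarrow> (LINT x::'a|lborel. (0::real))"
  proof (rule integral_dominated_convergence[OF _ _ f2])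
    show "AE x in lborel. (\<lambda>k. (h (real k) x)\<^sup>2) \<longlonglongrightarrow> 0"
    proof (intro AE_I2)
      fix x
      obtain N where N: "norm (f x) < real N" using reals_Archimedean2 by blast
      have "\<forall>\<^sub>F k in sequentially. 0 = (h (real k) x)\<^sup>2"
        using eventually_ge_at_top[of N] by eventually_elim (use N in \<open>auto simp: h_def\<close>)
      then show "(\<lambda>k. (h (real k) x)\<^sup>2) \<longlonglongrightarrow> 0" by (rule Lim_transform_eventually[OF tendsto_const])
    qed
  qed (auto simp: h_def)
  have key: "norm ((LINT x|lborel. f (x + w) * cnj (f x)) - (LINT x|lborel. f x * cnj (f x)))
     \<le> R * (LINT x|lborel. norm (f (x + w) - f x)) + (2 * d * S + (LINT x|lborel. (h R x)\<^sup>2) / (2 * d))"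
    if d: "d > 0" and R: "R \<ge> 0" for w R d
  proof -
    have "(LINT x|lborel. f (x + w) * cnj (f x)) - (LINT x|lborel. f x * cnj (f x))
       = (LINT x|lborel. (f (x + w) - f x) * cnj (f x))"
      using IP[of w] IP[of 0] by (subst Bochner_Integration.integral_diff[symmetric]) (auto simp: algebra_simps)
    also have "norm \<dots> \<le> (LINT x|lborel. norm ((f (x + w) - f x) * cnj (f x)))"
      by (rule integral_norm_bound)
    also have "\<dots> \<le> (LINT x|lborel. R * norm (f (x + w) - f x)
        + (d * (norm (f (x + w)))\<^sup>2 + d * (norm (f x))\<^sup>2 + (h R x)\<^sup>2 / (2 * d)))"
    proof (rule integral_mono_AE')
      show "integrable lborel (\<lambda>x. R * norm (f (x + w) - f x)
        + (d * (norm (f (x + w)))\<^sup>2 + d * (norm (f x))\<^sup>2 + (h R x)\<^sup>2 / (2 * d)))"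
        using f T1 T2 f2 Ih by auto
      show "AE x in lborel. norm ((f (x + w) - f x) * cnj (f x)) \<le> R * norm (f (x + w) - f x)
        + (d * (norm (f (x + w)))\<^sup>2 + d * (norm (f x))\<^sup>2 + (h R x)\<^sup>2 / (2 * d))"
      proof (intro AE_I2)
        fix x
        have pos: "0 \<le> d * (norm (f (x + w)))\<^sup>2 + d * (norm (f x))\<^sup>2 + (h R x)\<^sup>2 / (2 * d)" using d by simp
        show "norm ((f (x + w) - f x) * cnj (f x)) \<le> R * norm (f (x + w) - f x)
          + (d * (norm (f (x + w)))\<^sup>2 + d * (norm (f x))\<^sup>2 + (h R x)\<^sup>2 / (2 * d))"
        proof (cases "norm (f x) > R")
          case False
          then have "norm (f (x + w) - f x) * norm (f x) \<le> R * norm (f (x + w) - f x)"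
            by (subst mult.commute) (intro mult_right_mono, auto)
          then show ?thesis using pos by (simp add: norm_mult)
        next
          case True
          have "norm (f (x + w) - f x) * norm (f x) \<le> (norm (f (x + w)) + norm (f x)) * norm (f x)"
            by (intro mult_right_mono norm_triangle_ineq4) auto
          also have "\<dots> \<le> (d * (norm (f (x + w)))\<^sup>2 + (norm (f x))\<^sup>2 / (4 * d)) + (d * (norm (f x))\<^sup>2 + (norm (f x))\<^sup>2 / (4 * d))"
            unfolding distrib_right by (intro add_mono mult_le_weighted_squares d)
          also have "\<dots> = d * (norm (f (x + w)))\<^sup>2 + d * (norm (f x))\<^sup>2 + (h R x)\<^sup>2 / (2 * d)"
            using True d by (simp add: h_def field_simps)
          finally show ?thesis using R by (simp add: norm_mult add_increasing)
        qed
      qed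
    qed (use R d in auto)
    also have "\<dots> = R * (LINT x|lborel. norm (f (x + w) - f x)) + (d * (LINT x|lborel. (norm (f (x + w)))\<^sup>2) + d * S + (LINT x|lborel. (h R x)\<^sup>2) / (2 * d))"
      using f T1 T2 f2 Ih by (simp add: S_def)
    also have "(LINT x|lborel. (norm (f (x + w)))\<^sup>2) = S"
      unfolding S_def by (rule lborel_integral_translate(1)) measurable
    finally show ?thesis by (simp add: algebra_simps)
  qed
  show ?thesis
  proof (rule LIMSEQ_I)
    fix r :: real assume r: "r > 0"
    define d where "d = r / (6 * (S + 1))"
    have d: "d > 0" using r S0 by (simp add: d_def)
    have dS: "2 * d * S \<le> r / 3"
    proof -
      have "2 * d * S \<le> 2 * d * (S + 1)" using d by simp
      also have "\<dots> = r / 3" using S0 by (simp add: d_def field_simps)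
      finally show ?thesis .
    qed
    obtain k where k: "(LINT x|lborel. (h (real k) x)\<^sup>2) < 2 * d * (r / 3)"
      using LIMSEQ_D[OF h0, of "2 * d * (r / 3)"] r d by fastforce
    then have k': "(LINT x|lborel. (h (real k) x)\<^sup>2) / (2 * d) < r / 3"
      using d by (simp add: field_simps)
    have "(\<lambda>n. real k * (LINT x|lborel. norm (f (x + z n) - f x))) \<longlonglongrightarrow> real k * 0"
      by (intro tendsto_intros L1_translation f z)
    then obtain N where N: "\<And>n. n \<ge> N \<Longrightarrow> real k * (LINT x|lborel. norm (f (x + z n) - f x)) < r / 3"
      using LIMSEQ_D[of _ "real k * 0" "r / 3"] r by fastforce
    show "\<exists>N. \<forall>n\<ge>N. norm ((LINT x|lborel. f (x + z n) * cnj (f x)) - (LINT x|lborel. f x * cnj (f x))) < r"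
    proof (intro exI[of _ N] allI impI)
      fix n assume "n \<ge> N"
      then show "norm ((LINT x|lborel. f (x + z n) * cnj (f x)) - (LINT x|lborel. f x * cnj (f x))) < r"
        using key[OF d, of "real k" "z n"] N[of n] dS k' by linarith
    qed
  qed
qed

text \<open>Multiplying \<open>|F f|\<^sup>2\<close> by a Gaussian and summing turns it into a Gaussian
  average of the autocorrelation of \<open>f\<close>; as the Gaussian flattens, the average
  concentrates at the origin.\<close>

lemma gauss_plancherel:
  fixes f :: "'a::euclidean_space \<Rightarrow> complex"
  assumes f: "integrable lborel f" and f2: "integrable lborel (\<lambda>x. (norm (f x))\<^sup>2)" and e: "e > 0"
  shows "(LINT x|lborel. complex_of_real ((norm (fourier f x))\<^sup>2 * gauss e x))
    = complex_of_real (sqrt (2 * pi) ^ DIM('a)) *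
      (LINT u|lborel. complex_of_real (gauss 1 u) * (LINT x|lborel. f (x + e *\<^sub>R u) * cnj (f x)))"
proof -
  have m[measurable]: "f \<in> borel_measurable borel" using f borel_measurable_integrable by auto
  have fc: "integrable lborel (\<lambda>x. cnj (f x))" using f by simp
  have gi: "integrable lborel (\<lambda>x::'a. complex_of_real (gauss e x))" "integrable lborel (\<lambda>x::'a. complex_of_real (gauss 1 x))"
    by (simp_all add: complex_of_real_integrable_eq gauss_integrable(1) e)
  have Fb: "norm (fourier f x) \<le> (LINT y|lborel. norm (f y))" for x by (rule norm_fourier_le)
  have sq: "complex_of_real ((norm (fourier f x))\<^sup>2 * gauss e x)
      = (LINT y|lborel. cis (y \<bullet> x) * fourier f x * complex_of_real (gauss e x) * cnj (f y))" for x
  proof -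
    have "cnj (fourier f x) = (LINT y|lborel. cis (y \<bullet> x) * cnj (f y))"
    proof -
      have "cnj (fourier f x) = (LINT y|lborel. cnj (cis (- (y \<bullet> x)) * f y))"
        unfolding fourier_def by (rule Bochner_Integration.integral_cnj[symmetric])
      then show ?thesis by (simp only: complex_cnj_mult cis_cnj minus_minus)
    qed
    then have "complex_of_real ((norm (fourier f x))\<^sup>2 * gauss e x)
      = fourier f x * complex_of_real (gauss e x) * (LINT y|lborel. cis (y \<bullet> x) * cnj (f y))"
      by (simp only: of_real_mult complex_norm_square mult_ac)
    then show ?thesis
      unfolding integral_mult_right_zero[symmetric] by (simp add: mult_ac)
  qed
  have "integrable (lborel \<Otimes>\<^sub>M lborel) (\<lambda>(x::'a, y). complex_of_real (gauss e x) * cnj (f y))"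
    by (rule integrable_pair_mult[OF gi(1) fc])
  then have "integrable (lborel \<Otimes>\<^sub>M lborel) (\<lambda>p. complex_of_real (LINT y|lborel. norm (f y)) * (case p of (x::'a, y) \<Rightarrow> complex_of_real (gauss e x) * cnj (f y)))"
    by (rule integrable_mult_right)
  then have I: "integrable (lborel \<Otimes>\<^sub>M lborel)
      (\<lambda>(x, y). cis (y \<bullet> x) * fourier f x * complex_of_real (gauss e x) * cnj (f y))"
  proof (rule Bochner_Integration.integrable_bound)
    show "AE p in lborel \<Otimes>\<^sub>M lborel. norm (case p of (x, y) \<Rightarrow> cis (y \<bullet> x) * fourier f x * complex_of_real (gauss e x) * cnj (f y))
      \<le> norm (complex_of_real (LINT y|lborel. norm (f y)) * (case p of (x::'a, y) \<Rightarrow> complex_of_real (gauss e x) * cnj (f y)))"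
    proof (intro AE_I2)
      fix p :: "'a \<times> 'a"
      obtain x y where p: "p = (x, y)" by (cases p)
      have L0: "(LINT y|lborel. norm (f y)) \<ge> 0" by simp
      show "norm (case p of (x, y) \<Rightarrow> cis (y \<bullet> x) * fourier f x * complex_of_real (gauss e x) * cnj (f y))
      \<le> norm (complex_of_real (LINT y|lborel. norm (f y)) * (case p of (x, y) \<Rightarrow> complex_of_real (gauss e x) * cnj (f y)))"
        unfolding p prod.case norm_mult norm_cis mult_1_left norm_of_real abs_of_nonneg[OF L0] mult.assoc
        by (intro mult_right_mono Fb) auto
    qed
  qed measurable
  have I2: "integrable (lborel \<Otimes>\<^sub>M lborel) (\<lambda>(u, x). complex_of_real (gauss 1 u) * (f (x + e *\<^sub>R u) * cnj (f x)))"
  proof (rule lborel_pair.Fubini_integrable)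
    have b: "norm (f (x + e *\<^sub>R u) * cnj (f x)) \<le> (norm (f (x + e *\<^sub>R u)))\<^sup>2 + (norm (f x))\<^sup>2" for u x
      using abs_mult_le_squares[of "norm (f (x + e *\<^sub>R u))" "norm (f x)"] by (simp add: norm_mult)
    have T2: "integrable lborel (\<lambda>x. (norm (f (x + w)))\<^sup>2)" for w
      using f2 by (subst lborel_integral_translate(2)) auto
    have B: "integrable lborel (\<lambda>x. (norm (f (x + w)))\<^sup>2 + (norm (f x))\<^sup>2)" for w
      using T2 f2 by simp
    have P: "integrable lborel (\<lambda>x. f (x + e *\<^sub>R u) * cnj (f x))" for u
      by (rule Bochner_Integration.integrable_bound[OF B[of "e *\<^sub>R u"]])
        (use b in \<open>auto intro: order_trans[OF b]\<close>)
    show "AE u in lborel. integrable lborel (\<lambda>y. case (u, y) of (u, x) \<Rightarrow> complex_of_real (gauss 1 u) * (f (x + e *\<^sub>R u) * cnj (f x)))"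
      using P by simp
    show "integrable lborel (\<lambda>u. LINT y|lborel. norm (case (u, y) of (u, x) \<Rightarrow> complex_of_real (gauss 1 u) * (f (x + e *\<^sub>R u) * cnj (f x))))"
    proof (rule Bochner_Integration.integrable_bound)
      show "integrable lborel (\<lambda>u::'a. gauss 1 u * (2 * (LINT x|lborel. (norm (f x))\<^sup>2)))"
        using gauss_integrable(1)[of 1, where 'a='a] by simp
      show "AE u in lborel. norm (LINT y|lborel. norm (case (u, y) of (u, x) \<Rightarrow> complex_of_real (gauss 1 u) * (f (x + e *\<^sub>R u) * cnj (f x))))
        \<le> norm (gauss 1 u * (2 * (LINT x|lborel. (norm (f x))\<^sup>2)))"
      proof (intro AE_I2)
        fix u :: 'a
        have "(LINT x|lborel. norm (f (x + e *\<^sub>R u) * cnj (f x))) \<le> (LINT x|lborel. (norm (f (x + e *\<^sub>R u)))\<^sup>2 + (norm (f x))\<^sup>2)"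
          using P B b by (intro integral_mono) auto
        also have "\<dots> = (LINT x|lborel. (norm (f (x + e *\<^sub>R u)))\<^sup>2) + (LINT x|lborel. (norm (f x))\<^sup>2)"
          using T2 f2 by simp
        also have "(LINT x|lborel. (norm (f (x + e *\<^sub>R u)))\<^sup>2) = (LINT x|lborel. (norm (f x))\<^sup>2)"
          by (rule lborel_integral_translate(1)) measurable
        finally have "gauss 1 u * (LINT x|lborel. norm (f (x + e *\<^sub>R u) * cnj (f x))) \<le> gauss 1 u * (2 * (LINT x|lborel. (norm (f x))\<^sup>2))"
          using gauss_pos[of 1 u] by (intro mult_left_mono) auto
        then show "norm (LINT y|lborel. norm (case (u, y) of (u, x) \<Rightarrow> complex_of_real (gauss 1 u) * (f (x + e *\<^sub>R u) * cnj (f x))))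
          \<le> norm (gauss 1 u * (2 * (LINT x|lborel. (norm (f x))\<^sup>2)))"
          by (simp add: norm_mult abs_mult abs_of_pos[OF gauss_pos] mult.assoc)
      qed
    qed measurable
  qed measurable
  have "(LINT x|lborel. complex_of_real ((norm (fourier f x))\<^sup>2 * gauss e x))
    = (LINT x|lborel. (LINT y|lborel. cis (y \<bullet> x) * fourier f x * complex_of_real (gauss e x) * cnj (f y)))"
    by (simp only: sq)
  also have "\<dots> = (LINT y|lborel. (LINT x|lborel. cis (y \<bullet> x) * fourier f x * complex_of_real (gauss e x) * cnj (f y)))"
    using lborel_pair.Fubini_integral[OF I] by simp
  also have "\<dots> = (LINT y|lborel. complex_of_real (sqrt (2 * pi) ^ DIM('a)) * ((LINT u|lborel. f (y + e *\<^sub>R u) * complex_of_real (gauss 1 u)) * cnj (f y)))"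
    unfolding integral_mult_left_zero gauss_inversion[OF f e] by (simp only: mult.assoc)
  also have "\<dots> = complex_of_real (sqrt (2 * pi) ^ DIM('a)) * (LINT y|lborel. (LINT u|lborel. f (y + e *\<^sub>R u) * complex_of_real (gauss 1 u)) * cnj (f y))"
    by (rule integral_mult_right_zero)
  also have "(LINT y|lborel. (LINT u|lborel. f (y + e *\<^sub>R u) * complex_of_real (gauss 1 u)) * cnj (f y))
      = (LINT y|lborel. (LINT u|lborel. complex_of_real (gauss 1 u) * (f (y + e *\<^sub>R u) * cnj (f y))))"
    unfolding integral_mult_left_zero[symmetric] by (simp only: mult_ac)
  also have "\<dots> = (LINT u|lborel. (LINT y|lborel. complex_of_real (gauss 1 u) * (f (y + e *\<^sub>R u) * cnj (f y))))"
    by (rule lborel_pair.Fubini_integral[OF I2])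
  finally show ?thesis unfolding integral_mult_right_zero .
qed

text \<open>The Gaussian factor increases to \<open>1\<close>, so monotone convergence gives integrability of
  \<open>\<bar>F f\<bar>\<^sup>2\<close> together with the value of its integral.\<close>

theorem plancherel:
  fixes f :: "'a::euclidean_space \<Rightarrow> complex"
  assumes f: "integrable lborel f" and f2: "integrable lborel (\<lambda>x. (norm (f x))\<^sup>2)"
  shows "integrable lborel (\<lambda>x. (norm (fourier f x))\<^sup>2)"
    and "(LINT x|lborel. (norm (fourier f x))\<^sup>2) = (2 * pi) ^ DIM('a) * (LINT x|lborel. (norm (f x))\<^sup>2)"
proof -
  have m[measurable]: "f \<in> borel_measurable borel" using f borel_measurable_integrable by auto
  let ?e = "\<lambda>n. 1 / real (Suc n)"
  have e0: "?e \<longlonglongrightarrow> 0" by (rule LIMSEQ_Suc[OF lim_1_over_n])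
  let ?S = "LINT x|lborel. (norm (f x))\<^sup>2"
  let ?A = "\<lambda>z. LINT x|lborel. f (x + z) * cnj (f x)"
  have A0: "?A 0 = complex_of_real ?S"
    by (simp add: complex_norm_square[symmetric] integral_complex_of_real[symmetric] del: integral_complex_of_real of_real_power)
  have bA: "norm (?A w) \<le> 2 * ?S" for w
  proof -
    have b: "norm (f (x + w) * cnj (f x)) \<le> (norm (f (x + w)))\<^sup>2 + (norm (f x))\<^sup>2" for x
      using abs_mult_le_squares[of "norm (f (x + w))" "norm (f x)"] by (simp add: norm_mult)
    have T2: "integrable lborel (\<lambda>x. (norm (f (x + w)))\<^sup>2)"
      using f2 by (subst lborel_integral_translate(2)) auto
    have "norm (?A w) \<le> (LINT x|lborel. norm (f (x + w) * cnj (f x)))" by (rule integral_norm_bound)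
    also have "\<dots> \<le> (LINT x|lborel. (norm (f (x + w)))\<^sup>2 + (norm (f x))\<^sup>2)"
      using T2 f2 b by (intro integral_mono_AE') auto
    also have "\<dots> = (LINT x|lborel. (norm (f (x + w)))\<^sup>2) + ?S" using T2 f2 by simp
    also have "(LINT x|lborel. (norm (f (x + w)))\<^sup>2) = ?S"
      by (rule lborel_integral_translate(1)) measurable
    finally show ?thesis by simp
  qed
  have L: "(\<lambda>n. LINT u|lborel. complex_of_real (gauss 1 u) * ?A (?e n *\<^sub>R u))
      \<longlonglongrightarrow> (LINT u::'a|lborel. complex_of_real (gauss 1 u) * complex_of_real ?S)"
  proof (rule integral_dominated_convergence[where w = "\<lambda>u. gauss 1 u * (2 * ?S)"])
    show "integrable lborel (\<lambda>u::'a. gauss 1 u * (2 * ?S))"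
      using gauss_integrable(1)[of 1, where 'a='a] by simp
    show "AE u in lborel. (\<lambda>n. complex_of_real (gauss 1 u) * ?A (?e n *\<^sub>R u)) \<longlonglongrightarrow> complex_of_real (gauss 1 (u::'a)) * complex_of_real ?S"
    proof (intro AE_I2 tendsto_intros)
      fix u :: 'a
      have "(\<lambda>n. ?e n *\<^sub>R u) \<longlonglongrightarrow> 0 *\<^sub>R u" by (intro tendsto_intros e0)
      then have "(\<lambda>n. ?A (?e n *\<^sub>R u)) \<longlonglongrightarrow> (LINT x|lborel. f x * cnj (f x))"
        by (intro autocorrelation_tendsto[OF f f2]) simp
      then show "(\<lambda>n. ?A (?e n *\<^sub>R u)) \<longlonglongrightarrow> complex_of_real ?S" using A0 by simp
    qed
    show "AE u in lborel. norm (complex_of_real (gauss 1 u) * ?A (?e n *\<^sub>R u)) \<le> gauss 1 (u::'a) * (2 * ?S)" for n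
    proof (intro AE_I2)
      fix u :: 'a
      have "norm (complex_of_real (gauss 1 u) * ?A (?e n *\<^sub>R u)) = gauss 1 u * norm (?A (?e n *\<^sub>R u))"
        by (simp only: norm_mult norm_of_real abs_of_pos[OF gauss_pos])
      then show "norm (complex_of_real (gauss 1 u) * ?A (?e n *\<^sub>R u)) \<le> gauss 1 (u::'a) * (2 * ?S)"
        using mult_left_mono[OF bA less_imp_le[OF gauss_pos]] by metis
    qed
  qed measurable
  have G1: "(LINT u::'a|lborel. complex_of_real (gauss 1 u) * complex_of_real ?S) = complex_of_real (sqrt (2 * pi) ^ DIM('a) * ?S)"
    using gauss_integrable(2)[of 1, where 'a='a] by (simp add: integral_complex_of_real)
  have "(\<lambda>n. complex_of_real (LINT x|lborel. (norm (fourier f x))\<^sup>2 * gauss (?e n) x))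
      \<longlonglongrightarrow> complex_of_real (sqrt (2 * pi) ^ DIM('a)) * complex_of_real (sqrt (2 * pi) ^ DIM('a) * ?S)"
    unfolding integral_complex_of_real[symmetric]
    by (subst gauss_plancherel[OF f f2]) (use tendsto_mult_left[OF L[unfolded G1]] in simp_all)
  then have "(\<lambda>n. LINT x|lborel. (norm (fourier f x))\<^sup>2 * gauss (?e n) x)
      \<longlonglongrightarrow> sqrt (2 * pi) ^ DIM('a) * (sqrt (2 * pi) ^ DIM('a) * ?S)"
    unfolding of_real_mult[symmetric] by (simp only: tendsto_of_real_iff)
  also have "sqrt (2 * pi) ^ DIM('a) * (sqrt (2 * pi) ^ DIM('a) * ?S) = (2 * pi) ^ DIM('a) * ?S"
  proof -
    have "sqrt (2 * pi) ^ DIM('a) * (sqrt (2 * pi) ^ DIM('a) * ?S) = (sqrt (2 * pi) * sqrt (2 * pi)) ^ DIM('a) * ?S"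
      by (simp only: power_mult_distrib mult.assoc)
    then show ?thesis by simp
  qed
  finally have lim: "(\<lambda>n. LINT x|lborel. (norm (fourier f x))\<^sup>2 * gauss (?e n) x) \<longlonglongrightarrow> (2 * pi) ^ DIM('a) * ?S" .
  have I: "integrable lborel (\<lambda>x. (norm (fourier f x))\<^sup>2 * gauss (?e n) x)" for n
  proof (rule Bochner_Integration.integrable_bound)
    show "integrable lborel (\<lambda>x::'a. (LINT y|lborel. norm (f y))\<^sup>2 * gauss (?e n) x)"
      by (intro integrable_mult_right gauss_integrable) simp
    show "AE x in lborel. norm ((norm (fourier f x))\<^sup>2 * gauss (?e n) x) \<le> norm ((LINT y|lborel. norm (f y))\<^sup>2 * gauss (?e n) x)"
      unfolding norm_mult by (intro AE_I2 mult_right_mono) (auto intro!: power_mono norm_fourier_le)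
  qed measurable
  have mono: "AE x in lborel. mono (\<lambda>n. (norm (fourier f x))\<^sup>2 * gauss (?e n) x)"
  proof (intro AE_I2 monoI mult_left_mono)
    fix x :: 'a and m n :: nat assume "m \<le> n"
    then have "?e n * norm x \<le> ?e m * norm x" by (intro mult_right_mono divide_left_mono) auto
    then have "(?e n * norm x)\<^sup>2 \<le> (?e m * norm x)\<^sup>2" by (intro power_mono) auto
    then show "gauss (?e m) x \<le> gauss (?e n) x" unfolding gauss_def exp_le_cancel_iff by linarith
  qed auto
  have conv: "AE x in lborel. (\<lambda>n. (norm (fourier f x))\<^sup>2 * gauss (?e n) x) \<longlonglongrightarrow> (norm (fourier f x))\<^sup>2"
    using tendsto_mult[OF tendsto_const gauss_tendsto, of "(norm (fourier f _))\<^sup>2"] by (intro AE_I2) simp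
  show "integrable lborel (\<lambda>x. (norm (fourier f x))\<^sup>2)"
    by (rule integrable_monotone_convergence[OF I mono conv lim]) measurable
  show "(LINT x|lborel. (norm (fourier f x))\<^sup>2) = (2 * pi) ^ DIM('a) * ?S"
    by (rule integral_monotone_convergence[OF I mono conv lim]) measurable
qed

subsection \<open>The Fourier transform on Schwartz space\<close>

lemma integrable_decay:
  "integrable lborel (\<lambda>x::'a::euclidean_space. 1 / (1 + norm x) ^ (2 * DIM('a)))"
proof (rule Bochner_Integration.integrable_bound)
  have "integrable lborel (\<lambda>t::real. inverse (1 + t\<^sup>2))"
    using integrable_inverse_1_plus_square by (simp add: set_integrable_def)
  then show "integrable lborel (\<lambda>x::'a. \<Prod>b\<in>Basis. inverse (1 + (x \<bullet> b)\<^sup>2))"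
    by (intro lborel_integral_prod_Basis)
  show "AE x::'a in lborel. norm (1 / (1 + norm x) ^ (2 * DIM('a))) \<le> norm (\<Prod>b\<in>(Basis::'a set). inverse (1 + (x \<bullet> b)\<^sup>2))"
  proof (intro AE_I2)
    fix x :: 'a
    have pos: "0 < 1 + (x \<bullet> b)\<^sup>2" for b by (smt (verit) zero_le_power2)
    have "(\<Prod>b\<in>(Basis::'a set). 1 + (x \<bullet> b)\<^sup>2) \<le> (\<Prod>b\<in>(Basis::'a set). (1 + norm x)\<^sup>2)"
    proof (intro prod_mono conjI)
      fix b :: 'a assume "b \<in> Basis"
      then have "(x \<bullet> b)\<^sup>2 \<le> (norm x)\<^sup>2"
        using Basis_le_norm[of b x] by (simp add: power2_le_iff_abs_le)
      then show "1 + (x \<bullet> b)\<^sup>2 \<le> (1 + norm x)\<^sup>2"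
        unfolding power2_sum by (simp add: add_increasing2)
    qed (use pos in \<open>simp add: less_imp_le\<close>)
    also have "\<dots> = (1 + norm x) ^ (2 * DIM('a))" by (simp add: power_mult)
    finally have "1 / (1 + norm x) ^ (2 * DIM('a)) \<le> 1 / (\<Prod>b\<in>(Basis::'a set). 1 + (x \<bullet> b)\<^sup>2)"
      using pos by (intro divide_left_mono prod_pos mult_pos_pos zero_less_power add_pos_nonneg) auto
    also have "\<dots> = (\<Prod>b\<in>(Basis::'a set). inverse (1 + (x \<bullet> b)\<^sup>2))"
      by (simp add: inverse_eq_divide prod_dividef)
    finally show "norm (1 / (1 + norm x) ^ (2 * DIM('a))) \<le> norm (\<Prod>b\<in>(Basis::'a set). inverse (1 + (x \<bullet> b)\<^sup>2))"
      by (simp add: abs_prod)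
  qed
qed measurable

lemma continuous_on_schwartz: "f \<in> schwartz \<Longrightarrow> continuous_on UNIV f"
  by (intro differentiable_imp_continuous_on schwartz_step(1))

lemma schwartz_measurable: "f \<in> schwartz \<Longrightarrow> f \<in> borel_measurable borel"
  by (intro borel_measurable_continuous_onI continuous_on_schwartz)

lemma schwartz_decay:
  assumes "f \<in> schwartz"
  obtains K where "K \<ge> 0" "\<And>x. norm (f x) \<le> K / (1 + norm x) ^ N"
proof -
  obtain K where K: "\<And>x. (1 + norm x) ^ N * norm (f x) \<le> K"
    using schwartz_step(2)[OF assms] unfolding rapid_def by meson
  have "norm (f x) \<le> K / (1 + norm x) ^ N" for x
  proof -
    have p: "(1 + norm x) ^ N > 0" by (intro zero_less_power) (smt (verit) norm_ge_zero)
    then show ?thesis using K[of x] by (simp add: field_simps)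
  qed
  moreover have "K \<ge> 0" using K[of 0] by (smt (verit) norm_ge_zero mult_nonneg_nonneg zero_le_power)
  ultimately show ?thesis using that by blast
qed

lemma schwartz_integrable:
  fixes f :: "'a::euclidean_space \<Rightarrow> complex"
  assumes "f \<in> schwartz"
  shows "integrable lborel f"
proof -
  obtain K where K: "K \<ge> 0" "\<And>x. norm (f x) \<le> K / (1 + norm x) ^ (2 * DIM('a))"
    using schwartz_decay[OF assms] by blast
  show ?thesis
  proof (rule Bochner_Integration.integrable_bound)
    show "integrable lborel (\<lambda>x::'a. K * (1 / (1 + norm x) ^ (2 * DIM('a))))"
      by (intro integrable_mult_right integrable_decay)
    show "AE x in lborel. norm (f x) \<le> norm (K * (1 / (1 + norm x) ^ (2 * DIM('a))))"
      using K by (intro AE_I2) (auto intro: order_trans[OF K(2)])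
  qed (use schwartz_measurable[OF assms] in simp)
qed

lemma cis_minus_le: "norm (cis a - cis b) \<le> \<bar>a - b\<bar>"
proof -
  have "cis a - cis b = cis b * (cis (a - b) - 1)" by (simp add: algebra_simps cis_mult)
  then have "norm (cis a - cis b) = norm (cis (a - b) - 1)" by (simp add: norm_mult)
  also have "\<dots> \<le> \<bar>a - b\<bar>" using iexp_approx1[of "a - b" 0] by (simp add: cis_conv_exp)
  finally show ?thesis .
qed

lemma cis_linear_le: "norm (cis u - 1 - \<i> * complex_of_real u) \<le> u\<^sup>2"
proof -
  have "norm (cis u - 1 - \<i> * complex_of_real u) \<le> u\<^sup>2 / 2"
    using iexp_approx1[of u 1] by (simp add: cis_conv_exp power2_eq_square diff_diff_eq)
  also have "\<dots> \<le> u\<^sup>2" by simp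
  finally show ?thesis .
qed

lemma norm_le_sum_Basis_mult: "norm x * k \<le> (\<Sum>b\<in>Basis. \<bar>x \<bullet> b\<bar> * k)" if "k \<ge> 0"
  using mult_right_mono[OF norm_le_l1[of x] that] by (simp add: sum_distrib_right)

lemma schwartz_norm_mult_integrable:
  fixes f :: "'a::euclidean_space \<Rightarrow> complex"
  assumes f: "f \<in> schwartz"
  shows "integrable lborel (\<lambda>x. (norm x) ^ m * norm (f x))"
proof -
  obtain K where K: "K \<ge> 0" "\<And>x. norm (f x) \<le> K / (1 + norm x) ^ (2 * DIM('a) + m)"
    using schwartz_decay[OF assms] by blast
  have [measurable]: "f \<in> borel_measurable borel" by (rule schwartz_measurable[OF f])
  show ?thesis
  proof (rule Bochner_Integration.integrable_bound)
    show "integrable lborel (\<lambda>x::'a. K * (1 / (1 + norm x) ^ (2 * DIM('a))))"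
      by (intro integrable_mult_right integrable_decay)
    show "AE x in lborel. norm ((norm x) ^ m * norm (f x)) \<le> norm (K * (1 / (1 + norm x) ^ (2 * DIM('a))))"
    proof (intro AE_I2)
      fix x :: 'a
      have p: "1 + norm x > 0" by (smt (verit) norm_ge_zero)
      have "norm x ^ m * norm (f x) \<le> (1 + norm x) ^ m * (K / (1 + norm x) ^ (2 * DIM('a) + m))"
        using K by (intro mult_mono power_mono) auto
      also have "\<dots> = K * (1 / (1 + norm x) ^ (2 * DIM('a)))"
        using p by (simp add: power_add)
      finally show "norm ((norm x) ^ m * norm (f x)) \<le> norm (K * (1 / (1 + norm x) ^ (2 * DIM('a))))"
        using K(1) by simp
    qed
  qed measurable
qed

text \<open>The quadratic remainder of the exponential is integrable against a Schwartz function,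
  which gives the derivative with an explicit error.\<close>

lemma fourier_has_derivative:
  fixes f :: "'a::euclidean_space \<Rightarrow> complex"
  assumes f: "f \<in> schwartz"
  shows "(fourier f has_derivative
    (\<lambda>h. LINT x|lborel. cis (- (x \<bullet> \<xi>)) * (- \<i> * complex_of_real (x \<bullet> h) * f x))) (at \<xi>)"
proof -
  have [measurable]: "f \<in> borel_measurable borel" by (rule schwartz_measurable[OF f])
  define D where "D h = (LINT x|lborel. cis (- (x \<bullet> \<xi>)) * (- \<i> * complex_of_real (x \<bullet> h) * f x))" for h
  have nb: "\<bar>x \<bullet> h\<bar> * norm (f x) \<le> norm h * (norm x ^ 1 * norm (f x))" for x h
    using mult_right_mono[OF Cauchy_Schwarz_ineq2[of x h] norm_ge_zero[of "f x"]] by (simp add: mult_ac)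
  have ID: "integrable lborel (\<lambda>x. cis (- (x \<bullet> \<xi>)) * (- \<i> * complex_of_real (x \<bullet> h) * f x))" for h
  proof (rule Bochner_Integration.integrable_bound)
    show "integrable lborel (\<lambda>x. norm h * (norm x ^ 1 * norm (f x)))"
      by (intro integrable_mult_right schwartz_norm_mult_integrable f)
  qed (use nb in \<open>auto simp: norm_mult\<close>)
  have add: "D (h + k) = D h + D k" for h k
    unfolding D_def Bochner_Integration.integral_add[OF ID ID, symmetric]
    by (simp add: inner_add_right algebra_simps)
  have scale: "D (r *\<^sub>R h) = r *\<^sub>R D h" for r h
  proof -
    have "(\<lambda>x. cis (- (x \<bullet> \<xi>)) * (- \<i> * complex_of_real (x \<bullet> (r *\<^sub>R h)) * f x))
      = (\<lambda>x. complex_of_real r * (cis (- (x \<bullet> \<xi>)) * (- \<i> * complex_of_real (x \<bullet> h) * f x)))"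
      by (simp add: algebra_simps)
    then show ?thesis unfolding D_def by (simp only: integral_mult_right_zero scaleR_conv_of_real)
  qed
  have bnd: "norm (D h) \<le> norm h * (LINT x|lborel. norm x ^ 1 * norm (f x))" for h
  proof -
    have "norm (D h) \<le> (LINT x|lborel. norm (cis (- (x \<bullet> \<xi>)) * (- \<i> * complex_of_real (x \<bullet> h) * f x)))"
      unfolding D_def by (rule integral_norm_bound)
    also have "\<dots> \<le> (LINT x|lborel. norm h * (norm x ^ 1 * norm (f x)))"
      using nb by (intro integral_mono_AE' integrable_mult_right schwartz_norm_mult_integrable f)
        (auto simp: norm_mult)
    finally show ?thesis by simp
  qed
  have bl: "bounded_linear D"
    by (rule bounded_linear_intro[OF add scale bnd])
  let ?C = "LINT x|lborel. norm x ^ 2 * norm (f x)"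
  have IF: "integrable lborel (\<lambda>x. cis (- (x \<bullet> \<eta>)) * f x)" for \<eta>
    by (intro integrable_cis_mult schwartz_integrable f) measurable
  have rem: "norm (fourier f (\<xi> + h) - fourier f \<xi> - D h) \<le> (norm h)\<^sup>2 * ?C" for h
  proof -
    have "fourier f (\<xi> + h) - fourier f \<xi> - D h
      = (LINT x|lborel. cis (- (x \<bullet> \<xi>)) * (cis (- (x \<bullet> h)) - 1 - \<i> * complex_of_real (- (x \<bullet> h))) * f x)"
      unfolding fourier_def D_def
      by (subst Bochner_Integration.integral_diff[symmetric], (intro IF)+,
          subst Bochner_Integration.integral_diff[symmetric], (intro Bochner_Integration.integrable_diff IF ID)+)
        (simp add: algebra_simps inner_add_right cis_mult)
    also have "norm \<dots> \<le> (LINT x|lborel. norm (cis (- (x \<bullet> \<xi>)) * (cis (- (x \<bullet> h)) - 1 - \<i> * complex_of_real (- (x \<bullet> h))) * f x))"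
      by (rule integral_norm_bound)
    also have "\<dots> \<le> (LINT x|lborel. (norm h)\<^sup>2 * (norm x ^ 2 * norm (f x)))"
    proof (rule integral_mono_AE')
      show "integrable lborel (\<lambda>x. (norm h)\<^sup>2 * (norm x ^ 2 * norm (f x)))"
        by (intro integrable_mult_right schwartz_norm_mult_integrable f)
      show "AE x in lborel. norm (cis (- (x \<bullet> \<xi>)) * (cis (- (x \<bullet> h)) - 1 - \<i> * complex_of_real (- (x \<bullet> h))) * f x) \<le> (norm h)\<^sup>2 * (norm x ^ 2 * norm (f x))"
      proof (intro AE_I2)
        fix x :: 'a
        have "norm (cis (- (x \<bullet> h)) - 1 - \<i> * complex_of_real (- (x \<bullet> h))) \<le> (- (x \<bullet> h))\<^sup>2"
          by (rule cis_linear_le)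
        also have "\<dots> \<le> (norm x * norm h)\<^sup>2"
          using Cauchy_Schwarz_ineq2[of x h] by (simp add: power2_le_iff_abs_le)
        finally show "norm (cis (- (x \<bullet> \<xi>)) * (cis (- (x \<bullet> h)) - 1 - \<i> * complex_of_real (- (x \<bullet> h))) * f x) \<le> (norm h)\<^sup>2 * (norm x ^ 2 * norm (f x))"
          using mult_right_mono[OF _ norm_ge_zero[of "f x"]]
          unfolding norm_mult norm_cis mult_1_left power_mult_distrib
          by (metis mult.assoc mult.commute)
      qed
    qed auto
    finally show ?thesis by simp
  qed
  have "((\<lambda>h. norm (fourier f (\<xi> + h) - fourier f \<xi> - D h) / norm h) \<longlongrightarrow> 0) (at 0)"
  proof (rule tendsto_sandwich[OF _ _ tendsto_const[of 0]])
    show "\<forall>\<^sub>F h in at 0. 0 \<le> norm (fourier f (\<xi> + h) - fourier f \<xi> - D h) / norm h" by simp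
    show "\<forall>\<^sub>F h in at 0. norm (fourier f (\<xi> + h) - fourier f \<xi> - D h) / norm h \<le> norm h * ?C"
    proof (rule eventually_at_filter[THEN iffD2], intro always_eventually allI impI)
      fix h :: 'a assume "h \<noteq> 0"
      then show "norm (fourier f (\<xi> + h) - fourier f \<xi> - D h) / norm h \<le> norm h * ?C"
        using rem[of h] by (simp add: divide_le_eq power2_eq_square mult_ac)
    qed
    have "((\<lambda>h::'a. norm h * ?C) \<longlongrightarrow> norm (0::'a) * ?C) (at 0)" by (intro tendsto_intros)
    then show "((\<lambda>h::'a. norm h * ?C) \<longlongrightarrow> 0) (at 0)" by simp
  qed
  then have "(fourier f has_derivative D) (at \<xi>)"
    using bl unfolding has_derivative_at by simp
  then show ?thesis unfolding D_def[abs_def] .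
qed

lemma partial_fourier:
  fixes f :: "'a::euclidean_space \<Rightarrow> complex"
  assumes "f \<in> schwartz"
  shows "partial b (fourier f) = fourier (\<lambda>x. - \<i> * (complex_of_real (x \<bullet> b) * f x))"
  using partial_eq[OF fourier_has_derivative[OF assms], of b] by (auto simp: fourier_def mult_ac)

lemma difference_quotient_tendsto:
  assumes f: "(f has_vector_derivative f') (at x)"
  shows "(\<lambda>k. (f (x + 1 / real (Suc k)) - f x) /\<^sub>R (1 / real (Suc k))) \<longlonglongrightarrow> f'"
proof -
  have A: "((\<lambda>s. norm (f (x + s) - f x - s *\<^sub>R f') / norm s) \<longlongrightarrow> 0) (at 0)"
    using f by (simp add: has_vector_derivative_def has_derivative_at)
  have B: "norm (f (x + s) - f x - s *\<^sub>R f') / norm s = norm ((f (x + s) - f x) /\<^sub>R s - f')" if "s \<noteq> 0" for s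
  proof -
    have "f (x + s) - f x - s *\<^sub>R f' = s *\<^sub>R ((f (x + s) - f x) /\<^sub>R s - f')"
      using that by (simp add: scaleR_diff_right)
    then show ?thesis using that by simp
  qed
  have "((\<lambda>s. norm ((f (x + s) - f x) /\<^sub>R s - f')) \<longlongrightarrow> 0) (at 0)"
    by (rule Lim_transform_eventually[OF A]) (use B in \<open>simp add: eventually_at_filter\<close>)
  from LIM_zero_cancel[OF tendsto_norm_zero_cancel[OF this]]
  have C: "((\<lambda>s. (f (x + s) - f x) /\<^sub>R s) \<longlongrightarrow> f') (at 0)" .
  have "filterlim (\<lambda>k. 1 / real (Suc k)) (at 0) sequentially"
    using LIMSEQ_Suc[OF lim_1_over_n] by (auto simp: filterlim_at)
  from filterlim_compose[OF C this] show ?thesis .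
qed

text \<open>Translation invariance of Lebesgue measure replaces integration by parts: both sides
  are the limit of the transforms of the difference quotients.\<close>

lemma fourier_partial:
  fixes f :: "'a::euclidean_space \<Rightarrow> complex"
  assumes f: "f \<in> schwartz" and b: "b \<in> Basis"
  shows "fourier (partial b f) \<xi> = \<i> * complex_of_real (\<xi> \<bullet> b) * fourier f \<xi>"
proof -
  have [measurable]: "f \<in> borel_measurable borel" "partial b f \<in> borel_measurable borel"
    using schwartz_measurable f schwartz_step(3)[OF f b] by auto
  obtain K where K: "K \<ge> 0" "\<And>x. norm (partial b f x) \<le> K / (1 + norm x) ^ (2 * DIM('a))"
    using schwartz_decay[OF schwartz_step(3)[OF f b]] by blast
  let ?h = "\<lambda>n. 1 / real (Suc n)"
  have h0: "?h \<longlonglongrightarrow> 0" by (rule LIMSEQ_Suc[OF lim_1_over_n])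
  have hat: "filterlim ?h (at 0) sequentially"
    using h0 by (auto simp: filterlim_at)
  let ?q = "\<lambda>n x. (f (x + ?h n *\<^sub>R b) - f x) / complex_of_real (?h n)"
  have der: "((\<lambda>s. f (x + s *\<^sub>R b)) has_vector_derivative partial b f (x + s *\<^sub>R b)) (at s within S)" for x s S
  proof -
    have d: "(f has_derivative (\<lambda>h. partial h f (x + s *\<^sub>R b))) (at (x + s *\<^sub>R b))"
      by (rule has_derivative_partial[OF schwartz_step(1)[OF f]])
    have "((\<lambda>s. x + s *\<^sub>R b) has_derivative (\<lambda>k. k *\<^sub>R b)) (at s within S)"
      by (auto intro!: derivative_eq_intros)
    from has_derivative_compose[OF this d]
    have "((\<lambda>s. f (x + s *\<^sub>R b)) has_derivative (\<lambda>k. partial (k *\<^sub>R b) f (x + s *\<^sub>R b))) (at s within S)" .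
    moreover have "partial (k *\<^sub>R b) f (x + s *\<^sub>R b) = k *\<^sub>R partial b f (x + s *\<^sub>R b)" for k
      using linear_scale[OF has_derivative_linear[OF d]] by blast
    ultimately show ?thesis by (simp add: has_vector_derivative_def)
  qed
  have qlim: "(\<lambda>n. ?q n x) \<longlonglongrightarrow> partial b f x" for x
    using difference_quotient_tendsto[OF der[of x 0 UNIV]] by (simp add: scaleR_conv_of_real field_simps)
  have qb: "norm (?q n x) \<le> K * 2 ^ (2 * DIM('a)) * (1 / (1 + norm x) ^ (2 * DIM('a)))" for n x
  proof -
    have hp: "0 < ?h n" "?h n \<le> 1" by auto
    have "norm (partial b f (x + s *\<^sub>R b)) \<le> K * 2 ^ (2 * DIM('a)) * (1 / (1 + norm x) ^ (2 * DIM('a)))"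
      if s: "s \<in> {0..?h n}" for s
    proof -
      have "norm x \<le> norm (x + s *\<^sub>R b) + norm (s *\<^sub>R b)"
        using norm_triangle_ineq4[of "x + s *\<^sub>R b" "s *\<^sub>R b"] by simp
      moreover have "norm (s *\<^sub>R b) \<le> 1"
      proof -
        have "0 \<le> s" "s \<le> 1" using s hp(2) unfolding atLeastAtMost_iff by linarith+
        then show ?thesis using norm_Basis[OF b] by simp
      qed
      moreover have "u \<le> v + w \<Longrightarrow> w \<le> 1 \<Longrightarrow> 0 \<le> v \<Longrightarrow> 1 + u \<le> 2 * (1 + v)" for u v w :: real
        by simp
      ultimately have "1 + norm x \<le> 2 * (1 + norm (x + s *\<^sub>R b))"
        using norm_ge_zero[of "x + s *\<^sub>R b"] by blast
      then have "(1 + norm x) ^ (2 * DIM('a)) \<le> (2 * (1 + norm (x + s *\<^sub>R b))) ^ (2 * DIM('a))"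
        by (intro power_mono) auto
      then have p: "(1 + norm x) ^ (2 * DIM('a)) \<le> 2 ^ (2 * DIM('a)) * (1 + norm (x + s *\<^sub>R b)) ^ (2 * DIM('a))"
        by (simp only: power_mult_distrib)
      have pos: "(1 + norm x) ^ (2 * DIM('a)) > 0" "(1 + norm (x + s *\<^sub>R b)) ^ (2 * DIM('a)) > 0"
        by (intro zero_less_power; smt (verit) norm_ge_zero)+
      have "norm (partial b f (x + s *\<^sub>R b)) \<le> K / (1 + norm (x + s *\<^sub>R b)) ^ (2 * DIM('a))" by (rule K)
      also have "\<dots> \<le> K * 2 ^ (2 * DIM('a)) * (1 / (1 + norm x) ^ (2 * DIM('a)))"
        using mult_left_mono[OF p K(1)] pos by (simp add: divide_le_eq le_divide_eq field_simps)
      finally show ?thesis .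
    qed
    note bd = this
    let ?L = "K * 2 ^ (2 * DIM('a)) * (1 / (1 + norm x) ^ (2 * DIM('a)))"
    have "norm (f (x + ?h n *\<^sub>R b) - f (x + 0 *\<^sub>R b)) \<le> ?L * norm (?h n - 0)"
    proof (rule differentiable_bound[where S = "{0..?h n}" and f = "\<lambda>s. f (x + s *\<^sub>R b)" and f' = "\<lambda>s k. k *\<^sub>R partial b f (x + s *\<^sub>R b)"])
      show "((\<lambda>s. f (x + s *\<^sub>R b)) has_derivative (\<lambda>k. k *\<^sub>R partial b f (x + s *\<^sub>R b))) (at s within {0..?h n})" for s
        using der unfolding has_vector_derivative_def .
      show "onorm (\<lambda>k. k *\<^sub>R partial b f (x + s *\<^sub>R b)) \<le> ?L" if "s \<in> {0..?h n}" for s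
      proof (rule onorm_le)
        fix k :: real
        show "norm (k *\<^sub>R partial b f (x + s *\<^sub>R b)) \<le> ?L * norm k"
          using mult_right_mono[OF bd[OF that] norm_ge_zero[of k]] unfolding norm_scaleR real_norm_def
          by (simp only: mult.commute)
      qed
    qed auto
    then have "norm (f (x + ?h n *\<^sub>R b) - f x) \<le> ?L * ?h n"
      using hp(1) by (simp del: of_nat_Suc)
    then show ?thesis
      unfolding norm_divide norm_of_real abs_of_pos[OF hp(1)] pos_divide_le_eq[OF hp(1)] .
  qed
  have L1: "(\<lambda>n. LINT x|lborel. cis (- (x \<bullet> \<xi>)) * ?q n x) \<longlonglongrightarrow> fourier (partial b f) \<xi>"
    unfolding fourier_def
  proof (rule integral_dominated_convergence)
    show "integrable lborel (\<lambda>x::'a. K * 2 ^ (2 * DIM('a)) * (1 / (1 + norm x) ^ (2 * DIM('a))))"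
      by (intro integrable_mult_right integrable_decay)
    show "AE x in lborel. (\<lambda>n. cis (- (x \<bullet> \<xi>)) * ?q n x) \<longlonglongrightarrow> cis (- (x \<bullet> \<xi>)) * partial b f x"
      by (intro AE_I2 tendsto_mult tendsto_const qlim)
    show "AE x in lborel. norm (cis (- (x \<bullet> \<xi>)) * ?q n x) \<le> K * 2 ^ (2 * DIM('a)) * (1 / (1 + norm x) ^ (2 * DIM('a)))" for n
      using qb[of _ n] by (intro AE_I2) (simp only: norm_mult norm_cis mult_1_left)
  qed measurable
  have IF: "integrable lborel (\<lambda>x. cis (- (x \<bullet> \<eta>)) * f x)" for \<eta>
    by (intro integrable_cis_mult schwartz_integrable f) measurable
  have eq: "(LINT x|lborel. cis (- (x \<bullet> \<xi>)) * ?q n x)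
      = (cis (?h n * (\<xi> \<bullet> b)) - 1) / complex_of_real (?h n) * fourier f \<xi>" for n
  proof -
    let ?g = "\<lambda>x. cis (- (x \<bullet> \<xi>)) * f x"
    have 1: "cis (- (x \<bullet> \<xi>)) * f (x + ?h n *\<^sub>R b) = cis (?h n * (\<xi> \<bullet> b)) * ?g (x + ?h n *\<^sub>R b)" for x
      unfolding mult.assoc[symmetric] cis_mult by (simp add: inner_add_left inner_commute[of \<xi> b])
    have IT: "integrable lborel (\<lambda>x. ?g (x + ?h n *\<^sub>R b))"
      using IF by (subst lborel_integral_translate(2)[where f = ?g]) auto
    have "(LINT x|lborel. cis (- (x \<bullet> \<xi>)) * ?q n x)
      = (LINT x|lborel. (cis (?h n * (\<xi> \<bullet> b)) * ?g (x + ?h n *\<^sub>R b) - ?g x) / complex_of_real (?h n))"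
      unfolding 1[symmetric] by (simp add: field_simps)
    also have "\<dots> = (cis (?h n * (\<xi> \<bullet> b)) * (LINT x|lborel. ?g (x + ?h n *\<^sub>R b)) - fourier f \<xi>) / complex_of_real (?h n)"
      using IT IF[of \<xi>] by (simp add: fourier_def)
    also have "(LINT x|lborel. ?g (x + ?h n *\<^sub>R b)) = fourier f \<xi>"
      unfolding fourier_def by (rule lborel_integral_translate(1)[where f = ?g]) measurable
    finally show ?thesis by (simp add: field_simps)
  qed
  have "((\<lambda>s. (cis (s * (\<xi> \<bullet> b)) - 1) / complex_of_real s) \<longlongrightarrow> \<i> * complex_of_real (\<xi> \<bullet> b)) (at 0)"
  proof (rule LIM_I)
    fix r :: real assume r: "r > 0"
    show "\<exists>d>0. \<forall>s. s \<noteq> 0 \<and> norm (s - 0) < d \<longrightarrow> norm ((cis (s * (\<xi> \<bullet> b)) - 1) / complex_of_real s - \<i> * complex_of_real (\<xi> \<bullet> b)) < r"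
    proof (intro exI[of _ "r / ((\<xi> \<bullet> b)\<^sup>2 + 1)"] conjI allI impI)
      show "r / ((\<xi> \<bullet> b)\<^sup>2 + 1) > 0" using r by (intro divide_pos_pos) (auto intro: add_nonneg_pos)
      fix s :: real assume s: "s \<noteq> 0 \<and> norm (s - 0) < r / ((\<xi> \<bullet> b)\<^sup>2 + 1)"
      have "(cis (s * (\<xi> \<bullet> b)) - 1) / complex_of_real s - \<i> * complex_of_real (\<xi> \<bullet> b)
        = (cis (s * (\<xi> \<bullet> b)) - 1 - \<i> * complex_of_real (s * (\<xi> \<bullet> b))) / complex_of_real s"
        using s by (simp add: field_simps)
      then have "norm ((cis (s * (\<xi> \<bullet> b)) - 1) / complex_of_real s - \<i> * complex_of_real (\<xi> \<bullet> b))
         \<le> (s * (\<xi> \<bullet> b))\<^sup>2 / \<bar>s\<bar>"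
        using cis_linear_le[of "s * (\<xi> \<bullet> b)"] by (simp add: norm_divide divide_right_mono)
      also have "\<dots> = \<bar>s\<bar> * (\<xi> \<bullet> b)\<^sup>2" using s
        by (cases "s > 0") (auto simp: power_mult_distrib power2_eq_square)
      also have "\<dots> \<le> \<bar>s\<bar> * ((\<xi> \<bullet> b)\<^sup>2 + 1)" by (intro mult_left_mono) auto
      also have "\<dots> < r" using s by (simp add: less_divide_eq add_nonneg_pos)
      finally show "norm ((cis (s * (\<xi> \<bullet> b)) - 1) / complex_of_real s - \<i> * complex_of_real (\<xi> \<bullet> b)) < r" .
    qed
  qed
  from filterlim_compose[OF this hat]
  have "(\<lambda>n. (cis (?h n * (\<xi> \<bullet> b)) - 1) / complex_of_real (?h n) * fourier f \<xi>) \<longlonglongrightarrow> \<i> * complex_of_real (\<xi> \<bullet> b) * fourier f \<xi>"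
    by (intro tendsto_intros)
  then show ?thesis using LIMSEQ_unique[OF L1] unfolding eq by blast
qed

text \<open>Each further power of \<open>1 + \<bar>\<xi>\<bar>\<close> is paid for by one more derivative of \<open>f\<close>.\<close>

lemma rapid_fourier:
  fixes f :: "'a::euclidean_space \<Rightarrow> complex"
  assumes "f \<in> schwartz"
  shows "rapid (fourier f)"
  unfolding rapid_def
proof
  fix N
  show "\<exists>K. \<forall>x. (1 + norm x) ^ N * norm (fourier f x) \<le> K"
    using assms
  proof (induction N arbitrary: f)
    case 0
    then show ?case using norm_fourier_le[of f] by auto
  next
    case (Suc N)
    obtain K where K: "\<And>x. (1 + norm x) ^ N * norm (fourier f x) \<le> K" using Suc by blast
    have "\<forall>b\<in>Basis. \<exists>K. \<forall>x. (1 + norm x) ^ N * norm (fourier (partial b f) x) \<le> K"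
      using Suc.IH schwartz_step(3)[OF Suc.prems] by blast
    then obtain L where L: "\<And>b x. b \<in> Basis \<Longrightarrow> (1 + norm x) ^ N * norm (fourier (partial b f) x) \<le> L b"
      by metis
    have "(1 + norm x) ^ Suc N * norm (fourier f x) \<le> K + sum L Basis" for x
    proof -
      let ?k = "(1 + norm x) ^ N * norm (fourier f x)"
      have "(1 + norm x) ^ Suc N * norm (fourier f x) = ?k + norm x * ?k" by (simp add: algebra_simps)
      also have "\<dots> \<le> ?k + (\<Sum>b\<in>Basis. \<bar>x \<bullet> b\<bar> * ?k)"
        by (intro add_left_mono norm_le_sum_Basis_mult) auto
      also have "(\<Sum>b\<in>Basis. \<bar>x \<bullet> b\<bar> * ?k) = (\<Sum>b\<in>Basis. (1 + norm x) ^ N * norm (fourier (partial b f) x))"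
        by (intro sum.cong refl) (simp add: fourier_partial[OF Suc.prems] norm_mult mult_ac)
      also have "?k + \<dots> \<le> K + sum L Basis" by (intro add_mono K sum_mono L)
      finally show ?thesis .
    qed
    then show ?case by blast
  qed
qed

text \<open>The transforms of Schwartz functions decay rapidly and are closed under derivatives, since a
  derivative of a transform is the transform of a coordinate multiple.\<close>

theorem schwartz_fourier:
  assumes "f \<in> schwartz"
  shows "fourier f \<in> schwartz"
proof (rule schwartz_coinduct[where C = "fourier ` schwartz"])
  show "fourier f \<in> fourier ` schwartz" using assms by blast
next
  fix g :: "'a \<Rightarrow> complex" assume "g \<in> fourier ` schwartz"
  then obtain f where f: "f \<in> schwartz" "g = fourier f" by auto
  show "g differentiable_on UNIV" using fourier_has_derivative[OF f(1)] f(2) by (auto intro: differentiable_onI_UNIV)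
  show "rapid g" using rapid_fourier f by blast
  fix b :: 'a assume "b \<in> Basis"
  then show "partial b g \<in> fourier ` schwartz"
    unfolding f(2) partial_fourier[OF f(1)] by (intro imageI schwartz_cmult schwartz_coordinate_mult f)
qed

lemma inverse_fourier_eq:
  "inverse_fourier f = (\<lambda>x. (1 / complex_of_real ((2 * pi) ^ DIM('a::euclidean_space))) * fourier f (- (x::'a)))"
  by (auto simp: inverse_fourier_def fourier_def inner_commute)

lemma schwartz_inverse_fourier: "f \<in> schwartz \<Longrightarrow> inverse_fourier f \<in> schwartz"
  unfolding inverse_fourier_eq by (intro schwartz_cmult schwartz_reflect schwartz_fourier)

lemma inverse_fourier_fourier:
  fixes f :: "'a::euclidean_space \<Rightarrow> complex"
  assumes f: "f \<in> schwartz"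
  shows "inverse_fourier (fourier f) = f"
proof
  fix x
  obtain K where K: "K \<ge> 0" "\<And>x. norm (f x) \<le> K / (1 + norm x) ^ 0" using schwartz_decay[OF f] by blast
  have "isCont f x" using continuous_on_schwartz[OF f] by (simp add: continuous_on_eq_continuous_at)
  then show "inverse_fourier (fourier f) x = f x"
    using fourier_inversion[OF schwartz_integrable[OF f] schwartz_integrable[OF schwartz_fourier[OF f]], of x K] K(2)
    by (simp add: inverse_fourier_def)
qed

lemma fourier_inverse_fourier:
  fixes f :: "'a::euclidean_space \<Rightarrow> complex"
  assumes f: "f \<in> schwartz"
  shows "fourier (inverse_fourier f) = f"
proof
  fix x :: 'a
  have [measurable]: "f \<in> borel_measurable borel" by (rule schwartz_measurable[OF f])
  let ?c = "1 / complex_of_real ((2 * pi) ^ DIM('a))"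
  have "fourier (inverse_fourier f) x = (LINT \<xi>|lborel. cis (- (\<xi> \<bullet> x)) * (?c * fourier f (- \<xi>)))"
    unfolding fourier_def[of "inverse_fourier f"] unfolding inverse_fourier_eq ..
  also have "\<dots> = (LINT \<xi>|lborel. (\<lambda>\<xi>. cis (x \<bullet> \<xi>) * fourier f \<xi> / complex_of_real ((2 * pi) ^ DIM('a))) (- \<xi>))"
    by (simp add: inner_commute)
  also have "\<dots> = (LINT \<xi>|lborel. cis (x \<bullet> \<xi>) * fourier f \<xi> / complex_of_real ((2 * pi) ^ DIM('a)))"
    by (rule lborel_integral_reflect(1)) measurable
  also have "\<dots> = inverse_fourier (fourier f) x" unfolding inverse_fourier_def by (rule integral_divide_zero)
  finally show "fourier (inverse_fourier f) x = f x" using inverse_fourier_fourier[OF f] by simp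
qed

section \<open>Testing bounds Sobolev norms from below\<close>

lemma integral_mult_le_L2:
  fixes f g :: "'a::euclidean_space \<Rightarrow> complex"
  assumes [measurable]: "f \<in> borel_measurable borel" "g \<in> borel_measurable borel"
    and f: "integrable lborel (\<lambda>x. (norm (f x))\<^sup>2)" and g: "integrable lborel (\<lambda>x. (norm (g x))\<^sup>2)"
  shows "norm (LINT x|lborel. f x * g x) \<le> sqrt (LINT x|lborel. (norm (f x))\<^sup>2) * sqrt (LINT x|lborel. (norm (g x))\<^sup>2)"
proof -
  let ?F = "LINT x|lborel. (norm (f x))\<^sup>2" and ?G = "LINT x|lborel. (norm (g x))\<^sup>2"
  have F0: "?F \<ge> 0" "?G \<ge> 0" by simp_all
  have P: "norm (LINT x|lborel. f x * g x) \<le> d * ?F + ?G / (4 * d)" if d: "d > 0" for d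
  proof -
    have "norm (LINT x|lborel. f x * g x) \<le> (LINT x|lborel. norm (f x * g x))" by (rule integral_norm_bound)
    also have "\<dots> \<le> (LINT x|lborel. d * (norm (f x))\<^sup>2 + (norm (g x))\<^sup>2 / (4 * d))"
      using mult_le_weighted_squares[OF d] f g d by (intro integral_mono_AE') (auto simp: norm_mult)
    also have "\<dots> = d * ?F + ?G / (4 * d)" using f g by simp
    finally show ?thesis .
  qed
  define a b where "a = sqrt ?F" and "b = sqrt ?G"
  have ab: "a \<ge> 0" "b \<ge> 0" "?F = a\<^sup>2" "?G = b\<^sup>2" using F0 by (auto simp: a_def b_def)
  have "norm (LINT x|lborel. f x * g x) \<le> a * b + e" if e: "e > 0" for e :: real
  proof -
    define r where "r = e / (2 * (a + b + 1)) "
    have r: "r > 0" using e ab by (simp add: r_def)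
    \<comment> \<open>the weight \<open>b / (2 a)\<close> is optimal; the shift by \<open>r\<close> avoids the degenerate cases\<close>
    define d where "d = (b + r) / (2 * (a + r))"
    have d: "d > 0" using r ab by (simp add: d_def)
    have "d * a\<^sup>2 \<le> d * (a * (a + r))" using d ab r by (intro mult_left_mono) (auto simp: power2_eq_square algebra_simps)
    also have "\<dots> = a * (b + r) / 2" using ab r by (simp add: d_def field_simps)
    finally have 1: "d * a\<^sup>2 \<le> a * (b + r) / 2" .
    have "b\<^sup>2 / (4 * d) \<le> b * (b + r) / (4 * d)" using d ab r by (intro divide_right_mono) (auto simp: power2_eq_square algebra_simps)
    also have "\<dots> = b * (a + r) / 2"
    proof -
      have "b + r \<noteq> 0" "a + r \<noteq> 0" using ab r by linarith+
      then show ?thesis by (simp add: d_def field_simps)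
    qed
    finally have "b\<^sup>2 / (4 * d) \<le> b * (a + r) / 2" .
    moreover have "a * (b + r) / 2 + b * (a + r) / 2 = a * b + r * (a + b) / 2" by (simp add: field_simps)
    ultimately have "norm (LINT x|lborel. f x * g x) \<le> a * b + r * (a + b) / 2"
      using 1 P[OF d] unfolding ab(3,4) by linarith
    also have "r * (a + b) / 2 \<le> r * (2 * (a + b + 1))" using r ab by (simp add: algebra_simps)
    also have "\<dots> = e" using ab by (simp add: r_def)
    finally show ?thesis by simp
  qed
  then show ?thesis unfolding a_def[symmetric] b_def[symmetric] by (rule field_le_epsilon)
qed

text \<open>The Bessel potential of order \<open>s\<close> is symmetric and invertible on Schwartz space, so
  testing against \<open>\<theta>\<close> is the same as testing the potential of the distribution against the
  inverse potential of \<open>\<theta>\<close>.\<close>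

theorem sobolev_norm_on_lower_bound:
  fixes \<theta> :: "'a::euclidean_space \<Rightarrow> complex"
  assumes \<theta>: "test_function (interior D) \<theta>"
  shows "\<exists>C>0. \<forall>u. ennreal (norm (u \<theta>) / C) \<le> sobolev_norm_on s 2 D u"
proof -
  have S: "\<theta> \<in> schwartz" by (rule test_function_schwartz[OF \<theta>])
  define \<psi> where "\<psi> = (\<lambda>\<xi>. complex_of_real ((1 + (norm \<xi>)\<^sup>2) powr (- s / 2)) * inverse_fourier \<theta> \<xi>)"
  have \<psi>: "\<psi> \<in> schwartz" unfolding \<psi>_def by (intro schwartz_bracket_mult schwartz_inverse_fourier S)
  define \<phi> where "\<phi> = fourier \<psi>"
  have \<phi>: "\<phi> \<in> schwartz" unfolding \<phi>_def by (intro schwartz_fourier \<psi>)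
  have pot: "bessel_potential s v \<phi> = v \<theta>" for v
  proof -
    have pos: "1 + (norm \<xi>)\<^sup>2 > 0" for \<xi> :: 'a by (smt (verit) zero_le_power2)
    have "(\<lambda>\<xi>. complex_of_real ((1 + (norm \<xi>)\<^sup>2) powr (s / 2)) * \<psi> \<xi>) = inverse_fourier \<theta>"
      unfolding \<psi>_def using pos
      by (auto simp: fun_eq_iff mult.assoc[symmetric] powr_add[symmetric] simp flip: of_real_mult)
         (metis less_irrefl)+
    then show ?thesis
      by (simp add: bessel_potential_def inverse_fourier_dist_def mult_dist_def fourier_dist_def
          \<phi>_def inverse_fourier_fourier[OF \<psi>] fourier_inverse_fourier[OF S])
  qed
  let ?P = "sqrt (LINT x|lborel. (norm (\<phi> x))\<^sup>2)"
  define C where "C = ?P + 1"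
  have C: "C > 0" unfolding C_def by (smt (verit) real_sqrt_ge_zero integral_nonneg_AE AE_I2 zero_le_power2)
  have \<phi>2: "integrable lborel (\<lambda>x. (norm (\<phi> x))\<^sup>2)"
  proof -
    obtain K where K: "K \<ge> 0" "\<And>x. norm (\<phi> x) \<le> K / (1 + norm x) ^ 0" using schwartz_decay[OF \<phi>] by blast
    have [measurable]: "\<phi> \<in> borel_measurable borel" by (rule schwartz_measurable[OF \<phi>])
    show ?thesis
    proof (rule Bochner_Integration.integrable_bound)
      show "integrable lborel (\<lambda>x. K * norm (\<phi> x))" using schwartz_integrable[OF \<phi>] by simp
      show "AE x in lborel. norm ((norm (\<phi> x))\<^sup>2) \<le> norm (K * norm (\<phi> x))"
        using K by (intro AE_I2) (auto simp: power2_eq_square intro!: mult_right_mono)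
    qed measurable
  qed
  have "ennreal (norm (u \<theta>) / C) \<le> sobolev_norm_on s 2 D u" for u
    unfolding sobolev_norm_on_def
  proof (rule Inf_greatest, safe)
    fix v assume v: "\<forall>\<phi>. test_function (interior D) \<phi> \<longrightarrow> v \<phi> = u \<phi>"
    show "ennreal (norm (u \<theta>) / C) \<le> sobolev_norm s 2 v"
      unfolding sobolev_norm_def
    proof (rule Inf_greatest, safe)
      fix g :: "'a \<Rightarrow> complex" assume g: "g \<in> Lp_space 2" and gv: "\<forall>\<phi>\<in>schwartz. bessel_potential s v \<phi> = dist_of g \<phi>"
      have gm: "g \<in> borel_measurable borel" and g2: "integrable lborel (\<lambda>x. (norm (g x))\<^sup>2)"
        using g by (auto simp: Lp_space_def)
      have "u \<theta> = (LINT x|lborel. g x * \<phi> x)"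
        using v \<theta> pot[of v] gv \<phi> by (auto simp: dist_of_def)
      then have "norm (u \<theta>) \<le> sqrt (LINT x|lborel. (norm (g x))\<^sup>2) * ?P"
        using integral_mult_le_L2[OF gm schwartz_measurable[OF \<phi>] g2 \<phi>2] by simp
      also have "\<dots> \<le> sqrt (LINT x|lborel. (norm (g x))\<^sup>2) * C"
        by (intro mult_left_mono) (auto simp: C_def)
      finally have "norm (u \<theta>) / C \<le> sqrt (LINT x|lborel. (norm (g x))\<^sup>2)" using C by (simp add: divide_le_eq)
      also have "\<dots> = Lp_norm 2 g" by (simp add: Lp_norm_def powr_half_sqrt)
      finally show "ennreal (norm (u \<theta>) / C) \<le> ennreal (Lp_norm 2 g)" by (rule ennreal_leI)
    qed
  qed
  then show ?thesis using C by blast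
qed

section \<open>Duhamel's formula for the wave equation in the plane\<close>

lemma has_vector_derivative_along_path:
  assumes \<gamma>: "(\<gamma> has_vector_derivative v) (at s within T)"
    and sub: "\<gamma> ` T \<subseteq> S" and s: "s \<in> T"
    and p: "(p has_derivative q) (at (\<gamma> s) within S)"
  shows "((\<lambda>s. p (\<gamma> s)) has_vector_derivative q v) (at s within T)"
proof -
  have "((\<lambda>s. p (\<gamma> s)) has_derivative (\<lambda>k. q (k *\<^sub>R v))) (at s within T)"
    using has_derivative_in_compose[OF \<gamma>[unfolded has_vector_derivative_def] has_derivative_subset[OF p sub]] .
  moreover have "q (k *\<^sub>R v) = k *\<^sub>R q v" for k
    using linear_scale[OF has_derivative_linear[OF p]] by blast
  ultimately show ?thesis by (simp add: has_vector_derivative_def)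
qed

text \<open>Comparing two computations of the \<open>a\<close>-derivative of \<open>f a b - f a 0\<close> shows that the
  two mixed derivatives have the same integrals over \<open>{0..b}\<close> for every \<open>b\<close>. One-sided squares
  suffice, so the symmetry also holds on the boundary of the half-space.\<close>

lemma mixed_derivatives_equal:
  fixes f :: "real \<Rightarrow> real \<Rightarrow> 'b::banach"
  assumes d: "d > 0"
    and fa: "\<And>a b. a \<in> {0..d} \<Longrightarrow> b \<in> {0..d} \<Longrightarrow> ((\<lambda>a. f a b) has_vector_derivative fa a b) (at a within {0..d})"
    and fb: "\<And>a b. a \<in> {0..d} \<Longrightarrow> b \<in> {0..d} \<Longrightarrow> ((\<lambda>b. f a b) has_vector_derivative fb a b) (at b within {0..d})"
    and fab: "\<And>a b. a \<in> {0..d} \<Longrightarrow> b \<in> {0..d} \<Longrightarrow> ((\<lambda>b. fa a b) has_vector_derivative fab a b) (at b within {0..d})"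
    and fba: "\<And>a b. a \<in> {0..d} \<Longrightarrow> b \<in> {0..d} \<Longrightarrow> ((\<lambda>a. fb a b) has_vector_derivative fba a b) (at a within {0..d})"
    and cb: "\<And>a. a \<in> {0..d} \<Longrightarrow> continuous_on {0..d} (fb a)"
    and cab: "continuous_on {0..d} (fab 0)"
    and cba: "continuous_on ({0..d} \<times> {0..d}) (\<lambda>(a, b). fba a b)"
  shows "fab 0 0 = fba 0 0"
proof -
  have z: "0 \<in> {0..d}" using d by simp
  have c0: "continuous_on {0..d} (fba 0)"
  proof -
    have "continuous_on {0..d} (\<lambda>b. (\<lambda>(a, b). fba a b) (0, b))"
      by (rule continuous_on_compose2[OF cba]) (use d in \<open>auto intro!: continuous_intros\<close>)
    then show ?thesis by simp
  qed
  have eq: "integral {0..b} (fab 0) = integral {0..b} (fba 0)" if b: "b \<in> {0..d}" for b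
  proof -
    have sub: "{0..b} \<subseteq> {0..d}" using b by auto
    have F: "integral {0..b} (fb a) = f a b - f a 0" if a: "a \<in> {0..d}" for a
      using b by (intro integral_unique fundamental_theorem_of_calculus has_vector_derivative_within_subset[OF fb[OF a] sub]) auto
    have "((\<lambda>a. integral (cbox 0 b) (fb a)) has_vector_derivative integral (cbox 0 b) (fba 0)) (at 0 within {0..d})"
    proof (rule leibniz_rule_vector_derivative)
      show "((\<lambda>a. fb a c) has_vector_derivative fba a c) (at a within {0..d})" if "a \<in> {0..d}" "c \<in> cbox 0 b" for a c
        using fba that sub by auto
      show "fb a integrable_on cbox 0 b" if "a \<in> {0..d}" for a
        using continuous_on_subset[OF cb[OF that] sub] by (intro integrable_continuous) simp
      show "continuous_on ({0..d} \<times> cbox 0 b) (\<lambda>(a, b). fba a b)"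
        by (rule continuous_on_subset[OF cba]) (use sub in auto)
    qed (use z in auto)
    moreover have "((\<lambda>a. integral (cbox 0 b) (fb a)) has_vector_derivative (fa 0 b - fa 0 0)) (at 0 within {0..d})"
    proof (rule has_vector_derivative_transform[where f = "\<lambda>a. f a b - f a 0"])
      show "((\<lambda>a. f a b - f a 0) has_vector_derivative (fa 0 b - fa 0 0)) (at 0 within {0..d})"
        using z b by (intro has_vector_derivative_diff fa)
    qed (use F z in auto)
    ultimately have "integral {0..b} (fba 0) = fa 0 b - fa 0 0"
      using vector_derivative_unique_within_closed_interval[of 0 d 0] d by auto
    also have "\<dots> = integral {0..b} (fab 0)"
      using b by (intro integral_unique[symmetric] fundamental_theorem_of_calculus
          has_vector_derivative_within_subset[OF fab[OF z] sub]) auto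
    finally show ?thesis by simp
  qed
  have "((\<lambda>u. integral {0..u} (fab 0)) has_vector_derivative fba 0 0) (at 0 within {0..d})"
    by (rule has_vector_derivative_transform[OF z _ integral_has_vector_derivative[OF c0 z]]) (use eq in auto)
  from vector_derivative_unique_within_closed_interval[of 0 d 0, OF d _ integral_has_vector_derivative[OF cab z, folded cbox_interval] this[folded cbox_interval]]
  show ?thesis using d by simp
qed

definition light_cone :: "real \<Rightarrow> plane \<Rightarrow> spacetime \<Rightarrow> spacetime" where
  "light_cone t x w = (fst w,
     x + ((t - fst w) * sin (snd (snd w))) *\<^sub>R (cos (fst (snd w)), sin (fst (snd w))))"

abbreviation cone_box :: "real \<Rightarrow> spacetime set" where
  "cone_box t \<equiv> cbox (0, 0, 0) (t, 2 * pi, pi / 2)"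

abbreviation half_space :: "spacetime set" where "half_space \<equiv> {0..} \<times> UNIV"

text \<open>Let \<open>p0, p1, p2\<close> be the first derivatives of a solution \<open>u\<close> and \<open>q0, q1, q2\<close> the
  derivatives of these. Following the backward light cone with vertex \<open>(t, x)\<close>, the quantity
  \<open>(t - s) (p0 + sin \<phi> (cos \<theta> p1 + sin \<theta> p2)) + u\<close>, averaged over the cone section at time \<open>s\<close>
  with weight \<open>sin \<phi>\<close>, vanishes at \<open>s = 0\<close> and equals \<open>2 pi u\<close> at \<open>s = t\<close>. The planar section is
  the projection of a sphere, with \<open>\<theta>\<close> and \<open>\<phi>\<close> its longitude and colatitude. The derivative of the
  average in \<open>s\<close> is the average of \<open>t - s\<close> times the source, because two total derivatives, one in
  \<open>\<phi>\<close> and one in \<open>\<theta>\<close>, integrate to zero.\<close>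

locale C2_wave =
  fixes u p0 p1 p2 :: "spacetime \<Rightarrow> 'b::banach" and q0 q1 q2 :: "spacetime \<Rightarrow> spacetime \<Rightarrow> 'b"
  assumes du: "\<And>z. z \<in> half_space \<Longrightarrow> (u has_derivative (\<lambda>h. fst h *\<^sub>R p0 z + fst (snd h) *\<^sub>R p1 z + snd (snd h) *\<^sub>R p2 z)) (at z within half_space)"
    and dp: "\<And>z. z \<in> half_space \<Longrightarrow> (p0 has_derivative q0 z) (at z within half_space)"
      "\<And>z. z \<in> half_space \<Longrightarrow> (p1 has_derivative q1 z) (at z within half_space)"
      "\<And>z. z \<in> half_space \<Longrightarrow> (p2 has_derivative q2 z) (at z within half_space)"
    and cq: "\<And>e. e \<in> {e_t, e_1, e_2} \<Longrightarrow> continuous_on half_space (\<lambda>z. q0 z e)"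
      "\<And>e. e \<in> {e_t, e_1, e_2} \<Longrightarrow> continuous_on half_space (\<lambda>z. q1 z e)"
      "\<And>e. e \<in> {e_t, e_1, e_2} \<Longrightarrow> continuous_on half_space (\<lambda>z. q2 z e)"
    and init: "\<And>x. u (0, x) = 0" "\<And>x. p0 (0, x) = 0"
begin

lemma cu: "continuous_on half_space u" and cp: "continuous_on half_space p0" "continuous_on half_space p1" "continuous_on half_space p2"
  using du dp by (auto intro!: has_derivative_continuous_on)

lemma q_expand:
  assumes "z \<in> half_space"
  shows "q0 z (a, k *\<^sub>R (b, c)) = a *\<^sub>R q0 z e_t + (k * b) *\<^sub>R q0 z e_1 + (k * c) *\<^sub>R q0 z e_2"
    and "q1 z (a, k *\<^sub>R (b, c)) = a *\<^sub>R q1 z e_t + (k * b) *\<^sub>R q1 z e_1 + (k * c) *\<^sub>R q1 z e_2"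
    and "q2 z (a, k *\<^sub>R (b, c)) = a *\<^sub>R q2 z e_t + (k * b) *\<^sub>R q2 z e_1 + (k * c) *\<^sub>R q2 z e_2"
proof -
  have e: "(a, k *\<^sub>R (b, c)) = a *\<^sub>R e_t + (k * b) *\<^sub>R e_1 + (k * c) *\<^sub>R e_2" by simp
  have L: "linear (q0 z)" "linear (q1 z)" "linear (q2 z)" using dp[OF assms(1)] has_derivative_linear by blast+
  show "q0 z (a, k *\<^sub>R (b, c)) = a *\<^sub>R q0 z e_t + (k * b) *\<^sub>R q0 z e_1 + (k * c) *\<^sub>R q0 z e_2"
    unfolding e linear_add[OF L(1)] linear_scale[OF L(1)] ..
  show "q1 z (a, k *\<^sub>R (b, c)) = a *\<^sub>R q1 z e_t + (k * b) *\<^sub>R q1 z e_1 + (k * c) *\<^sub>R q1 z e_2"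
    unfolding e linear_add[OF L(2)] linear_scale[OF L(2)] ..
  show "q2 z (a, k *\<^sub>R (b, c)) = a *\<^sub>R q2 z e_t + (k * b) *\<^sub>R q2 z e_1 + (k * c) *\<^sub>R q2 z e_2"
    unfolding e linear_add[OF L(3)] linear_scale[OF L(3)] ..
qed

lemma time_derivatives_commute:
  assumes z: "z \<in> half_space"
  shows "q1 z e_t = q0 z e_1" "q2 z e_t = q0 z e_2"
proof -
  obtain s x y where zz: "z = (s, x, y)" and s: "s \<ge> 0" using z by auto
  have "q1 z e_t = q0 z e_1 \<and> q2 z e_t = q0 z e_2"
  proof (intro conjI)
    have in_S: "(s + a, w) \<in> half_space" if "a \<in> {0..1}" for a w using that s by auto
    have A: "((\<lambda>a. (s + a, w)) has_vector_derivative e_t) (at a within {0..1})" for a and w :: plane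
      unfolding has_vector_derivative_def by (auto intro!: derivative_eq_intros simp: zero_prod_def)
    have B1: "((\<lambda>b. (r, x + b, y)) has_vector_derivative e_1) (at b within {0..1})" for b r :: real
      unfolding has_vector_derivative_def by (auto intro!: derivative_eq_intros)
    have B2: "((\<lambda>b. (r, x, y + b)) has_vector_derivative e_2) (at b within {0..1})" for b r :: real
      unfolding has_vector_derivative_def by (auto intro!: derivative_eq_intros)
    note path = has_vector_derivative_along_path[where S = half_space]
    have imA: "(\<lambda>a. (s + a, w)) ` {0..1} \<subseteq> half_space" for w using in_S by auto
    have imB: "(\<lambda>b. (s + a, \<beta> b)) ` {0..1} \<subseteq> half_space" if "a \<in> {0..1}" for a and \<beta> :: "real \<Rightarrow> plane"
      using in_S[OF that] by auto
    have "q0 (s + 0, x + 0, y) e_1 = q1 (s + 0, x + 0, y) e_t"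
    proof (rule mixed_derivatives_equal[of 1 "\<lambda>a b. u (s + a, x + b, y)" "\<lambda>a b. p0 (s + a, x + b, y)" "\<lambda>a b. p1 (s + a, x + b, y)"
         "\<lambda>a b. q0 (s + a, x + b, y) e_1" "\<lambda>a b. q1 (s + a, x + b, y) e_t"])
      fix a b :: real assume ab: "a \<in> {0..1}" "b \<in> {0..1}"
      show "((\<lambda>a. u (s + a, x + b, y)) has_vector_derivative p0 (s + a, x + b, y)) (at a within {0..1})"
        using path[OF A[where w = "(x + b, y)"] imA ab(1) du[OF in_S[OF ab(1)]]] by simp
      show "((\<lambda>b. u (s + a, x + b, y)) has_vector_derivative p1 (s + a, x + b, y)) (at b within {0..1})"
        using path[OF B1[where r = "s + a"] imB[OF ab(1)] ab(2) du[OF in_S[OF ab(1)]]] by simp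
      show "((\<lambda>b. p0 (s + a, x + b, y)) has_vector_derivative q0 (s + a, x + b, y) e_1) (at b within {0..1})"
        using path[OF B1[where r = "s + a"] imB[OF ab(1)] ab(2) dp(1)[OF in_S[OF ab(1)]]] by simp
      show "((\<lambda>a. p1 (s + a, x + b, y)) has_vector_derivative q1 (s + a, x + b, y) e_t) (at a within {0..1})"
        using path[OF A[where w = "(x + b, y)"] imA ab(1) dp(2)[OF in_S[OF ab(1)]]] by simp
    next
      fix a :: real assume "a \<in> {0..1}"
      then show "continuous_on {0..1} (\<lambda>b. p1 (s + a, x + b, y))"
        using in_S by (intro continuous_on_compose2[OF cp(2)]) (auto intro!: continuous_intros)
    next
      show "continuous_on {0..1} (\<lambda>b. q0 (s + 0, x + b, y) e_1)"
        using in_S[of 0] by (intro continuous_on_compose2[OF cq(1)[of e_1]]) (auto intro!: continuous_intros)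
      show "continuous_on ({0..1} \<times> {0..1}) (\<lambda>(a, b). q1 (s + a, x + b, y) e_t)"
        using in_S unfolding case_prod_beta
        by (intro continuous_on_compose2[OF cq(2)[of e_t]]) (auto intro!: continuous_intros)
    qed auto
    then show "q1 z e_t = q0 z e_1" by (simp add: zz)
    have "q0 (s + 0, x, y + 0) e_2 = q2 (s + 0, x, y + 0) e_t"
    proof (rule mixed_derivatives_equal[of 1 "\<lambda>a b. u (s + a, x, y + b)" "\<lambda>a b. p0 (s + a, x, y + b)" "\<lambda>a b. p2 (s + a, x, y + b)"
         "\<lambda>a b. q0 (s + a, x, y + b) e_2" "\<lambda>a b. q2 (s + a, x, y + b) e_t"])
      fix a b :: real assume ab: "a \<in> {0..1}" "b \<in> {0..1}"
      show "((\<lambda>a. u (s + a, x, y + b)) has_vector_derivative p0 (s + a, x, y + b)) (at a within {0..1})"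
        using path[OF A[where w = "(x, y + b)"] imA ab(1) du[OF in_S[OF ab(1)]]] by simp
      show "((\<lambda>b. u (s + a, x, y + b)) has_vector_derivative p2 (s + a, x, y + b)) (at b within {0..1})"
        using path[OF B2[where r = "s + a"] imB[OF ab(1)] ab(2) du[OF in_S[OF ab(1)]]] by simp
      show "((\<lambda>b. p0 (s + a, x, y + b)) has_vector_derivative q0 (s + a, x, y + b) e_2) (at b within {0..1})"
        using path[OF B2[where r = "s + a"] imB[OF ab(1)] ab(2) dp(1)[OF in_S[OF ab(1)]]] by simp
      show "((\<lambda>a. p2 (s + a, x, y + b)) has_vector_derivative q2 (s + a, x, y + b) e_t) (at a within {0..1})"
        using path[OF A[where w = "(x, y + b)"] imA ab(1) dp(3)[OF in_S[OF ab(1)]]] by simp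
    next
      fix a :: real assume "a \<in> {0..1}"
      then show "continuous_on {0..1} (\<lambda>b. p2 (s + a, x, y + b))"
        using in_S by (intro continuous_on_compose2[OF cp(3)]) (auto intro!: continuous_intros)
    next
      show "continuous_on {0..1} (\<lambda>b. q0 (s + 0, x, y + b) e_2)"
        using in_S[of 0] by (intro continuous_on_compose2[OF cq(1)[of e_2]]) (auto intro!: continuous_intros)
      show "continuous_on ({0..1} \<times> {0..1}) (\<lambda>(a, b). q2 (s + a, x, y + b) e_t)"
        using in_S unfolding case_prod_beta
        by (intro continuous_on_compose2[OF cq(3)[of e_t]]) (auto intro!: continuous_intros)
    qed auto
    then show "q2 z e_t = q0 z e_2" by (simp add: zz)
  qed
  then show "q1 z e_t = q0 z e_1" "q2 z e_t = q0 z e_2" by auto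
qed

lemma init_space: "p1 (0, x) = 0" "p2 (0, x) = 0"
proof -
  obtain a b where x: "x = (a, b)" by (cases x)
  have zS: "(0, w) \<in> half_space" for w by simp
  have B1: "((\<lambda>k. (0, k, b)) has_vector_derivative e_1) (at a)"
    unfolding has_vector_derivative_def by (auto intro!: derivative_eq_intros)
  have B2: "((\<lambda>k. (0, a, k)) has_vector_derivative e_2) (at b)"
    unfolding has_vector_derivative_def by (auto intro!: derivative_eq_intros)
  have "((\<lambda>k. u (0, k, b)) has_vector_derivative p1 (0, a, b)) (at a)"
    using has_vector_derivative_along_path[OF B1 _ _ du[OF zS]] zS by auto
  then show "p1 (0, x) = 0"
    using vector_derivative_unique_at[OF _ has_vector_derivative_const[of 0]] by (simp add: init x)
  have "((\<lambda>k. u (0, a, k)) has_vector_derivative p2 (0, a, b)) (at b)"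
    using has_vector_derivative_along_path[OF B2 _ _ du[OF zS]] zS by auto
  then show "p2 (0, x) = 0"
    using vector_derivative_unique_at[OF _ has_vector_derivative_const[of 0]] by (simp add: init x)
qed

theorem duhamel:
  assumes t: "t > 0"
  shows "(2 * pi) *\<^sub>R u (t, x) = integral (cone_box t) (\<lambda>w. ((t - fst w) * sin (snd (snd w))) *\<^sub>R
    (q0 (light_cone t x w) e_t - q1 (light_cone t x w) e_1 - q2 (light_cone t x w) e_2))"
proof -
  let ?Z = "light_cone t x"
  let ?B = "cone_box t"
  let ?R = "cbox (0, 0) (2 * pi, pi / 2)"
  have box: "?B = cbox 0 t \<times> ?R" by (simp add: cbox_Pair_eq)
  have ZS: "?Z w \<in> half_space" if "fst w \<in> {0..t}" for w using that by (auto simp: light_cone_def)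
  have ZB: "?Z ` ?B \<subseteq> half_space" by (rule image_subsetI, rule ZS) (auto simp: box)
  have cZ: "continuous_on T ?Z" for T unfolding light_cone_def by (intro continuous_intros)
  note cc = continuous_on_compose2[OF _ cZ[of ?B] ZB]
  note cu' = cc[OF cu] and cp' = cc[OF cp(1)] cc[OF cp(2)] cc[OF cp(3)]
    and cq' = cc[OF cq(1)] cc[OF cq(2)] cc[OF cq(3)]
  define c d \<sigma> where "c w = cos (fst (snd w))" and "d w = sin (fst (snd w))" and "\<sigma> w = sin (snd (snd w))"
    for w :: spacetime
  have ccont: "continuous_on T c" "continuous_on T d" "continuous_on T \<sigma>" for T
    unfolding c_def d_def \<sigma>_def by (intro continuous_intros)+
  \<comment> \<open>\<open>E\<close> and \<open>Q\<close> are the first and second radial derivatives of \<open>u\<close>, \<open>T\<close> is the second tangential one\<close>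
  define E where "E w = c w *\<^sub>R p1 (?Z w) + d w *\<^sub>R p2 (?Z w)" for w
  define Q where "Q w = (c w * c w) *\<^sub>R q1 (?Z w) e_1 + (c w * d w) *\<^sub>R q1 (?Z w) e_2
     + (d w * c w) *\<^sub>R q2 (?Z w) e_1 + (d w * d w) *\<^sub>R q2 (?Z w) e_2" for w
  define T where "T w = (d w * d w) *\<^sub>R q1 (?Z w) e_1 - (c w * d w) *\<^sub>R q1 (?Z w) e_2
     - (d w * c w) *\<^sub>R q2 (?Z w) e_1 + (c w * c w) *\<^sub>R q2 (?Z w) e_2" for w
  have cd: "c w * c w + d w * d w = 1" for w
    using sin_cos_squared_add3[of "fst (snd w)"] by (simp add: c_def d_def)
  have QT: "Q w + T w = q1 (?Z w) e_1 + q2 (?Z w) e_2" for w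
  proof -
    have "Q w + T w = (c w * c w + d w * d w) *\<^sub>R q1 (?Z w) e_1 + (c w * c w + d w * d w) *\<^sub>R q2 (?Z w) e_2"
      by (simp add: Q_def T_def scaleR_left_distrib algebra_simps)
    then show ?thesis by (simp add: cd)
  qed
  have cE: "continuous_on ?B E" unfolding E_def by (intro continuous_intros ccont cp')
  have cQ: "continuous_on ?B Q" unfolding Q_def by (intro continuous_intros ccont cq') auto
  have cT: "continuous_on ?B T" unfolding T_def by (intro continuous_intros ccont cq') auto

  \<comment> \<open>\<open>G1\<close> is the \<open>\<phi>\<close>-derivative of \<open>sin \<phi> cos \<phi> E\<close>, which vanishes at both ends\<close>
  define G1 where "G1 w = (1 - \<sigma> w * \<sigma> w - \<sigma> w * \<sigma> w) *\<^sub>R E w + ((t - fst w) * \<sigma> w * (1 - (\<sigma> w)\<^sup>2)) *\<^sub>R Q w" for w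
  have cG1: "continuous_on ?B G1" unfolding G1_def by (intro continuous_intros ccont cE cQ)
  have I1: "integral (cbox 0 (pi / 2)) (\<lambda>\<phi>. G1 (s, \<theta>, \<phi>)) = 0" if s: "s \<in> {0..t}" for s \<theta>
  proof -
    have Zd: "((\<lambda>\<phi>. ?Z (s, \<theta>, \<phi>)) has_vector_derivative (0, ((t - s) * cos \<phi>) *\<^sub>R (cos \<theta>, sin \<theta>))) (at \<phi> within {0..pi / 2})" for \<phi>
      unfolding light_cone_def has_vector_derivative_def by (auto intro!: derivative_eq_intros)
    have im: "(\<lambda>\<phi>. ?Z (s, \<theta>, \<phi>)) ` {0..pi / 2} \<subseteq> half_space" using s by (intro image_subsetI ZS) auto
    have pd: "((\<lambda>\<phi>. p1 (?Z (s, \<theta>, \<phi>))) has_vector_derivative q1 (?Z (s, \<theta>, \<phi>)) (0, ((t - s) * cos \<phi>) *\<^sub>R (cos \<theta>, sin \<theta>))) (at \<phi> within {0..pi / 2})"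
        "((\<lambda>\<phi>. p2 (?Z (s, \<theta>, \<phi>))) has_vector_derivative q2 (?Z (s, \<theta>, \<phi>)) (0, ((t - s) * cos \<phi>) *\<^sub>R (cos \<theta>, sin \<theta>))) (at \<phi> within {0..pi / 2})"
      if "\<phi> \<in> {0..pi / 2}" for \<phi>
      using ZS s by (intro has_vector_derivative_along_path[OF Zd im that] dp; auto)+
    have "((\<lambda>\<phi>. G1 (s, \<theta>, \<phi>)) has_integral
        ((sin (pi / 2) * cos (pi / 2)) *\<^sub>R (cos \<theta> *\<^sub>R p1 (?Z (s, \<theta>, pi / 2)) + sin \<theta> *\<^sub>R p2 (?Z (s, \<theta>, pi / 2)))
         - (sin 0 * cos 0) *\<^sub>R (cos \<theta> *\<^sub>R p1 (?Z (s, \<theta>, 0)) + sin \<theta> *\<^sub>R p2 (?Z (s, \<theta>, 0))))) {0..pi / 2}"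
    proof (rule fundamental_theorem_of_calculus)
      fix \<phi> :: real assume \<phi>: "\<phi> \<in> {0..pi / 2}"
      have zs: "?Z (s, \<theta>, \<phi>) \<in> half_space" using ZS s by auto
      have s2: "cos \<phi> * cos \<phi> = 1 - sin \<phi> * sin \<phi>" using sin_cos_squared_add3[of \<phi>] by linarith
      have k: "sin \<phi> * cos \<phi> * (a * ((t - s) * cos \<phi> * b)) = (t - s) * sin \<phi> * (1 - (sin \<phi>)\<^sup>2) * (a * b)" for a b
        using s2 by algebra
      have k0: "cos \<phi> * cos \<phi> - sin \<phi> * sin \<phi> = 1 - sin \<phi> * sin \<phi> - sin \<phi> * sin \<phi>" using s2 by algebra
      have sc: "((\<lambda>\<phi>. sin \<phi> * cos \<phi>) has_real_derivative (cos \<phi> * cos \<phi> - sin \<phi> * sin \<phi>)) (at \<phi> within {0..pi / 2})"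
        by (auto intro!: derivative_eq_intros)
      have "((\<lambda>\<phi>. (sin \<phi> * cos \<phi>) *\<^sub>R (cos \<theta> *\<^sub>R p1 (?Z (s, \<theta>, \<phi>)) + sin \<theta> *\<^sub>R p2 (?Z (s, \<theta>, \<phi>)))) has_vector_derivative
          (sin \<phi> * cos \<phi>) *\<^sub>R (cos \<theta> *\<^sub>R q1 (?Z (s, \<theta>, \<phi>)) (0, ((t - s) * cos \<phi>) *\<^sub>R (cos \<theta>, sin \<theta>))
             + sin \<theta> *\<^sub>R q2 (?Z (s, \<theta>, \<phi>)) (0, ((t - s) * cos \<phi>) *\<^sub>R (cos \<theta>, sin \<theta>)))
          + (cos \<phi> * cos \<phi> - sin \<phi> * sin \<phi>) *\<^sub>R (cos \<theta> *\<^sub>R p1 (?Z (s, \<theta>, \<phi>)) + sin \<theta> *\<^sub>R p2 (?Z (s, \<theta>, \<phi>)))) (at \<phi> within {0..pi / 2})"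
        by (intro has_vector_derivative_scaleR[OF sc] has_vector_derivative_add
            bounded_linear.has_vector_derivative[OF bounded_linear_scaleR_right] pd \<phi>)
      also have "(sin \<phi> * cos \<phi>) *\<^sub>R (cos \<theta> *\<^sub>R q1 (?Z (s, \<theta>, \<phi>)) (0, ((t - s) * cos \<phi>) *\<^sub>R (cos \<theta>, sin \<theta>))
             + sin \<theta> *\<^sub>R q2 (?Z (s, \<theta>, \<phi>)) (0, ((t - s) * cos \<phi>) *\<^sub>R (cos \<theta>, sin \<theta>)))
          + (cos \<phi> * cos \<phi> - sin \<phi> * sin \<phi>) *\<^sub>R (cos \<theta> *\<^sub>R p1 (?Z (s, \<theta>, \<phi>)) + sin \<theta> *\<^sub>R p2 (?Z (s, \<theta>, \<phi>))) = G1 (s, \<theta>, \<phi>)"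
        unfolding q_expand[OF zs]
          by (simp add: scaleR_add_right k k0 G1_def E_def Q_def c_def d_def \<sigma>_def)
      finally show "((\<lambda>\<phi>. (sin \<phi> * cos \<phi>) *\<^sub>R (cos \<theta> *\<^sub>R p1 (?Z (s, \<theta>, \<phi>)) + sin \<theta> *\<^sub>R p2 (?Z (s, \<theta>, \<phi>)))) has_vector_derivative G1 (s, \<theta>, \<phi>)) (at \<phi> within {0..pi / 2})" .
    qed simp
    then show ?thesis by (simp add: integral_unique)
  qed

  \<comment> \<open>\<open>G2\<close> is the \<open>\<theta>\<close>-derivative of the first tangential derivative of \<open>u\<close>, which is periodic\<close>
  define G2 where "G2 w = - E w + ((t - fst w) * \<sigma> w) *\<^sub>R T w" for w
  have cG2: "continuous_on ?B G2" unfolding G2_def by (intro continuous_intros ccont cE cT)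
  have I2: "integral (cbox 0 (2 * pi)) (\<lambda>\<theta>. G2 (s, \<theta>, \<phi>)) = 0" if s: "s \<in> {0..t}" for s \<phi>
  proof -
    have Zd: "((\<lambda>\<theta>. ?Z (s, \<theta>, \<phi>)) has_vector_derivative (0, ((t - s) * sin \<phi>) *\<^sub>R (- sin \<theta>, cos \<theta>))) (at \<theta> within {0..2 * pi})" for \<theta>
      unfolding light_cone_def has_vector_derivative_def by (auto intro!: derivative_eq_intros)
    have im: "(\<lambda>\<theta>. ?Z (s, \<theta>, \<phi>)) ` {0..2 * pi} \<subseteq> half_space" using s by (intro image_subsetI ZS) auto
    have pd: "((\<lambda>\<theta>. p1 (?Z (s, \<theta>, \<phi>))) has_vector_derivative q1 (?Z (s, \<theta>, \<phi>)) (0, ((t - s) * sin \<phi>) *\<^sub>R (- sin \<theta>, cos \<theta>))) (at \<theta> within {0..2 * pi})"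
        "((\<lambda>\<theta>. p2 (?Z (s, \<theta>, \<phi>))) has_vector_derivative q2 (?Z (s, \<theta>, \<phi>)) (0, ((t - s) * sin \<phi>) *\<^sub>R (- sin \<theta>, cos \<theta>))) (at \<theta> within {0..2 * pi})"
      if "\<theta> \<in> {0..2 * pi}" for \<theta>
      using ZS s by (intro has_vector_derivative_along_path[OF Zd im that] dp; auto)+
    have "((\<lambda>\<theta>. G2 (s, \<theta>, \<phi>)) has_integral
        (((- sin (2 * pi)) *\<^sub>R p1 (?Z (s, 2 * pi, \<phi>)) + cos (2 * pi) *\<^sub>R p2 (?Z (s, 2 * pi, \<phi>)))
         - ((- sin 0) *\<^sub>R p1 (?Z (s, 0, \<phi>)) + cos 0 *\<^sub>R p2 (?Z (s, 0, \<phi>))))) {0..2 * pi}"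
    proof (rule fundamental_theorem_of_calculus)
      fix \<theta> :: real assume \<theta>: "\<theta> \<in> {0..2 * pi}"
      have zs: "?Z (s, \<theta>, \<phi>) \<in> half_space" using ZS s by auto
      have d1: "((\<lambda>\<theta>. - sin \<theta>) has_real_derivative (- cos \<theta>)) (at \<theta> within {0..2 * pi})"
        and d2: "(cos has_real_derivative (- sin \<theta>)) (at \<theta> within {0..2 * pi})"
        by (auto intro!: derivative_eq_intros)
      have "((\<lambda>\<theta>. (- sin \<theta>) *\<^sub>R p1 (?Z (s, \<theta>, \<phi>)) + cos \<theta> *\<^sub>R p2 (?Z (s, \<theta>, \<phi>))) has_vector_derivative
          ((- sin \<theta>) *\<^sub>R q1 (?Z (s, \<theta>, \<phi>)) (0, ((t - s) * sin \<phi>) *\<^sub>R (- sin \<theta>, cos \<theta>)) + (- cos \<theta>) *\<^sub>R p1 (?Z (s, \<theta>, \<phi>)))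
          + (cos \<theta> *\<^sub>R q2 (?Z (s, \<theta>, \<phi>)) (0, ((t - s) * sin \<phi>) *\<^sub>R (- sin \<theta>, cos \<theta>)) + (- sin \<theta>) *\<^sub>R p2 (?Z (s, \<theta>, \<phi>)))) (at \<theta> within {0..2 * pi})"
        by (intro has_vector_derivative_scaleR[OF d1] has_vector_derivative_scaleR[OF d2] has_vector_derivative_add pd \<theta>)
      also have "((- sin \<theta>) *\<^sub>R q1 (?Z (s, \<theta>, \<phi>)) (0, ((t - s) * sin \<phi>) *\<^sub>R (- sin \<theta>, cos \<theta>)) + (- cos \<theta>) *\<^sub>R p1 (?Z (s, \<theta>, \<phi>)))
          + (cos \<theta> *\<^sub>R q2 (?Z (s, \<theta>, \<phi>)) (0, ((t - s) * sin \<phi>) *\<^sub>R (- sin \<theta>, cos \<theta>)) + (- sin \<theta>) *\<^sub>R p2 (?Z (s, \<theta>, \<phi>))) = G2 (s, \<theta>, \<phi>)"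
        unfolding q_expand[OF zs]
          by (simp add: scaleR_add_right scaleR_diff_right G2_def E_def T_def c_def d_def \<sigma>_def mult_ac)
      finally show "((\<lambda>\<theta>. (- sin \<theta>) *\<^sub>R p1 (?Z (s, \<theta>, \<phi>)) + cos \<theta> *\<^sub>R p2 (?Z (s, \<theta>, \<phi>))) has_vector_derivative G2 (s, \<theta>, \<phi>)) (at \<theta> within {0..2 * pi})" .
    qed simp
    then show ?thesis by (simp add: integral_unique light_cone_def)
  qed

  \<comment> \<open>\<open>G3\<close> is the \<open>s\<close>-derivative of \<open>(t - s) (p0 + sin \<phi> E) + u\<close>\<close>
  define G3 where "G3 w = (t - fst w) *\<^sub>R (q0 (?Z w) e_t - (\<sigma> w)\<^sup>2 *\<^sub>R Q w) - \<sigma> w *\<^sub>R E w - \<sigma> w *\<^sub>R E w" for w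
  have cG3: "continuous_on ?B G3" unfolding G3_def by (intro continuous_intros ccont cE cQ cq') auto
  have I3: "integral (cbox 0 t) (\<lambda>s. G3 (s, \<theta>, \<phi>)) = u (t, x)" for \<theta> \<phi>
  proof -
    have Zd: "((\<lambda>s. ?Z (s, \<theta>, \<phi>)) has_vector_derivative (1, (- sin \<phi>) *\<^sub>R (cos \<theta>, sin \<theta>))) (at s within {0..t})" for s
      unfolding light_cone_def has_vector_derivative_def by (auto intro!: derivative_eq_intros)
    have im: "(\<lambda>s. ?Z (s, \<theta>, \<phi>)) ` {0..t} \<subseteq> half_space" by (intro image_subsetI ZS) auto
    let ?V = "(1, (- sin \<phi>) *\<^sub>R (cos \<theta>, sin \<theta>)) :: spacetime"
    have pd: "((\<lambda>s. p0 (?Z (s, \<theta>, \<phi>))) has_vector_derivative q0 (?Z (s, \<theta>, \<phi>)) ?V) (at s within {0..t})"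
        "((\<lambda>s. p1 (?Z (s, \<theta>, \<phi>))) has_vector_derivative q1 (?Z (s, \<theta>, \<phi>)) ?V) (at s within {0..t})"
        "((\<lambda>s. p2 (?Z (s, \<theta>, \<phi>))) has_vector_derivative q2 (?Z (s, \<theta>, \<phi>)) ?V) (at s within {0..t})"
      if "s \<in> {0..t}" for s
      using ZS that by (intro has_vector_derivative_along_path[OF Zd im that] dp; auto)+
    have ud: "((\<lambda>s. u (?Z (s, \<theta>, \<phi>))) has_vector_derivative (fst ?V *\<^sub>R p0 (?Z (s, \<theta>, \<phi>)) + fst (snd ?V) *\<^sub>R p1 (?Z (s, \<theta>, \<phi>)) + snd (snd ?V) *\<^sub>R p2 (?Z (s, \<theta>, \<phi>)))) (at s within {0..t})"
      if "s \<in> {0..t}" for s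
    proof -
      have zs: "?Z (s, \<theta>, \<phi>) \<in> half_space" using ZS that by auto
      from has_vector_derivative_along_path[OF Zd im that du[OF zs]] show ?thesis by simp
    qed
    let ?I = "\<lambda>s. (t - s) *\<^sub>R (p0 (?Z (s, \<theta>, \<phi>)) + sin \<phi> *\<^sub>R (cos \<theta> *\<^sub>R p1 (?Z (s, \<theta>, \<phi>)) + sin \<theta> *\<^sub>R p2 (?Z (s, \<theta>, \<phi>)))) + u (?Z (s, \<theta>, \<phi>))"
    have "((\<lambda>s. G3 (s, \<theta>, \<phi>)) has_integral (?I t - ?I 0)) {0..t}"
    proof (rule fundamental_theorem_of_calculus)
      fix s :: real assume s: "s \<in> {0..t}"
      have zs: "?Z (s, \<theta>, \<phi>) \<in> half_space" using ZS s by auto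
      have d1: "((\<lambda>s. t - s) has_real_derivative (- 1)) (at s within {0..t})"
        by (auto intro!: derivative_eq_intros)
      let ?D = "((t - s) *\<^sub>R (q0 (?Z (s, \<theta>, \<phi>)) ?V + sin \<phi> *\<^sub>R (cos \<theta> *\<^sub>R q1 (?Z (s, \<theta>, \<phi>)) ?V + sin \<theta> *\<^sub>R q2 (?Z (s, \<theta>, \<phi>)) ?V))
          + (- 1) *\<^sub>R (p0 (?Z (s, \<theta>, \<phi>)) + sin \<phi> *\<^sub>R (cos \<theta> *\<^sub>R p1 (?Z (s, \<theta>, \<phi>)) + sin \<theta> *\<^sub>R p2 (?Z (s, \<theta>, \<phi>)))))
          + (fst ?V *\<^sub>R p0 (?Z (s, \<theta>, \<phi>)) + fst (snd ?V) *\<^sub>R p1 (?Z (s, \<theta>, \<phi>)) + snd (snd ?V) *\<^sub>R p2 (?Z (s, \<theta>, \<phi>)))"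
      have "(?I has_vector_derivative ?D) (at s within {0..t})"
        by (intro has_vector_derivative_scaleR[OF d1] has_vector_derivative_add
            bounded_linear.has_vector_derivative[OF bounded_linear_scaleR_right] pd ud s)
      also have "?D = G3 (s, \<theta>, \<phi>)"
        unfolding q_expand[OF zs] time_derivatives_commute[OF zs]
          by (simp add: G3_def E_def Q_def c_def d_def \<sigma>_def power2_eq_square algebra_simps)
      finally show "(?I has_vector_derivative G3 (s, \<theta>, \<phi>)) (at s within {0..t})" .
    qed (use t in simp)
    then show ?thesis by (simp add: integral_unique light_cone_def init init_space flip: zero_prod_def)
  qed

  have J1: "integral ?B G1 = 0"
  proof -
    have "integral ?B G1 = integral (cbox 0 t) (\<lambda>s. integral ?R (\<lambda>y. G1 (s, y)))"
      by (rule integral_prod_continuous[OF cG1])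
    also have "\<dots> = integral (cbox 0 t) (\<lambda>s. 0)"
    proof (rule Henstock_Kurzweil_Integration.integral_cong)
      fix s assume s: "s \<in> cbox 0 t"
      have "continuous_on ?R (\<lambda>y. G1 (s, y))"
        using s by (intro continuous_on_compose2[OF cG1]) (auto simp: box intro!: continuous_intros)
      from integral_prod_continuous[OF this]
      show "integral ?R (\<lambda>y. G1 (s, y)) = 0" using I1 s by simp
    qed
    finally show ?thesis by simp
  qed
  have J2: "integral ?B G2 = 0"
  proof -
    have "integral ?B G2 = integral (cbox 0 t) (\<lambda>s. integral ?R (\<lambda>y. G2 (s, y)))"
      by (rule integral_prod_continuous[OF cG2])
    also have "\<dots> = integral (cbox 0 t) (\<lambda>s. 0)"
    proof (rule Henstock_Kurzweil_Integration.integral_cong)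
      fix s assume s: "s \<in> cbox 0 t"
      have c: "continuous_on ?R (\<lambda>y. G2 (s, y))"
        using s by (intro continuous_on_compose2[OF cG2]) (auto simp: box intro!: continuous_intros)
      have "integral ?R (\<lambda>y. G2 (s, y)) = integral (cbox 0 (2 * pi)) (\<lambda>\<theta>. integral (cbox 0 (pi / 2)) (\<lambda>\<phi>. G2 (s, \<theta>, \<phi>)))"
        by (rule integral_prod_continuous[OF c])
      also have "\<dots> = integral (cbox 0 (pi / 2)) (\<lambda>\<phi>. integral (cbox 0 (2 * pi)) (\<lambda>\<theta>. G2 (s, \<theta>, \<phi>)))"
        by (rule integral_swap_continuous) (use c in \<open>simp add: case_prod_beta\<close>)
      finally show "integral ?R (\<lambda>y. G2 (s, y)) = 0" using I2 s by simp
    qed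
    finally show ?thesis by simp
  qed
  have J3: "integral ?B (\<lambda>w. \<sigma> w *\<^sub>R G3 w) = (2 * pi) *\<^sub>R u (t, x)"
  proof -
    have c: "continuous_on ?B (\<lambda>w. \<sigma> w *\<^sub>R G3 w)" by (intro continuous_intros ccont cG3)
    have "integral ?B (\<lambda>w. \<sigma> w *\<^sub>R G3 w) = integral (cbox 0 t) (\<lambda>s. integral ?R (\<lambda>y. \<sigma> (s, y) *\<^sub>R G3 (s, y)))"
      by (rule integral_prod_continuous[OF c])
    also have "\<dots> = integral ?R (\<lambda>y. integral (cbox 0 t) (\<lambda>s. \<sigma> (s, y) *\<^sub>R G3 (s, y)))"
      by (rule integral_swap_continuous) (use c in \<open>simp add: case_prod_beta\<close>)
    also have "\<dots> = integral ?R (\<lambda>y. sin (snd y) *\<^sub>R u (t, x))"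
    proof (rule Henstock_Kurzweil_Integration.integral_cong)
      fix y :: "real \<times> real"
      show "integral (cbox 0 t) (\<lambda>s. \<sigma> (s, y) *\<^sub>R G3 (s, y)) = sin (snd y) *\<^sub>R u (t, x)"
        using I3[of "fst y" "snd y"] by (simp add: \<sigma>_def)
    qed
    also have "\<dots> = integral (cbox 0 (2 * pi)) (\<lambda>\<theta>. integral (cbox 0 (pi / 2)) (\<lambda>\<phi>. sin \<phi> *\<^sub>R u (t, x)))"
      by (subst integral_prod_continuous) (auto intro!: continuous_intros)
    also have "integral (cbox 0 (pi / 2)) (\<lambda>\<phi>. sin \<phi> *\<^sub>R u (t, x)) = u (t, x)"
    proof -
      have "((\<lambda>\<phi>. sin \<phi> *\<^sub>R u (t, x)) has_integral ((- cos (pi / 2)) *\<^sub>R u (t, x) - (- cos 0) *\<^sub>R u (t, x))) {0..pi / 2}"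
        by (rule fundamental_theorem_of_calculus)
          (auto intro!: derivative_eq_intros simp: has_vector_derivative_def)
      then show ?thesis by (simp add: integral_unique)
    qed
    finally show ?thesis by simp
  qed
  \<comment> \<open>the weighted source is \<open>sin \<phi> G3 - (G1 + G2)\<close>\<close>
  have "integral ?B (\<lambda>w. ((t - fst w) * sin (snd (snd w))) *\<^sub>R (q0 (?Z w) e_t - q1 (?Z w) e_1 - q2 (?Z w) e_2))
     = integral ?B (\<lambda>w. \<sigma> w *\<^sub>R G3 w - (G1 w + G2 w))"
  proof (rule Henstock_Kurzweil_Integration.integral_cong)
    fix w
    have "q0 (?Z w) e_t - q1 (?Z w) e_1 - q2 (?Z w) e_2 = q0 (?Z w) e_t - (Q w + T w)"
      by (simp add: QT)
    note qq = this
    have two: "(2 * a) *\<^sub>R E w = a *\<^sub>R E w + a *\<^sub>R E w" for a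
      by (simp add: scaleR_add_left[symmetric])
    show "((t - fst w) * sin (snd (snd w))) *\<^sub>R (q0 (?Z w) e_t - q1 (?Z w) e_1 - q2 (?Z w) e_2)
        = \<sigma> w *\<^sub>R G3 w - (G1 w + G2 w)"
      unfolding qq by (simp add: G1_def G2_def G3_def \<sigma>_def algebra_simps power2_eq_square two)
  qed
  also have "\<dots> = integral ?B (\<lambda>w. \<sigma> w *\<^sub>R G3 w) - (integral ?B G1 + integral ?B G2)"
  proof -
    have i: "G1 integrable_on ?B" "G2 integrable_on ?B" "(\<lambda>w. \<sigma> w *\<^sub>R G3 w) integrable_on ?B"
      by (intro integrable_continuous continuous_intros cG1 cG2 cG3 ccont)+
    show ?thesis
      using Henstock_Kurzweil_Integration.integral_diff[OF i(3) integrable_add[OF i(1,2)]]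
        Henstock_Kurzweil_Integration.integral_add[OF i(1,2)] by simp
  qed
  finally show ?thesis using J1 J2 J3 by simp
qed

end

lemma e_Basis: "e_t \<in> Basis" "e_1 \<in> Basis" "e_2 \<in> Basis"
  by (auto simp: Basis_prod_def zero_prod_def)

theorem wave_solution_duhamel:
  fixes u :: "spacetime \<Rightarrow> real"
  assumes w: "wave_solution f u" and t: "t > 0"
  shows "u (t, x) = 1 / (2 * pi) * integral (cone_box t)
    (\<lambda>w. (t - fst w) * sin (snd (snd w)) * f (light_cone t x w))"
proof -
  let ?S = "half_space"
  let ?D = "pderiv_within ?S"
  have C2: "Ck_on (Suc (Suc 0)) ?S u"
    and eq: "\<And>z. z \<in> ?S \<Longrightarrow> ?D e_t (?D e_t u) z - (?D e_1 (?D e_1 u) z + ?D e_2 (?D e_2 u) z) = f z"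
    and init: "\<And>x. u (0, x) = 0" "\<And>x. ?D e_t u (0, x) = 0"
    using w by (auto simp: wave_solution_def Let_def numeral_2_eq_2)
  have d: "g differentiable_on ?S \<Longrightarrow> z \<in> ?S \<Longrightarrow> (g has_derivative (\<lambda>h. ?D h g z)) (at z within ?S)" for g z
    by (auto simp: pderiv_within_def differentiable_on_def frechet_derivative_works)
  have ud: "u differentiable_on ?S" and pd: "\<And>b. b \<in> Basis \<Longrightarrow> ?D b u differentiable_on ?S"
    and qc: "\<And>b c. b \<in> Basis \<Longrightarrow> c \<in> Basis \<Longrightarrow> continuous_on ?S (?D c (?D b u))"
    using C2 by auto
  interpret C2_wave u "?D e_t u" "?D e_1 u" "?D e_2 u"
    "\<lambda>z h. ?D h (?D e_t u) z" "\<lambda>z h. ?D h (?D e_1 u) z" "\<lambda>z h. ?D h (?D e_2 u) z"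
  proof
    fix z assume z: "z \<in> ?S"
    show "(u has_derivative (\<lambda>h. fst h *\<^sub>R ?D e_t u z + fst (snd h) *\<^sub>R ?D e_1 u z + snd (snd h) *\<^sub>R ?D e_2 u z)) (at z within ?S)"
    proof (rule has_derivative_eq_rhs[OF d[OF ud z]])
      have L: "linear (\<lambda>h. ?D h u z)" using d[OF ud z] has_derivative_linear by blast
      have e: "h = fst h *\<^sub>R e_t + fst (snd h) *\<^sub>R e_1 + snd (snd h) *\<^sub>R e_2" for h :: spacetime
        by (cases h) auto
      show "(\<lambda>h. ?D h u z) = (\<lambda>h. fst h *\<^sub>R ?D e_t u z + fst (snd h) *\<^sub>R ?D e_1 u z + snd (snd h) *\<^sub>R ?D e_2 u z)"
        by (rule ext, subst e) (simp only: linear_add[OF L] linear_scale[OF L])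
    qed
    show "(?D e_t u has_derivative (\<lambda>h. ?D h (?D e_t u) z)) (at z within ?S)"
      "(?D e_1 u has_derivative (\<lambda>h. ?D h (?D e_1 u) z)) (at z within ?S)"
      "(?D e_2 u has_derivative (\<lambda>h. ?D h (?D e_2 u) z)) (at z within ?S)"
      by (intro d pd e_Basis z)+
  qed (use qc init e_Basis in auto)
  have "2 * pi * u (t, x) = integral (cone_box t) (\<lambda>w. (t - fst w) * sin (snd (snd w)) *
    (?D e_t (?D e_t u) (light_cone t x w) - ?D e_1 (?D e_1 u) (light_cone t x w) - ?D e_2 (?D e_2 u) (light_cone t x w)))"
    using duhamel[OF t] by simp
  also have "\<dots> = integral (cone_box t) (\<lambda>w. (t - fst w) * sin (snd (snd w)) * f (light_cone t x w))"
  proof (rule Henstock_Kurzweil_Integration.integral_cong)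
    fix w assume "w \<in> cone_box t"
    then have "light_cone t x w \<in> ?S" by (cases w) (auto simp: light_cone_def cbox_Pair_eq)
    from eq[OF this] show "(t - fst w) * sin (snd (snd w)) *
    (?D e_t (?D e_t u) (light_cone t x w) - ?D e_1 (?D e_1 u) (light_cone t x w) - ?D e_2 (?D e_2 u) (light_cone t x w))
      = (t - fst w) * sin (snd (snd w)) * f (light_cone t x w)" by (simp add: diff_diff_eq)
  qed
  finally show ?thesis by (simp add: field_simps)
qed

section \<open>Wave response to a plane wave\<close>

text \<open>This is \<open>\<integral>\<^sub>0\<^sup>s cis (a v) dv\<close>.\<close>

definition cis_integral :: "real \<Rightarrow> real \<Rightarrow> complex" where
  "cis_integral a s = (if a = 0 then complex_of_real s else (cis (a * s) - 1) / (\<i> * complex_of_real a))"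

lemma cis_integral_0 [simp]: "cis_integral a 0 = 0"
  by (simp add: cis_integral_def)

lemma has_vector_derivative_cis_mult:
  "((\<lambda>s. cis (a * s)) has_vector_derivative \<i> * complex_of_real a * cis (a * s)) (at s within T)"
  unfolding has_vector_derivative_def
  by (auto intro!: derivative_eq_intros simp: fun_eq_iff scaleR_conv_of_real)

lemma cis_integral_deriv:
  "(cis_integral a has_vector_derivative cis (a * s)) (at s within T)"
proof (cases "a = 0")
  case True
  then have "cis_integral a = complex_of_real" by (auto simp: cis_integral_def)
  then show ?thesis using True 
    by (auto intro!: derivative_eq_intros simp: has_vector_derivative_def scaleR_conv_of_real)
next
  case False
  have "((\<lambda>s. (cis (a * s) - 1) / (\<i> * complex_of_real a)) has_vector_derivative
      (\<i> * complex_of_real a * cis (a * s) - 0) / (\<i> * complex_of_real a)) (at s within T)"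
    by (intro has_vector_derivative_divide has_vector_derivative_diff has_vector_derivative_cis_mult
        has_vector_derivative_const)
  moreover have "(\<lambda>s. (cis (a * s) - 1) / (\<i> * complex_of_real a)) = cis_integral a"
    using False by (auto simp: cis_integral_def)
  ultimately show ?thesis using False by simp
qed

lemma cis_integral_upper: "a \<noteq> 0 \<Longrightarrow> norm (cis_integral a s) \<le> 2 / \<bar>a\<bar>"
  using norm_triangle_ineq4[of "cis (a * s)" 1]
  by (simp add: cis_integral_def norm_divide norm_mult divide_right_mono)

lemma cis_integral_lower:
  assumes "s \<ge> 0" "\<bar>a\<bar> * s \<le> 1"
  shows "norm (cis_integral a s) \<ge> s / 2"
proof (cases "a = 0")
  case True then show ?thesis using assms by (simp add: cis_integral_def)
next
  case False
  have "norm (\<i> * complex_of_real (a * s)) - norm (cis (a * s) - 1) \<le> norm (\<i> * complex_of_real (a * s) - (cis (a * s) - 1))"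
    by (rule norm_triangle_ineq2)
  also have "\<dots> = norm (cis (a * s) - 1 - \<i> * complex_of_real (a * s))"
    by (rule norm_minus_commute)
  also have "\<dots> \<le> (a * s)\<^sup>2 / 2"
    using iexp_approx1[of "a * s" 1] by (simp add: cis_conv_exp power2_eq_square diff_diff_eq)
  also have "\<dots> \<le> \<bar>a * s\<bar> / 2"
  proof -
    have "\<bar>a * s\<bar> \<le> 1" using assms by (simp add: abs_mult)
    then have "\<bar>a * s\<bar> * \<bar>a * s\<bar> \<le> \<bar>a * s\<bar> * 1" by (intro mult_left_mono) auto
    then show ?thesis by (simp add: power2_eq_square flip: abs_mult)
  qed
  finally have "\<bar>a * s\<bar> / 2 \<le> norm (cis (a * s) - 1)"
    unfolding norm_mult norm_ii norm_of_real mult_1_left by linarith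
  then have "\<bar>a\<bar> * (s / 2) \<le> norm (cis (a * s) - 1)" using assms by (simp add: abs_mult)
  then show ?thesis using False by (simp add: cis_integral_def norm_divide norm_mult field_simps)
qed

text \<open>The solution of \<open>g'' + r\<^sup>2 g = cis (\<xi> s)\<close> with vanishing initial data.\<close>

definition wave_kernel :: "real \<Rightarrow> real \<Rightarrow> real \<Rightarrow> complex" where
  "wave_kernel \<xi> r s = (cis (r * s) * cis_integral (\<xi> - r) s - cis ((- r) * s) * cis_integral (\<xi> + r) s)
     / (2 * \<i> * complex_of_real r)"

definition wave_kernel' :: "real \<Rightarrow> real \<Rightarrow> real \<Rightarrow> complex" where
  "wave_kernel' \<xi> r s = (cis (r * s) * cis_integral (\<xi> - r) s + cis ((- r) * s) * cis_integral (\<xi> + r) s) / 2"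

lemma wave_kernel_deriv:
  assumes r: "r \<noteq> 0"
  shows "(wave_kernel \<xi> r has_vector_derivative wave_kernel' \<xi> r s) (at s within T)"
    and "(wave_kernel' \<xi> r has_vector_derivative (cis (\<xi> * s) - complex_of_real (r\<^sup>2) * wave_kernel \<xi> r s)) (at s within T)"
proof -
  let ?A = "cis_integral (\<xi> - r)" and ?B = "cis_integral (\<xi> + r)"
  have A: "((\<lambda>s. cis (r * s) * ?A s) has_vector_derivative
      (cis (r * s) * cis ((\<xi> - r) * s) + \<i> * complex_of_real r * cis (r * s) * ?A s)) (at s within T)"
    by (intro has_vector_derivative_mult has_vector_derivative_cis_mult cis_integral_deriv)
  have B: "((\<lambda>s. cis ((- r) * s) * ?B s) has_vector_derivative
      (cis ((- r) * s) * cis ((\<xi> + r) * s) + \<i> * complex_of_real (- r) * cis ((- r) * s) * ?B s)) (at s within T)"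
    by (intro has_vector_derivative_mult has_vector_derivative_cis_mult cis_integral_deriv)
  have c: "cis (r * s) * cis ((\<xi> - r) * s) = cis (\<xi> * s)" "cis ((- r) * s) * cis ((\<xi> + r) * s) = cis (\<xi> * s)"
    by (simp_all add: cis_mult algebra_simps)
  note D1 = has_vector_derivative_divide[OF has_vector_derivative_diff[OF A B], of "2 * \<i> * complex_of_real r"]
  note D2 = has_vector_derivative_divide[OF has_vector_derivative_add[OF A B], of 2]
  show "(wave_kernel \<xi> r has_vector_derivative wave_kernel' \<xi> r s) (at s within T)"
    unfolding wave_kernel_def[abs_def] wave_kernel'_def
    by (rule has_vector_derivative_eq_rhs[OF D1[unfolded c]]) (use r in \<open>simp add: field_simps\<close>)
  show "(wave_kernel' \<xi> r has_vector_derivative (cis (\<xi> * s) - complex_of_real (r\<^sup>2) * wave_kernel \<xi> r s)) (at s within T)"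
    unfolding wave_kernel_def wave_kernel'_def[abs_def]
    by (rule has_vector_derivative_eq_rhs[OF D2[unfolded c]]) (use r in \<open>simp add: field_simps power2_eq_square\<close>)
qed

lemma wave_kernel_init: "wave_kernel \<xi> r 0 = 0" "wave_kernel' \<xi> r 0 = 0"
  by (simp_all add: wave_kernel_def wave_kernel'_def)

text \<open>Near the resonance \<open>\<xi> = r\<close> the first oscillatory integral has size \<open>t\<close>, and the second
  one stays bounded by \<open>2 / r\<close>.\<close>

lemma wave_kernel_lower:
  assumes t: "t > 0" and \<xi>: "0 \<le> \<xi>" "\<bar>\<xi> - r\<bar> * t \<le> 1" and r: "r > 0" "8 \<le> r * t"
  shows "norm (wave_kernel \<xi> r t) \<ge> t / (8 * r)"
proof -
  have "norm (cis (r * t) * cis_integral (\<xi> - r) t - cis ((- r) * t) * cis_integral (\<xi> + r) t)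
      \<ge> norm (cis_integral (\<xi> - r) t) - norm (cis_integral (\<xi> + r) t)"
    using norm_triangle_ineq2[of "cis (r * t) * cis_integral (\<xi> - r) t" "cis ((- r) * t) * cis_integral (\<xi> + r) t"]
    by (simp add: norm_mult)
  moreover have "norm (cis_integral (\<xi> - r) t) \<ge> t / 2" using t \<xi> by (intro cis_integral_lower) auto
  moreover have "norm (cis_integral (\<xi> + r) t) \<le> 2 / \<bar>\<xi> + r\<bar>" using \<xi> r by (intro cis_integral_upper) auto
  moreover have "2 / \<bar>\<xi> + r\<bar> \<le> 2 / r" using \<xi> r by (intro divide_left_mono) auto
  moreover have "2 / r \<le> t / 4" using r t by (simp add: field_simps)
  ultimately have "norm (cis (r * t) * cis_integral (\<xi> - r) t - cis ((- r) * t) * cis_integral (\<xi> + r) t) \<ge> t / 4"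
    by linarith
  then show ?thesis using r by (simp add: wave_kernel_def norm_divide norm_mult field_simps)
qed

text \<open>Duhamel's formula, applied to the explicit solution with source \<open>cis (z \<bullet> (\<xi>, \<eta>))\<close>,
  evaluates the average over the light cone without computing any Bessel integral.\<close>

lemma cone_integral_plane_wave:
  fixes \<eta> :: plane
  assumes t: "t > 0" and \<eta>: "\<eta> \<noteq> 0"
  shows "integral (cone_box t) (\<lambda>w. ((t - fst w) * sin (snd (snd w))) *\<^sub>R cis (light_cone t x w \<bullet> (\<xi>, \<eta>)))
    = complex_of_real (2 * pi) * (cis (x \<bullet> \<eta>) * wave_kernel \<xi> (norm \<eta>) t)"
proof -
  define r where "r = norm \<eta>"
  have r: "r \<noteq> 0" using \<eta> by (simp add: r_def)
  define a b where "a = fst \<eta>" and "b = snd \<eta>"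
  have ab: "\<eta> = (a, b)" by (simp add: a_def b_def)
  have r2: "r\<^sup>2 = a\<^sup>2 + b\<^sup>2" by (simp add: r_def ab norm_Pair)
  let ?c = "\<lambda>z::spacetime. cis (snd z \<bullet> \<eta>)"
  let ?g = "\<lambda>z::spacetime. wave_kernel \<xi> r (fst z)"
  let ?g1 = "\<lambda>z::spacetime. wave_kernel' \<xi> r (fst z)"
  let ?g2 = "\<lambda>z::spacetime. cis (\<xi> * fst z) - complex_of_real (r\<^sup>2) * wave_kernel \<xi> r (fst z)"
  let ?l = "\<lambda>h::spacetime. complex_of_real (snd h \<bullet> \<eta>)"
  have dc: "(?c has_derivative (\<lambda>h. \<i> * ?l h * ?c z)) (at z within half_space)" for z
    by (auto intro!: derivative_eq_intros simp: scaleR_conv_of_real fun_eq_iff mult_ac)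
  have dg: "(?g has_derivative (\<lambda>h. fst h *\<^sub>R ?g1 z)) (at z within half_space)"
    and dg1: "(?g1 has_derivative (\<lambda>h. fst h *\<^sub>R ?g2 z)) (at z within half_space)" for z
    using has_derivative_compose[OF has_derivative_fst[OF has_derivative_ident]
        wave_kernel_deriv(1)[OF r, of \<xi> "fst z" UNIV, unfolded has_vector_derivative_def]]
      has_derivative_compose[OF has_derivative_fst[OF has_derivative_ident]
        wave_kernel_deriv(2)[OF r, of \<xi> "fst z" UNIV, unfolded has_vector_derivative_def]] by auto
  have dcg: "((\<lambda>z. ?c z * ?g z) has_derivative (\<lambda>h. ?c z * (fst h *\<^sub>R ?g1 z) + \<i> * ?l h * ?c z * ?g z)) (at z within half_space)" for z
    by (rule has_derivative_mult[OF dc dg])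
  have dcg1: "((\<lambda>z. ?c z * ?g1 z) has_derivative (\<lambda>h. ?c z * (fst h *\<^sub>R ?g2 z) + \<i> * ?l h * ?c z * ?g1 z)) (at z within half_space)" for z
    by (rule has_derivative_mult[OF dc dg1])
  have cont: "continuous_on half_space ?c" "continuous_on half_space ?g" "continuous_on half_space ?g1" "continuous_on half_space ?g2"
    using has_derivative_continuous_on[OF dc] has_derivative_continuous_on[OF dg] has_derivative_continuous_on[OF dg1]
    by (auto intro!: continuous_intros)
  interpret C2_wave "\<lambda>z. ?c z * ?g z" "\<lambda>z. ?c z * ?g1 z"
    "\<lambda>z. \<i> * complex_of_real a * (?c z * ?g z)" "\<lambda>z. \<i> * complex_of_real b * (?c z * ?g z)"
    "\<lambda>z h. ?c z * (fst h *\<^sub>R ?g2 z) + \<i> * ?l h * ?c z * ?g1 z"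
    "\<lambda>z h. \<i> * complex_of_real a * (?c z * (fst h *\<^sub>R ?g1 z) + \<i> * ?l h * ?c z * ?g z)"
    "\<lambda>z h. \<i> * complex_of_real b * (?c z * (fst h *\<^sub>R ?g1 z) + \<i> * ?l h * ?c z * ?g z)"
  proof
    fix z :: spacetime
    show "((\<lambda>z. ?c z * ?g z) has_derivative (\<lambda>h. fst h *\<^sub>R (?c z * ?g1 z) + fst (snd h) *\<^sub>R (\<i> * complex_of_real a * (?c z * ?g z))
        + snd (snd h) *\<^sub>R (\<i> * complex_of_real b * (?c z * ?g z)))) (at z within half_space)"
      by (rule has_derivative_eq_rhs[OF dcg]) (auto simp: fun_eq_iff ab scaleR_conv_of_real algebra_simps)
    show "((\<lambda>z. ?c z * ?g1 z) has_derivative (\<lambda>h. ?c z * (fst h *\<^sub>R ?g2 z) + \<i> * ?l h * ?c z * ?g1 z)) (at z within half_space)"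
      by (rule dcg1)
    show "((\<lambda>z. \<i> * complex_of_real a * (?c z * ?g z)) has_derivative (\<lambda>h. \<i> * complex_of_real a * (?c z * (fst h *\<^sub>R ?g1 z) + \<i> * ?l h * ?c z * ?g z))) (at z within half_space)"
      "((\<lambda>z. \<i> * complex_of_real b * (?c z * ?g z)) has_derivative (\<lambda>h. \<i> * complex_of_real b * (?c z * (fst h *\<^sub>R ?g1 z) + \<i> * ?l h * ?c z * ?g z))) (at z within half_space)"
      by (rule has_derivative_mult_right[OF dcg])+
  next
    fix e :: spacetime
    show "continuous_on half_space (\<lambda>z. ?c z * (fst e *\<^sub>R ?g2 z) + \<i> * ?l e * ?c z * ?g1 z)"
      "continuous_on half_space (\<lambda>z. \<i> * complex_of_real a * (?c z * (fst e *\<^sub>R ?g1 z) + \<i> * ?l e * ?c z * ?g z))"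
      "continuous_on half_space (\<lambda>z. \<i> * complex_of_real b * (?c z * (fst e *\<^sub>R ?g1 z) + \<i> * ?l e * ?c z * ?g z))"
      by (intro continuous_intros cont)+
  qed (simp_all add: wave_kernel_init)
  have src: "?c z * (fst e_t *\<^sub>R ?g2 z) + \<i> * ?l e_t * ?c z * ?g1 z
     - \<i> * complex_of_real a * (?c z * (fst e_1 *\<^sub>R ?g1 z) + \<i> * ?l e_1 * ?c z * ?g z)
     - \<i> * complex_of_real b * (?c z * (fst e_2 *\<^sub>R ?g1 z) + \<i> * ?l e_2 * ?c z * ?g z) = cis (z \<bullet> (\<xi>, \<eta>))" for z
  proof -
    have "complex_of_real (r\<^sup>2) = complex_of_real a * complex_of_real a + complex_of_real b * complex_of_real b"
      unfolding r2 by (simp add: power2_eq_square)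
    moreover have "cis (z \<bullet> (\<xi>, \<eta>)) = ?c z * cis (\<xi> * fst z)"
      by (cases z) (simp add: cis_mult add.commute mult.commute)
    ultimately show ?thesis by (simp add: ab algebra_simps)
  qed
  have "(2 * pi) *\<^sub>R (?c (t, x) * ?g (t, x)) = integral (cone_box t) (\<lambda>w. ((t - fst w) * sin (snd (snd w))) *\<^sub>R cis (light_cone t x w \<bullet> (\<xi>, \<eta>)))"
    using duhamel[OF t, of x] unfolding src by simp
  then show ?thesis by (simp add: r_def scaleR_conv_of_real)
qed

section \<open>Gaussian variables and white noise\<close>

subsection \<open>Fourth moments\<close>

context prob_space
begin

lemma centered_gaussian_moments:
  assumes "centered_gaussian M Y"
  shows "Y \<in> borel_measurable M" "integrable M (\<lambda>\<omega>. (Y \<omega>)\<^sup>2)" "integrable M (\<lambda>\<omega>. (Y \<omega>) ^ 4)"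
    and "expectation (\<lambda>\<omega>. (Y \<omega>) ^ 4) = 3 * (expectation (\<lambda>\<omega>. (Y \<omega>)\<^sup>2))\<^sup>2"
proof -
  show [measurable]: "Y \<in> borel_measurable M" using assms by (simp add: centered_gaussian_def)
  have "integrable M (\<lambda>\<omega>. (Y \<omega>)\<^sup>2) \<and> integrable M (\<lambda>\<omega>. (Y \<omega>) ^ 4) \<and>
     expectation (\<lambda>\<omega>. (Y \<omega>) ^ 4) = 3 * (expectation (\<lambda>\<omega>. (Y \<omega>)\<^sup>2))\<^sup>2"
  proof (cases "AE \<omega> in M. Y \<omega> = 0")
    case True
    have "integrable M (\<lambda>\<omega>. (Y \<omega>) ^ n) \<and> expectation (\<lambda>\<omega>. (Y \<omega>) ^ n) = 0" if n: "n > 0" for n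
    proof -
      have e: "AE \<omega> in M. (Y \<omega>) ^ n = 0" using True by eventually_elim (use n in simp)
      have "integrable M (\<lambda>\<omega>. (Y \<omega>) ^ n) \<longleftrightarrow> integrable M (\<lambda>\<omega>. 0::real)"
        by (rule integrable_cong_AE) (use e in auto)
      moreover have "expectation (\<lambda>\<omega>. (Y \<omega>) ^ n) = expectation (\<lambda>\<omega>. 0::real)"
        by (rule integral_cong_AE) (use e in auto)
      ultimately show ?thesis by simp
    qed
    from this[of 2] this[of 4] show ?thesis by simp
  next
    case False
    then obtain \<sigma> where \<sigma>: "\<sigma> > 0" and D: "distributed M lborel Y (\<lambda>y. ennreal (normal_density 0 \<sigma> y))"
      using assms by (auto simp: centered_gaussian_def)
    have m: "integrable M (\<lambda>\<omega>. (Y \<omega>) ^ (2 * k)) \<and> expectation (\<lambda>\<omega>. (Y \<omega>) ^ (2 * k)) = fact (2 * k) / ((2 / \<sigma>\<^sup>2) ^ k * fact k)" for k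
      using normal_moment_even[OF \<sigma>, of 0 k] distributed_integrable[OF D, of "\<lambda>y. y ^ (2 * k)"]
        distributed_integral[OF D, of "\<lambda>y. y ^ (2 * k)"] by (auto simp: has_bochner_integral_iff)
    from m[of 1] m[of 2] \<sigma> show ?thesis by (simp add: fact_numeral power2_eq_square field_simps)
  qed
  then show "integrable M (\<lambda>\<omega>. (Y \<omega>)\<^sup>2)" "integrable M (\<lambda>\<omega>. (Y \<omega>) ^ 4)"
    "expectation (\<lambda>\<omega>. (Y \<omega>) ^ 4) = 3 * (expectation (\<lambda>\<omega>. (Y \<omega>)\<^sup>2))\<^sup>2" by auto
qed

lemma centered_gaussian_AE_eq:
  assumes X: "centered_gaussian M X" and [measurable]: "Y \<in> borel_measurable M"
    and eq: "AE \<omega> in M. Y \<omega> = X \<omega>"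
  shows "centered_gaussian M Y"
proof -
  have [measurable]: "X \<in> borel_measurable M" using X by (simp add: centered_gaussian_def)
  have d: "distr M lborel X = distr M lborel Y"
    by (rule distr_cong_AE) (use eq in auto)
  show ?thesis
    unfolding centered_gaussian_def
  proof (intro conjI)
    show "(AE \<omega> in M. Y \<omega> = 0) \<or> (\<exists>\<sigma>>0. distributed M lborel Y (\<lambda>y. ennreal (normal_density 0 \<sigma> y)))"
    proof (cases "AE \<omega> in M. X \<omega> = 0")
      case True
      with eq have "AE \<omega> in M. Y \<omega> = 0" by eventually_elim simp
      then show ?thesis by simp
    next
      case False
      then show ?thesis using X d unfolding centered_gaussian_def distributed_def by auto
    qed
  qed measurable
qed

lemma integrable_mult_L2:
  fixes X Y :: "'a \<Rightarrow> real"
  assumes [measurable]: "X \<in> borel_measurable M" "Y \<in> borel_measurable M"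
    and "integrable M (\<lambda>\<omega>. (X \<omega>)\<^sup>2)" "integrable M (\<lambda>\<omega>. (Y \<omega>)\<^sup>2)"
  shows "integrable M (\<lambda>\<omega>. X \<omega> * Y \<omega>)"
proof (rule Bochner_Integration.integrable_bound)
  show "integrable M (\<lambda>\<omega>. (X \<omega>)\<^sup>2 + (Y \<omega>)\<^sup>2)" using assms by simp
  show "AE \<omega> in M. norm (X \<omega> * Y \<omega>) \<le> norm ((X \<omega>)\<^sup>2 + (Y \<omega>)\<^sup>2)"
    using abs_mult_le_squares by (intro AE_I2) (auto intro: order_trans)
  qed measurable

text \<open>Polarising the identity between the fourth and the second moment of \<open>X + Y\<close> and
  \<open>X - Y\<close> gives the covariance of the squares.\<close>

lemma gaussian_wick_covariance:
  assumes g: "\<And>a b. centered_gaussian M (\<lambda>\<omega>. a * X \<omega> + b * Y \<omega>)"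
  defines "s \<equiv> expectation (\<lambda>\<omega>. (X \<omega>)\<^sup>2)" and "r \<equiv> expectation (\<lambda>\<omega>. (Y \<omega>)\<^sup>2)"
    and "k \<equiv> expectation (\<lambda>\<omega>. X \<omega> * Y \<omega>)"
  shows "integrable M (\<lambda>\<omega>. ((X \<omega>)\<^sup>2 - s) * ((Y \<omega>)\<^sup>2 - r))"
    and "expectation (\<lambda>\<omega>. ((X \<omega>)\<^sup>2 - s) * ((Y \<omega>)\<^sup>2 - r)) = 2 * k\<^sup>2"
proof -
  have gX: "centered_gaussian M X" and gY: "centered_gaussian M Y"
    using g[of 1 0] g[of 0 1] by simp_all
  have gP: "centered_gaussian M (\<lambda>\<omega>. X \<omega> + Y \<omega>)" and gM: "centered_gaussian M (\<lambda>\<omega>. X \<omega> - Y \<omega>)"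
    using g[of 1 1] g[of 1 "-1"] by simp_all
  note mX = centered_gaussian_moments[OF gX] and mY = centered_gaussian_moments[OF gY]
    and mP = centered_gaussian_moments[OF gP] and mM = centered_gaussian_moments[OF gM]
  note [measurable] = mX(1) mY(1)
  have IXY: "integrable M (\<lambda>\<omega>. X \<omega> * Y \<omega>)"
    using mX mY by (intro integrable_mult_L2)
  have IXXYY: "integrable M (\<lambda>\<omega>. (X \<omega>)\<^sup>2 * (Y \<omega>)\<^sup>2)"
    using mX mY by (intro integrable_mult_L2) (auto simp flip: power_mult)
  have sP: "expectation (\<lambda>\<omega>. (X \<omega> + Y \<omega>)\<^sup>2) = s + r + 2 * k"
  proof -
    have "expectation (\<lambda>\<omega>. (X \<omega> + Y \<omega>)\<^sup>2) = expectation (\<lambda>\<omega>. (X \<omega>)\<^sup>2 + (Y \<omega>)\<^sup>2 + 2 * (X \<omega> * Y \<omega>))"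
      by (simp add: power2_sum mult.assoc)
    then show ?thesis using mX mY IXY by (simp add: s_def r_def k_def)
  qed
  have sM: "expectation (\<lambda>\<omega>. (X \<omega> - Y \<omega>)\<^sup>2) = s + r - 2 * k"
  proof -
    have "expectation (\<lambda>\<omega>. (X \<omega> - Y \<omega>)\<^sup>2) = expectation (\<lambda>\<omega>. (X \<omega>)\<^sup>2 + (Y \<omega>)\<^sup>2 - 2 * (X \<omega> * Y \<omega>))"
      by (simp add: power2_diff mult.assoc)
    then show ?thesis using mX mY IXY by (simp add: s_def r_def k_def)
  qed
  have pol: "(x + y) ^ 4 + (x - y) ^ 4 = 2 * x ^ 4 + 12 * (x\<^sup>2 * y\<^sup>2) + 2 * y ^ 4" for x y :: real
    by algebra
  have "expectation (\<lambda>\<omega>. (X \<omega> + Y \<omega>) ^ 4) + expectation (\<lambda>\<omega>. (X \<omega> - Y \<omega>) ^ 4)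
    = expectation (\<lambda>\<omega>. 2 * (X \<omega>) ^ 4 + 12 * ((X \<omega>)\<^sup>2 * (Y \<omega>)\<^sup>2) + 2 * (Y \<omega>) ^ 4)"
    unfolding Bochner_Integration.integral_add[OF mP(3) mM(3), symmetric] pol ..
  also have "\<dots> = 2 * expectation (\<lambda>\<omega>. (X \<omega>) ^ 4) + 12 * expectation (\<lambda>\<omega>. (X \<omega>)\<^sup>2 * (Y \<omega>)\<^sup>2) + 2 * expectation (\<lambda>\<omega>. (Y \<omega>) ^ 4)"
    using mX mY IXXYY by simp
  finally have "3 * (s + r + 2 * k)\<^sup>2 + 3 * (s + r - 2 * k)\<^sup>2 = 6 * s\<^sup>2 + 12 * expectation (\<lambda>\<omega>. (X \<omega>)\<^sup>2 * (Y \<omega>)\<^sup>2) + 6 * r\<^sup>2"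
    unfolding mP(4) mM(4) mX(4) mY(4) sP sM by (simp add: s_def r_def)
  then have E4: "expectation (\<lambda>\<omega>. (X \<omega>)\<^sup>2 * (Y \<omega>)\<^sup>2) = s * r + 2 * k\<^sup>2"
    by (simp add: power2_eq_square algebra_simps)
  have eq: "((X \<omega>)\<^sup>2 - s) * ((Y \<omega>)\<^sup>2 - r) = (X \<omega>)\<^sup>2 * (Y \<omega>)\<^sup>2 - r * (X \<omega>)\<^sup>2 - s * (Y \<omega>)\<^sup>2 + s * r" for \<omega>
    by (simp add: algebra_simps)
  show "integrable M (\<lambda>\<omega>. ((X \<omega>)\<^sup>2 - s) * ((Y \<omega>)\<^sup>2 - r))"
    unfolding eq using mX mY IXXYY by auto
  have "expectation (\<lambda>\<omega>. ((X \<omega>)\<^sup>2 - s) * ((Y \<omega>)\<^sup>2 - r))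
    = expectation (\<lambda>\<omega>. (X \<omega>)\<^sup>2 * (Y \<omega>)\<^sup>2) - r * s - s * r + s * r"
    unfolding eq using mX mY IXXYY by (simp add: s_def r_def prob_space)
  then show "expectation (\<lambda>\<omega>. ((X \<omega>)\<^sup>2 - s) * ((Y \<omega>)\<^sup>2 - r)) = 2 * k\<^sup>2"
    unfolding E4 by simp
qed

end

lemma (in complete_measure) borel_measurable_AE_eq:
  assumes X: "X \<in> borel_measurable M" and eq: "AE \<omega> in M. Y \<omega> = X \<omega>"
  shows "Y \<in> borel_measurable M"
proof (rule measurableI)
  fix A :: "'b set" assume A: "A \<in> sets borel"
  obtain N where N: "N \<in> null_sets M" "{\<omega> \<in> space M. Y \<omega> \<noteq> X \<omega>} \<subseteq> N"
    using eq by (auto elim!: AE_E simp: null_sets_def)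
  have 1: "X -` A \<inter> space M - N \<in> sets M" using X A N by (intro sets.Diff measurable_sets) auto
  have 2: "Y -` A \<inter> space M \<inter> N \<in> sets M" by (rule complete[OF _ N(1)]) auto
  have eq: "Y -` A \<inter> space M = (X -` A \<inter> space M - N) \<union> (Y -` A \<inter> space M \<inter> N)" using N(2) by auto
  from sets.Un[OF 1 2] show "Y -` A \<inter> space M \<in> sets M" unfolding eq[symmetric] .
qed simp

subsection \<open>White noise on the Fourier side\<close>

lemma Lp_space_2_iff:
  "f \<in> Lp_space 2 \<longleftrightarrow> f \<in> borel_measurable borel \<and> integrable lborel (\<lambda>x. (norm (f x))\<^sup>2)"
  by (simp add: Lp_space_def)

lemma Lp_space_2_combine:
  fixes f g :: "'a::euclidean_space \<Rightarrow> real"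
  assumes "f \<in> Lp_space 2" "g \<in> Lp_space 2"
  shows "integrable lborel (\<lambda>x. f x * g x)" "(\<lambda>x. a * f x + b * g x) \<in> Lp_space 2"
proof -
  have m[measurable]: "f \<in> borel_measurable borel" "g \<in> borel_measurable borel"
    and i: "integrable lborel (\<lambda>x. (f x)\<^sup>2)" "integrable lborel (\<lambda>x. (g x)\<^sup>2)"
    using assms by (auto simp: Lp_space_2_iff)
  show I: "integrable lborel (\<lambda>x. f x * g x)"
  proof (rule Bochner_Integration.integrable_bound)
    show "integrable lborel (\<lambda>x. (f x)\<^sup>2 + (g x)\<^sup>2)" using i by simp
    show "AE x in lborel. norm (f x * g x) \<le> norm ((f x)\<^sup>2 + (g x)\<^sup>2)"
      using abs_mult_le_squares by (intro AE_I2) (auto intro: order_trans)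
  qed measurable
  have "(\<lambda>x. (a * f x + b * g x)\<^sup>2) = (\<lambda>x. a\<^sup>2 * (f x)\<^sup>2 + b\<^sup>2 * (g x)\<^sup>2 + 2 * a * b * (f x * g x))"
    by (simp add: power2_eq_square algebra_simps)
  then show "(\<lambda>x. a * f x + b * g x) \<in> Lp_space 2"
    using i I by (simp add: Lp_space_2_iff)
qed

text \<open>Functions whose Fourier transform is given by a convergent integral, is square integrable and
  real.\<close>

definition hermitian_L2 :: "('a::euclidean_space \<Rightarrow> complex) \<Rightarrow> bool" where
  "hermitian_L2 f \<longleftrightarrow> integrable lborel f \<and> integrable lborel (\<lambda>x. (norm (f x))\<^sup>2) \<and> (\<forall>x. f (- x) = cnj (f x))"

lemma hermitian_L2_measurable: "hermitian_L2 f \<Longrightarrow> f \<in> borel_measurable borel"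
  using borel_measurable_integrable by (auto simp: hermitian_L2_def)

lemma hermitian_L2_combine:
  fixes f g :: "'a::euclidean_space \<Rightarrow> complex"
  assumes f: "hermitian_L2 f" and g: "hermitian_L2 g"
  shows "hermitian_L2 (\<lambda>x. complex_of_real a * f x + complex_of_real b * g x)"
proof -
  note [measurable] = hermitian_L2_measurable[OF f] hermitian_L2_measurable[OF g]
  have "integrable lborel (\<lambda>x. (norm (complex_of_real a * f x + complex_of_real b * g x))\<^sup>2)"
  proof (rule Bochner_Integration.integrable_bound)
    show "integrable lborel (\<lambda>x. 2 * (a\<^sup>2 * (norm (f x))\<^sup>2) + 2 * (b\<^sup>2 * (norm (g x))\<^sup>2))"
      using f g by (auto simp: hermitian_L2_def)
    show "AE x in lborel. norm ((norm (complex_of_real a * f x + complex_of_real b * g x))\<^sup>2)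
      \<le> norm (2 * (a\<^sup>2 * (norm (f x))\<^sup>2) + 2 * (b\<^sup>2 * (norm (g x))\<^sup>2))"
    proof (intro AE_I2)
      fix x
      have "(norm (complex_of_real a * f x + complex_of_real b * g x))\<^sup>2 \<le> (\<bar>a\<bar> * norm (f x) + \<bar>b\<bar> * norm (g x))\<^sup>2"
        using norm_triangle_ineq[of "complex_of_real a * f x" "complex_of_real b * g x"]
        by (intro power_mono) (auto simp: norm_mult)
      also have "\<dots> \<le> 2 * (a\<^sup>2 * (norm (f x))\<^sup>2) + 2 * (b\<^sup>2 * (norm (g x))\<^sup>2)"
        using sum_squares_bound[of "\<bar>a\<bar> * norm (f x)" "\<bar>b\<bar> * norm (g x)"]
        by (simp add: power2_sum power_mult_distrib)
      finally show "norm ((norm (complex_of_real a * f x + complex_of_real b * g x))\<^sup>2)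
        \<le> norm (2 * (a\<^sup>2 * (norm (f x))\<^sup>2) + 2 * (b\<^sup>2 * (norm (g x))\<^sup>2))" by simp
    qed
  qed measurable
  then show ?thesis using f g by (auto simp: hermitian_L2_def)
qed

lemma fourier_combine:
  assumes "integrable lborel f" "integrable lborel g"
  shows "fourier (\<lambda>x. a * f x + b * g x) \<xi> = a * fourier f \<xi> + b * fourier g \<xi>"
proof -
  have i: "integrable lborel (\<lambda>x. cis (- (x \<bullet> \<xi>)) * f x)" "integrable lborel (\<lambda>x. cis (- (x \<bullet> \<xi>)) * g x)"
    by (intro integrable_cis_mult assms; measurable)+
  have "fourier (\<lambda>x. a * f x + b * g x) \<xi> = (LINT x|lborel. a * (cis (- (x \<bullet> \<xi>)) * f x) + b * (cis (- (x \<bullet> \<xi>)) * g x))"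
    unfolding fourier_def by (simp add: algebra_simps)
  also have "\<dots> = a * fourier f \<xi> + b * fourier g \<xi>"
    using i by (simp add: fourier_def)
  finally show ?thesis .
qed

lemma hermitian_fourier_real:
  assumes f: "hermitian_L2 f"
  shows "fourier f \<xi> = complex_of_real (Re (fourier f \<xi>))"
proof -
  note [measurable] = hermitian_L2_measurable[OF f]
  have "cnj (fourier f \<xi>) = (LINT x|lborel. cnj (cis (- (x \<bullet> \<xi>)) * f x))"
    unfolding fourier_def by (rule Bochner_Integration.integral_cnj[symmetric])
  also have "\<dots> = (LINT x|lborel. (\<lambda>x. cis (- (x \<bullet> \<xi>)) * f x) (- x))"
    using f by (simp add: hermitian_L2_def cis_cnj)
  also have "\<dots> = fourier f \<xi>"
    unfolding fourier_def by (rule lborel_integral_reflect(1)) measurable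
  finally show ?thesis by (simp add: complex_eq_iff)
qed

lemma hermitian_norm_fourier: "hermitian_L2 f \<Longrightarrow> norm (fourier f \<xi>) = \<bar>Re (fourier f \<xi>)\<bar>"
  using hermitian_fourier_real[of f \<xi>] by (metis norm_of_real)

lemma hermitian_fourier_Lp: 
  assumes f: "hermitian_L2 f"
  shows "(\<lambda>\<xi>. Re (fourier f \<xi>)) \<in> Lp_space 2"
    and "(LINT \<xi>|lborel. (Re (fourier f \<xi>))\<^sup>2) = (2 * pi) ^ DIM('a) * (LINT x|lborel. (norm (f (x::'a::euclidean_space)))\<^sup>2)"
proof -
  note [measurable] = hermitian_L2_measurable[OF f]
  have i: "integrable lborel f" "integrable lborel (\<lambda>x. (norm (f x))\<^sup>2)" using f by (auto simp: hermitian_L2_def)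
  have e: "(Re (fourier f \<xi>))\<^sup>2 = (norm (fourier f \<xi>))\<^sup>2" for \<xi>
    using hermitian_norm_fourier[OF f, of \<xi>] by simp
  show "(\<lambda>\<xi>. Re (fourier f \<xi>)) \<in> Lp_space 2"
    using plancherel(1)[OF i] by (simp add: Lp_space_2_iff e)
  show "(LINT \<xi>|lborel. (Re (fourier f \<xi>))\<^sup>2) = (2 * pi) ^ DIM('a) * (LINT x|lborel. (norm (f x))\<^sup>2)"
    using plancherel(2)[OF i] by (simp add: e)
qed

lemma cmod_add_square: "(norm (z + w))\<^sup>2 = (norm z)\<^sup>2 + (norm w)\<^sup>2 + 2 * Re (z * cnj w)"
  unfolding cmod_power2 by (simp add: power2_eq_square algebra_simps)

text \<open>Polarisation of Plancherel's identity.\<close>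

lemma hermitian_parseval:
  fixes f g :: "'a::euclidean_space \<Rightarrow> complex"
  assumes f: "hermitian_L2 f" and g: "hermitian_L2 g"
  shows "(LINT \<xi>|lborel. Re (fourier f \<xi>) * Re (fourier g \<xi>)) = (2 * pi) ^ DIM('a) * (LINT x|lborel. Re (f x * cnj (g x)))"
proof -
  note [measurable] = hermitian_L2_measurable[OF f] hermitian_L2_measurable[OF g]
  have i: "integrable lborel f" "integrable lborel (\<lambda>x. (norm (f x))\<^sup>2)"
    "integrable lborel g" "integrable lborel (\<lambda>x. (norm (g x))\<^sup>2)" using f g by (auto simp: hermitian_L2_def)
  have h: "hermitian_L2 (\<lambda>x. f x + g x)" using hermitian_L2_combine[OF f g, of 1 1] by simp
  have F: "fourier (\<lambda>x. f x + g x) \<xi> = fourier f \<xi> + fourier g \<xi>" for \<xi>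
    using fourier_combine[OF i(1,3), of 1 1] by simp
  have Ic: "integrable lborel (\<lambda>x. Re (f x * cnj (g x)))"
  proof -
    have "integrable lborel (\<lambda>x. ((norm (f x + g x))\<^sup>2 - (norm (f x))\<^sup>2 - (norm (g x))\<^sup>2) / 2)"
      using i h by (auto simp: hermitian_L2_def)
    moreover have "((norm (f x + g x))\<^sup>2 - (norm (f x))\<^sup>2 - (norm (g x))\<^sup>2) / 2 = Re (f x * cnj (g x))" for x
      unfolding cmod_add_square by simp
    ultimately show ?thesis by (simp only:)
  qed
  let ?F = "\<lambda>\<xi>. Re (fourier f \<xi>)" and ?G = "\<lambda>\<xi>. Re (fourier g \<xi>)"
  have L: "?F \<in> Lp_space 2" "?G \<in> Lp_space 2" using hermitian_fourier_Lp(1) f g by auto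
  have IF: "integrable lborel (\<lambda>\<xi>. (?F \<xi>)\<^sup>2)" "integrable lborel (\<lambda>\<xi>. (?G \<xi>)\<^sup>2)"
    using L by (auto simp: Lp_space_2_iff)
  have "(LINT \<xi>|lborel. (?F \<xi> + ?G \<xi>)\<^sup>2) = (2 * pi) ^ DIM('a) * (LINT x|lborel. (norm (f x + g x))\<^sup>2)"
    using hermitian_fourier_Lp(2)[OF h] by (simp add: F)
  also have "(LINT x|lborel. (norm (f x + g x))\<^sup>2) = (LINT x|lborel. (norm (f x))\<^sup>2) + (LINT x|lborel. (norm (g x))\<^sup>2) + 2 * (LINT x|lborel. Re (f x * cnj (g x)))"
    unfolding cmod_add_square
      Bochner_Integration.integral_add[OF Bochner_Integration.integrable_add[OF i(2,4)] integrable_mult_right[OF Ic]]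
      Bochner_Integration.integral_add[OF i(2,4)] integral_mult_right_zero ..
  finally have 1: "(LINT \<xi>|lborel. (?F \<xi> + ?G \<xi>)\<^sup>2) = (LINT \<xi>|lborel. (?F \<xi>)\<^sup>2) + (LINT \<xi>|lborel. (?G \<xi>)\<^sup>2)
     + 2 * ((2 * pi) ^ DIM('a) * (LINT x|lborel. Re (f x * cnj (g x))))"
    unfolding hermitian_fourier_Lp(2)[OF f] hermitian_fourier_Lp(2)[OF g] by (simp add: algebra_simps)
  have "(LINT \<xi>|lborel. (?F \<xi> + ?G \<xi>)\<^sup>2) = (LINT \<xi>|lborel. (?F \<xi>)\<^sup>2 + (?G \<xi>)\<^sup>2 + 2 * (?F \<xi> * ?G \<xi>))"
    by (simp add: power2_sum mult.assoc)
  also have "\<dots> = (LINT \<xi>|lborel. (?F \<xi>)\<^sup>2) + (LINT \<xi>|lborel. (?G \<xi>)\<^sup>2) + 2 * (LINT \<xi>|lborel. ?F \<xi> * ?G \<xi>)"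
    using IF Lp_space_2_combine(1)[OF L] by simp
  finally show ?thesis using 1 by simp
qed

locale white_noise_space = prob_space M + complete_measure M for M :: "'w measure" +
  fixes W :: "('a::euclidean_space \<Rightarrow> real) \<Rightarrow> 'w \<Rightarrow> real"
  assumes noise: "white_noise M W"
begin

lemma W_gaussian:
  assumes "f \<in> Lp_space 2"
  shows "centered_gaussian M (W f)"
proof -
  have "centered_gaussian_family M (Lp_space 2) W" using noise by (simp add: white_noise_def)
  from this[unfolded centered_gaussian_family_def, rule_format, of "{f}" "\<lambda>_. 1"] assms
  show ?thesis by simp
qed

lemma W_cov: "f \<in> Lp_space 2 \<Longrightarrow> g \<in> Lp_space 2 \<Longrightarrow> expectation (\<lambda>\<omega>. W f \<omega> * W g \<omega>) = (LINT x|lborel. f x * g x)"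
  using noise by (simp add: white_noise_def)

lemma W_integrable: "f \<in> Lp_space 2 \<Longrightarrow> g \<in> Lp_space 2 \<Longrightarrow> integrable M (\<lambda>\<omega>. W f \<omega> * W g \<omega>)"
  using centered_gaussian_moments[OF W_gaussian] by (intro integrable_mult_L2)

text \<open>The isometry alone forces linearity: the defect has variance zero.\<close>

lemma W_linear:
  assumes f: "f \<in> Lp_space 2" and g: "g \<in> Lp_space 2"
  shows "AE \<omega> in M. W (\<lambda>x. a * f x + b * g x) \<omega> = a * W f \<omega> + b * W g \<omega>"
proof -
  let ?h = "\<lambda>x. a * f x + b * g x"
  have h: "?h \<in> Lp_space 2" by (rule Lp_space_2_combine(2)[OF f g])
  note I = W_integrable[OF f f] W_integrable[OF f g] W_integrable[OF g g] W_integrable[OF h f] W_integrable[OF h g] W_integrable[OF h h]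
  note J = Lp_space_2_combine(1)[OF f f] Lp_space_2_combine(1)[OF f g] Lp_space_2_combine(1)[OF g g]
  have sq: "(W ?h \<omega> - (a * W f \<omega> + b * W g \<omega>))\<^sup>2 = W ?h \<omega> * W ?h \<omega> - 2 * a * (W ?h \<omega> * W f \<omega>) - 2 * b * (W ?h \<omega> * W g \<omega>)
      + a\<^sup>2 * (W f \<omega> * W f \<omega>) + 2 * a * b * (W f \<omega> * W g \<omega>) + b\<^sup>2 * (W g \<omega> * W g \<omega>)" for \<omega>
    by (simp add: power2_eq_square algebra_simps)
  define ff fg gg where "ff = (LINT x|lborel. f x * f x)" and "fg = (LINT x|lborel. f x * g x)" and "gg = (LINT x|lborel. g x * g x)"
  have hf: "(LINT x|lborel. ?h x * f x) = a * ff + b * fg"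
  proof -
    have "(LINT x|lborel. ?h x * f x) = (LINT x|lborel. a * (f x * f x) + b * (f x * g x))"
      by (simp add: algebra_simps)
    then show ?thesis using J by (simp add: ff_def fg_def)
  qed
  have hg: "(LINT x|lborel. ?h x * g x) = a * fg + b * gg"
  proof -
    have "(LINT x|lborel. ?h x * g x) = (LINT x|lborel. a * (f x * g x) + b * (g x * g x))"
      by (simp add: algebra_simps)
    then show ?thesis using J by (simp add: gg_def fg_def)
  qed
  have hh: "(LINT x|lborel. ?h x * ?h x) = a * (a * ff + b * fg) + b * (a * fg + b * gg)"
  proof -
    have "(LINT x|lborel. ?h x * ?h x) = (LINT x|lborel. a * (?h x * f x) + b * (?h x * g x))"
      by (simp add: algebra_simps)
    then show ?thesis using Lp_space_2_combine(1)[OF h f] Lp_space_2_combine(1)[OF h g] by (simp add: hf hg)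
  qed
  have "expectation (\<lambda>\<omega>. (W ?h \<omega> - (a * W f \<omega> + b * W g \<omega>))\<^sup>2) = 0"
    unfolding sq using I
    by (simp add: W_cov f g h hf hg hh ff_def[symmetric] fg_def[symmetric] gg_def[symmetric])
      (simp add: power2_eq_square algebra_simps)
  moreover have "integrable M (\<lambda>\<omega>. (W ?h \<omega> - (a * W f \<omega> + b * W g \<omega>))\<^sup>2)"
    unfolding sq using I by auto
  ultimately have "AE \<omega> in M. (W ?h \<omega> - (a * W f \<omega> + b * W g \<omega>))\<^sup>2 = 0"
    by (subst (asm) integral_nonneg_eq_0_iff_AE) auto
  then show ?thesis by eventually_elim simp
qed

lemma W_cong_AE:
  assumes f: "f \<in> Lp_space 2" and g: "g \<in> Lp_space 2" and eq: "AE x in lborel. f x = g x"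
  shows "AE \<omega> in M. W f \<omega> = W g \<omega>"
proof -
  have [measurable]: "f \<in> borel_measurable borel" "g \<in> borel_measurable borel"
    using f g by (auto simp: Lp_space_2_iff)
  note I = W_integrable[OF f f] W_integrable[OF f g] W_integrable[OF g g]
  have sq: "(W f \<omega> - W g \<omega>)\<^sup>2 = W f \<omega> * W f \<omega> - 2 * (W f \<omega> * W g \<omega>) + W g \<omega> * W g \<omega>" for \<omega>
    by (simp add: power2_eq_square algebra_simps)
  have 1: "(LINT x|lborel. f x * f x) = (LINT x|lborel. g x * g x)"
    and 2: "(LINT x|lborel. f x * g x) = (LINT x|lborel. g x * g x)"
    by (rule integral_cong_AE; use eq in auto)+
  have "expectation (\<lambda>\<omega>. (W f \<omega> - W g \<omega>)\<^sup>2) = 0"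
    unfolding sq using I by (simp add: W_cov f g 1 2)
  moreover have "integrable M (\<lambda>\<omega>. (W f \<omega> - W g \<omega>)\<^sup>2)" unfolding sq using I by auto
  ultimately have "AE \<omega> in M. (W f \<omega> - W g \<omega>)\<^sup>2 = 0"
    by (subst (asm) integral_nonneg_eq_0_iff_AE) auto
  then show ?thesis by eventually_elim simp
qed

text \<open>By duality, \<open>V f\<close> is the integral of \<open>f\<close> against the Fourier transform of the white noise.\<close>

definition V :: "('a \<Rightarrow> complex) \<Rightarrow> 'w \<Rightarrow> real" where
  "V f = W (\<lambda>x. Re (fourier f x))"

lemma V_gaussian: "hermitian_L2 f \<Longrightarrow> centered_gaussian M (V f)"
  unfolding V_def by (intro W_gaussian hermitian_fourier_Lp)

lemma V_measurable: "hermitian_L2 f \<Longrightarrow> V f \<in> borel_measurable M"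
  using V_gaussian by (simp add: centered_gaussian_def)

lemma V_cov:
  assumes "hermitian_L2 f" "hermitian_L2 g"
  shows "expectation (\<lambda>\<omega>. V f \<omega> * V g \<omega>) = (2 * pi) ^ DIM('a) * (LINT x|lborel. Re (f x * cnj (g x)))"
  unfolding V_def by (simp add: W_cov hermitian_fourier_Lp assms hermitian_parseval)

lemma V_linear:
  assumes f: "hermitian_L2 f" and g: "hermitian_L2 g"
  shows "AE \<omega> in M. V (\<lambda>x. complex_of_real a * f x + complex_of_real b * g x) \<omega> = a * V f \<omega> + b * V g \<omega>"
proof -
  have "(\<lambda>x. Re (fourier (\<lambda>x. complex_of_real a * f x + complex_of_real b * g x) x))
     = (\<lambda>x. a * Re (fourier f x) + b * Re (fourier g x))"
    using f g by (simp add: fourier_combine hermitian_L2_def)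
  then show ?thesis unfolding V_def using W_linear[OF hermitian_fourier_Lp(1)[OF f] hermitian_fourier_Lp(1)[OF g]] by simp
qed

lemma hermitian_L2_zero: "hermitian_L2 (\<lambda>x. 0)"
  by (simp add: hermitian_L2_def)

lemma V_sum:
  assumes "finite I" "\<And>i. i \<in> I \<Longrightarrow> hermitian_L2 (f i)"
  shows "hermitian_L2 (\<lambda>x. \<Sum>i\<in>I. complex_of_real (a i) * f i x) \<and>
    (AE \<omega> in M. V (\<lambda>x. \<Sum>i\<in>I. complex_of_real (a i) * f i x) \<omega> = (\<Sum>i\<in>I. a i * V (f i) \<omega>))"
  using assms
proof (induction I rule: finite_induct)
  case empty
  have "AE \<omega> in M. V (\<lambda>x. complex_of_real 0 * 0 + complex_of_real 0 * 0) \<omega> = 0 * V (\<lambda>x. 0) \<omega> + 0 * V (\<lambda>x. 0) \<omega>"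
    by (rule V_linear[OF hermitian_L2_zero hermitian_L2_zero])
  then show ?case by (simp add: hermitian_L2_zero)
next
  case (insert i I)
  let ?s = "\<lambda>x. \<Sum>i\<in>I. complex_of_real (a i) * f i x"
  have s: "hermitian_L2 ?s" and eq: "AE \<omega> in M. V ?s \<omega> = (\<Sum>i\<in>I. a i * V (f i) \<omega>)" using insert by auto
  have e: "(\<lambda>x. \<Sum>i\<in>insert i I. complex_of_real (a i) * f i x) = (\<lambda>x. complex_of_real (a i) * f i x + complex_of_real 1 * ?s x)"
    using insert by simp
  have "AE \<omega> in M. V (\<lambda>x. complex_of_real (a i) * f i x + complex_of_real 1 * ?s x) \<omega> = a i * V (f i) \<omega> + 1 * V ?s \<omega>"
    using insert by (intro V_linear s) auto
  with eq have "AE \<omega> in M. V (\<lambda>x. complex_of_real (a i) * f i x + complex_of_real 1 * ?s x) \<omega> = (\<Sum>i\<in>insert i I. a i * V (f i) \<omega>)"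
    by eventually_elim (use insert in simp)
  moreover have "hermitian_L2 (\<lambda>x. complex_of_real (a i) * f i x + complex_of_real 1 * ?s x)"
    using insert by (intro hermitian_L2_combine s) auto
  ultimately show ?case unfolding e by simp
qed

lemma V_pair_gaussian:
  assumes f: "hermitian_L2 f" and g: "hermitian_L2 g"
  shows "centered_gaussian M (\<lambda>\<omega>. a * V f \<omega> + b * V g \<omega>)"
proof (rule centered_gaussian_AE_eq)
  note [measurable] = V_measurable[OF f] V_measurable[OF g]
  show "centered_gaussian M (V (\<lambda>x. complex_of_real a * f x + complex_of_real b * g x))"
    by (intro V_gaussian hermitian_L2_combine f g)
  show "(\<lambda>\<omega>. a * V f \<omega> + b * V g \<omega>) \<in> borel_measurable M" by measurable
  show "AE \<omega> in M. a * V f \<omega> + b * V g \<omega> = V (\<lambda>x. complex_of_real a * f x + complex_of_real b * g x) \<omega>"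
    using V_linear[OF f g, of a b] by eventually_elim simp
qed

text \<open>By the isometry \<open>V (fk k)\<close> converges to \<open>V f\<close> in mean square, and Fatou's lemma identifies this
  limit with the almost sure one.\<close>

lemma V_limit:
  assumes f: "hermitian_L2 f" and fk: "\<And>k. hermitian_L2 (fk k)"
    and L2: "(\<lambda>k. LINT x|lborel. (norm (fk k x - f x))\<^sup>2) \<longlonglongrightarrow> 0"
    and Xk: "\<And>k. AE \<omega> in M. Xk k \<omega> = c * V (fk k) \<omega>"
    and lim: "AE \<omega> in M. (\<lambda>k. Xk k \<omega>) \<longlonglongrightarrow> X \<omega>"
  shows "AE \<omega> in M. X \<omega> = c * V f \<omega>"
proof -
  note [measurable] = V_measurable[OF f] V_measurable[OF fk]
  have d: "hermitian_L2 (\<lambda>x. complex_of_real 1 * fk k x + complex_of_real (-1) * f x)" for k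
    by (intro hermitian_L2_combine f fk)
  let ?u = "\<lambda>k \<omega>. ennreal ((c * (V (fk k) \<omega> - V f \<omega>))\<^sup>2)"
  have int: "(\<integral>\<^sup>+\<omega>. ?u k \<omega> \<partial>M) = ennreal (c\<^sup>2 * ((2 * pi) ^ DIM('a) * (LINT x|lborel. (norm (fk k x - f x))\<^sup>2)))" for k
  proof -
    let ?d = "\<lambda>x. complex_of_real 1 * fk k x + complex_of_real (-1) * f x"
    have "(\<integral>\<^sup>+\<omega>. ?u k \<omega> \<partial>M) = (\<integral>\<^sup>+\<omega>. ennreal (c\<^sup>2 * (V ?d \<omega>)\<^sup>2) \<partial>M)"
    proof (rule nn_integral_cong_AE)
      show "AE \<omega> in M. ?u k \<omega> = ennreal (c\<^sup>2 * (V ?d \<omega>)\<^sup>2)"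
        using V_linear[OF fk[of k] f, of 1 "-1"] by eventually_elim (simp add: power_mult_distrib)
    qed
    also have "\<dots> = ennreal (expectation (\<lambda>\<omega>. c\<^sup>2 * (V ?d \<omega>)\<^sup>2))"
      using centered_gaussian_moments(2)[OF V_gaussian[OF d]] by (intro nn_integral_eq_integral) auto
    also have "expectation (\<lambda>\<omega>. c\<^sup>2 * (V ?d \<omega>)\<^sup>2) = c\<^sup>2 * ((2 * pi) ^ DIM('a) * (LINT x|lborel. Re (?d x * cnj (?d x))))"
      using V_cov[OF d d] by (simp add: power2_eq_square)
    also have "(LINT x|lborel. Re (?d x * cnj (?d x))) = (LINT x|lborel. (norm (fk k x - f x))\<^sup>2)"
      by (intro Bochner_Integration.integral_cong refl) (simp only: complex_norm_square[symmetric] Re_complex_of_real, simp)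
    finally show ?thesis .
  qed
  have "(\<lambda>k. ennreal (c\<^sup>2 * ((2 * pi) ^ DIM('a) * (LINT x|lborel. (norm (fk k x - f x))\<^sup>2)))) \<longlonglongrightarrow> ennreal (c\<^sup>2 * ((2 * pi) ^ DIM('a) * 0))"
    by (intro tendsto_ennrealI tendsto_intros L2)
  then have "liminf (\<lambda>k. \<integral>\<^sup>+\<omega>. ?u k \<omega> \<partial>M) = 0"
    unfolding int by (intro lim_imp_Liminf) auto
  then have "(\<integral>\<^sup>+\<omega>. liminf (\<lambda>k. ?u k \<omega>) \<partial>M) = 0"
    using nn_integral_liminf[of ?u M] by simp
  then have z: "AE \<omega> in M. liminf (\<lambda>k. ?u k \<omega>) = 0"
    by (subst (asm) nn_integral_0_iff_AE) auto
  have Xall: "AE \<omega> in M. \<forall>k. Xk k \<omega> = c * V (fk k) \<omega>" using Xk by (simp add: AE_all_countable)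
  show ?thesis
    using z lim Xall
  proof eventually_elim
    case (elim \<omega>)
    have "(\<lambda>k. ?u k \<omega>) \<longlonglongrightarrow> ennreal ((X \<omega> - c * V f \<omega>)\<^sup>2)"
    proof (intro tendsto_ennrealI tendsto_power)
      have "(\<lambda>k. Xk k \<omega> - c * V f \<omega>) \<longlonglongrightarrow> X \<omega> - c * V f \<omega>" by (intro tendsto_intros elim(2))
      then show "(\<lambda>k. c * (V (fk k) \<omega> - V f \<omega>)) \<longlonglongrightarrow> X \<omega> - c * V f \<omega>"
        using elim(3) by (simp add: algebra_simps)
    qed
    then have "liminf (\<lambda>k. ?u k \<omega>) = ennreal ((X \<omega> - c * V f \<omega>)\<^sup>2)"
      by (intro lim_imp_Liminf) auto
    then show "X \<omega> = c * V f \<omega>" using elim(1) by (simp add: ennreal_eq_0_iff)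
  qed
qed

text \<open>For an integrable symbol of compact support the truncations to balls are eventually
  constant, so its \<open>L\<^sup>2\<close> Fourier transform is the classical one.\<close>

lemma noise_fourier_compact:
  assumes f: "hermitian_L2 f" and supp: "\<And>x. norm x > R \<Longrightarrow> f x = 0"
  shows "AE \<omega> in M. Re (noise_fourier W f \<omega>) = V f \<omega>"
proof -
  note [measurable] = hermitian_L2_measurable[OF f]
  let ?P = "\<lambda>g. g \<in> Lp_space 2 \<and>
     ((\<lambda>R. \<integral>\<^sup>+x. ennreal ((norm (g x - fourier (\<lambda>y. indicator (cball 0 R) y * f y) x))\<^sup>2) \<partial>lborel) \<longlongrightarrow> 0) at_top"
  have ind: "(\<lambda>y. indicator (cball 0 r) y * f y) = f" if "r \<ge> R" for r
    using supp that by (auto simp: fun_eq_iff indicator_def not_le)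
  have ev: "\<forall>\<^sub>F r in at_top. (\<integral>\<^sup>+x. ennreal ((norm (g x - fourier (\<lambda>y. indicator (cball 0 r) y * f y) x))\<^sup>2) \<partial>lborel)
      = (\<integral>\<^sup>+x. ennreal ((norm (g x - fourier f x))\<^sup>2) \<partial>lborel)" for g :: "'a \<Rightarrow> complex"
    using eventually_ge_at_top[of R] by eventually_elim (simp add: ind)
  have i: "integrable lborel f" "integrable lborel (\<lambda>x. (norm (f x))\<^sup>2)" using f by (auto simp: hermitian_L2_def)
  have "?P (fourier f)"
  proof
    show "fourier f \<in> Lp_space 2" using plancherel(1)[OF i] by (simp add: Lp_space_2_iff)
    have "((\<lambda>R. (\<integral>\<^sup>+x. ennreal ((norm (fourier f x - fourier f x))\<^sup>2) \<partial>lborel)) \<longlongrightarrow> 0) (at_top :: real filter)" by simp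
    then show "((\<lambda>R. \<integral>\<^sup>+x. ennreal ((norm (fourier f x - fourier (\<lambda>y. indicator (cball 0 R) y * f y) x))\<^sup>2) \<partial>lborel) \<longlongrightarrow> 0) at_top"
      by (rule Lim_transform_eventually) (use ev[of "fourier f"] in \<open>eventually_elim, simp\<close>)
  qed
  then have P: "?P (L2_fourier f)" unfolding L2_fourier_def by (rule someI[of ?P])
  then have m[measurable]: "L2_fourier f \<in> borel_measurable borel" by (simp add: Lp_space_2_iff)
  have "((\<lambda>R::real. \<integral>\<^sup>+x. ennreal ((norm (L2_fourier f x - fourier f x))\<^sup>2) \<partial>lborel) \<longlongrightarrow> 0) at_top"
    by (rule Lim_transform_eventually[OF conjunct2[OF P] ev])
  then have "(\<integral>\<^sup>+x. ennreal ((norm (L2_fourier f x - fourier f x))\<^sup>2) \<partial>lborel) = 0"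
    by (simp add: tendsto_const_iff)
  then have "AE x in lborel. ennreal ((norm (L2_fourier f x - fourier f x))\<^sup>2) = 0"
    by (subst (asm) nn_integral_0_iff_AE) auto
  then have eq: "AE x in lborel. Re (L2_fourier f x) = Re (fourier f x)"
    by eventually_elim (simp add: ennreal_eq_0_iff)
  have i1: "integrable lborel (\<lambda>x. (Re (fourier f x))\<^sup>2)"
    using hermitian_fourier_Lp(1)[OF f] by (simp add: Lp_space_2_iff)
  have "integrable lborel (\<lambda>x. (Re (L2_fourier f x))\<^sup>2) \<longleftrightarrow> integrable lborel (\<lambda>x. (Re (fourier f x))\<^sup>2)"
    by (rule integrable_cong_AE) (use eq in auto)
  then have "(\<lambda>x. Re (L2_fourier f x)) \<in> Lp_space 2" using i1 by (simp add: Lp_space_2_iff)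
  from W_cong_AE[OF this hermitian_fourier_Lp(1)[OF f] eq]
  show ?thesis by (simp add: noise_fourier_def V_def)
qed

end

section \<open>Spectral representation of the solution\<close>

subsection \<open>The spectral amplitude\<close>

lemma integrable_powr_interval:
  fixes a R :: real
  assumes a: "a > -1" and R: "R \<ge> 0"
  shows "integrable lborel (\<lambda>x. indicator {-R..R} x * \<bar>x\<bar> powr a)"
proof -
  let ?g = "\<lambda>x::real. indicator {0..R} x * x powr a"
  have "(\<lambda>x. x powr a) integrable_on {0..R}"
    using has_integral_powr_from_0[OF a R] by blast
  then have "(\<lambda>x. x powr a) absolutely_integrable_on {0..R}"
    by (intro nonnegative_absolutely_integrable_1) auto
  then have "integrable lebesgue ?g"
    unfolding set_integrable_def by simp
  then have g: "integrable lborel ?g"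
    by (subst (asm) integrable_completion) auto
  have g': "integrable lborel (\<lambda>x. ?g (- x))"
    using g by (subst lborel_integral_reflect(2)) auto
  show ?thesis
  proof (rule Bochner_Integration.integrable_bound)
    show "integrable lborel (\<lambda>x. ?g x + ?g (- x))" using g g' by (rule Bochner_Integration.integrable_add)
    show "AE x in lborel. norm (indicator {-R..R} x * \<bar>x\<bar> powr a) \<le> norm (?g x + ?g (- x))"
      by (intro AE_I2) (auto simp: indicator_def abs_if)
  qed measurable
qed

lemma coordinate_measurable [measurable]:
  "(\<lambda>w::spacetime. fst w) \<in> borel_measurable borel" "(\<lambda>w::spacetime. snd w) \<in> borel_measurable borel"
  "(\<lambda>w::spacetime. fst (snd w)) \<in> borel_measurable borel" "(\<lambda>w::spacetime. snd (snd w)) \<in> borel_measurable borel"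
  by (intro borel_measurable_continuous_onI continuous_intros)+

text \<open>The modulus of the mixed derivative of the harmonizable kernel, restricted to the frequency box. On
  the coordinate axes it vanishes, as \<open>0 powr a = 0\<close>.\<close>

definition amp :: "real \<Rightarrow> real \<Rightarrow> real \<Rightarrow> nat \<Rightarrow> spacetime \<Rightarrow> real" where
  "amp H0 H1 H2 n w = indicator (frequency_box n) w *
     (\<bar>fst w\<bar> powr (1/2 - H0) * (\<bar>fst (snd w)\<bar> powr (1/2 - H1) * \<bar>snd (snd w)\<bar> powr (1/2 - H2)))"

lemma frequency_box_measurable [measurable]: "frequency_box n \<in> sets borel"
proof -
  have "closed {w::spacetime. \<bar>fst w\<bar> \<le> 2 ^ n \<and> norm (snd w) \<le> 2 ^ n}"
    by (intro closed_Collect_conj closed_Collect_le continuous_intros)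
  moreover have "frequency_box n = {w. \<bar>fst w\<bar> \<le> 2 ^ n \<and> norm (snd w) \<le> 2 ^ n}"
    by (auto simp: frequency_box_def)
  ultimately show ?thesis by simp
qed

lemma frequency_box_bound: "w \<in> frequency_box n \<Longrightarrow> norm w \<le> 2 * 2 ^ n"
proof -
  assume w: "w \<in> frequency_box n"
  have "norm w \<le> norm (fst w) + norm (snd w)" unfolding norm_prod_def[of w] by (intro sqrt_sum_squares_le_sum) auto
  then show ?thesis using w by (auto simp: frequency_box_def)
qed

lemma amp_measurable [measurable]: "amp H0 H1 H2 n \<in> borel_measurable borel"
  unfolding amp_def[abs_def]
  by (intro borel_measurable_times borel_measurable_indicator powr_real_measurable borel_measurable_abs
      coordinate_measurable frequency_box_measurable borel_measurable_const)

lemma amp_nonneg: "amp H0 H1 H2 n w \<ge> 0"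
  by (simp add: amp_def)

lemma amp_integrable:
  assumes H: "H0 < 1" "H1 < 1" "H2 < 1"
  shows "integrable lborel (\<lambda>w. (amp H0 H1 H2 n w)\<^sup>2)" "integrable lborel (amp H0 H1 H2 n)"
proof -
  let ?g = "\<lambda>h x::real. indicator {-(2 ^ n)..2 ^ n} x * \<bar>x\<bar> powr (1 - 2 * h)"
  have g: "integrable lborel (?g h)" if "h < 1" for h
    using that by (intro integrable_powr_interval) auto
  have "integrable (lborel \<Otimes>\<^sub>M lborel) (\<lambda>(x, y). ?g H1 x * ?g H2 y)"
    by (intro integrable_pair_mult g H)
  then have "integrable lborel (\<lambda>(x, y). ?g H1 x * ?g H2 y)" by (simp add: lborel_prod)
  then have "integrable (lborel \<Otimes>\<^sub>M lborel) (\<lambda>(x, y). ?g H0 x * (case y of (x, y) \<Rightarrow> ?g H1 x * ?g H2 y))"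
    by (intro integrable_pair_mult g H)
  then have I: "integrable lborel (\<lambda>(x, y). ?g H0 x * (case y of (x, y) \<Rightarrow> ?g H1 x * ?g H2 y))"
    by (simp add: lborel_prod)
  show sq: "integrable lborel (\<lambda>w. (amp H0 H1 H2 n w)\<^sup>2)"
  proof (rule Bochner_Integration.integrable_bound[OF I])
    show "AE w in lborel. norm ((amp H0 H1 H2 n w)\<^sup>2) \<le> norm (case w of (x, y) \<Rightarrow> ?g H0 x * (case y of (x, y) \<Rightarrow> ?g H1 x * ?g H2 y))"
    proof (intro AE_I2)
      fix w :: spacetime
      obtain x y z where w: "w = (x, y, z)" by (cases w)
      have p: "(\<bar>v\<bar> powr (1/2 - h))\<^sup>2 = \<bar>v\<bar> powr (1 - 2 * h)" for v h :: real
        by (cases "v = 0") (auto simp: powr_power)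
      show "norm ((amp H0 H1 H2 n w)\<^sup>2) \<le> norm (case w of (x, y) \<Rightarrow> ?g H0 x * (case y of (x, y) \<Rightarrow> ?g H1 x * ?g H2 y))"
      proof (cases "w \<in> frequency_box n")
        case True
        then have "\<bar>x\<bar> \<le> 2 ^ n" "norm (y, z) \<le> 2 ^ n" by (auto simp: frequency_box_def w)
        moreover have "\<bar>y\<bar> \<le> norm (y, z)" "\<bar>z\<bar> \<le> norm (y, z)"
          using norm_fst_le[of y z] norm_snd_le[of z y] by auto
        ultimately show ?thesis using True
          by (simp add: amp_def w power_mult_distrib p indicator_def abs_le_iff)
      next
        case False then show ?thesis by (simp add: amp_def)
      qed
    qed
  qed measurable
  have fin: "integrable lborel (indicator (frequency_box n) :: spacetime \<Rightarrow> real)"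
  proof (rule integrable_real_indicator)
    have "frequency_box n \<subseteq> cball 0 (2 * 2 ^ n)" using frequency_box_bound by auto
    then have "emeasure lborel (frequency_box n) \<le> emeasure lborel (cball (0::spacetime) (2 * 2 ^ n))"
      by (intro emeasure_mono) auto
    also have "\<dots> < \<infinity>" by (rule emeasure_lborel_cball_finite)
    finally show "emeasure lborel (frequency_box n) < \<infinity>" .
  qed auto
  show "integrable lborel (amp H0 H1 H2 n)"
  proof (rule Bochner_Integration.integrable_bound[OF Bochner_Integration.integrable_add[OF fin sq]])
    show "AE w in lborel. norm (amp H0 H1 H2 n w) \<le> norm (indicator (frequency_box n) w + (amp H0 H1 H2 n w)\<^sup>2)"
    proof (intro AE_I2)
      fix w
      have "a \<le> 1 + a\<^sup>2" if "a \<ge> 0" for a :: real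
        using sum_squares_bound[of a 1] that by simp
      from this[OF amp_nonneg[of H0 H1 H2 n w]] have le: "amp H0 H1 H2 n w \<le> 1 + (amp H0 H1 H2 n w)\<^sup>2" .
      show "norm (amp H0 H1 H2 n w) \<le> norm (indicator (frequency_box n) w + (amp H0 H1 H2 n w)\<^sup>2)"
      proof (cases "w \<in> frequency_box n")
        case True then show ?thesis using le amp_nonneg[of H0 H1 H2 n w] by simp
      next
        case False then show ?thesis by (simp add: amp_def)
      qed
    qed
  qed measurable
qed

subsection \<open>Symbols\<close>

text \<open>The hermitian symmetry keeps the noise integrals real, and boundedness makes every symbol square
  integrable against the squared amplitude.\<close>

definition symbol :: "('a::euclidean_space \<Rightarrow> complex) \<Rightarrow> bool" where
  "symbol m \<longleftrightarrow> m \<in> borel_measurable borel \<and> (\<exists>C. \<forall>w. norm (m w) \<le> C) \<and> (\<forall>w. m (- w) = cnj (m w))"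

lemma symbol_limit:
  assumes "\<And>k. symbol (mk k)" "\<And>k w. norm (mk k w) \<le> C" "\<And>w. (\<lambda>k. mk k w) \<longlonglongrightarrow> m w"
  shows "symbol m"
  unfolding symbol_def
proof (intro conjI exI allI)
  show "m \<in> borel_measurable borel"
    by (rule borel_measurable_LIMSEQ_metric[of mk]) (use assms in \<open>auto simp: symbol_def\<close>)
  fix w
  show "norm (m w) \<le> C"
    by (rule LIMSEQ_le_const2[OF tendsto_norm[OF assms(3)]]) (use assms(2) in auto)
  have "(\<lambda>k. cnj (mk k w)) \<longlonglongrightarrow> cnj (m w)" by (intro tendsto_intros assms)
  moreover have "(\<lambda>k. cnj (mk k w)) \<longlonglongrightarrow> m (- w)"
    using assms(3)[of "- w"] assms(1) by (simp add: symbol_def)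
  ultimately show "m (- w) = cnj (m w)" by (rule LIMSEQ_unique[symmetric])
qed

lemma symbol_combine:
  assumes "symbol f" "symbol g"
  shows "symbol (\<lambda>w. complex_of_real a * f w + complex_of_real b * g w)"
  unfolding symbol_def
proof (intro conjI)
  obtain C D where "\<And>w. norm (f w) \<le> C" "\<And>w. norm (g w) \<le> D" using assms unfolding symbol_def by metis
  then have "norm (complex_of_real a * f w + complex_of_real b * g w) \<le> \<bar>a\<bar> * C + \<bar>b\<bar> * D" for w
    by (intro norm_triangle_le add_mono) (auto simp: norm_mult mult_left_mono)
  then show "\<exists>C. \<forall>w. norm (complex_of_real a * f w + complex_of_real b * g w) \<le> C" by blast
qed (use assms in \<open>auto simp: symbol_def\<close>)

lemma symbol_mult:
  assumes "symbol f" "symbol g"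
  shows "symbol (\<lambda>w. f w * g w)"
  unfolding symbol_def
proof (intro conjI)
  obtain C D where "\<And>w. norm (f w) \<le> C" "\<And>w. norm (g w) \<le> D" using assms unfolding symbol_def by metis
  then have "norm (f w * g w) \<le> C * D" for w
    unfolding norm_mult by (intro mult_mono order_trans[OF norm_ge_zero]) auto
  then show "\<exists>C. \<forall>w. norm (f w * g w) \<le> C" by blast
qed (use assms in \<open>auto simp: symbol_def\<close>)

lemma symbol_sum:
  assumes "finite I" "\<And>i. i \<in> I \<Longrightarrow> symbol (f i)"
  shows "symbol (\<lambda>w. \<Sum>i\<in>I. complex_of_real (a i) * f i w)"
  using assms
proof (induction I rule: finite_induct)
  case empty show ?case by (auto simp: symbol_def)
next
  case (insert i I)
  have "symbol (\<lambda>w. complex_of_real (a i) * f i w + complex_of_real 1 * (\<Sum>i\<in>I. complex_of_real (a i) * f i w))"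
    using insert by (intro symbol_combine) auto
  then show ?case using insert by simp
qed

lemma symbol_hermitian:
  assumes H: "H0 < 1" "H1 < 1" "H2 < 1" and m: "symbol m"
  shows "hermitian_L2 (\<lambda>w. complex_of_real (amp H0 H1 H2 n w) * m w)"
proof -
  obtain C where C: "\<And>w. norm (m w) \<le> C" using m unfolding symbol_def by metis
  have [measurable]: "m \<in> borel_measurable borel" using m by (simp add: symbol_def)
  note I = amp_integrable[OF H, of n]
  show ?thesis unfolding hermitian_L2_def
  proof (intro conjI allI)
    show "integrable lborel (\<lambda>w. complex_of_real (amp H0 H1 H2 n w) * m w)"
    proof (rule Bochner_Integration.integrable_bound[OF integrable_mult_left[OF I(2), of C]])
      show "AE w in lborel. norm (complex_of_real (amp H0 H1 H2 n w) * m w) \<le> norm (amp H0 H1 H2 n w * C)"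
      proof (intro AE_I2)
        fix w :: spacetime
        have "norm (complex_of_real (amp H0 H1 H2 n w) * m w) = amp H0 H1 H2 n w * norm (m w)"
          using amp_nonneg by (simp add: norm_mult)
        also have "\<dots> \<le> amp H0 H1 H2 n w * C" by (intro mult_left_mono C amp_nonneg)
        finally show "norm (complex_of_real (amp H0 H1 H2 n w) * m w) \<le> norm (amp H0 H1 H2 n w * C)" by simp
      qed
    qed measurable
    show "integrable lborel (\<lambda>w. (norm (complex_of_real (amp H0 H1 H2 n w) * m w))\<^sup>2)"
    proof (rule Bochner_Integration.integrable_bound[OF integrable_mult_left[OF I(1), of "C\<^sup>2"]])
      show "AE w in lborel. norm ((norm (complex_of_real (amp H0 H1 H2 n w) * m w))\<^sup>2) \<le> norm ((amp H0 H1 H2 n w)\<^sup>2 * C\<^sup>2)"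
        using C by (intro AE_I2) (auto simp: norm_mult power_mult_distrib intro!: mult_left_mono power_mono)
    qed measurable
    fix w :: spacetime
    have "- w \<in> frequency_box n \<longleftrightarrow> w \<in> frequency_box n" by (cases w) (simp add: frequency_box_def norm_Pair)
    then have "amp H0 H1 H2 n (- w) = amp H0 H1 H2 n w" by (simp add: amp_def indicator_def)
    moreover have "m (- w) = cnj (m w)" using m unfolding symbol_def by blast
    ultimately show "complex_of_real (amp H0 H1 H2 n (- w)) * m (- w) = cnj (complex_of_real (amp H0 H1 H2 n w) * m w)"
      by simp
  qed
qed

subsection \<open>Increment and derivative factors\<close>

text \<open>Once the amplitude is split off, the harmonizable kernel is a product of increment factors
  \<open>dfac\<close>. Their derivatives in \<open>x\<close> are the factors \<open>efac\<close>; at frequency \<open>0\<close> both vanish, the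
  latter because \<open>sgn 0 = 0\<close>.\<close>

definition dfac :: "real \<Rightarrow> real \<Rightarrow> complex" where
  "dfac x \<zeta> = (cis (x * \<zeta>) - 1) / complex_of_real \<bar>\<zeta>\<bar>"

definition efac :: "real \<Rightarrow> real \<Rightarrow> complex" where
  "efac x \<zeta> = \<i> * complex_of_real (sgn \<zeta>) * cis (x * \<zeta>)"

lemma harmonic_factor_eq: "harmonic_factor h x \<zeta> = complex_of_real (\<bar>\<zeta>\<bar> powr (1/2 - h)) * dfac x \<zeta>"
proof (cases "\<zeta> = 0")
  case True then show ?thesis by (simp add: harmonic_factor_def dfac_def)
next
  case False
  have "\<bar>\<zeta>\<bar> powr (1/2 - h) * \<bar>\<zeta>\<bar> powr (h + 1/2) = \<bar>\<zeta>\<bar> powr 1"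
    unfolding powr_add[symmetric] by simp
  then have "\<bar>\<zeta>\<bar> powr (1/2 - h) * \<bar>\<zeta>\<bar> powr (h + 1/2) = \<bar>\<zeta>\<bar>" using False by simp
  then have "1 / \<bar>\<zeta>\<bar> powr (h + 1/2) = \<bar>\<zeta>\<bar> powr (1/2 - h) / \<bar>\<zeta>\<bar>" using False by (simp add: field_simps)
  then have eq: "complex_of_real (1 / \<bar>\<zeta>\<bar> powr (h + 1/2)) = complex_of_real (\<bar>\<zeta>\<bar> powr (1/2 - h) / \<bar>\<zeta>\<bar>)" by simp
  have "harmonic_factor h x \<zeta> = (cis (x * \<zeta>) - 1) * complex_of_real (1 / \<bar>\<zeta>\<bar> powr (h + 1/2))"
    by (simp add: harmonic_factor_def)
  also have "\<dots> = complex_of_real (\<bar>\<zeta>\<bar> powr (1/2 - h)) * dfac x \<zeta>"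
    unfolding eq by (simp add: dfac_def)
  finally show ?thesis .
qed

lemma dfac_quotient_bound:
  assumes "h \<noteq> 0"
  shows "norm ((dfac (x + h) \<zeta> - dfac x \<zeta>) / complex_of_real h) \<le> 1"
proof (cases "\<zeta> = 0")
  case True then show ?thesis by (simp add: dfac_def)
next
  case False
  have "dfac (x + h) \<zeta> - dfac x \<zeta> = (cis ((x + h) * \<zeta>) - cis (x * \<zeta>)) / complex_of_real \<bar>\<zeta>\<bar>"
    by (simp add: dfac_def diff_divide_distrib)
  then have "norm ((dfac (x + h) \<zeta> - dfac x \<zeta>) / complex_of_real h) = norm (cis ((x + h) * \<zeta>) - cis (x * \<zeta>)) / (\<bar>\<zeta>\<bar> * \<bar>h\<bar>)"
    by (simp add: norm_divide norm_mult)
  also have "\<dots> \<le> \<bar>(x + h) * \<zeta> - x * \<zeta>\<bar> / (\<bar>\<zeta>\<bar> * \<bar>h\<bar>)"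
    by (intro divide_right_mono cis_minus_le) auto
  also have "\<dots> = 1" using False assms by (simp add: algebra_simps abs_mult)
  finally show ?thesis .
qed

lemma dfac_bound: "norm (dfac x \<zeta>) \<le> \<bar>x\<bar>"
  using dfac_quotient_bound[of x 0 \<zeta>]
  by (cases "x = 0") (auto simp: dfac_def norm_divide norm_mult divide_le_eq mult.commute)

lemma dfac_deriv: "((\<lambda>x. dfac x \<zeta>) has_vector_derivative efac x \<zeta>) (at x)"
proof (cases "\<zeta> = 0")
  case True then show ?thesis by (simp add: dfac_def efac_def)
next
  case False
  have "((\<lambda>x. (cis (\<zeta> * x) - 1) / complex_of_real \<bar>\<zeta>\<bar>) has_vector_derivative
     (\<i> * complex_of_real \<zeta> * cis (\<zeta> * x) - 0) / complex_of_real \<bar>\<zeta>\<bar>) (at x)"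
    by (intro has_vector_derivative_divide has_vector_derivative_diff has_vector_derivative_cis_mult
        has_vector_derivative_const)
  moreover have "(\<i> * complex_of_real \<zeta> * cis (\<zeta> * x) - 0) / complex_of_real \<bar>\<zeta>\<bar> = efac x \<zeta>"
    using False by (auto simp: efac_def sgn_if mult.commute)
  ultimately show ?thesis by (simp add: dfac_def mult.commute)
qed

lemma efac_bound: "norm (efac x \<zeta>) \<le> 1"
  by (simp add: efac_def norm_mult sgn_if)

lemma dfac_cnj: "dfac x (- \<zeta>) = cnj (dfac x \<zeta>)" and efac_cnj: "efac x (- \<zeta>) = cnj (efac x \<zeta>)"
  by (simp_all add: dfac_def efac_def cis_cnj sgn_minus)

lemma dfac_measurable[measurable]: "dfac x \<in> borel_measurable borel"
  and efac_measurable[measurable]: "efac x \<in> borel_measurable borel"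
  unfolding dfac_def[abs_def] efac_def[abs_def] by measurable

lemma symbol_factor:
  fixes l :: "spacetime \<Rightarrow> real"
  assumes l: "l \<in> borel_measurable borel" "\<And>w. l (- w) = - l w"
  shows "symbol (\<lambda>w. dfac x (l w))" "symbol (\<lambda>w. efac x (l w))"
proof -
  note [measurable] = l(1)
  show "symbol (\<lambda>w. dfac x (l w))"
    unfolding symbol_def using dfac_bound[of x] by (auto simp: l(2) dfac_cnj)
  have "\<exists>C. \<forall>w. norm (efac x (l w)) \<le> C" using efac_bound[of x] by blast
  then show "symbol (\<lambda>w. efac x (l w))" unfolding symbol_def by (simp add: l(2) efac_cnj)
qed

lemma symbol_factors:
  "symbol (\<lambda>w::spacetime. dfac x (fst w))" "symbol (\<lambda>w::spacetime. efac x (fst w))"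
  "symbol (\<lambda>w::spacetime. dfac x (fst (snd w)))" "symbol (\<lambda>w::spacetime. efac x (fst (snd w)))"
  "symbol (\<lambda>w::spacetime. dfac x (snd (snd w)))" "symbol (\<lambda>w::spacetime. efac x (snd (snd w)))"
  by (rule symbol_factor; simp)+

subsection \<open>From the noise to its density and to the solution\<close>

lemma fine_divisions:
  fixes a b :: "'a::euclidean_space"
  obtains p where "\<And>k::nat. p k tagged_division_of cbox a b"
    "\<And>k x K. (x, K) \<in> p k \<Longrightarrow> K \<subseteq> ball x (1 / real (Suc k))"
proof -
  have "\<exists>p. p tagged_division_of cbox a b \<and> (\<lambda>x. ball x (1 / real (Suc k))) fine p" for k
    using fine_division_exists[of "\<lambda>x. ball x (1 / real (Suc k))" a b] gauge_ball[of "1 / real (Suc k)"] by (metis of_nat_0_less_iff zero_less_Suc zero_less_divide_1_iff)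
  then obtain p where "\<And>k. p k tagged_division_of cbox a b \<and> (\<lambda>x. ball x (1 / real (Suc k))) fine p k" by metis
  then show ?thesis by (intro that[of p]) (auto dest: fineD)
qed

text \<open>The divisions are chosen before the integrand, because the same evaluation points have to serve all
  sample paths and all frequencies.\<close>

lemma riemann_sum_tendsto:
  fixes f :: "'a::euclidean_space \<Rightarrow> 'b::banach"
  assumes p: "\<And>k::nat. p k tagged_division_of cbox a b"
    "\<And>k x K. (x, K) \<in> p k \<Longrightarrow> K \<subseteq> ball x (1 / real (Suc k))"
    and f: "continuous_on (cbox a b) f"
  shows "(\<lambda>k. \<Sum>(x, K)\<in>p k. measure lborel K *\<^sub>R f x) \<longlonglongrightarrow> integral (cbox a b) f"
proof (rule LIMSEQ_I)
  fix r :: real assume r: "r > 0"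
  define e where "e = r / (measure lborel (cbox a b) + 1)"
  have c0: "measure lborel (cbox a b) \<ge> 0" by simp
  then have c1: "measure lborel (cbox a b) + 1 > 0" by linarith
  have e: "e > 0" using r c1 by (simp only: e_def divide_pos_pos)
  have ec: "e * measure lborel (cbox a b) < r"
    unfolding e_def times_divide_eq_left pos_divide_less_eq[OF c1] using r by (simp add: distrib_left)
  obtain d where d: "d > 0" "\<And>x y. x \<in> cbox a b \<Longrightarrow> y \<in> cbox a b \<Longrightarrow> dist y x < d \<Longrightarrow> dist (f y) (f x) < e"
    using compact_uniformly_continuous[OF f compact_cbox] e unfolding uniformly_continuous_on_def by metis
  obtain N where N: "1 / real (Suc N) < d" using nat_approx_posE[OF d(1)] by blast
  have fi: "f integrable_on cbox a b" by (rule integrable_continuous[OF f])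
  have "norm ((\<Sum>(x, K)\<in>p k. measure lborel K *\<^sub>R f x) - integral (cbox a b) f) < r" if k: "k \<ge> N" for k
  proof -
    have kd: "1 / real (Suc k) < d"
    proof -
      have "1 / real (Suc k) \<le> 1 / real (Suc N)" using k by (intro divide_left_mono) auto
      then show ?thesis using N by linarith
    qed
    have "(\<Sum>(x, K)\<in>p k. measure lborel K *\<^sub>R f x) - integral (cbox a b) f
      = (\<Sum>(x, K)\<in>p k. measure lborel K *\<^sub>R f x - integral K f)"
      unfolding integral_combine_tagged_division_topdown[OF fi p(1)[of k]]
      by (simp add: sum_subtractf case_prod_beta)
    also have "norm \<dots> \<le> (\<Sum>(x, K)\<in>p k. e * measure lborel K)"
    proof (rule sum_norm_le, clarify)
      fix x K assume xK: "(x, K) \<in> p k"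
      obtain u v where K: "K = cbox u v" using tagged_division_ofD(4)[OF p(1) xK] by blast
      have x: "x \<in> cbox a b" and sub: "K \<subseteq> cbox a b"
        using tagged_division_ofD(2,3)[OF p(1) xK] by auto
      have fK: "f integrable_on cbox u v"
        using integrable_on_subcbox[OF fi] sub K by simp
      have "measure lborel K *\<^sub>R f x - integral K f = integral K (\<lambda>y. f x - f y)"
        unfolding K using fK by (subst Henstock_Kurzweil_Integration.integral_diff) auto
      also have "norm \<dots> \<le> e * measure lborel K"
        unfolding K
      proof (rule integrable_bound)
        show "0 \<le> e" using e by simp
        show "(\<lambda>y. f x - f y) integrable_on cbox u v" using fK by (intro integrable_diff) auto
        fix y assume "y \<in> cbox u v"
        then have y: "y \<in> cbox a b" "dist x y < d" using sub K p(2)[OF xK] kd by auto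
        then show "norm (f x - f y) \<le> e"
          using d(2)[OF x y(1)] by (simp add: dist_norm norm_minus_commute less_imp_le dist_commute)
      qed
      finally show "norm (measure lborel K *\<^sub>R f x - integral K f) \<le> e * measure lborel K" .
    qed
    also have "\<dots> = e * measure lborel (cbox a b)"
      using additive_content_tagged_division[OF p(1)[of k]] by (simp add: case_prod_beta flip: sum_distrib_left)
    finally show ?thesis using ec by linarith
  qed
  then show "\<exists>N. \<forall>k\<ge>N. norm ((\<Sum>(x, K)\<in>p k. measure lborel K *\<^sub>R f x) - integral (cbox a b) f) < r" by blast
qed

definition sgn3 :: "spacetime \<Rightarrow> complex" where
  "sgn3 w = \<i> * complex_of_real (sgn (fst w)) * (\<i> * complex_of_real (sgn (fst (snd w)))) * (\<i> * complex_of_real (sgn (snd (snd w))))"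

lemma efac_product:
  "efac (fst z) (fst w) * efac (fst (snd z)) (fst (snd w)) * efac (snd (snd z)) (snd (snd w)) = sgn3 w * cis (z \<bullet> w)"
proof -
  have "cis (z \<bullet> w) = cis (fst z * fst w) * cis (fst (snd z) * fst (snd w)) * cis (snd (snd z) * snd (snd w))"
    by (cases z, cases w) (simp add: cis_mult add.assoc)
  then show ?thesis by (simp add: efac_def sgn3_def mult_ac)
qed

text \<open>The response of the wave equation to the plane wave of frequency \<open>w\<close>, with the phase that comes
  from differentiating the noise.\<close>

definition solution_symbol :: "real \<Rightarrow> plane \<Rightarrow> spacetime \<Rightarrow> complex" where
  "solution_symbol t x w = sgn3 w * (cis (x \<bullet> snd w) * wave_kernel (fst w) (norm (snd w)) t)"

locale fbm_noise = white_noise_space M W for M :: "'w measure" and W :: "(spacetime \<Rightarrow> real) \<Rightarrow> 'w \<Rightarrow> real" +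
  fixes H0 H1 H2 :: real
  assumes H_less_1: "H0 < 1" "H1 < 1" "H2 < 1"
begin

definition \<Phi> :: "nat \<Rightarrow> (spacetime \<Rightarrow> complex) \<Rightarrow> 'w \<Rightarrow> real" where
  "\<Phi> n m = V (\<lambda>w. complex_of_real (amp H0 H1 H2 n w) * m w)"

lemmas herm = symbol_hermitian[OF H_less_1]

lemma Phi_combine:
  assumes "symbol f" "symbol g"
  shows "AE \<omega> in M. \<Phi> n (\<lambda>w. complex_of_real a * f w + complex_of_real b * g w) \<omega> = a * \<Phi> n f \<omega> + b * \<Phi> n g \<omega>"
proof -
  have e: "(\<lambda>w. complex_of_real (amp H0 H1 H2 n w) * (complex_of_real a * f w + complex_of_real b * g w))
     = (\<lambda>w. complex_of_real a * (complex_of_real (amp H0 H1 H2 n w) * f w) + complex_of_real b * (complex_of_real (amp H0 H1 H2 n w) * g w))"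
    by (simp add: algebra_simps)
  show ?thesis unfolding \<Phi>_def e by (intro V_linear herm assms)
qed

lemma Phi_sum:
  assumes "finite I" "\<And>i. i \<in> I \<Longrightarrow> symbol (f i)"
  shows "AE \<omega> in M. \<Phi> n (\<lambda>w. \<Sum>i\<in>I. complex_of_real (a i) * f i w) \<omega> = (\<Sum>i\<in>I. a i * \<Phi> n (f i) \<omega>)"
proof -
  have e: "(\<lambda>w. complex_of_real (amp H0 H1 H2 n w) * (\<Sum>i\<in>I. complex_of_real (a i) * f i w))
     = (\<lambda>w. \<Sum>i\<in>I. complex_of_real (a i) * (complex_of_real (amp H0 H1 H2 n w) * f i w))"
    by (simp add: sum_distrib_left mult_ac)
  show ?thesis unfolding \<Phi>_def e
    using V_sum[OF assms(1), of "\<lambda>i w. complex_of_real (amp H0 H1 H2 n w) * f i w" a] herm assms(2) by blast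
qed

text \<open>Bounded pointwise convergence of symbols suffices for mean square convergence, because
  the amplitude is square integrable.\<close>

lemma Phi_limit:
  assumes mk: "\<And>k. symbol (mk k)" and C: "\<And>k w. norm (mk k w) \<le> C" and m: "\<And>w. (\<lambda>k. mk k w) \<longlonglongrightarrow> m w"
    and Xk: "\<And>k. AE \<omega> in M. Xk k \<omega> = c * \<Phi> n (mk k) \<omega>"
    and lim: "AE \<omega> in M. (\<lambda>k. Xk k \<omega>) \<longlonglongrightarrow> X \<omega>"
  shows "AE \<omega> in M. X \<omega> = c * \<Phi> n m \<omega>"
proof -
  have sm: "symbol m" by (rule symbol_limit[OF mk C m])
  have [measurable]: "m \<in> borel_measurable borel" "mk k \<in> borel_measurable borel" for k
    using sm mk by (auto simp: symbol_def)
  have mC: "norm (m w) \<le> C" for w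
    by (rule LIMSEQ_le_const2[OF tendsto_norm[OF m]]) (use C in auto)
  let ?a = "\<lambda>w. complex_of_real (amp H0 H1 H2 n w)"
  have sq: "(norm (?a w * mk k w - ?a w * m w))\<^sup>2 = (amp H0 H1 H2 n w)\<^sup>2 * (norm (mk k w - m w))\<^sup>2" for w k
    by (simp add: norm_mult power_mult_distrib flip: right_diff_distrib)
  have "(\<lambda>k. LINT w|lborel. (norm (?a w * mk k w - ?a w * m w))\<^sup>2) \<longlonglongrightarrow> (LINT w::spacetime|lborel. (0::real))"
    unfolding sq
  proof (rule integral_dominated_convergence[where w = "\<lambda>w. (amp H0 H1 H2 n w)\<^sup>2 * (2 * C)\<^sup>2"])
    show "integrable lborel (\<lambda>w. (amp H0 H1 H2 n w)\<^sup>2 * (2 * C)\<^sup>2)"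
      by (intro integrable_mult_left amp_integrable H_less_1)
    show "AE w in lborel. (\<lambda>k. (amp H0 H1 H2 n w)\<^sup>2 * (norm (mk k w - m w))\<^sup>2) \<longlonglongrightarrow> 0"
    proof (intro AE_I2)
      fix w
      have "(\<lambda>k. (amp H0 H1 H2 n w)\<^sup>2 * (norm (mk k w - m w))\<^sup>2) \<longlonglongrightarrow> (amp H0 H1 H2 n w)\<^sup>2 * (norm (m w - m w))\<^sup>2"
        by (intro tendsto_intros m)
      then show "(\<lambda>k. (amp H0 H1 H2 n w)\<^sup>2 * (norm (mk k w - m w))\<^sup>2) \<longlonglongrightarrow> 0" by simp
    qed
    show "AE w in lborel. norm ((amp H0 H1 H2 n w)\<^sup>2 * (norm (mk k w - m w))\<^sup>2) \<le> (amp H0 H1 H2 n w)\<^sup>2 * (2 * C)\<^sup>2" for k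
    proof (intro AE_I2)
      fix w
      have "norm (mk k w - m w) \<le> 2 * C" using norm_triangle_ineq4[of "mk k w" "m w"] C[of k w] mC[of w] by linarith
      then have "(norm (mk k w - m w))\<^sup>2 \<le> (2 * C)\<^sup>2" by (intro power_mono) auto
      then have "(amp H0 H1 H2 n w)\<^sup>2 * (norm (mk k w - m w))\<^sup>2 \<le> (amp H0 H1 H2 n w)\<^sup>2 * (2 * C)\<^sup>2"
        by (intro mult_left_mono) auto
      then show "norm ((amp H0 H1 H2 n w)\<^sup>2 * (norm (mk k w - m w))\<^sup>2) \<le> (amp H0 H1 H2 n w)\<^sup>2 * (2 * C)\<^sup>2" by simp
    qed
  qed measurable
  then have "(\<lambda>k. LINT w|lborel. (norm (?a w * mk k w - ?a w * m w))\<^sup>2) \<longlonglongrightarrow> 0" by simp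
  from V_limit[OF herm[OF sm, of n] herm[OF mk, of n] this Xk[unfolded \<Phi>_def] lim]
  show ?thesis unfolding \<Phi>_def .
qed

lemma Phi_cov:
  assumes "symbol f" "symbol g"
  shows "expectation (\<lambda>\<omega>. \<Phi> n f \<omega> * \<Phi> n g \<omega>)
    = (2 * pi) ^ 3 * (LINT w|lborel. (amp H0 H1 H2 n w)\<^sup>2 * Re (f w * cnj (g w)))"
proof -
  have a: "Re (complex_of_real (amp H0 H1 H2 n w) * f w * cnj (complex_of_real (amp H0 H1 H2 n w) * g w))
    = (amp H0 H1 H2 n w)\<^sup>2 * Re (f w * cnj (g w))" for w
    by (simp add: power2_eq_square algebra_simps)
  have d: "DIM(spacetime) = 3" by simp
  show ?thesis
    unfolding \<Phi>_def V_cov[OF herm[OF assms(1)] herm[OF assms(2)]] a d ..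
qed

text \<open>The harmonizable kernel is the amplitude times three increment factors.\<close>

lemma noise_repr:
  assumes B: "harmonizable_version M W c H0 H1 H2 (frequency_box n) B"
  shows "AE \<omega> in M. B s x \<omega> = c * \<Phi> n (\<lambda>w. dfac s (fst w) * dfac (fst x) (fst (snd w)) * dfac (snd x) (snd (snd w))) \<omega>"
proof -
  let ?m = "\<lambda>w. dfac s (fst w) * dfac (fst x) (fst (snd w)) * dfac (snd x) (snd (snd w))"
  have sm: "symbol ?m" by (intro symbol_mult symbol_factors)
  have k: "(\<lambda>w. indicator (frequency_box n) w * harmonic_kernel H0 H1 H2 s x w) = (\<lambda>w. complex_of_real (amp H0 H1 H2 n w) * ?m w)"
    by (auto simp: fun_eq_iff harmonic_kernel_def harmonic_factor_eq amp_def indicator_def)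
  have "AE \<omega> in M. complex_of_real (B s x \<omega>) = complex_of_real c * noise_fourier W (\<lambda>w. complex_of_real (amp H0 H1 H2 n w) * ?m w) \<omega>"
    using B[unfolded harmonizable_version_def, rule_format, of s x] unfolding k .
  moreover have "AE \<omega> in M. Re (noise_fourier W (\<lambda>w. complex_of_real (amp H0 H1 H2 n w) * ?m w) \<omega>) = \<Phi> n ?m \<omega>"
    unfolding \<Phi>_def
  proof (rule noise_fourier_compact[OF herm[OF sm], of "2 * 2 ^ n"])
    fix w :: spacetime assume "2 * 2 ^ n < norm w"
    then have "w \<notin> frequency_box n" using frequency_box_bound[of w n] by auto
    then show "complex_of_real (amp H0 H1 H2 n w) * ?m w = 0" by (simp add: amp_def)
  qed
  ultimately show ?thesis
  proof eventually_elim
    case (elim \<omega>)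
    from elim(1) have "Re (complex_of_real (B s x \<omega>)) = Re (complex_of_real c * noise_fourier W (\<lambda>w. complex_of_real (amp H0 H1 H2 n w) * ?m w) \<omega>)"
      by (rule arg_cong)
    then show ?case using elim(2) by simp
  qed
qed

text \<open>The difference quotients of the field converge along each path, and their symbols converge boundedly
  when an increment factor is replaced by its derivative, so the two limits correspond.\<close>

lemma Phi_partial:
  fixes X :: "spacetime \<Rightarrow> 'w \<Rightarrow> real"
  assumes X: "\<And>z. AE \<omega> in M. X z \<omega> = c * \<Phi> n (m z) \<omega>"
    and d: "AE \<omega> in M. (\<lambda>z. X z \<omega>) differentiable_on UNIV"
    and A: "symbol A" and l: "\<And>x. symbol (\<lambda>w. dfac x (l w))"
    and form: "\<And>s w. m (z + s *\<^sub>R b) w = A w * dfac (r + s) (l w)"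
  shows "AE \<omega> in M. partial b (\<lambda>z. X z \<omega>) z = c * \<Phi> n (\<lambda>w. A w * efac r (l w)) \<omega>"
proof -
  let ?h = "\<lambda>k. 1 / real (Suc k)"
  obtain C where C: "\<And>w. norm (A w) \<le> C" using A unfolding symbol_def by metis
  let ?mk = "\<lambda>k w. complex_of_real (1 / ?h k) * m (z + ?h k *\<^sub>R b) w + complex_of_real (- (1 / ?h k)) * m z w"
  have sm: "symbol (m (z + s *\<^sub>R b))" for s
    unfolding form[abs_def] by (intro symbol_mult A l)
  have sm0: "symbol (m z)" using sm[of 0] by simp
  have form0: "m z w = A w * dfac r (l w)" for w using form[of 0 w] by simp
  have mk_eq: "?mk k w = A w * ((dfac (r + ?h k) (l w) - dfac r (l w)) / complex_of_real (?h k))" for k w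
    unfolding form form0 by (simp add: field_simps)
  show ?thesis
  proof (rule Phi_limit[where mk = ?mk and C = C and Xk = "\<lambda>k \<omega>. (X (z + ?h k *\<^sub>R b) \<omega> - X z \<omega>) /\<^sub>R ?h k"])
    show "symbol (?mk k)" for k by (intro symbol_combine sm sm0)
    show "norm (?mk k w) \<le> C" for k w
    proof -
      have "norm (?mk k w) = norm (A w) * norm ((dfac (r + ?h k) (l w) - dfac r (l w)) / complex_of_real (?h k))"
        unfolding mk_eq by (rule norm_mult)
      also have "\<dots> \<le> C * 1"
        by (intro mult_mono C dfac_quotient_bound order_trans[OF norm_ge_zero C]) auto
      finally show ?thesis by simp
    qed
    show "(\<lambda>k. ?mk k w) \<longlonglongrightarrow> A w * efac r (l w)" for w
      unfolding mk_eq
    proof (intro tendsto_mult tendsto_const)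
      show "(\<lambda>k. (dfac (r + ?h k) (l w) - dfac r (l w)) / complex_of_real (?h k)) \<longlonglongrightarrow> efac r (l w)"
        using difference_quotient_tendsto[OF dfac_deriv[of "l w" r]] by (simp add: scaleR_conv_of_real field_simps)
    qed
    show "AE \<omega> in M. (X (z + ?h k *\<^sub>R b) \<omega> - X z \<omega>) /\<^sub>R ?h k = c * \<Phi> n (?mk k) \<omega>" for k
      using X[of "z + ?h k *\<^sub>R b"] X[of z] Phi_combine[OF sm[of "?h k"] sm0, of n "1 / ?h k" "- (1 / ?h k)"]
    proof eventually_elim
      case (elim \<omega>)
      have "(c * P - c * Q) /\<^sub>R h = c * ((1 / h) * P + (- (1 / h)) * Q)" for h P Q :: real
        by (simp add: divide_inverse algebra_simps)
      then show ?case unfolding elim .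
    qed
    show "AE \<omega> in M. (\<lambda>k. (X (z + ?h k *\<^sub>R b) \<omega> - X z \<omega>) /\<^sub>R ?h k) \<longlonglongrightarrow> partial b (\<lambda>z. X z \<omega>) z"
      using d
    proof eventually_elim
      case (elim \<omega>)
      have g: "((\<lambda>s. z + s *\<^sub>R b) has_vector_derivative b) (at 0 within UNIV)"
        unfolding has_vector_derivative_def by (auto intro!: derivative_eq_intros)
      have "((\<lambda>s. X (z + s *\<^sub>R b) \<omega>) has_vector_derivative partial b (\<lambda>z. X z \<omega>) (z + 0 *\<^sub>R b)) (at 0 within UNIV)"
        by (rule has_vector_derivative_along_path[where \<gamma> = "\<lambda>s. z + s *\<^sub>R b" and S = UNIV and p = "\<lambda>z. X z \<omega>" and q = "\<lambda>h. partial h (\<lambda>z. X z \<omega>) (z + 0 *\<^sub>R b)", OF g])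
          (use has_derivative_partial[OF elim] in auto)
      from difference_quotient_tendsto[OF this] show ?case by simp
    qed
  qed
qed

lemma density_repr:
  assumes B: "harmonizable_version M W c H0 H1 H2 (frequency_box n) B"
    and smooth: "AE \<omega> in M. smooth_on UNIV (\<lambda>(s, x). B s x \<omega>)"
  shows "AE \<omega> in M. mixed_derivative (\<lambda>(s, x). B s x \<omega>) z = c * \<Phi> n (\<lambda>w. sgn3 w * cis (z \<bullet> w)) \<omega>"
proof -
  let ?X0 = "\<lambda>z \<omega>. (\<lambda>(s, x). B s x \<omega>) z"
  let ?X1 = "\<lambda>z \<omega>. partial e_2 (\<lambda>z. ?X0 z \<omega>) z"
  let ?X2 = "\<lambda>z \<omega>. partial e_1 (\<lambda>z. ?X1 z \<omega>) z"
  have d0: "AE \<omega> in M. (\<lambda>z. ?X0 z \<omega>) differentiable_on UNIV"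
    using smooth by eventually_elim (rule smooth_on_step)
  have d1: "AE \<omega> in M. (\<lambda>z. ?X1 z \<omega>) differentiable_on UNIV"
    using smooth by eventually_elim (rule smooth_on_step(1)[OF smooth_on_step(2)[OF _ e_Basis(3)]])
  have d2: "AE \<omega> in M. (\<lambda>z. ?X2 z \<omega>) differentiable_on UNIV"
    using smooth by eventually_elim
      (rule smooth_on_step(1)[OF smooth_on_step(2)[OF smooth_on_step(2)[OF _ e_Basis(3)] e_Basis(2)]])
  have X0: "AE \<omega> in M. ?X0 z \<omega> = c * \<Phi> n (\<lambda>w. dfac (fst z) (fst w) * dfac (fst (snd z)) (fst (snd w)) * dfac (snd (snd z)) (snd (snd w))) \<omega>" for z
    using noise_repr[OF B, of "fst z" "snd z"] by (simp add: case_prod_beta)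
  have X1: "AE \<omega> in M. ?X1 z \<omega> = c * \<Phi> n (\<lambda>w. dfac (fst z) (fst w) * dfac (fst (snd z)) (fst (snd w)) * efac (snd (snd z)) (snd (snd w))) \<omega>" for z
    by (rule Phi_partial[OF X0 d0, where l = "\<lambda>w. snd (snd w)"])
      (auto intro!: symbol_mult symbol_factors)
  have X2: "AE \<omega> in M. ?X2 z \<omega> = c * \<Phi> n (\<lambda>w. dfac (fst z) (fst w) * efac (snd (snd z)) (snd (snd w)) * efac (fst (snd z)) (fst (snd w))) \<omega>" for z
    by (rule Phi_partial[OF X1 d1, where l = "\<lambda>w. fst (snd w)"])
      (auto intro!: symbol_mult symbol_factors)
  have "AE \<omega> in M. partial e_t (\<lambda>z. ?X2 z \<omega>) z = c * \<Phi> n (\<lambda>w. (efac (snd (snd z)) (snd (snd w)) * efac (fst (snd z)) (fst (snd w))) * efac (fst z) (fst w)) \<omega>"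
    by (rule Phi_partial[OF X2 d2, where l = "\<lambda>w. fst w"])
      (auto intro!: symbol_mult symbol_factors)
  moreover have "(\<lambda>w. (efac (snd (snd z)) (snd (snd w)) * efac (fst (snd z)) (fst (snd w))) * efac (fst z) (fst w)) = (\<lambda>w. sgn3 w * cis (z \<bullet> w))"
    unfolding efac_product[symmetric] by (simp only: mult_ac)
  ultimately show ?thesis unfolding mixed_derivative_def by simp
qed

lemma symbol_plane_wave: "symbol (\<lambda>w::spacetime. sgn3 w * cis (z \<bullet> w))"
  unfolding efac_product[symmetric] by (intro symbol_mult symbol_factors)

lemma norm_sgn3_le: "norm (sgn3 w) \<le> 1"
  unfolding sgn3_def norm_mult by (auto simp: sgn_if)

text \<open>The Riemann sums of Duhamel's integral are finite combinations of values of the noise density, so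
  the spectral representation passes to them by linearity. Their limit exists along each path, where
  it is the solution, and for each frequency, where it is the response to a plane wave.\<close>

theorem solution_repr:
  assumes B: "harmonizable_version M W c H0 H1 H2 (frequency_box n) B"
    and smooth: "AE \<omega> in M. smooth_on UNIV (\<lambda>(s, x). B s x \<omega>)"
    and sol: "AE \<omega> in M. wave_solution (mixed_derivative (\<lambda>(s, x). B s x \<omega>)) (\<lambda>(s, x). \<Psi> s x \<omega>)"
    and t: "t > 0"
  shows "symbol (solution_symbol t x)"
    and "AE \<omega> in M. \<Psi> t x \<omega> = c * \<Phi> n (solution_symbol t x) \<omega>"
proof -
  let ?w = "\<lambda>w::spacetime. (t - fst w) * sin (snd (snd w))"
  let ?B = "cone_box t"
  obtain p where p: "\<And>k::nat. p k tagged_division_of ?B"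
    "\<And>k x K. (x, K) \<in> p k \<Longrightarrow> K \<subseteq> ball x (1 / real (Suc k))"
    using fine_divisions by blast
  have fin: "finite (p k)" for k using p(1) by auto
  let ?a = "\<lambda>i::spacetime \<times> spacetime set. measure lborel (snd i) * ?w (fst i) / (2 * pi)"
  let ?f = "\<lambda>i::spacetime \<times> spacetime set. \<lambda>w::spacetime. sgn3 w * cis (light_cone t x (fst i) \<bullet> w)"
  let ?mk = "\<lambda>k w. \<Sum>i\<in>p k. complex_of_real (?a i) * ?f i w"
  have wb: "\<bar>?w v\<bar> \<le> t" if "v \<in> ?B" for v
  proof -
    have "0 \<le> fst v" "fst v \<le> t" using that by (cases v; auto simp: cbox_Pair_eq)+
    then have "\<bar>t - fst v\<bar> * \<bar>sin (snd (snd v))\<bar> \<le> t * 1" by (intro mult_mono) auto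
    then show ?thesis by (simp add: abs_mult)
  qed
  have mkC: "norm (?mk k w) \<le> t * measure lborel ?B" for k w
  proof -
    have "norm (?mk k w) \<le> (\<Sum>i\<in>p k. measure lborel (snd i) * t)"
    proof (rule sum_norm_le)
      fix i assume i: "i \<in> p k"
      then have "fst i \<in> ?B" using tagged_division_ofD(2,3)[OF p(1)[of k], of "fst i" "snd i"] by auto
      note b = wb[OF this]
      have "norm (complex_of_real (?a i) * ?f i w) \<le> \<bar>?a i\<bar> * 1"
        unfolding norm_mult norm_of_real using norm_sgn3_le[of w] by (intro mult_left_mono) auto
      also have "\<bar>?a i\<bar> = measure lborel (snd i) * (\<bar>?w (fst i)\<bar> / (2 * pi))" by (simp add: abs_mult)
      also have "\<dots> * 1 \<le> measure lborel (snd i) * t"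
      proof -
        have "\<bar>?w (fst i)\<bar> / (2 * pi) \<le> \<bar>?w (fst i)\<bar> / 1"
          using pi_ge_two by (intro divide_left_mono) auto
        then have "\<bar>?w (fst i)\<bar> / (2 * pi) \<le> t" using b by linarith
        then have "measure lborel (snd i) * (\<bar>?w (fst i)\<bar> / (2 * pi)) \<le> measure lborel (snd i) * t"
          by (rule mult_left_mono) simp
        then show ?thesis by simp
      qed
      finally show "norm (complex_of_real (?a i) * ?f i w) \<le> measure lborel (snd i) * t" .
    qed
    also have "\<dots> = t * measure lborel ?B"
      using additive_content_tagged_division[OF p(1)[of k]] by (simp add: case_prod_beta mult.commute flip: sum_distrib_left)
    finally show ?thesis .
  qed
  have mk_symbol: "symbol (?mk k)" for k
    by (intro symbol_sum fin symbol_plane_wave)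
  have mk_lim: "(\<lambda>k. ?mk k w) \<longlonglongrightarrow> solution_symbol t x w" for w
  proof -
    let ?g = "\<lambda>v. (?w v) *\<^sub>R cis (light_cone t x v \<bullet> w)"
    have cg: "continuous_on ?B ?g" unfolding light_cone_def by (intro continuous_intros)
    have "(\<lambda>k. sgn3 w / complex_of_real (2 * pi) * (\<Sum>(v, K)\<in>p k. measure lborel K *\<^sub>R ?g v)) \<longlonglongrightarrow> sgn3 w / complex_of_real (2 * pi) * integral ?B ?g"
      by (intro tendsto_mult tendsto_const riemann_sum_tendsto p cg)
    moreover have "sgn3 w / complex_of_real (2 * pi) * (\<Sum>(v, K)\<in>p k. measure lborel K *\<^sub>R ?g v) = ?mk k w" for k
      unfolding sum_distrib_left by (intro sum.cong refl) (simp add: case_prod_beta scaleR_conv_of_real field_simps)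
    moreover have "sgn3 w / complex_of_real (2 * pi) * integral ?B ?g = solution_symbol t x w"
    proof (cases "snd w = 0")
      case True then show ?thesis by (simp add: solution_symbol_def sgn3_def)
    next
      case False
      from cone_integral_plane_wave[OF t False, of x "fst w"] show ?thesis
        by (simp add: solution_symbol_def)
    qed
    ultimately show ?thesis by simp
  qed
  show "symbol (solution_symbol t x)" by (rule symbol_limit[OF mk_symbol mkC mk_lim])
  let ?b = "\<lambda>\<omega>. mixed_derivative (\<lambda>(s, x). B s x \<omega>)"
  show "AE \<omega> in M. \<Psi> t x \<omega> = c * \<Phi> n (solution_symbol t x) \<omega>"
  proof (rule Phi_limit[OF mk_symbol mkC mk_lim])
    show "AE \<omega> in M. (\<Sum>i\<in>p k. ?a i * ?b \<omega> (light_cone t x (fst i))) = c * \<Phi> n (?mk k) \<omega>" for k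
    proof -
      have "AE \<omega> in M. \<forall>i\<in>p k. ?b \<omega> (light_cone t x (fst i)) = c * \<Phi> n (?f i) \<omega>"
        by (intro AE_finite_allI fin density_repr B smooth)
      moreover have "AE \<omega> in M. \<Phi> n (?mk k) \<omega> = (\<Sum>i\<in>p k. ?a i * \<Phi> n (?f i) \<omega>)"
        by (intro Phi_sum fin symbol_plane_wave)
      ultimately show ?thesis
      proof eventually_elim
        case (elim \<omega>)
        have "(\<Sum>i\<in>p k. ?a i * ?b \<omega> (light_cone t x (fst i))) = (\<Sum>i\<in>p k. c * (?a i * \<Phi> n (?f i) \<omega>))"
          using elim(1) by (intro sum.cong refl) simp
        then show ?case unfolding elim(2) by (simp only: sum_distrib_left)
      qed
    qed
    show "AE \<omega> in M. (\<lambda>k. \<Sum>i\<in>p k. ?a i * ?b \<omega> (light_cone t x (fst i))) \<longlonglongrightarrow> \<Psi> t x \<omega>"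
      using sol smooth
    proof eventually_elim
      case (elim \<omega>)
      let ?g = "\<lambda>v. ?w v * ?b \<omega> (light_cone t x v)"
      have "?b \<omega> differentiable_on UNIV" unfolding mixed_derivative_def
        by (rule smooth_on_step(1)[OF smooth_on_step(2)[OF smooth_on_step(2)[OF smooth_on_step(2)[OF elim(2) e_Basis(3)] e_Basis(2)] e_Basis(1)]])
      then have cb: "continuous_on UNIV (?b \<omega>)" by (rule differentiable_imp_continuous_on)
      have cg: "continuous_on ?B ?g"
        by (intro continuous_intros continuous_on_compose2[OF cb]) (auto simp: light_cone_def intro!: continuous_intros)
      have "(\<lambda>k. 1 / (2 * pi) * (\<Sum>(v, K)\<in>p k. measure lborel K *\<^sub>R ?g v)) \<longlonglongrightarrow> 1 / (2 * pi) * integral ?B ?g"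
        by (intro tendsto_mult tendsto_const riemann_sum_tendsto p cg)
      moreover have "1 / (2 * pi) * (\<Sum>(v, K)\<in>p k. measure lborel K *\<^sub>R ?g v) = (\<Sum>i\<in>p k. ?a i * ?b \<omega> (light_cone t x (fst i)))" for k
        unfolding sum_distrib_left by (intro sum.cong refl) (simp add: case_prod_beta field_simps)
      ultimately show ?case using wave_solution_duhamel[OF elim(1) t, of x] by simp
    qed
  qed
qed

end

section \<open>The second moment of the tested Wick square\<close>

lemma dyadic_floor_tendsto: "(\<lambda>k. of_int \<lfloor>2 ^ k * a\<rfloor> / 2 ^ k) \<longlonglongrightarrow> (a::real)"
proof (rule LIMSEQ_I)
  fix r :: real assume r: "r > 0"
  obtain N where N: "(1 / 2 :: real) ^ N < r" using real_arch_pow_inv[OF r, of "1/2"] by auto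
  have "norm (of_int \<lfloor>2 ^ k * a\<rfloor> / 2 ^ k - a) < r" if k: "k \<ge> N" for k
  proof -
    have p: "(2::real) ^ k > 0" by simp
    have "norm (of_int \<lfloor>2 ^ k * a\<rfloor> / 2 ^ k - a) = \<bar>of_int \<lfloor>2 ^ k * a\<rfloor> - 2 ^ k * a\<bar> / 2 ^ k"
      using p by (simp add: field_simps abs_divide flip: abs_mult)
    also have "\<dots> \<le> 1 / 2 ^ k"
    proof (intro divide_right_mono)
      show "\<bar>of_int \<lfloor>2 ^ k * a\<rfloor> - 2 ^ k * a\<bar> \<le> 1" by linarith
    qed simp
    also have "\<dots> = (1 / 2) ^ k" by (simp add: power_divide)
    also have "\<dots> \<le> (1 / 2) ^ N" using k by (intro power_decreasing) auto
    finally show ?thesis using N by linarith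
  qed
  then show "\<exists>N. \<forall>k\<ge>N. norm (of_int \<lfloor>2 ^ k * a\<rfloor> / 2 ^ k - a) < r" by blast
qed

text \<open>A process with continuous paths is the limit of its values on dyadic grids, hence jointly
  measurable.\<close>

lemma continuous_paths_measurable:
  fixes Z :: "plane \<Rightarrow> 'w \<Rightarrow> real"
  assumes m: "\<And>y. Z y \<in> borel_measurable M" and c: "\<And>\<omega>. continuous_on UNIV (\<lambda>y. Z y \<omega>)"
  shows "(\<lambda>(y, \<omega>). Z y \<omega>) \<in> borel_measurable (lborel \<Otimes>\<^sub>M M)"
proof (rule borel_measurable_LIMSEQ_metric)
  let ?L = "lborel \<Otimes>\<^sub>M M :: (plane \<times> 'w) measure"
  have fl: "(\<lambda>p. \<lfloor>2 ^ k * fst (fst p)\<rfloor>) \<in> measurable ?L (count_space UNIV)"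
    "(\<lambda>p. \<lfloor>2 ^ k * snd (fst p)\<rfloor>) \<in> measurable ?L (count_space UNIV)" for k :: nat
  proof -
    have f: "(\<lambda>y::plane. \<lfloor>2 ^ k * fst y\<rfloor>) \<in> measurable borel (count_space UNIV)"
      "(\<lambda>y::plane. \<lfloor>2 ^ k * snd y\<rfloor>) \<in> measurable borel (count_space UNIV)"
      by (intro measurable_compose[OF _ measurable_real_floor] borel_measurable_continuous_onI continuous_intros)+
    have g: "fst \<in> measurable ?L borel" using measurable_fst[of lborel M] by simp
    show "(\<lambda>p. \<lfloor>2 ^ k * fst (fst p)\<rfloor>) \<in> measurable ?L (count_space UNIV)"
      "(\<lambda>p. \<lfloor>2 ^ k * snd (fst p)\<rfloor>) \<in> measurable ?L (count_space UNIV)"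
      using measurable_compose[OF g f(1)] measurable_compose[OF g f(2)] by simp_all
  qed
  show "(\<lambda>p. Z (of_int \<lfloor>2 ^ k * fst (fst p)\<rfloor> / 2 ^ k, of_int \<lfloor>2 ^ k * snd (fst p)\<rfloor> / 2 ^ k) (snd p)) \<in> borel_measurable ?L" for k
  proof (rule measurable_compose_countable[OF _ fl(1)[of k], where f = "\<lambda>i p. Z (of_int i / 2 ^ k, of_int \<lfloor>2 ^ k * snd (fst p)\<rfloor> / 2 ^ k) (snd p)"])
    fix i :: int
    show "(\<lambda>p. Z (of_int i / 2 ^ k, of_int \<lfloor>2 ^ k * snd (fst p)\<rfloor> / 2 ^ k) (snd p)) \<in> borel_measurable ?L"
    proof (rule measurable_compose_countable[OF _ fl(2)[of k], where f = "\<lambda>j p. Z (of_int i / 2 ^ k, of_int j / 2 ^ k) (snd p)"])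
      fix j :: int
      show "(\<lambda>p. Z (of_int i / 2 ^ k, of_int j / 2 ^ k) (snd p)) \<in> borel_measurable ?L"
        by (rule measurable_compose[OF measurable_snd m])
    qed
  qed
  fix p :: "plane \<times> 'w"
  have "(\<lambda>k. (of_int \<lfloor>2 ^ k * fst (fst p)\<rfloor> / 2 ^ k, of_int \<lfloor>2 ^ k * snd (fst p)\<rfloor> / 2 ^ k)) \<longlonglongrightarrow> (fst (fst p), snd (fst p))"
    by (intro tendsto_Pair dyadic_floor_tendsto)
  then have "(\<lambda>k. Z (of_int \<lfloor>2 ^ k * fst (fst p)\<rfloor> / 2 ^ k, of_int \<lfloor>2 ^ k * snd (fst p)\<rfloor> / 2 ^ k) (snd p)) \<longlonglongrightarrow> Z (fst (fst p), snd (fst p)) (snd p)"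
    by (rule continuous_on_tendsto_compose[OF c]) auto
  then show "(\<lambda>k. Z (of_int \<lfloor>2 ^ k * fst (fst p)\<rfloor> / 2 ^ k, of_int \<lfloor>2 ^ k * snd (fst p)\<rfloor> / 2 ^ k) (snd p)) \<longlonglongrightarrow> (case p of (y, \<omega>) \<Rightarrow> Z y \<omega>)"
    by (simp add: case_prod_beta)
qed

lemma lborel_integral_pair_mult:
  fixes f :: "'a::euclidean_space \<Rightarrow> real" and g :: "'b::euclidean_space \<Rightarrow> real"
  assumes f: "integrable lborel f" and g: "integrable lborel g"
  shows "integrable lborel (\<lambda>p. f (fst p) * g (snd p))"
    and "(LINT p|lborel. f (fst p) * g (snd p)) = (LINT x|lborel. f x) * (LINT y|lborel. g y)"
proof -
  have I: "integrable (lborel \<Otimes>\<^sub>M lborel) (\<lambda>(x, y). f x * g y)" by (rule integrable_pair_mult[OF f g])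
  then show "integrable lborel (\<lambda>p. f (fst p) * g (snd p))"
    by (simp add: lborel_prod split_beta')
  have "(LINT p|lborel. f (fst p) * g (snd p)) = integral\<^sup>L (lborel \<Otimes>\<^sub>M lborel) (\<lambda>(x, y). f x * g y)"
    by (simp add: lborel_prod split_beta')
  also have "\<dots> = (LINT x|lborel. (LINT y|lborel. f x * g y))"
    by (rule lborel_pair.integral_fst[OF I, symmetric])
  also have "\<dots> = (LINT x|lborel. f x) * (LINT y|lborel. g y)" by simp
  finally show "(LINT p|lborel. f (fst p) * g (snd p)) = (LINT x|lborel. f x) * (LINT y|lborel. g y)" .
qed

text \<open>By Fubini the second moment is a double integral of the covariances of the Wick squares, and each
  of these is twice a squared covariance of the field.\<close>

lemma (in prob_space) wick_second_moment:
  fixes Z :: "plane \<Rightarrow> 'a \<Rightarrow> real" and \<theta> :: "plane \<Rightarrow> real"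
  assumes gauss: "\<And>y y' a b. centered_gaussian M (\<lambda>\<omega>. a * Z y \<omega> + b * Z y' \<omega>)"
    and cont: "\<And>\<omega>. continuous_on UNIV (\<lambda>y. Z y \<omega>)"
    and S: "\<And>y. expectation (\<lambda>\<omega>. (Z y \<omega>)\<^sup>2) = S"
    and \<theta>: "continuous_on UNIV \<theta>" "\<And>y. \<theta> y \<ge> 0" "compact T" "{y. \<theta> y \<noteq> 0} \<subseteq> T"
  defines "u \<equiv> \<lambda>\<omega>. LINT y|lborel. ((Z y \<omega>)\<^sup>2 - S) * \<theta> y"
    and "K \<equiv> \<lambda>p. expectation (\<lambda>\<omega>. Z (fst p) \<omega> * Z (snd p) \<omega>)"
  shows "integrable lborel (\<lambda>p. \<theta> (fst p) * \<theta> (snd p) * (K p)\<^sup>2)"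
    and "integrable M (\<lambda>\<omega>. (u \<omega>)\<^sup>2)"
    and "(\<integral>\<^sup>+\<omega>. ennreal ((u \<omega>)\<^sup>2) \<partial>M) = ennreal (2 * (LINT p|lborel. \<theta> (fst p) * \<theta> (snd p) * (K p)\<^sup>2))"
proof -
  interpret P: pair_sigma_finite "lborel :: (plane \<times> plane) measure" M ..
  have gZ: "centered_gaussian M (Z y)" for y using gauss[of 1 y 0 y] by simp
  note mom = centered_gaussian_moments[OF gZ]
  have Zm[measurable]: "Z y \<in> borel_measurable M" for y by (rule mom)
  let ?w = "\<lambda>y \<omega>. (Z y \<omega>)\<^sup>2 - S"
  have wick: "integrable M (\<lambda>\<omega>. ?w y \<omega> * ?w y' \<omega>)" "expectation (\<lambda>\<omega>. ?w y \<omega> * ?w y' \<omega>) = 2 * (expectation (\<lambda>\<omega>. Z y \<omega> * Z y' \<omega>))\<^sup>2" for y y'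
    using gaussian_wick_covariance[of "Z y" "Z y'", OF gauss] by (simp_all add: S)
  have ZM: "(\<lambda>(y, \<omega>). Z y \<omega>) \<in> borel_measurable (lborel \<Otimes>\<^sub>M M)"
    by (rule continuous_paths_measurable[OF Zm cont])
  have pr: "(\<lambda>q. (fst (fst q), snd q)) \<in> measurable ((lborel :: (plane \<times> plane) measure) \<Otimes>\<^sub>M M) (lborel \<Otimes>\<^sub>M M)"
    "(\<lambda>q. (snd (fst q), snd q)) \<in> measurable ((lborel :: (plane \<times> plane) measure) \<Otimes>\<^sub>M M) (lborel \<Otimes>\<^sub>M M)"
    unfolding lborel_prod[where 'a=plane and 'b=plane, symmetric] by measurable
  have Z1: "(\<lambda>q. Z (fst (fst q)) (snd q)) \<in> borel_measurable ((lborel :: (plane \<times> plane) measure) \<Otimes>\<^sub>M M)"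
    and Z2: "(\<lambda>q. Z (snd (fst q)) (snd q)) \<in> borel_measurable ((lborel :: (plane \<times> plane) measure) \<Otimes>\<^sub>M M)"
    using measurable_compose[OF pr(1) ZM] measurable_compose[OF pr(2) ZM] by simp_all
  have \<theta>m[measurable]: "\<theta> \<in> borel_measurable borel" by (rule borel_measurable_continuous_onI[OF \<theta>(1)])
  have th: "(\<lambda>p. \<theta> (fst p) * \<theta> (snd p)) \<in> borel_measurable (lborel :: (plane \<times> plane) measure)"
    unfolding lborel_prod[where 'a=plane and 'b=plane, symmetric] by measurable
  have th': "(\<lambda>q. \<theta> (fst (fst q)) * \<theta> (snd (fst q))) \<in> borel_measurable ((lborel :: (plane \<times> plane) measure) \<Otimes>\<^sub>M M)"
    using measurable_compose[OF measurable_fst[of _ M] th] by simp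
  have compact_int: "integrable lborel (\<lambda>y. g y * \<theta> y)" if g: "continuous_on UNIV g" for g :: "plane \<Rightarrow> real"
  proof -
    have "integrable lborel (\<lambda>y. indicator T y *\<^sub>R (g y * \<theta> y))"
      by (rule borel_integrable_compact[OF \<theta>(3)])
        (intro continuous_intros continuous_on_subset[OF g] continuous_on_subset[OF \<theta>(1)]; simp)
    moreover have "(\<lambda>y. indicator T y *\<^sub>R (g y * \<theta> y)) = (\<lambda>y. g y * \<theta> y)"
      using \<theta>(4) by (auto simp: fun_eq_iff indicator_def)
    ultimately show ?thesis by simp
  qed
  have \<theta>i: "integrable lborel \<theta>" using compact_int[of "\<lambda>_. 1"] by simp
  let ?F = "\<lambda>p \<omega>. \<theta> (fst p) * \<theta> (snd p) * (?w (fst p) \<omega> * ?w (snd p) \<omega>)"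
  have Fm: "(\<lambda>(p, \<omega>). ?F p \<omega>) \<in> borel_measurable (lborel \<Otimes>\<^sub>M M)"
  proof -
    have "(\<lambda>q. ?F (fst q) (snd q)) \<in> borel_measurable ((lborel :: (plane \<times> plane) measure) \<Otimes>\<^sub>M M)"
      by (intro borel_measurable_times[OF th'] borel_measurable_times borel_measurable_diff
          borel_measurable_power Z1 Z2 borel_measurable_const)
    then show ?thesis by (simp add: split_beta')
  qed
  have ww: "expectation (\<lambda>\<omega>. \<bar>?w y \<omega> * ?w y' \<omega>\<bar>) \<le> 4 * S\<^sup>2" for y y'
  proof -
    have sq: "integrable M (\<lambda>\<omega>. (?w y \<omega>)\<^sup>2)" "expectation (\<lambda>\<omega>. (?w y \<omega>)\<^sup>2) = 2 * S\<^sup>2" for y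
      using wick[of y y] S[of y] by (simp_all add: power2_eq_square)
    have "expectation (\<lambda>\<omega>. \<bar>?w y \<omega> * ?w y' \<omega>\<bar>) \<le> expectation (\<lambda>\<omega>. (?w y \<omega>)\<^sup>2 + (?w y' \<omega>)\<^sup>2)"
      using wick(1) sq(1) abs_mult_le_squares by (intro integral_mono) auto
    also have "\<dots> = 4 * S\<^sup>2" using sq by simp
    finally show ?thesis .
  qed
  have FI: "integrable (lborel \<Otimes>\<^sub>M M) (\<lambda>(p, \<omega>). ?F p \<omega>)"
  proof (rule P.Fubini_integrable[OF Fm])
    show "AE p in lborel. integrable M (\<lambda>\<omega>. case (p, \<omega>) of (p, \<omega>) \<Rightarrow> ?F p \<omega>)"
      using wick(1) by simp
    show "integrable lborel (\<lambda>p. \<integral>\<omega>. norm (case (p, \<omega>) of (p, \<omega>) \<Rightarrow> ?F p \<omega>) \<partial>M)"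
    proof (rule Bochner_Integration.integrable_bound)
      show "integrable lborel (\<lambda>p. \<theta> (fst p) * \<theta> (snd p) * (4 * S\<^sup>2))"
        by (intro integrable_mult_left lborel_integral_pair_mult \<theta>i)
      have "(\<lambda>(p, \<omega>). norm (?F p \<omega>)) \<in> borel_measurable (lborel \<Otimes>\<^sub>M M)"
        using measurable_compose[OF Fm borel_measurable_norm] by (simp only: split_beta')
      from borel_measurable_lebesgue_integral[OF this]
      show "(\<lambda>p. \<integral>\<omega>. norm (case (p, \<omega>) of (p, \<omega>) \<Rightarrow> ?F p \<omega>) \<partial>M) \<in> borel_measurable lborel" by simp
      show "AE p in lborel. norm (\<integral>\<omega>. norm (case (p, \<omega>) of (p, \<omega>) \<Rightarrow> ?F p \<omega>) \<partial>M) \<le> norm (\<theta> (fst p) * \<theta> (snd p) * (4 * S\<^sup>2))"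
      proof (intro AE_I2)
        fix p :: "plane \<times> plane"
        have t0: "\<theta> (fst p) * \<theta> (snd p) \<ge> 0" using \<theta>(2) by simp
        have "(\<integral>\<omega>. norm (case (p, \<omega>) of (p, \<omega>) \<Rightarrow> ?F p \<omega>) \<partial>M) = \<theta> (fst p) * \<theta> (snd p) * expectation (\<lambda>\<omega>. \<bar>?w (fst p) \<omega> * ?w (snd p) \<omega>\<bar>)"
          unfolding prod.case real_norm_def abs_mult[of "\<theta> (fst p) * \<theta> (snd p)"] abs_of_nonneg[OF t0]
          by (rule integral_mult_right_zero)
        also have "\<dots> \<le> \<theta> (fst p) * \<theta> (snd p) * (4 * S\<^sup>2)" by (intro mult_left_mono ww t0)
        finally show "norm (\<integral>\<omega>. norm (case (p, \<omega>) of (p, \<omega>) \<Rightarrow> ?F p \<omega>) \<partial>M) \<le> norm (\<theta> (fst p) * \<theta> (snd p) * (4 * S\<^sup>2))"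
          by (simp del: norm_mult)
      qed
    qed
  qed
  have inner: "(\<integral>\<omega>. ?F p \<omega> \<partial>M) = 2 * (\<theta> (fst p) * \<theta> (snd p) * (K p)\<^sup>2)" for p
    unfolding K_def using wick(2) by simp
  have "integrable lborel (\<lambda>p. 2 * (\<theta> (fst p) * \<theta> (snd p) * (K p)\<^sup>2))"
    using P.integrable_fst[OF FI] unfolding inner .
  then show "integrable lborel (\<lambda>p. \<theta> (fst p) * \<theta> (snd p) * (K p)\<^sup>2)"
    using integrable_mult_right[of "1/2" lborel "\<lambda>p. 2 * (\<theta> (fst p) * \<theta> (snd p) * (K p)\<^sup>2)"] by simp
  have usq: "(\<integral>p. ?F p \<omega> \<partial>lborel) = (u \<omega>)\<^sup>2" for \<omega>
  proof -
    have g: "integrable lborel (\<lambda>y. ?w y \<omega> * \<theta> y)"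
      by (intro compact_int continuous_intros cont)
    have "(\<integral>p. ?F p \<omega> \<partial>lborel) = (LINT p|lborel. (?w (fst p) \<omega> * \<theta> (fst p)) * (?w (snd p) \<omega> * \<theta> (snd p)))"
      by (simp add: mult_ac)
    also have "\<dots> = u \<omega> * u \<omega>" unfolding u_def by (rule lborel_integral_pair_mult(2)[OF g g])
    finally show ?thesis by (simp add: power2_eq_square)
  qed
  show iu: "integrable M (\<lambda>\<omega>. (u \<omega>)\<^sup>2)" using P.integrable_snd[OF FI] unfolding usq .
  have "expectation (\<lambda>\<omega>. (u \<omega>)\<^sup>2) = (LINT p|lborel. (\<integral>\<omega>. ?F p \<omega> \<partial>M))"
    using P.Fubini_integral[OF FI] unfolding usq .
  also have "\<dots> = 2 * (LINT p|lborel. \<theta> (fst p) * \<theta> (snd p) * (K p)\<^sup>2)" unfolding inner by simp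
  finally show "(\<integral>\<^sup>+\<omega>. ennreal ((u \<omega>)\<^sup>2) \<partial>M) = ennreal (2 * (LINT p|lborel. \<theta> (fst p) * \<theta> (snd p) * (K p)\<^sup>2))"
    using nn_integral_eq_integral[OF iu] by simp
qed

section \<open>Spectral lower bound\<close>

lemma cos_ge_half: "\<bar>x::real\<bar> \<le> 1 \<Longrightarrow> cos x \<ge> 1 / 2"
proof -
  assume x: "\<bar>x\<bar> \<le> 1"
  have "cos \<bar>x\<bar> \<ge> cos (pi / 3)"
    using x pi_gt3 by (intro cos_monotone_0_pi_le) auto
  then show ?thesis by (simp add: cos_60)
qed

text \<open>By the addition theorem the integral is a sum of two squares, hence nonnegative; for small \<open>\<zeta>\<close>
  the cosine is at least \<open>1/2\<close> on all of \<open>Q \<times> Q\<close>.\<close>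

lemma ball_cos_energy:
  fixes a \<zeta> :: plane
  assumes r: "r > 0"
  defines "Q \<equiv> ball a (r / 2)"
  shows "integrable lborel (\<lambda>p. indicator Q (fst p) * indicator Q (snd p) * cos ((fst p - snd p) \<bullet> \<zeta>) :: real)"
    and "(LINT p|lborel. indicator Q (fst p) * indicator Q (snd p) * cos ((fst p - snd p) \<bullet> \<zeta>)) \<ge> (0::real)"
    and "norm \<zeta> \<le> 1 / r \<Longrightarrow>
      (LINT p|lborel. indicator Q (fst p) * indicator Q (snd p) * cos ((fst p - snd p) \<bullet> \<zeta>)) \<ge> (measure lborel Q)\<^sup>2 / 2"
proof -
  have [measurable]: "Q \<in> sets borel" by (simp add: Q_def)
  have Qf: "emeasure lborel Q < \<infinity>" unfolding Q_def by (rule emeasure_lborel_ball_finite)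
  have iQ: "integrable lborel (indicator Q :: plane \<Rightarrow> real)"
    using Qf by (intro integrable_real_indicator) auto
  have ic: "integrable lborel (\<lambda>y. indicator Q y * cos (y \<bullet> \<zeta>))" and isn: "integrable lborel (\<lambda>y. indicator Q y * sin (y \<bullet> \<zeta>))"
    by (rule Bochner_Integration.integrable_bound[OF iQ]; auto simp: indicator_def)+
  have eq: "indicator Q (fst p) * indicator Q (snd p) * cos ((fst p - snd p) \<bullet> \<zeta>)
    = (indicator Q (fst p) * cos (fst p \<bullet> \<zeta>)) * (indicator Q (snd p) * cos (snd p \<bullet> \<zeta>))
     + (indicator Q (fst p) * sin (fst p \<bullet> \<zeta>)) * (indicator Q (snd p) * sin (snd p \<bullet> \<zeta>) :: real)" for p
    by (simp add: inner_diff_left cos_diff algebra_simps)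
  note c = lborel_integral_pair_mult[OF ic ic] and s = lborel_integral_pair_mult[OF isn isn]
  show I: "integrable lborel (\<lambda>p. indicator Q (fst p) * indicator Q (snd p) * cos ((fst p - snd p) \<bullet> \<zeta>) :: real)"
    unfolding eq by (intro Bochner_Integration.integrable_add c s)
  show "(LINT p|lborel. indicator Q (fst p) * indicator Q (snd p) * cos ((fst p - snd p) \<bullet> \<zeta>)) \<ge> (0::real)"
    unfolding eq Bochner_Integration.integral_add[OF c(1) s(1)] c(2) s(2) by simp
  assume \<zeta>: "norm \<zeta> \<le> 1 / r"
  note q = lborel_integral_pair_mult[OF iQ iQ]
  have "(measure lborel Q)\<^sup>2 / 2 = (LINT p|lborel. indicator Q (fst p) * indicator Q (snd p) * (1 / 2))"
    using q Qf by (simp add: power2_eq_square)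
  also have "\<dots> \<le> (LINT p|lborel. indicator Q (fst p) * indicator Q (snd p) * cos ((fst p - snd p) \<bullet> \<zeta>))"
  proof (rule integral_mono[OF _ I])
    show "integrable lborel (\<lambda>p. indicator Q (fst p) * indicator Q (snd p) * (1 / 2) :: real)"
      using q by simp
    fix p
    show "indicator Q (fst p) * indicator Q (snd p) * (1 / 2) \<le> indicator Q (fst p) * indicator Q (snd p) * cos ((fst p - snd p) \<bullet> \<zeta>)"
    proof (cases "fst p \<in> Q \<and> snd p \<in> Q")
      case True
      then have "dist (fst p) a < r / 2" "dist (snd p) a < r / 2" by (auto simp: Q_def dist_commute)
      then have "norm (fst p - snd p) \<le> r" using dist_triangle2[of "fst p" "snd p" a] by (simp add: dist_norm)
      then have "\<bar>(fst p - snd p) \<bullet> \<zeta>\<bar> \<le> r * (1 / r)"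
        using r \<zeta> by (intro order_trans[OF Cauchy_Schwarz_ineq2] mult_mono) auto
      then show ?thesis using True r cos_ge_half by simp
    next
      case False then show ?thesis by (auto simp: indicator_def)
    qed
  qed
  finally show "(LINT p|lborel. indicator Q (fst p) * indicator Q (snd p) * cos ((fst p - snd p) \<bullet> \<zeta>)) \<ge> (measure lborel Q)\<^sup>2 / 2" .
qed

text \<open>Expanding the square turns the energy into a double integral of \<open>\<rho> w * \<rho> w'\<close> against a kernel
  that is nonnegative everywhere and at least \<open>\<bar>Q\<bar>\<^sup>2 / 4\<close> where the spatial frequencies differ by at most
  \<open>1 / r\<close>. Restricting to pairs in a common cell leaves the squares of the cell masses.\<close>

lemma spectral_energy_lower_bound:
  fixes \<rho> :: "spacetime \<Rightarrow> real" and a :: plane and C :: "'i \<Rightarrow> spacetime set"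
  assumes \<rho>: "integrable lborel \<rho>" "\<And>w. \<rho> w \<ge> 0" and r: "r > 0"
    and I: "finite I" "\<And>i. i \<in> I \<Longrightarrow> C i \<in> sets borel" "disjoint_family_on C I"
    and small: "\<And>i w w'. i \<in> I \<Longrightarrow> w \<in> C i \<Longrightarrow> w' \<in> C i \<Longrightarrow> norm (snd w - snd w') \<le> 1 / r"
  defines "Q \<equiv> ball a (r / 2)"
    and "K \<equiv> \<lambda>p. LINT w|lborel. \<rho> w * cos ((fst p - snd p) \<bullet> snd w)"
  shows "(measure lborel Q)\<^sup>2 / 4 * (\<Sum>i\<in>I. (LINT w|lborel. indicator (C i) w * \<rho> w)\<^sup>2)
    \<le> (LINT p|lborel. indicator Q (fst p) * indicator Q (snd p) * (K p)\<^sup>2)"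
proof -
  let ?q = "measure lborel Q"
  have [measurable]: "Q \<in> sets borel" by (simp add: Q_def)
  have \<rho>m[measurable]: "\<rho> \<in> borel_measurable borel" using \<rho>(1) borel_measurable_integrable by auto
  have iQ: "integrable lborel (indicator Q :: plane \<Rightarrow> real)"
    unfolding Q_def by (intro integrable_real_indicator emeasure_lborel_ball_finite) auto
  have QQ: "integrable lborel (\<lambda>p. indicator Q (fst p) * indicator Q (snd p) :: real)"
    by (rule lborel_integral_pair_mult(1)[OF iQ iQ])
  have RR: "integrable lborel (\<lambda>v. \<rho> (fst v) * \<rho> (snd v))"
    by (rule lborel_integral_pair_mult(1)[OF \<rho>(1) \<rho>(1)])
  have ccos: "continuous_on UNIV (cos :: real \<Rightarrow> real)"
    by (intro continuous_at_imp_continuous_on) simp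
  let ?g = "\<lambda>p v. cos ((fst p - snd p) \<bullet> snd (fst v)) * cos ((fst p - snd p) \<bullet> snd (snd v)) :: real"
  let ?G = "\<lambda>(p::plane \<times> plane) (v::spacetime \<times> spacetime). (indicator Q (fst p) * indicator Q (snd p)) * (\<rho> (fst v) * \<rho> (snd v)) * ?g p v"
  have gc: "(\<lambda>z. ?g (fst z) (snd z)) \<in> borel_measurable borel"
    by (intro borel_measurable_continuous_onI continuous_on_mult continuous_on_compose2[OF ccos]
        continuous_intros) auto
  have gm: "(\<lambda>(p, v). ?g p v) \<in> borel_measurable (lborel \<Otimes>\<^sub>M lborel)"
    using gc by (simp add: split_beta' lborel_prod)
  have GI: "integrable (lborel \<Otimes>\<^sub>M lborel) (\<lambda>(p, v). ?G p v)"
  proof (rule Bochner_Integration.integrable_bound[OF integrable_pair_mult[OF QQ RR]])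
    have "(\<lambda>(p, v). (indicator Q (fst p) * indicator Q (snd p)) * (\<rho> (fst v) * \<rho> (snd v))) \<in> borel_measurable (lborel \<Otimes>\<^sub>M lborel)"
      using integrable_pair_mult[OF QQ RR] by (rule borel_measurable_integrable)
    from borel_measurable_times[OF this gm]
    show "(\<lambda>(p, v). ?G p v) \<in> borel_measurable (lborel \<Otimes>\<^sub>M lborel)" by (simp only: split_beta')
    have g1: "\<bar>?g p v\<bar> \<le> 1" for p v
      unfolding abs_mult using mult_mono[OF abs_cos_le_one abs_cos_le_one] by simp
    show "AE z in lborel \<Otimes>\<^sub>M lborel. norm (case z of (p, v) \<Rightarrow> ?G p v)
      \<le> norm (case z of (p, v) \<Rightarrow> (indicator Q (fst p) * indicator Q (snd p)) * (\<rho> (fst v) * \<rho> (snd v)))"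
    proof (intro AE_I2)
      fix z :: "(plane \<times> plane) \<times> (spacetime \<times> spacetime)"
      obtain p v where z: "z = (p, v)" by (cases z)
      show "norm (case z of (p, v) \<Rightarrow> ?G p v)
      \<le> norm (case z of (p, v) \<Rightarrow> (indicator Q (fst p) * indicator Q (snd p)) * (\<rho> (fst v) * \<rho> (snd v)))"
      proof -
        have le: "\<bar>X * Y\<bar> \<le> \<bar>X\<bar>" if "\<bar>Y\<bar> \<le> 1" for X Y :: real
          using that by (simp add: abs_mult mult_left_le)
        show ?thesis unfolding z prod.case real_norm_def by (rule le[OF g1])
      qed
    qed
  qed
  have Kint: "integrable lborel (\<lambda>w. \<rho> w * cos (y \<bullet> snd w))" for y
  proof (rule Bochner_Integration.integrable_bound[OF \<rho>(1)])
    have "(\<lambda>w::spacetime. cos (y \<bullet> snd w)) \<in> borel_measurable borel"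
      by (intro borel_measurable_continuous_onI continuous_on_compose2[OF ccos] continuous_intros) auto
    then show "(\<lambda>w. \<rho> w * cos (y \<bullet> snd w)) \<in> borel_measurable lborel" by simp
    show "AE w in lborel. norm (\<rho> w * cos (y \<bullet> snd w)) \<le> norm (\<rho> w)"
      by (intro AE_I2) (simp add: abs_mult mult_left_le)
  qed
  have Ksq: "(LINT v|lborel. ?G p v) = indicator Q (fst p) * indicator Q (snd p) * (K p)\<^sup>2" for p
  proof -
    have "(LINT v|lborel. ?G p v) = (LINT v|lborel. (indicator Q (fst p) * indicator Q (snd p)) *
       ((\<rho> (fst v) * cos ((fst p - snd p) \<bullet> snd (fst v))) * (\<rho> (snd v) * cos ((fst p - snd p) \<bullet> snd (snd v)))))"
      by (simp add: mult_ac)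
    also have "\<dots> = (indicator Q (fst p) * indicator Q (snd p)) * (K p * K p)"
      unfolding integral_mult_right_zero lborel_integral_pair_mult(2)[OF Kint Kint] K_def ..
    finally show ?thesis by (simp add: power2_eq_square)
  qed
  let ?E = "\<lambda>\<zeta>. LINT p|lborel. indicator Q (fst p) * indicator Q (snd p) * cos ((fst p - snd p) \<bullet> \<zeta>) :: real"
  note E = ball_cos_energy[OF r, where a = a, folded Q_def]
  have J: "(LINT p|lborel. ?G p v) = \<rho> (fst v) * \<rho> (snd v) * ((?E (snd (fst v) - snd (snd v)) + ?E (snd (fst v) + snd (snd v))) / 2)" for v
  proof -
    have g: "?g p v = (cos ((fst p - snd p) \<bullet> (snd (fst v) - snd (snd v))) + cos ((fst p - snd p) \<bullet> (snd (fst v) + snd (snd v)))) / 2" for p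
      by (simp add: inner_diff_right inner_add_right cos_diff cos_add)
    have "(LINT p|lborel. ?G p v) = (LINT p|lborel. (\<rho> (fst v) * \<rho> (snd v) / 2) *
        (indicator Q (fst p) * indicator Q (snd p) * cos ((fst p - snd p) \<bullet> (snd (fst v) - snd (snd v)))
        + indicator Q (fst p) * indicator Q (snd p) * cos ((fst p - snd p) \<bullet> (snd (fst v) + snd (snd v)))))"
      unfolding g by (simp add: field_simps)
    also have "\<dots> = (\<rho> (fst v) * \<rho> (snd v) / 2) * (?E (snd (fst v) - snd (snd v)) + ?E (snd (fst v) + snd (snd v)))"
      unfolding integral_mult_right_zero Bochner_Integration.integral_add[OF E(1) E(1)] ..
    finally show ?thesis by simp
  qed
  let ?c = "\<lambda>i w. indicator (C i) w * \<rho> w"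
  have ci: "integrable lborel (?c i)" if "i \<in> I" for i
  proof (rule Bochner_Integration.integrable_bound[OF \<rho>(1)])
    show "?c i \<in> borel_measurable lborel" using I(2)[OF that] by simp
  qed (auto simp: indicator_def)
  note cc = lborel_integral_pair_mult[OF ci ci]
  have Jlow: "(\<Sum>i\<in>I. ?q\<^sup>2 / 4 * (?c i (fst v) * ?c i (snd v))) \<le> (LINT p|lborel. ?G p v)" for v
  proof (cases "\<exists>i\<in>I. fst v \<in> C i \<and> snd v \<in> C i")
    case True
    then obtain i where i: "i \<in> I" "fst v \<in> C i" "snd v \<in> C i" by blast
    have z: "?q\<^sup>2 / 4 * (?c j (fst v) * ?c j (snd v)) = 0" if "j \<in> I - {i}" for j
    proof -
      have "C j \<inter> C i = {}" using I(3) that i(1) by (auto simp: disjoint_family_on_def)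
      then show ?thesis using i by (auto simp: indicator_def)
    qed
    have "(\<Sum>i\<in>I. ?q\<^sup>2 / 4 * (?c i (fst v) * ?c i (snd v))) = ?q\<^sup>2 / 4 * (?c i (fst v) * ?c i (snd v))"
      using sum.remove[OF I(1) i(1), of "\<lambda>i. ?q\<^sup>2 / 4 * (?c i (fst v) * ?c i (snd v))"] z by (simp add: sum.neutral)
    also have "\<dots> = \<rho> (fst v) * \<rho> (snd v) * ((?q\<^sup>2 / 2 + 0) / 2)" using i by simp
    also have "\<dots> \<le> \<rho> (fst v) * \<rho> (snd v) * ((?E (snd (fst v) - snd (snd v)) + ?E (snd (fst v) + snd (snd v))) / 2)"
      by (intro mult_left_mono divide_right_mono add_mono E(2) E(3)[OF small[OF i]] mult_nonneg_nonneg \<rho>(2)) simp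
    finally show ?thesis unfolding J .
  next
    case False
    then have "(\<Sum>i\<in>I. ?q\<^sup>2 / 4 * (?c i (fst v) * ?c i (snd v))) = 0"
      by (intro sum.neutral) (auto simp: indicator_def)
    also have "0 \<le> (LINT p|lborel. ?G p v)"
      unfolding J by (intro mult_nonneg_nonneg \<rho>(2) divide_nonneg_nonneg add_nonneg_nonneg E(2)) auto
    finally show ?thesis .
  qed
  have "?q\<^sup>2 / 4 * (\<Sum>i\<in>I. (LINT w|lborel. ?c i w)\<^sup>2) = (\<Sum>i\<in>I. ?q\<^sup>2 / 4 * (LINT v|lborel. ?c i (fst v) * ?c i (snd v)))"
    unfolding sum_distrib_left by (intro sum.cong refl) (simp add: cc(2) power2_eq_square)
  also have "\<dots> = (LINT v|lborel. (\<Sum>i\<in>I. ?q\<^sup>2 / 4 * (?c i (fst v) * ?c i (snd v))))"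
    by (subst Bochner_Integration.integral_sum) (auto intro!: integrable_mult_right cc(1))
  also have "\<dots> \<le> (LINT v|lborel. (LINT p|lborel. ?G p v))"
  proof (rule integral_mono)
    show "integrable lborel (\<lambda>v. \<Sum>i\<in>I. ?q\<^sup>2 / 4 * (?c i (fst v) * ?c i (snd v)))"
      by (intro Bochner_Integration.integrable_sum integrable_mult_right cc(1))
    show "integrable lborel (\<lambda>v. LINT p|lborel. ?G p v)" by (rule lborel_pair.integrable_snd[OF GI])
  qed (rule Jlow)
  also have "\<dots> = (LINT p|lborel. (LINT v|lborel. ?G p v))" by (rule lborel_pair.Fubini_integral[OF GI])
  finally show ?thesis unfolding Ksq .
qed

section \<open>Divergence\<close>

text \<open>The factor \<open>1/4\<close> is the value at the extreme exponent \<open>-1\<close> and the extreme ratio \<open>v = 4 \<rho>\<close>.\<close>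

lemma powr_lower_comparable:
  fixes v e \<rho> :: real
  assumes \<rho>: "\<rho> > 0" and v: "\<rho> \<le> v" "v \<le> 4 * \<rho>" and e: "e \<ge> -1"
  shows "v powr e \<ge> \<rho> powr e / 4"
proof (cases "e \<ge> 0")
  case True
  then have "\<rho> powr e \<le> v powr e" using \<rho> v by (intro powr_mono2) auto
  moreover have "\<rho> powr e \<ge> 0" by simp
  ultimately show ?thesis by linarith
next
  case False
  have "(4::real) powr -1 \<le> 4 powr e" using e by (intro powr_mono) auto
  then have "1 / 4 \<le> (4::real) powr e" by (simp add: powr_minus)
  then have "\<rho> powr e * (1 / 4) \<le> \<rho> powr e * 4 powr e" by (intro mult_left_mono) auto
  also have "\<dots> = (4 * \<rho>) powr e" using \<rho> by (simp add: powr_mult)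
  also have "\<dots> \<le> v powr e" using \<rho> v False by (intro powr_mono2') auto
  finally show ?thesis by simp
qed

text \<open>In space a lattice square of side \<open>\<delta>\<close>, in time an interval of length \<open>\<tau>\<close> that starts on the
  resonance \<open>\<xi> = \<bar>\<eta>\<bar>\<close> of the lower left corner.\<close>

definition cell :: "real \<Rightarrow> real \<Rightarrow> nat \<times> nat \<Rightarrow> spacetime set" where
  "cell \<delta> \<tau> = (\<lambda>(j, k). let m = norm (real j * \<delta>, real k * \<delta>) in
     box (m, real j * \<delta>, real k * \<delta>) (m + \<tau>, real (Suc j) * \<delta>, real (Suc k) * \<delta>))"

lemma mem_cell:
  "(\<xi>, x, y) \<in> cell \<delta> \<tau> (j, k) \<longleftrightarrow>
    norm (real j * \<delta>, real k * \<delta>) < \<xi> \<and> \<xi> < norm (real j * \<delta>, real k * \<delta>) + \<tau> \<and>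
    real j * \<delta> < x \<and> x < real (Suc j) * \<delta> \<and> real k * \<delta> < y \<and> y < real (Suc k) * \<delta>"
  by (auto simp: cell_def Let_def box_def Basis_prod_def)

lemma cell_disjoint:
  assumes "\<delta> > 0"
  shows "disjoint_family_on (cell \<delta> \<tau>) I"
proof -
  have uniq: "j = j'" if "real j * \<delta> < x" "x < real (Suc j) * \<delta>" "real j' * \<delta> < x" "x < real (Suc j') * \<delta>" for j j' :: nat and x
  proof -
    have "real j * \<delta> < real (Suc j') * \<delta>" "real j' * \<delta> < real (Suc j) * \<delta>" using that by linarith+
    then have "real j < real (Suc j')" "real j' < real (Suc j)" using assms by (simp_all only: mult_less_cancel_right_pos)
    then show ?thesis by linarith
  qed
  show ?thesis unfolding disjoint_family_on_def
  proof (intro ballI impI)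
    fix p q :: "nat \<times> nat" assume "p \<noteq> q"
    then show "cell \<delta> \<tau> p \<inter> cell \<delta> \<tau> q = {}"
      by (cases p; cases q) (auto simp: mem_cell dest: uniq simp del: of_nat_Suc)
  qed
qed

lemma measure_cell:
  assumes "\<delta> > 0" "\<tau> > 0"
  shows "measure lborel (cell \<delta> \<tau> p) = \<tau> * \<delta>\<^sup>2" "emeasure lborel (cell \<delta> \<tau> p) < \<infinity>"
proof -
  obtain j k where p: "p = (j, k)" by (cases p)
  define m where "m = norm (real j * \<delta>, real k * \<delta>)"
  have c: "cell \<delta> \<tau> p = box (m, real j * \<delta>, real k * \<delta>) (m + \<tau>, real (Suc j) * \<delta>, real (Suc k) * \<delta>)"
    by (simp add: cell_def p m_def Let_def)
  have B: "(Basis :: spacetime set) = {e_t, e_1, e_2}" by (auto simp: Basis_prod_def zero_prod_def)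
  have ne: "e_t \<noteq> e_1" "e_t \<noteq> e_2" "e_1 \<noteq> e_2" by simp_all
  show "emeasure lborel (cell \<delta> \<tau> p) < \<infinity>" unfolding c by (rule emeasure_lborel_box_finite)
  have "measure lborel (cell \<delta> \<tau> p) = (\<Prod>b\<in>Basis. ((m + \<tau>, real (Suc j) * \<delta>, real (Suc k) * \<delta>) - (m, real j * \<delta>, real k * \<delta>)) \<bullet> b)"
    unfolding c using assms by (intro measure_lborel_box) (auto simp: B algebra_simps)
  also have "\<dots> = \<tau> * \<delta>\<^sup>2" using assms by (simp add: B power2_eq_square algebra_simps)
  finally show "measure lborel (cell \<delta> \<tau> p) = \<tau> * \<delta>\<^sup>2" .
qed

lemma norm_pair_le_sum: "norm (x, y) \<le> \<bar>x\<bar> + \<bar>y::real\<bar>" for x :: real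
  by (simp add: norm_Pair sqrt_sum_squares_le_sum_abs)

lemma cell_diameter:
  assumes "w \<in> cell \<delta> \<tau> p" "w' \<in> cell \<delta> \<tau> p"
  shows "norm (snd w - snd w') \<le> 2 * \<delta>"
proof -
  obtain \<xi> x y \<xi>' x' y' j k where w: "w = (\<xi>, x, y)" "w' = (\<xi>', x', y')" "p = (j, k)"
    by (cases w, cases w', cases p) auto
  have "\<bar>x - x'\<bar> \<le> \<delta>" "\<bar>y - y'\<bar> \<le> \<delta>"
    using assms unfolding w mem_cell by (auto simp: abs_le_iff algebra_simps)
  then show ?thesis using norm_pair_le_sum[of "x - x'" "y - y'"] by (simp add: w)
qed

text \<open>On a cell at distance of order \<open>R\<close> from the origin all three frequencies are comparable to \<open>R\<close>,
  so the squared amplitude has order \<open>R\<close> to the power \<open>3 - 2 (H0 + H1 + H2) \<ge> 1\<close>. The time frequency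
  is close enough to the resonance for the squared response to have order \<open>R\<close> to the power \<open>-2\<close>.
  The constant \<open>65536\<close> is \<open>64\<close> from the three factors \<open>1/4\<close> of the amplitude times \<open>32\<^sup>2\<close> from
  the response.\<close>

lemma spectral_density_lower:
  fixes H0 H1 H2 t \<delta> \<tau> :: real
  assumes H: "H0 < 1" "H1 < 1" "H2 < 1" "H0 + H1 + H2 \<le> 1"
    and t: "t > 0" and \<delta>: "\<delta> > 0" "4 * \<delta> * t \<le> 1" and \<tau>: "\<tau> > 0" "2 * \<tau> * t \<le> 1"
    and j: "1 \<le> real j * \<delta>" "8 \<le> real j * \<delta> * t" "\<tau> \<le> real j * \<delta>" and k: "k \<in> {j..<2 * j}"
    and n: "4 * (real j * \<delta>) \<le> 2 ^ n" and w: "w \<in> cell \<delta> \<tau> (j, k)"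
  shows "t\<^sup>2 / (65536 * (real j * \<delta>)) \<le> (amp H0 H1 H2 n w)\<^sup>2 * (norm (solution_symbol t 0 w))\<^sup>2"
proof -
  define R where "R = real j * \<delta>"
  obtain \<xi> x y where we: "w = (\<xi>, x, y)" by (cases w)
  define m where "m = norm (real j * \<delta>, real k * \<delta>)"
  have c: "m < \<xi>" "\<xi> < m + \<tau>" "real j * \<delta> < x" "x < real (Suc j) * \<delta>" "real k * \<delta> < y" "y < real (Suc k) * \<delta>"
    using w unfolding we mem_cell m_def by auto
  have R: "R \<ge> 1" "8 \<le> R * t" "\<tau> \<le> R" "4 * R \<le> 2 ^ n" using j n by (auto simp: R_def)
  have j1: "j \<ge> 1" using j(1) by (cases j) auto
  have sj: "real (Suc j) * \<delta> \<le> 2 * R"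
  proof -
    have "real (Suc j) * \<delta> \<le> (2 * real j) * \<delta>" using j1 \<delta> by (intro mult_right_mono) auto
    then show ?thesis by (simp add: R_def)
  qed
  have kj: "R \<le> real k * \<delta>" using k \<delta> by (simp add: R_def)
  have sk: "real (Suc k) * \<delta> \<le> 2 * R"
  proof -
    have "real (Suc k) \<le> 2 * real j" using k by auto
    then have "real (Suc k) * \<delta> \<le> (2 * real j) * \<delta>" using \<delta> by (intro mult_right_mono) auto
    then show ?thesis by (simp add: R_def)
  qed
  have k2: "real k * \<delta> \<le> 2 * R" using sk \<delta> by (simp add: algebra_simps)
  have x: "R \<le> x" "x \<le> 2 * R" using c sj by (auto simp: R_def)
  have y: "R \<le> y" "y \<le> 2 * R" using c sk kj by auto
  have mR: "R \<le> m" "m \<le> 3 * R"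
  proof -
    show "R \<le> m" unfolding m_def using norm_fst_le[of "real j * \<delta>" "real k * \<delta>"] R(1) by (simp add: R_def)
    show "m \<le> 3 * R" unfolding m_def using norm_pair_le_sum[of "real j * \<delta>" "real k * \<delta>"] k2 kj R(1) by (simp add: R_def)
  qed
  have \<xi>: "R \<le> \<xi>" "\<xi> \<le> 4 * R" using c mR R by auto
  define q where "q = norm (x, y)"
  have q: "R \<le> q" "q \<le> 4 * R"
  proof -
    show "R \<le> q" unfolding q_def using norm_fst_le[of x y] x R(1) by simp
    show "q \<le> 4 * R" unfolding q_def using norm_pair_le_sum[of x y] x y R(1) by simp
  qed
  have qm: "\<bar>q - m\<bar> \<le> 2 * \<delta>"
  proof -
    have "\<bar>q - m\<bar> \<le> norm ((x, y) - (real j * \<delta>, real k * \<delta>))" unfolding q_def m_def by (rule norm_triangle_ineq3)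
    also have "\<dots> \<le> \<bar>x - real j * \<delta>\<bar> + \<bar>y - real k * \<delta>\<bar>" using norm_pair_le_sum by simp
    also have "\<dots> \<le> 2 * \<delta>" using c by (simp add: abs_le_iff algebra_simps)
    finally show ?thesis .
  qed
  have "\<bar>\<xi> - q\<bar> \<le> \<tau> + 2 * \<delta>" using qm c by (simp add: abs_le_iff)
  then have "\<bar>\<xi> - q\<bar> * t \<le> (\<tau> + 2 * \<delta>) * t" using t by (intro mult_right_mono) auto
  also have "\<dots> \<le> 1" using \<delta> \<tau> by (simp add: algebra_simps)
  finally have res: "\<bar>\<xi> - q\<bar> * t \<le> 1" .
  have qt: "8 \<le> q * t" using R(2) mult_right_mono[OF q(1), of t] t by linarith
  have "norm (wave_kernel \<xi> q t) \<ge> t / (8 * q)"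
    using \<xi> q R by (intro wave_kernel_lower t res qt) auto
  moreover have "t / (8 * q) \<ge> t / (32 * R)" using t q R by (intro divide_left_mono) auto
  ultimately have wk: "t / (32 * R) \<le> norm (wave_kernel \<xi> q t)" by linarith
  have s3: "norm (sgn3 w) = 1" using \<xi> x y R by (simp add: sgn3_def we norm_mult sgn_if)
  have "norm (solution_symbol t 0 w) = norm (wave_kernel \<xi> q t)"
    by (simp add: solution_symbol_def norm_mult s3[unfolded we] we q_def)
  then have sym: "t\<^sup>2 / (1024 * R\<^sup>2) \<le> (norm (solution_symbol t 0 w))\<^sup>2"
    using power_mono[OF wk, of 2] t R by (simp add: power_divide power_mult_distrib)
  have box: "w \<in> frequency_box n" using \<xi> q R by (auto simp: frequency_box_def we q_def)
  have p: "(\<bar>v\<bar> powr (1/2 - h))\<^sup>2 = v powr (1 - 2 * h)" if "v > 0" for v h :: real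
    using that by (simp add: powr_power right_diff_distrib)
  have pos: "\<xi> > 0" "x > 0" "y > 0" using \<xi> x y R(1) by linarith+
  have amp2: "(amp H0 H1 H2 n w)\<^sup>2 = \<xi> powr (1 - 2 * H0) * (x powr (1 - 2 * H1) * y powr (1 - 2 * H2))"
    using box unfolding amp_def we by (simp add: power_mult_distrib p[OF pos(1)] p[OF pos(2)] p[OF pos(3)] del: abs_of_pos)
  have "(R powr (1 - 2 * H0) / 4) * ((R powr (1 - 2 * H1) / 4) * (R powr (1 - 2 * H2) / 4)) \<le> (amp H0 H1 H2 n w)\<^sup>2"
    unfolding amp2 using \<xi> x y R H by (intro mult_mono powr_lower_comparable mult_nonneg_nonneg) auto
  moreover have "R / 64 \<le> (R powr (1 - 2 * H0) / 4) * ((R powr (1 - 2 * H1) / 4) * (R powr (1 - 2 * H2) / 4))"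
  proof -
    have "R powr 1 \<le> R powr ((1 - 2 * H0) + ((1 - 2 * H1) + (1 - 2 * H2)))"
      using H R by (intro powr_mono) auto
    then show ?thesis using R unfolding powr_add by simp
  qed
  ultimately have am: "R / 64 \<le> (amp H0 H1 H2 n w)\<^sup>2" by linarith
  have "t\<^sup>2 / (65536 * R) = (R / 64) * (t\<^sup>2 / (1024 * R\<^sup>2))" using R by (simp add: field_simps power2_eq_square)
  also have "\<dots> \<le> (amp H0 H1 H2 n w)\<^sup>2 * (norm (solution_symbol t 0 w))\<^sup>2"
    using R by (intro mult_mono am sym) auto
  finally show ?thesis by (simp add: R_def)
qed

lemma harmonic_tail_diverges: "filterlim (\<lambda>N. \<Sum>j=j0..N. 1 / real j) at_top sequentially"
proof -
  have "filterlim (\<lambda>N. (harm N :: real) - (\<Sum>j\<in>{1..<j0}. 1 / real j)) at_top sequentially"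
  proof (rule filterlim_at_top_mono[OF _ always_eventually])
    show "filterlim (\<lambda>N. (- (\<Sum>j\<in>{1..<j0}. 1 / real j)) + (harm N :: real)) at_top sequentially"
      by (intro filterlim_tendsto_add_at_top[OF tendsto_const] harm_at_top)
  qed simp
  then show ?thesis
  proof (rule filterlim_at_top_mono)
    show "\<forall>\<^sub>F N in sequentially. harm N - (\<Sum>j\<in>{1..<j0}. 1 / real j) \<le> (\<Sum>j=j0..N. 1 / real j)"
    proof (rule always_eventually, rule allI)
      fix N
      have "harm N = (\<Sum>j\<in>{1..N}. 1 / real j)" by (simp add: harm_def inverse_eq_divide)
      also have "\<dots> \<le> (\<Sum>j\<in>{1..<j0} \<union> {j0..N}. 1 / real j)" by (intro sum_mono2) auto
      also have "\<dots> = (\<Sum>j\<in>{1..<j0}. 1 / real j) + (\<Sum>j=j0..N. 1 / real j)" by (intro sum.union_disjoint) auto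
      finally show "harm N - (\<Sum>j\<in>{1..<j0}. 1 / real j) \<le> (\<Sum>j=j0..N. 1 / real j)" by simp
    qed
  qed
qed

lemma bump_lower:
  assumes r: "r > 0" and y: "y \<in> ball a (r / 2)"
  shows "exp (- (1 / (3 * r\<^sup>2 / 4))) \<le> bump r a y"
proof -
  have "norm (y - a) \<le> r / 2" using y by (simp add: dist_norm norm_minus_commute)
  then have "(norm (y - a))\<^sup>2 \<le> (r / 2)\<^sup>2" by (intro power_mono) auto
  then have u: "3 * r\<^sup>2 / 4 \<le> r\<^sup>2 - (y - a) \<bullet> (y - a)"
    by (simp add: power2_norm_eq_inner power_divide)
  have p: "0 < 3 * r\<^sup>2 / 4" using r by simp
  have i: "(y - a) \<bullet> (y - a) < r\<^sup>2" using u p by linarith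
  have "1 / (r\<^sup>2 - (y - a) \<bullet> (y - a)) \<le> 1 / (3 * r\<^sup>2 / 4)" using u p by (intro frac_le) auto
  then show ?thesis using i by (simp add: bump_def flat_exp_def)
qed

context fbm_noise
begin

definition spectral_density :: "real \<Rightarrow> nat \<Rightarrow> real \<Rightarrow> spacetime \<Rightarrow> real" where
  "spectral_density c n t w = c\<^sup>2 * (2 * pi) ^ 3 * ((amp H0 H1 H2 n w)\<^sup>2 * (norm (solution_symbol t 0 w))\<^sup>2)"

lemma spectral_density_integrable:
  assumes "symbol (solution_symbol t 0)"
  shows "integrable lborel (spectral_density c n t)"
proof -
  have "integrable lborel (\<lambda>w. (norm (complex_of_real (amp H0 H1 H2 n w) * solution_symbol t 0 w))\<^sup>2)"
    using herm[OF assms] by (simp add: hermitian_L2_def)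
  then show ?thesis
    unfolding spectral_density_def[abs_def] by (intro integrable_mult_right) (simp add: norm_mult power_mult_distrib)
qed

lemma Phi_solution_cov:
  assumes "\<And>x. symbol (solution_symbol t x)"
  shows "expectation (\<lambda>\<omega>. (c * \<Phi> n (solution_symbol t x) \<omega>) * (c * \<Phi> n (solution_symbol t y) \<omega>))
    = (LINT w|lborel. spectral_density c n t w * cos ((x - y) \<bullet> snd w))"
proof -
  have R: "Re (solution_symbol t x w * cnj (solution_symbol t y w)) = (norm (solution_symbol t 0 w))\<^sup>2 * cos ((x - y) \<bullet> snd w)" for w
  proof -
    have e: "solution_symbol t v w = cis (v \<bullet> snd w) * solution_symbol t 0 w" for v
      by (simp add: solution_symbol_def)
    have "solution_symbol t x w * cnj (solution_symbol t y w)
      = cis (x \<bullet> snd w) * cis (- (y \<bullet> snd w)) * (solution_symbol t 0 w * cnj (solution_symbol t 0 w))"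
      unfolding e[of x] e[of y] by (simp add: cis_cnj)
    also have "\<dots> = cis ((x - y) \<bullet> snd w) * complex_of_real ((norm (solution_symbol t 0 w))\<^sup>2)"
      unfolding complex_norm_square by (simp add: cis_mult inner_diff_left)
    finally show ?thesis by simp
  qed
  have "expectation (\<lambda>\<omega>. (c * \<Phi> n (solution_symbol t x) \<omega>) * (c * \<Phi> n (solution_symbol t y) \<omega>))
    = c\<^sup>2 * expectation (\<lambda>\<omega>. \<Phi> n (solution_symbol t x) \<omega> * \<Phi> n (solution_symbol t y) \<omega>)"
    unfolding integral_mult_right_zero[symmetric] by (simp add: power2_eq_square mult_ac)
  also have "\<dots> = (LINT w|lborel. c\<^sup>2 * ((2 * pi) ^ 3 * ((amp H0 H1 H2 n w)\<^sup>2 * Re (solution_symbol t x w * cnj (solution_symbol t y w)))))"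
    unfolding Phi_cov[OF assms assms] integral_mult_right_zero ..
  also have "\<dots> = (LINT w|lborel. spectral_density c n t w * cos ((x - y) \<bullet> snd w))"
    unfolding R spectral_density_def by (simp only: mult_ac)
  finally show ?thesis .
qed

text \<open>The bump function is at least a constant on the ball of half its radius, so the energy tested with
  it dominates the energy on that ball. The constant \<open>\<kappa>\<close> collects this constant squared, the factor
  \<open>2\<close> of the second moment, the duality constant \<open>1 / A\<^sup>2\<close> and the factor \<open>1/4\<close> of the spectral
  bound.\<close>

theorem wick_energy_lower_bound:
  fixes a :: plane and C :: "'i \<Rightarrow> spacetime set"
  assumes B: "harmonizable_version M W c H0 H1 H2 (frequency_box n) B"
    and smooth: "AE \<omega> in M. smooth_on UNIV (\<lambda>(s, x). B s x \<omega>)"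
    and sol: "AE \<omega> in M. wave_solution (mixed_derivative (\<lambda>(s, x). B s x \<omega>)) (\<lambda>(s, x). \<Psi> s x \<omega>)"
    and t: "t > 0" and r: "r > 0" and A: "A > 0"
    and norm_bound: "\<And>v. ennreal (norm (v (\<lambda>x. complex_of_real (bump r a x))) / A) \<le> sobolev_norm_on s 2 D v"
    and I: "finite I" "\<And>i. i \<in> I \<Longrightarrow> C i \<in> sets borel" "disjoint_family_on C I"
    and small: "\<And>i w w'. i \<in> I \<Longrightarrow> w \<in> C i \<Longrightarrow> w' \<in> C i \<Longrightarrow> norm (snd w - snd w') \<le> 1 / r"
  defines "\<kappa> \<equiv> (exp (- (1 / (3 * r\<^sup>2 / 4))))\<^sup>2 * (measure lborel (ball a (r / 2)))\<^sup>2 / (2 * A\<^sup>2)"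
  shows "ennreal (\<kappa> * (\<Sum>i\<in>I. (LINT w|lborel. indicator (C i) w * spectral_density c n t w)\<^sup>2))
    \<le> (\<integral>\<^sup>+\<omega>. (sobolev_norm_on s 2 D (dist_of (\<lambda>y. complex_of_real (wick_square M \<Psi> t y \<omega>))))\<^sup>2 \<partial>M)"
proof -
  note repr = solution_repr[OF B smooth sol t]
  let ?m = "\<lambda>x. solution_symbol t x"
  have "AE \<omega> in M. continuous_on UNIV (\<lambda>x. \<Psi> t x \<omega>)"
    using sol
  proof eventually_elim
    case (elim \<omega>)
    then have "(\<lambda>(s, x). \<Psi> s x \<omega>) differentiable_on half_space"
      by (auto simp: wave_solution_def Let_def numeral_2_eq_2)
    then have c: "continuous_on half_space (\<lambda>(s, x). \<Psi> s x \<omega>)" by (rule differentiable_imp_continuous_on)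
    have "continuous_on UNIV (\<lambda>x. (\<lambda>(s, x). \<Psi> s x \<omega>) (t, x))"
      by (rule continuous_on_compose2[OF c]) (use t in \<open>auto intro!: continuous_intros\<close>)
    then show ?case by simp
  qed
  then obtain N where N: "N \<in> null_sets M" "{\<omega> \<in> space M. \<not> continuous_on UNIV (\<lambda>x. \<Psi> t x \<omega>)} \<subseteq> N"
    by (auto elim!: AE_E simp: null_sets_def)
  \<comment> \<open>a version of the field all of whose paths are continuous, for joint measurability\<close>
  define Z where "Z y \<omega> = (if \<omega> \<in> space M - N then \<Psi> t y \<omega> else 0)" for y \<omega>
  have good: "AE \<omega> in M. \<omega> \<in> space M - N" using AE_not_in[OF N(1)] AE_space by eventually_elim simp
  have cont: "continuous_on UNIV (\<lambda>y. Z y \<omega>)" for \<omega>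
    using N(2) by (cases "\<omega> \<in> space M - N") (auto simp: Z_def)
  have ZPhi: "AE \<omega> in M. Z y \<omega> = c * \<Phi> n (?m y) \<omega>" for y
    using good repr(2)[of y] by eventually_elim (simp add: Z_def)
  have Phim[measurable]: "\<Phi> n (?m y) \<in> borel_measurable M" for y
    unfolding \<Phi>_def by (intro V_measurable herm repr(1))
  have Zm[measurable]: "Z y \<in> borel_measurable M" for y
    by (rule borel_measurable_AE_eq[OF _ ZPhi]) measurable
  have \<Psi>m[measurable]: "\<Psi> t y \<in> borel_measurable M" for y
    by (rule borel_measurable_AE_eq[OF _ repr(2)]) measurable
  have gauss: "centered_gaussian M (\<lambda>\<omega>. p * Z y \<omega> + q * Z y' \<omega>)" for y y' p q
  proof (rule centered_gaussian_AE_eq)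
    show "centered_gaussian M (\<lambda>\<omega>. (p * c) * \<Phi> n (?m y) \<omega> + (q * c) * \<Phi> n (?m y') \<omega>)"
      unfolding \<Phi>_def by (intro V_pair_gaussian herm repr(1))
    show "AE \<omega> in M. p * Z y \<omega> + q * Z y' \<omega> = (p * c) * \<Phi> n (?m y) \<omega> + (q * c) * \<Phi> n (?m y') \<omega>"
      using ZPhi[of y] ZPhi[of y'] by eventually_elim simp
  qed measurable
  let ?K = "\<lambda>p. LINT w|lborel. spectral_density c n t w * cos ((fst p - snd p) \<bullet> snd w)"
  have cov: "expectation (\<lambda>\<omega>. Z y \<omega> * Z y' \<omega>) = ?K (y, y')" for y y'
  proof -
    have "expectation (\<lambda>\<omega>. Z y \<omega> * Z y' \<omega>) = expectation (\<lambda>\<omega>. (c * \<Phi> n (?m y) \<omega>) * (c * \<Phi> n (?m y') \<omega>))"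
    proof (rule integral_cong_AE)
      show "AE \<omega> in M. Z y \<omega> * Z y' \<omega> = (c * \<Phi> n (?m y) \<omega>) * (c * \<Phi> n (?m y') \<omega>)"
        using ZPhi[of y] ZPhi[of y'] by eventually_elim simp
    qed measurable
    then show ?thesis using Phi_solution_cov[OF repr(1), of c n y y'] by simp
  qed
  define S where "S = (LINT w|lborel. spectral_density c n t w)"
  have S: "expectation (\<lambda>\<omega>. (Z y \<omega>)\<^sup>2) = S" for y
    using cov[of y y] by (simp add: power2_eq_square S_def)
  have S\<Psi>: "expectation (\<lambda>\<omega>. (\<Psi> t y \<omega>)\<^sup>2) = S" for y
  proof -
    have "expectation (\<lambda>\<omega>. (\<Psi> t y \<omega>)\<^sup>2) = expectation (\<lambda>\<omega>. (Z y \<omega>)\<^sup>2)"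
    proof (rule integral_cong_AE)
      show "AE \<omega> in M. (\<Psi> t y \<omega>)\<^sup>2 = (Z y \<omega>)\<^sup>2"
        using good by eventually_elim (simp add: Z_def)
    qed measurable
    then show ?thesis by (simp add: S)
  qed
  let ?\<theta> = "bump r a"
  define u where "u \<omega> = (LINT y|lborel. ((Z y \<omega>)\<^sup>2 - S) * ?\<theta> y)" for \<omega>
  have \<theta>0: "{y. ?\<theta> y \<noteq> 0} \<subseteq> cball a r"
    using bump_nonzero_iff[OF r, of a] by (auto simp: dist_commute)
  note W2 = wick_second_moment[OF gauss cont S continuous_on_bump bump_nonneg compact_cball \<theta>0, folded u_def, unfolded cov prod.collapse]
  have "ennreal (\<kappa> * (\<Sum>i\<in>I. (LINT w|lborel. indicator (C i) w * spectral_density c n t w)\<^sup>2))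
    \<le> ennreal (1 / A\<^sup>2 * (2 * (LINT p|lborel. ?\<theta> (fst p) * ?\<theta> (snd p) * (?K p)\<^sup>2)))"
  proof (rule ennreal_leI)
    let ?e = "exp (- (1 / (3 * r\<^sup>2 / 4)))"
    let ?Q = "ball a (r / 2)"
    have low: "(measure lborel ?Q)\<^sup>2 / 4 * (\<Sum>i\<in>I. (LINT w|lborel. indicator (C i) w * spectral_density c n t w)\<^sup>2)
      \<le> (LINT p|lborel. indicator ?Q (fst p) * indicator ?Q (snd p) * (?K p)\<^sup>2)"
      by (rule spectral_energy_lower_bound[OF spectral_density_integrable[OF repr(1)] _ r I small])
        (simp_all add: spectral_density_def)
    have "?e\<^sup>2 * (LINT p|lborel. indicator ?Q (fst p) * indicator ?Q (snd p) * (?K p)\<^sup>2)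
      = (LINT p|lborel. ?e\<^sup>2 * (indicator ?Q (fst p) * indicator ?Q (snd p) * (?K p)\<^sup>2))"
      by (rule integral_mult_right_zero[symmetric])
    also have "\<dots> \<le> (LINT p|lborel. ?\<theta> (fst p) * ?\<theta> (snd p) * (?K p)\<^sup>2)"
    proof (rule integral_mono_AE'[OF W2(1)])
      show "AE p in lborel. ?e\<^sup>2 * (indicator ?Q (fst p) * indicator ?Q (snd p) * (?K p)\<^sup>2) \<le> ?\<theta> (fst p) * ?\<theta> (snd p) * (?K p)\<^sup>2"
      proof (intro AE_I2)
        fix p :: "plane \<times> plane"
        have b: "?e * indicator ?Q y \<le> ?\<theta> y" for y
          using bump_lower[OF r, of y a] bump_nonneg[of r a y] by (simp add: indicator_def)
        have "(?e * indicator ?Q (fst p)) * (?e * indicator ?Q (snd p)) \<le> ?\<theta> (fst p) * ?\<theta> (snd p)"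
          by (intro mult_mono b bump_nonneg) auto
        then have "(?e * indicator ?Q (fst p)) * (?e * indicator ?Q (snd p)) * (?K p)\<^sup>2 \<le> ?\<theta> (fst p) * ?\<theta> (snd p) * (?K p)\<^sup>2"
          by (rule mult_right_mono) simp
        then show "?e\<^sup>2 * (indicator ?Q (fst p) * indicator ?Q (snd p) * (?K p)\<^sup>2) \<le> ?\<theta> (fst p) * ?\<theta> (snd p) * (?K p)\<^sup>2"
          unfolding power2_eq_square[of ?e] by (simp only: mult_ac)
      qed
      show "AE p in lborel. 0 \<le> ?\<theta> (fst p) * ?\<theta> (snd p) * (?K p)\<^sup>2"
        by (intro AE_I2 mult_nonneg_nonneg bump_nonneg) simp
    qed
    finally have up: "?e\<^sup>2 * (LINT p|lborel. indicator ?Q (fst p) * indicator ?Q (snd p) * (?K p)\<^sup>2)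
       \<le> (LINT p|lborel. ?\<theta> (fst p) * ?\<theta> (snd p) * (?K p)\<^sup>2)" .
    have "\<kappa> * (\<Sum>i\<in>I. (LINT w|lborel. indicator (C i) w * spectral_density c n t w)\<^sup>2)
      = 2 / A\<^sup>2 * (?e\<^sup>2 * ((measure lborel ?Q)\<^sup>2 / 4 * (\<Sum>i\<in>I. (LINT w|lborel. indicator (C i) w * spectral_density c n t w)\<^sup>2)))"
      unfolding \<kappa>_def by (simp add: field_simps)
    also have "\<dots> \<le> 2 / A\<^sup>2 * (LINT p|lborel. ?\<theta> (fst p) * ?\<theta> (snd p) * (?K p)\<^sup>2)"
      by (intro mult_left_mono order_trans[OF mult_left_mono[OF low] up]) auto
    finally show "\<kappa> * (\<Sum>i\<in>I. (LINT w|lborel. indicator (C i) w * spectral_density c n t w)\<^sup>2)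
      \<le> 1 / A\<^sup>2 * (2 * (LINT p|lborel. ?\<theta> (fst p) * ?\<theta> (snd p) * (?K p)\<^sup>2))" by simp
  qed
  also have "\<dots> = ennreal (1 / A\<^sup>2) * (\<integral>\<^sup>+\<omega>. ennreal ((u \<omega>)\<^sup>2) \<partial>M)"
    unfolding W2(3) by (rule ennreal_mult') simp
  also have "\<dots> = (\<integral>\<^sup>+\<omega>. ennreal (1 / A\<^sup>2) * ennreal ((u \<omega>)\<^sup>2) \<partial>M)"
    using W2(2) by (intro nn_integral_cmult[symmetric]) auto
  also have "\<dots> \<le> (\<integral>\<^sup>+\<omega>. (sobolev_norm_on s 2 D (dist_of (\<lambda>y. complex_of_real (wick_square M \<Psi> t y \<omega>))))\<^sup>2 \<partial>M)"
  proof (rule nn_integral_mono_AE)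
    show "AE \<omega> in M. ennreal (1 / A\<^sup>2) * ennreal ((u \<omega>)\<^sup>2)
      \<le> (sobolev_norm_on s 2 D (dist_of (\<lambda>y. complex_of_real (wick_square M \<Psi> t y \<omega>))))\<^sup>2"
      using good
    proof eventually_elim
      case (elim \<omega>)
      have "dist_of (\<lambda>y. complex_of_real (wick_square M \<Psi> t y \<omega>)) (\<lambda>x. complex_of_real (?\<theta> x))
        = (LINT y|lborel. complex_of_real (((Z y \<omega>)\<^sup>2 - S) * ?\<theta> y))"
        using elim by (simp add: dist_of_def wick_square_def S\<Psi> Z_def)
      also have "\<dots> = complex_of_real (u \<omega>)" unfolding u_def by (rule integral_complex_of_real)
      finally have "ennreal (\<bar>u \<omega>\<bar> / A) \<le> sobolev_norm_on s 2 D (dist_of (\<lambda>y. complex_of_real (wick_square M \<Psi> t y \<omega>)))"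
        using norm_bound[of "dist_of (\<lambda>y. complex_of_real (wick_square M \<Psi> t y \<omega>))"] by simp
      then have "(ennreal (\<bar>u \<omega>\<bar> / A))\<^sup>2 \<le> (sobolev_norm_on s 2 D (dist_of (\<lambda>y. complex_of_real (wick_square M \<Psi> t y \<omega>))))\<^sup>2"
        by (intro power_mono) auto
      moreover have "(ennreal (\<bar>u \<omega>\<bar> / A))\<^sup>2 = ennreal (1 / A\<^sup>2) * ennreal ((u \<omega>)\<^sup>2)"
        using A by (simp add: ennreal_power power_divide flip: ennreal_mult')
      ultimately show ?case by simp
    qed
  qed
  finally show ?thesis .
qed

text \<open>For each \<open>j\<close> there are \<open>j\<close> cells with \<open>j \<le> k < 2 j\<close>, and the volume \<open>\<tau> \<delta>\<^sup>2\<close> of a cell times the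
  bound on the density there is \<open>b / j\<close>. This gives \<open>j \<cdot> (b / j)\<^sup>2 = b\<^sup>2 / j\<close>.\<close>

lemma cell_energy_lower:
  fixes c t \<delta> \<tau> :: real
  assumes H: "H0 + H1 + H2 \<le> 1" and sym: "symbol (solution_symbol t 0)"
    and t: "t > 0" and \<delta>: "\<delta> > 0" "4 * \<delta> * t \<le> 1" and \<tau>: "\<tau> > 0" "2 * \<tau> * t \<le> 1"
    and j0: "1 \<le> real j0 * \<delta>" "8 \<le> real j0 * \<delta> * t" "\<tau> \<le> real j0 * \<delta>"
    and n: "4 * (real N * \<delta>) \<le> 2 ^ n"
  defines "b \<equiv> c\<^sup>2 * (2 * pi) ^ 3 * t\<^sup>2 * \<tau> * \<delta> / 65536"
  shows "b\<^sup>2 * (\<Sum>j=j0..N. 1 / real j)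
    \<le> (\<Sum>p\<in>Sigma {j0..N} (\<lambda>j. {j..<2 * j}). (LINT w|lborel. indicator (cell \<delta> \<tau> p) w * spectral_density c n t w)\<^sup>2)"
proof -
  have mass: "b / real j \<le> (LINT w|lborel. indicator (cell \<delta> \<tau> (j, k)) w * spectral_density c n t w)"
    if j: "j \<in> {j0..N}" and k: "k \<in> {j..<2 * j}" for j k
  proof -
    have jd: "real j0 * \<delta> \<le> real j * \<delta>" "real j * \<delta> \<le> real N * \<delta>" using j \<delta> by (auto intro!: mult_right_mono)
    have j1: "1 \<le> real j * \<delta>" "8 \<le> real j * \<delta> * t" "\<tau> \<le> real j * \<delta>" "4 * (real j * \<delta>) \<le> 2 ^ n"
      using jd j0 n mult_right_mono[OF jd(1), of t] t by linarith+
    have jp: "real j > 0" using j1(1) by (cases j) auto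
    let ?l = "c\<^sup>2 * (2 * pi) ^ 3 * (t\<^sup>2 / (65536 * (real j * \<delta>)))"
    have mc: "measure lborel (cell \<delta> \<tau> (j, k)) = \<tau> * \<delta>\<^sup>2" "emeasure lborel (cell \<delta> \<tau> (j, k)) < \<infinity>"
      by (rule measure_cell[OF \<delta>(1) \<tau>(1)])+
    have cb: "cell \<delta> \<tau> (j, k) \<in> sets borel" by (simp add: cell_def Let_def)
    have ic: "integrable lborel (indicator (cell \<delta> \<tau> (j, k)) :: spacetime \<Rightarrow> real)"
      using mc cb by (intro integrable_real_indicator) auto
    have "b / real j = ?l * measure lborel (cell \<delta> \<tau> (j, k))"
      unfolding mc b_def using jp \<delta> by (simp add: field_simps power2_eq_square)
    also have "\<dots> = (LINT w|lborel. indicator (cell \<delta> \<tau> (j, k)) w * ?l)"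
      using mc cb by simp
    also have "\<dots> \<le> (LINT w|lborel. indicator (cell \<delta> \<tau> (j, k)) w * spectral_density c n t w)"
    proof (rule integral_mono)
      show "integrable lborel (\<lambda>w. indicator (cell \<delta> \<tau> (j, k)) w * ?l)" using ic by (rule integrable_mult_left)
      show "integrable lborel (\<lambda>w. indicator (cell \<delta> \<tau> (j, k)) w * spectral_density c n t w)"
      proof (rule Bochner_Integration.integrable_bound[OF spectral_density_integrable[OF sym]])
        show "(\<lambda>w. indicator (cell \<delta> \<tau> (j, k)) w * spectral_density c n t w) \<in> borel_measurable lborel"
          using cb borel_measurable_integrable[OF spectral_density_integrable[OF sym, of c n]] by simp
      qed (auto simp: indicator_def)
      fix w
      show "indicator (cell \<delta> \<tau> (j, k)) w * ?l \<le> indicator (cell \<delta> \<tau> (j, k)) w * spectral_density c n t w"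
      proof (cases "w \<in> cell \<delta> \<tau> (j, k)")
        case True
        have "?l \<le> spectral_density c n t w" unfolding spectral_density_def
          by (intro mult_left_mono spectral_density_lower[OF H_less_1 H t \<delta> \<tau> j1(1-3) k j1(4) True]) simp
        then show ?thesis using True by simp
      qed simp
    qed
    finally show ?thesis .
  qed
  have b0: "b \<ge> 0" unfolding b_def using t \<delta> \<tau> by simp
  have "b\<^sup>2 * (\<Sum>j=j0..N. 1 / real j) = (\<Sum>j=j0..N. (\<Sum>k\<in>{j..<2 * j}. (b / real j)\<^sup>2))"
    unfolding sum_distrib_left by (intro sum.cong refl) (simp add: power2_eq_square field_simps)
  also have "\<dots> \<le> (\<Sum>j=j0..N. (\<Sum>k\<in>{j..<2 * j}. (LINT w|lborel. indicator (cell \<delta> \<tau> (j, k)) w * spectral_density c n t w)\<^sup>2))"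
    using b0 by (intro sum_mono power_mono mass) auto
  also have "\<dots> = (\<Sum>p\<in>Sigma {j0..N} (\<lambda>j. {j..<2 * j}). (LINT w|lborel. indicator (cell \<delta> \<tau> p) w * spectral_density c n t w)\<^sup>2)"
    by (subst sum.Sigma) (auto simp: case_prod_beta)
  finally show ?thesis .
qed

end

theorem proposition1p4:
  fixes M :: "'w measure"
    and F :: "real \<Rightarrow> 'w measure"
    and W :: "(spacetime \<Rightarrow> real) \<Rightarrow> 'w \<Rightarrow> real"
    and H0 H1 H2 c\<^sub>H \<alpha> t :: real
    and B \<Psi> :: "nat \<Rightarrow> real \<Rightarrow> plane \<Rightarrow> 'w \<Rightarrow> real"
    and D :: "plane set"
  assumes space: "complete_filtered_prob_space M F"
    and noise: "white_noise M W"
    and H: "H0 \<in> {0<..<1}" "H1 \<in> {0<..<1}" "H2 \<in> {0<..<1}" "H0 + H1 + H2 \<le> 1"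
    and const: "harmonizable_constant M W H0 H1 H2 c\<^sub>H"
    and B_version:
      "\<And>n. n \<ge> 1 \<Longrightarrow> harmonizable_version M W c\<^sub>H H0 H1 H2 (frequency_box n) (B n)"
    and B_smooth: "\<And>n. n \<ge> 1 \<Longrightarrow> AE \<omega> in M. smooth_on UNIV (\<lambda>(s, x). B n s x \<omega>)"
    and \<Psi>_solution: "\<And>n. n \<ge> 1 \<Longrightarrow> AE \<omega> in M.
        wave_solution (mixed_derivative (\<lambda>(s, x). B n s x \<omega>)) (\<lambda>(s, x). \<Psi> n s x \<omega>)"
    and D: "compact D" "interior D \<noteq> {}"
    and \<alpha>: "\<alpha> > 0"
    and t: "t > 0"
  shows "(\<lambda>n. \<integral>\<^sup>+\<omega>. (sobolev_norm_on (- 2 * \<alpha>) 2 D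
            (dist_of (\<lambda>y. complex_of_real (wick_square M (\<Psi> n) t y \<omega>))))\<^sup>2 \<partial>M)
         \<longlonglongrightarrow> \<infinity>"
proof -
  interpret prob_space M using space by (simp add: complete_filtered_prob_space_def)
  interpret complete_measure M using space by (simp add: complete_filtered_prob_space_def)
  interpret fbm_noise M W H0 H1 H2
    by standard (use noise H in auto)
  have c: "c\<^sub>H > 0" using const by (simp add: harmonizable_constant_def)
  obtain a where a: "a \<in> interior D" using D(2) by blast
  then obtain r where r: "r > 0" "cball a r \<subseteq> interior D"
    using open_contains_cball[of "interior D"] by auto
  obtain A where A: "A > 0" "\<And>v. ennreal (norm (v (\<lambda>x. complex_of_real (bump r a x))) / A) \<le> sobolev_norm_on (- 2 * \<alpha>) 2 D v"
    using sobolev_norm_on_lower_bound[OF test_function_bump[OF r], of "- 2 * \<alpha>"] by blast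
  \<comment> \<open>\<open>\<delta> \<le> 1 / (2 r)\<close> makes the cells small; the other bounds keep \<open>\<bar>\<xi> - \<bar>\<eta>\<bar>\<bar> t \<le> 1\<close> on them\<close>
  define \<delta> where "\<delta> = min (1 / (2 * r)) (1 / (4 * t))"
  define \<tau> where "\<tau> = 1 / (2 * t)"
  have \<delta>: "\<delta> > 0" "4 * \<delta> * t \<le> 1" "2 * \<delta> \<le> 1 / r"
  proof -
    show "\<delta> > 0" using r t by (simp add: \<delta>_def)
    have "\<delta> \<le> 1 / (4 * t)" by (simp add: \<delta>_def)
    then show "4 * \<delta> * t \<le> 1" using t by (simp add: field_simps)
    have "\<delta> \<le> 1 / (2 * r)" by (simp add: \<delta>_def)
    then show "2 * \<delta> \<le> 1 / r" using r by (simp add: field_simps)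
  qed
  have \<tau>: "\<tau> > 0" "2 * \<tau> * t \<le> 1" using t by (simp_all add: \<tau>_def)
  \<comment> \<open>from \<open>j0\<close> on the cells are far enough from the origin for the lower bound on the density\<close>
  obtain j0 where "(1 + 8 / t + \<tau>) / \<delta> < real j0" using reals_Archimedean2 by blast
  then have j0': "1 + 8 / t + \<tau> < real j0 * \<delta>" using \<delta>(1) by (simp add: divide_less_eq)
  have t8: "8 / t > 0" using t by simp
  have j0: "1 \<le> real j0 * \<delta>" "\<tau> \<le> real j0 * \<delta>" using j0' t8 \<tau>(1) by linarith+
  have j0t: "8 \<le> real j0 * \<delta> * t"
  proof -
    have "8 / t \<le> real j0 * \<delta>" using j0' \<tau>(1) by linarith
    then show ?thesis using t by (simp add: divide_le_eq)
  qed
  define b where "b = c\<^sub>H\<^sup>2 * (2 * pi) ^ 3 * t\<^sup>2 * \<tau> * \<delta> / 65536"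
  have b: "b > 0" unfolding b_def using c t \<delta>(1) \<tau>(1) by simp
  define \<kappa> where "\<kappa> = (exp (- (1 / (3 * r\<^sup>2 / 4))))\<^sup>2 * (measure lborel (ball a (r / 2)))\<^sup>2 / (2 * A\<^sup>2)"
  have \<kappa>: "\<kappa> > 0"
  proof -
    have "measure lborel (ball a (r / 2)) > 0"
      using r(1) by (intro content_ball_pos) simp
    then show ?thesis unfolding \<kappa>_def using A(1) by simp
  qed
  let ?E = "\<lambda>n. \<integral>\<^sup>+\<omega>. (sobolev_norm_on (- 2 * \<alpha>) 2 D (dist_of (\<lambda>y. complex_of_real (wick_square M (\<Psi> n) t y \<omega>))))\<^sup>2 \<partial>M"
  have low: "ennreal (\<kappa> * b\<^sup>2 * (\<Sum>j=j0..n. 1 / real j)) \<le> ?E n" if n: "n \<ge> 1" "4 * (real n * \<delta>) \<le> 2 ^ n" for n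
  proof -
    let ?I = "Sigma {j0..n} (\<lambda>j. {j..<2 * j})"
    note rep = solution_repr[OF B_version[OF n(1)] B_smooth[OF n(1)] \<Psi>_solution[OF n(1)] t]
    have "\<kappa> * (b\<^sup>2 * (\<Sum>j=j0..n. 1 / real j)) \<le> \<kappa> * (\<Sum>p\<in>?I. (LINT w|lborel. indicator (cell \<delta> \<tau> p) w * spectral_density c\<^sub>H n t w)\<^sup>2)"
      unfolding b_def using \<kappa>
      by (intro mult_left_mono cell_energy_lower H(4) rep(1) t \<delta>(1,2) \<tau> j0 j0t n(2)) auto
    then have "ennreal (\<kappa> * b\<^sup>2 * (\<Sum>j=j0..n. 1 / real j)) \<le> ennreal (\<kappa> * (\<Sum>p\<in>?I. (LINT w|lborel. indicator (cell \<delta> \<tau> p) w * spectral_density c\<^sub>H n t w)\<^sup>2))"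
      by (intro ennreal_leI) (simp add: mult.assoc)
    also have "\<dots> \<le> ?E n"
      unfolding \<kappa>_def
    proof (rule wick_energy_lower_bound[OF B_version[OF n(1)] B_smooth[OF n(1)] \<Psi>_solution[OF n(1)] t r(1) A])
      show "finite ?I" by auto
      show "cell \<delta> \<tau> p \<in> sets borel" for p by (cases p) (simp add: cell_def Let_def)
      show "disjoint_family_on (cell \<delta> \<tau>) ?I" by (rule cell_disjoint[OF \<delta>(1)])
      show "norm (snd w - snd w') \<le> 1 / r" if "w \<in> cell \<delta> \<tau> p" "w' \<in> cell \<delta> \<tau> p" for p w w'
        using cell_diameter[OF that] \<delta>(3) by linarith
    qed
    finally show ?thesis .
  qed
  \<comment> \<open>the cells with \<open>j \<le> n\<close> reach frequencies of order \<open>n\<close>, which the box of size \<open>2\<^sup>n\<close> contains\<close>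
  have "(\<lambda>n. real n / 2 ^ n) \<longlonglongrightarrow> 0" using lim_n_over_pown[of "2::real"] by simp
  then have "\<forall>\<^sub>F n in sequentially. real n / 2 ^ n < 1 / (4 * \<delta>)"
    using \<delta>(1) by (intro order_tendstoD(2)) auto
  then have large: "\<forall>\<^sub>F n in sequentially. 4 * (real n * \<delta>) \<le> 2 ^ n"
    by eventually_elim (use \<delta>(1) in \<open>simp add: field_simps\<close>)
  have "filterlim (\<lambda>n. \<kappa> * b\<^sup>2 * (\<Sum>j=j0..n. 1 / real j)) at_top sequentially"
    using \<kappa> b by (intro filterlim_tendsto_pos_mult_at_top[OF tendsto_const] harmonic_tail_diverges) simp
  then have lim: "(\<lambda>n. ennreal (\<kappa> * b\<^sup>2 * (\<Sum>j=j0..n. 1 / real j))) \<longlonglongrightarrow> \<infinity>"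
    by (simp add: ennreal_tendsto_top_eq_at_top)
  show ?thesis
  proof (rule tendsto_sandwich[OF _ _ lim tendsto_const])
    show "\<forall>\<^sub>F n in sequentially. ennreal (\<kappa> * b\<^sup>2 * (\<Sum>j=j0..n. 1 / real j)) \<le> ?E n"
      using large eventually_ge_at_top[of 1] by eventually_elim (rule low)
  qed simp
qed

end
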